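(* Let an almost Grassmann structure $AG(p-1,p+q-1)$ be given on a differentiable manifold $M$ of dimension $pq$, with torsion components $a^{i\beta\gamma}_{\alpha jk}$ and curvature components $b^{\beta\gamma\delta}_{\alpha kl}$, $b^{i\gamma\delta}_{jkl}$. (i) If $p>2$ and $q\ge 2$, then the structure is $\alpha$-semiintegrable if and only if $a_\alpha=0$, $b^1_\alpha=0$ and $b^2_\alpha=0$, where $a_\alpha=\{a^{i\beta\gamma}_{\alpha(jk)}\}$, $b^1_\alpha=\{b^{i\gamma\delta}_{(jkl)}\}$, $b^2_\alpha=\{b^{[\beta\gamma\delta]}_{\alpha kl}\}$. (ii) If $p\ge 2$ and $q>2$, then the structure is $\beta$-semiintegrable if and only if $a_\beta=0$, $b^1_\beta=0$ and $b^2_\beta=0$, where $a_\beta=\{a^{i(\beta\gamma)}_{\alpha jk}\}$, $b^1_\beta=\{b^{i\gamma\delta}_{[jkl]}\}$, $b^2_\beta=\{b^{(\beta\gamma\delta)}_{\alpha kl}\}$.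
   Context: Conventions. Greek indices run over $1,\dots,p$, Latin indices over $p+1,\dots,p+q$; repeated indices are summed. Round (square) brackets denote symmetrization (alternation) over the enclosed indices; in $a_\alpha,a_\beta,b^1_\alpha,b^2_\alpha,b^1_\beta,b^2_\beta$ it is carried out over the upper or lower indices alone. In the symbols $a_\alpha,b^1_\alpha,b^2_\alpha$ and $a_\beta,b^1_\beta,b^2_\beta$ the subscripts $\alpha$, $\beta$ are labels, not tensor indices. Almost Grassmann structure. The Segre cone $SC(p,q)$ in a $pq$-dimensional vector space with coordinates $z^i_\alpha$ is the set $\{z^i_\alpha=t_\alpha s^i\}$, i.e. $\operatorname{rank}(z^i_\alpha)\le 1$. An almost Grassmann structure $AG(p-1,p+q-1)$ on $M$, $\dim M=pq$, is a differentiable fibration $x\mapsto SC_x\subset T_xM$ of Segre cones $SC_x=SC_x(p,q)$. An adapted frame $\{e^\alpha_i\}$ of $T_xM$ is one in which $SC_x=\{t_\alpha s^i e^\alpha_i\}$; $\omega^i_\alpha$ denotes the dual coframe. Fixing $s=(s^i)$ up to scale gives a $p$-dimensional plane generator $\xi$ of $SC_x$ (these form a $(q-1)$-parameter family), and fixing $t=(t_\alpha)$ up to scale gives a $q$-dimensional plane generator $\eta$ (these form a $(p-1)$-parameter family). The structure is a $G$-structure with $G=\mathbf{SL}(p)\times\mathbf{SL}(q)\times\mathbf{H}$, $\mathbf H$ the group of homotheties. Semiintegrability. Let $P_\alpha$ be the $(q-1)$-dimensional projective space parametrizing the $p$-dimensional generators $\xi$ of a Segre cone and $M_\alpha=M\times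 P_\alpha$. The bundle of generators $\xi$ induces on $M_\alpha$ a distribution $\Delta_\alpha$ of $p$-dimensional plane elements; the structure is $\alpha$-semiintegrable if $\Delta_\alpha$ is integrable. The integral manifolds of $\Delta_\alpha$ project to $p$-dimensional submanifolds $V_\alpha\subset M$ tangent at each of their points to a $p$-dimensional generator of the Segre cone, and through each point $x\in M$ there passes a $(q-1)$-parameter family of them (one tangent to each $p$-dimensional generator of $SC_x$). Equivalently, the system $\omega^i_\alpha=s^i\theta_\alpha$ (with $\theta_1,\dots,\theta_p$ basis forms on $V_\alpha$) is completely integrable. Similarly, with $P_\beta$ the $(p-1)$-dimensional projective space parametrizing the $q$-dimensional generators $\eta$ and $M_\beta=M\times P_\beta$, one has a distribution $\Delta_\beta$ of $q$-dimensional plane elements, and the structure is $\beta$-semiintegrable if $\Delta_\beta$ is integrable: through each $x$ there passes a $(p-1)$-parameter family of $q$-dimensional submanifolds $V_\beta$ tangent at each of their points to a $q$-dimensional generator; equivalently, the system $\omega^i_\alpha=s_\alpha\theta^i$ (with $\theta^{p+1},\dots,\theta^{p+q}$ independent on $V_\beta$) is completely integrable. Structure equations (normal Cartan connection). On the prolonged frame bundles associated with the structure there are forms $\omega^i_\alpha$, $\omega$, $\omega^\beta_\alpha$, $\omega^i_j$, $\omega^\alpha_i$ with $\omega^\gamma_\gamma=0$, $\omega^k_k=0$ and $$d\omega_\alpha^i-\omega_\alpha^j\wedge\omega_j^i-\omega_\alpha^\beta\wedge\omega_\beta^i-\omega\wedge\omega_\alpha^i=a_{\alpha jk}^{i\beta\gamma}\omega_\beta^j\wedge\omega_\gamma^k,$$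 $$d\omega_\alpha^\beta-\omega_\alpha^\gamma\wedge\omega_\gamma^\beta=\tfrac{q}{p+q}\bigl(\delta_\alpha^\beta\,\omega_\gamma^k\wedge\omega_k^\gamma-p\,\omega_\alpha^k\wedge\omega_k^\beta\bigr)+b_{\alpha kl}^{\beta\gamma\delta}\omega_\gamma^k\wedge\omega_\delta^l,$$ $$d\omega_j^i-\omega_j^k\wedge\omega_k^i=\tfrac{p}{p+q}\bigl(\delta_j^i\,\omega_k^\gamma\wedge\omega_\gamma^k-q\,\omega_j^\gamma\wedge\omega_\gamma^i\bigr)+b_{jkl}^{i\gamma\delta}\omega_\gamma^k\wedge\omega_\delta^l,$$ $$d\omega=\omega_i^\alpha\wedge\omega_\alpha^i,$$ $$d\omega_i^\alpha-\omega_i^\beta\wedge\omega_\beta^\alpha-\omega_i^j\wedge\omega_j^\alpha+\omega\wedge\omega_i^\alpha=c_{ijk}^{\alpha\beta\gamma}\omega_\gamma^k\wedge\omega_\beta^j-a_{\gamma ij}^{k\alpha\beta}\omega_k^\gamma\wedge\omega_\beta^j,$$ where $a^{i\beta\gamma}_{\alpha jk}=-a^{i\gamma\beta}_{\alpha kj}$, $a^{i\alpha\gamma}_{\alpha jk}=0$, $a^{i\beta\gamma}_{\alpha ik}=0$; $b^{\beta\gamma\delta}_{\alpha kl}=-b^{\beta\delta\gamma}_{\alpha lk}$, $b^{i\gamma\delta}_{jkl}=-b^{i\delta\gamma}_{jlk}$, $b^{\alpha\gamma\delta}_{\alpha kl}=0$, $b^{i\gamma\delta}_{ikl}=0$, and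 $b^{\gamma\alpha\delta}_{\alpha kl}-b^{i\gamma\delta}_{kil}+b^{\delta\alpha\gamma}_{\alpha lk}-b^{i\delta\gamma}_{lik}=0$; and $c^{[\alpha\beta\gamma]}_{[ijk]}=0$ (in this last identity only, alternation over the vertical pairs $\binom{\alpha}{i},\binom{\beta}{j},\binom{\gamma}{k}$). *)

theory Defs
  imports "HOL-Analysis.Analysis"
begin

section \<open>Smooth manifolds\<close>

text \<open>A manifold is a whole (Hausdorff, second countable) type together with an atlas; a chart is
  a pair \<open>(U, \<phi>)\<close> of a domain and a coordinate map into the Euclidean model space.  The maps
  \<open>\<phi>\<close> are total functions of which only the restriction to \<open>U\<close> matters.\<close>

type_synonym ('m, 'e) chart = "'m set \<times> ('m \<Rightarrow> 'e)"
type_synonym ('m, 'e) atlas = "('m, 'e) chart set"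

primrec Ck_on :: "nat \<Rightarrow> 'a::euclidean_space set \<Rightarrow> ('a \<Rightarrow> 'b::euclidean_space) \<Rightarrow> bool" where
  "Ck_on 0 S f \<longleftrightarrow> continuous_on S f"
| "Ck_on (Suc k) S f \<longleftrightarrow> f differentiable_on S \<and>
     (\<forall>v. Ck_on k S (\<lambda>x. frechet_derivative f (at x) v))"

text \<open>Only meant for open \<open>S\<close>.\<close>
definition smooth_on :: "'a::euclidean_space set \<Rightarrow> ('a \<Rightarrow> 'b::euclidean_space) \<Rightarrow> bool" where
  "smooth_on S f \<longleftrightarrow> (\<forall>k. Ck_on k S f)"

definition is_chart :: "('m::topological_space, 'e::euclidean_space) chart \<Rightarrow> bool" where
  "is_chart c \<longleftrightarrow> (case c of (U, \<phi>) \<Rightarrow>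
     open U \<and> open (\<phi> ` U) \<and> homeomorphism U (\<phi> ` U) \<phi> (inv_into U \<phi>))"

locale smooth_manifold =
  fixes A :: "('m::{t2_space, second_countable_topology}, 'e::euclidean_space) atlas"
  assumes charts: "c \<in> A \<Longrightarrow> is_chart c"
    and covering: "(\<Union>(U, \<phi>)\<in>A. U) = UNIV"
    and compatible: "(U, \<phi>) \<in> A \<Longrightarrow> (V, \<psi>) \<in> A \<Longrightarrow>
      smooth_on (\<phi> ` (U \<inter> V)) (\<psi> \<circ> inv_into U \<phi>)"

text \<open>The standard atlas of a Euclidean space; it makes functions to \<open>real\<close>, curves and
  coordinate maps special cases of smooth maps between manifolds.\<close>
definition eucl :: "('e, 'e::euclidean_space) atlas" where
  "eucl = {(UNIV, id)}"

definition smooth_map :: "('m::topological_space, 'e::euclidean_space) atlas \<Rightarrow>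
    ('n::topological_space, 'f::euclidean_space) atlas \<Rightarrow> 'm set \<Rightarrow> ('m \<Rightarrow> 'n) \<Rightarrow> bool" where
  "smooth_map A B S h \<longleftrightarrow> open S \<and> continuous_on S h \<and>
     (\<forall>(U, \<phi>)\<in>A. \<forall>(V, \<psi>)\<in>B.
        smooth_on (\<phi> ` (S \<inter> U \<inter> h -` V)) (\<psi> \<circ> h \<circ> inv_into U \<phi>))"

definition smooth_at :: "('m::topological_space, 'e::euclidean_space) atlas \<Rightarrow> 'm \<Rightarrow> ('m \<Rightarrow> real) \<Rightarrow> bool" where
  "smooth_at A x f \<longleftrightarrow> (\<exists>S. x \<in> S \<and> smooth_map A eucl S f)"

text \<open>The charts of the maximal atlas.\<close>
definition smooth_chart :: "('m::topological_space, 'e::euclidean_space) atlas \<Rightarrow> ('m, 'e) chart \<Rightarrow> bool" where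
  "smooth_chart A c \<longleftrightarrow> is_chart c \<and> (case c of (U, \<phi>) \<Rightarrow>
     smooth_map A eucl U \<phi> \<and> smooth_map eucl A (\<phi> ` U) (inv_into U \<phi>))"


section \<open>Tangent vectors, submanifolds, differential forms\<close>

text \<open>A tangent vector at \<open>x\<close> is the directional derivative operator along a smooth curve through
  \<open>x\<close>, acting on functions smooth near \<open>x\<close>.  It is set to \<open>0\<close> on all other functions, so that equal
  tangent vectors are equal as HOL functions.\<close>

type_synonym 'm tvec = "('m \<Rightarrow> real) \<Rightarrow> real"

definition velocity :: "('m::topological_space, 'e::euclidean_space) atlas \<Rightarrow> (real \<Rightarrow> 'm) \<Rightarrow> 'm tvec" where
  "velocity A \<gamma> = (\<lambda>f. if smooth_at A (\<gamma> 0) f then deriv (f \<circ> \<gamma>) 0 else 0)"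

text \<open>Velocities of the curves that stay in \<open>V\<close>: the tangent space \<open>T\<^sub>x V\<close> if \<open>V\<close> is a submanifold.\<close>
definition tangent_of :: "('m::topological_space, 'e::euclidean_space) atlas \<Rightarrow> 'm set \<Rightarrow> 'm \<Rightarrow> 'm tvec set" where
  "tangent_of A V x = {velocity A \<gamma> | \<gamma>. \<exists>\<epsilon>>0.
     smooth_map eucl A {-\<epsilon><..<\<epsilon>} \<gamma> \<and> \<gamma> 0 = x \<and> \<gamma> ` {-\<epsilon><..<\<epsilon>} \<subseteq> V}"

abbreviation tangent_space :: "('m::topological_space, 'e::euclidean_space) atlas \<Rightarrow> 'm \<Rightarrow> 'm tvec set" where
  "tangent_space A x \<equiv> tangent_of A UNIV x"

text \<open>The coordinate vector field of a chart in the direction \<open>z\<close> of the model space.\<close>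
definition coord_field :: "('m::topological_space, 'e::euclidean_space) atlas \<Rightarrow> ('m, 'e) chart \<Rightarrow> 'e \<Rightarrow> 'm \<Rightarrow> 'm tvec" where
  "coord_field A c z x = (case c of (U, \<phi>) \<Rightarrow>
     (\<lambda>f. if smooth_at A x f then frechet_derivative (f \<circ> inv_into U \<phi>) (at (\<phi> x)) z else 0))"

definition push_forward :: "('n::topological_space, 'f::euclidean_space) atlas \<Rightarrow> ('m \<Rightarrow> 'n) \<Rightarrow> 'm \<Rightarrow> 'm tvec \<Rightarrow> 'n tvec" where
  "push_forward B h x v = (\<lambda>f. if smooth_at B (h x) f then v (f \<circ> h) else 0)"

definition smooth_vector_field :: "('m::topological_space, 'e::euclidean_space) atlas \<Rightarrow> 'm set \<Rightarrow> ('m \<Rightarrow> 'm tvec) \<Rightarrow> bool" where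
  "smooth_vector_field A U X \<longleftrightarrow> open U \<and> (\<forall>x\<in>U. X x \<in> tangent_space A x) \<and>
     (\<forall>S f. S \<subseteq> U \<longrightarrow> smooth_map A eucl S f \<longrightarrow> smooth_map A eucl S (\<lambda>x. X x f))"

text \<open>Embedded \<open>k\<close>-dimensional submanifolds, by slice charts.\<close>
definition submanifold :: "('m::topological_space, 'e::euclidean_space) atlas \<Rightarrow> nat \<Rightarrow> 'm set \<Rightarrow> bool" where
  "submanifold A k V \<longleftrightarrow> (\<forall>x\<in>V. \<exists>U \<phi> L. smooth_chart A (U, \<phi>) \<and> x \<in> U \<and>
     subspace L \<and> dim L = k \<and> \<phi> ` (V \<inter> U) = \<phi> ` U \<inter> L)"

type_synonym 'm form1 = "'m \<Rightarrow> 'm tvec \<Rightarrow> real"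
type_synonym 'm form2 = "'m \<Rightarrow> 'm tvec \<Rightarrow> 'm tvec \<Rightarrow> real"

definition smooth_form :: "('m::topological_space, 'e::euclidean_space) atlas \<Rightarrow> 'm form1 \<Rightarrow> bool" where
  "smooth_form A \<theta> \<longleftrightarrow> (\<forall>(U, \<phi>)\<in>A.
     (\<forall>x\<in>U. linear (\<lambda>z. \<theta> x (coord_field A (U, \<phi>) z x))) \<and>
     (\<forall>z. smooth_map A eucl U (\<lambda>x. \<theta> x (coord_field A (U, \<phi>) z x))))"

definition wedge :: "'m form1 \<Rightarrow> 'm form1 \<Rightarrow> 'm form2" where
  "wedge \<theta> \<eta> x v w = \<theta> x v * \<eta> x w - \<theta> x w * \<eta> x v"

text \<open>\<open>d\<theta> = \<Theta>\<close>, evaluated on coordinate fields.  These commute, so that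
  \<open>d\<theta>(X, Y) = X(\<theta>(Y)) - Y(\<theta>(X)) - \<theta>([X, Y])\<close> loses its last term; the normalization
  agrees with that of \<^const>\<open>wedge\<close>.\<close>
definition has_ext_deriv :: "('m::topological_space, 'e::euclidean_space) atlas \<Rightarrow> 'm form1 \<Rightarrow> 'm form2 \<Rightarrow> bool" where
  "has_ext_deriv A \<theta> \<Theta> \<longleftrightarrow> (\<forall>(U, \<phi>)\<in>A. \<forall>x\<in>U. \<forall>z w.
     (let X = coord_field A (U, \<phi>) z; Y = coord_field A (U, \<phi>) w in
        X x (\<lambda>y. \<theta> y (Y y)) - Y x (\<lambda>y. \<theta> y (X y)) = \<Theta> x (X x) (Y x)))"


section \<open>Almost Grassmann structures\<close>

text \<open>The model tangent space consists of the \<open>p \<times> q\<close> matrices \<open>z\<close>, where \<open>z $ \<alpha> $ i\<close> is the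
  coordinate \<open>z\<^sup>i\<^sub>\<alpha>\<close>; the type \<open>'p\<close> indexes the Greek and \<open>'q\<close> the Latin indices.\<close>

definition outer :: "real ^ 'p \<Rightarrow> real ^ 'q \<Rightarrow> real ^ 'q ^ 'p" where
  "outer t s = (\<chi> \<alpha> i. t $ \<alpha> * s $ i)"

definition segre_cone :: "(real ^ 'q ^ 'p) set" where
  "segre_cone = {outer t s | t s. True}"

text \<open>\<open>SL(p) \<times> SL(q) \<times> H\<close> in its action on the model tangent space.\<close>
definition grassmann_group :: "(real ^ 'q ^ 'p \<Rightarrow> real ^ 'q ^ 'p) set" where
  "grassmann_group = {\<lambda>z. c *\<^sub>R (S ** z ** T) | (c::real) (S::real ^ 'p ^ 'p) (T::real ^ 'q ^ 'q).
     c \<noteq> 0 \<and> det S = 1 \<and> det T = 1}"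

text \<open>A frame of \<open>T\<^sub>x M\<close> is a linear isomorphism from the model space (\<open>u z = z\<^sup>i\<^sub>\<alpha> e\<^sup>\<alpha>\<^sub>i\<close>).\<close>
definition is_frame :: "('m::topological_space, 'e::euclidean_space) atlas \<Rightarrow> 'm \<Rightarrow> (real ^ 'q ^ 'p \<Rightarrow> 'm tvec) \<Rightarrow> bool" where
  "is_frame A x u \<longleftrightarrow> (\<forall>f. linear (\<lambda>z. u z f)) \<and> bij_betw u UNIV (tangent_space A x)"

text \<open>The structure consists of the cones \<open>SC\<close> and the \<open>G\<close>-structure \<open>F\<close> of frames adapted to
  them.  \<open>F\<close> determines \<open>SC\<close>; for \<open>p = q\<close> it moreover records which of the two families of plane
  generators is the family \<open>\<xi>\<close> (transposition preserves the cone but not \<open>F\<close>).\<close>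
locale almost_grassmann = smooth_manifold A
  for A :: "('m::{t2_space, second_countable_topology}, real ^ 'q ^ 'p) atlas" +
  fixes SC :: "'m \<Rightarrow> 'm tvec set"
    and F :: "'m \<Rightarrow> (real ^ 'q ^ 'p \<Rightarrow> 'm tvec) set"
  assumes frames: "u \<in> F x \<Longrightarrow> is_frame A x u"
    and adapted: "u \<in> F x \<Longrightarrow> u ` segre_cone = SC x"
    and orbit: "u \<in> F x \<Longrightarrow> F x = {u \<circ> g | g. g \<in> grassmann_group}"
    and local_sections: "\<exists>U e. open U \<and> x \<in> U \<and> (\<forall>y\<in>U. e y \<in> F y) \<and>
          (\<forall>z. smooth_vector_field A U (\<lambda>y. e y z))"

text \<open>The \<open>p\<close>-dimensional plane generators \<open>\<xi>\<close> and the \<open>q\<close>-dimensional plane generators \<open>\<eta>\<close> of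
  the cone \<open>SC\<^sub>x\<close>.\<close>

definition alpha_generators :: "('m \<Rightarrow> (real ^ 'q ^ 'p \<Rightarrow> 'm tvec) set) \<Rightarrow> 'm \<Rightarrow> 'm tvec set set" where
  "alpha_generators F x = {u ` {outer t s | t. True} | u s. u \<in> F x \<and> s \<noteq> 0}"

definition beta_generators :: "('m \<Rightarrow> (real ^ 'q ^ 'p \<Rightarrow> 'm tvec) set) \<Rightarrow> 'm \<Rightarrow> 'm tvec set set" where
  "beta_generators F x = {u ` {outer t s | s. True} | u t. u \<in> F x \<and> t \<noteq> 0}"

text \<open>For a family \<open>gen\<close> of \<open>k\<close>-dimensional generators, the points of the bundle \<open>M\<^sub>\<alpha>\<close> (or
  \<open>M\<^sub>\<beta>\<close>) are the pairs \<open>(x, \<xi>)\<close> with \<open>\<xi> \<in> gen x\<close>, and the plane element of the distribution at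
  \<open>(x, \<xi>)\<close> lies over \<open>\<xi>\<close>.  Hence an integral manifold is the lift \<open>{(y, T\<^sub>y V). y \<in> V}\<close> of a
  \<open>k\<close>-dimensional submanifold \<open>V\<close> all of whose tangent spaces are generators, and the distribution
  is integrable if there is an integral manifold through every point of the bundle.\<close>

definition generator_bundle :: "('m \<Rightarrow> 'm tvec set set) \<Rightarrow> ('m \<times> 'm tvec set) set" where
  "generator_bundle gen = {(x, \<xi>). \<xi> \<in> gen x}"

definition tangent_lift :: "('m::topological_space, 'e::euclidean_space) atlas \<Rightarrow> 'm set \<Rightarrow> ('m \<times> 'm tvec set) set" where
  "tangent_lift A V = {(y, tangent_of A V y) | y. y \<in> V}"

definition generators_integrable :: "('m::topological_space, 'e::euclidean_space) atlas \<Rightarrow> nat \<Rightarrow> ('m \<Rightarrow> 'm tvec set set) \<Rightarrow> bool" where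
  "generators_integrable A k gen \<longleftrightarrow> (\<forall>m\<in>generator_bundle gen. \<exists>V.
     submanifold A k V \<and> m \<in> tangent_lift A V \<and> tangent_lift A V \<subseteq> generator_bundle gen)"

definition alpha_semiintegrable ::
  "('m::topological_space, real ^ 'q ^ 'p) atlas \<Rightarrow> ('m \<Rightarrow> (real ^ 'q ^ 'p \<Rightarrow> 'm tvec) set) \<Rightarrow> bool" where
  "alpha_semiintegrable A F \<longleftrightarrow> generators_integrable A CARD('p) (alpha_generators F)"

definition beta_semiintegrable ::
  "('m::topological_space, real ^ 'q ^ 'p) atlas \<Rightarrow> ('m \<Rightarrow> (real ^ 'q ^ 'p \<Rightarrow> 'm tvec) set) \<Rightarrow> bool" where
  "beta_semiintegrable A F \<longleftrightarrow> generators_integrable A CARD('q) (beta_generators F)"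


section \<open>The normal Cartan connection\<close>

definition sym2 :: "('i \<Rightarrow> 'i \<Rightarrow> real) \<Rightarrow> 'i \<Rightarrow> 'i \<Rightarrow> real" where
  "sym2 f x y = (f x y + f y x) / 2"

definition sym3 :: "('i \<Rightarrow> 'i \<Rightarrow> 'i \<Rightarrow> real) \<Rightarrow> 'i \<Rightarrow> 'i \<Rightarrow> 'i \<Rightarrow> real" where
  "sym3 f x y z = (f x y z + f y z x + f z x y + f x z y + f z y x + f y x z) / 6"

definition alt3 :: "('i \<Rightarrow> 'i \<Rightarrow> 'i \<Rightarrow> real) \<Rightarrow> 'i \<Rightarrow> 'i \<Rightarrow> 'i \<Rightarrow> real" where
  "alt3 f x y z = (f x y z + f y z x + f z x y - f x z y - f z y x - f y x z) / 6"

text \<open>The bundle is a manifold \<open>P\<close> with atlas \<open>B\<close>, projection \<open>pr\<close> to \<open>M\<close>, and the map \<open>fr\<close> that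
  sends a point to its underlying adapted frame.  Of the forms and components on \<open>P\<close>,

    \<open>\<theta> \<alpha> i\<close> is \<open>\<omega>\<^sup>i\<^sub>\<alpha>\<close>, \<open>\<omega>\<close> is \<open>\<omega>\<close>, \<open>\<omega>g \<alpha> \<beta>\<close> is \<open>\<omega>\<^sub>\<alpha>\<^sup>\<beta>\<close>, \<open>\<omega>l j i\<close> is \<open>\<omega>\<^sub>j\<^sup>i\<close>, \<open>\<psi> i \<alpha>\<close> is \<open>\<omega>\<^sup>\<alpha>\<^sub>i\<close>,

    \<open>a i \<beta> \<gamma> \<alpha> j k\<close> is \<open>a\<^bsup>i\<beta>\<gamma>\<^esup>\<^bsub>\<alpha>jk\<^esub>\<close>, \<open>bg \<beta> \<gamma> \<delta> \<alpha> k l\<close> is \<open>b\<^bsup>\<beta>\<gamma>\<delta>\<^esup>\<^bsub>\<alpha>kl\<^esub>\<close>,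
    \<open>bl i \<gamma> \<delta> j k l\<close> is \<open>b\<^bsup>i\<gamma>\<delta>\<^esup>\<^bsub>jkl\<^esub>\<close>, \<open>c \<alpha> \<beta> \<gamma> i j k\<close> is \<open>c\<^bsup>\<alpha>\<beta>\<gamma>\<^esup>\<^bsub>ijk\<^esub>\<close>

  (upper indices first).\<close>

locale normal_Cartan_connection =
  almost_grassmann A SC F + P: smooth_manifold B
  for A :: "('m::{t2_space, second_countable_topology}, real ^ 'q ^ 'p) atlas"
    and SC :: "'m \<Rightarrow> 'm tvec set"
    and F :: "'m \<Rightarrow> (real ^ 'q ^ 'p \<Rightarrow> 'm tvec) set"
    and B :: "('n::{t2_space, second_countable_topology}, 'e::euclidean_space) atlas" +
  fixes pr :: "'n \<Rightarrow> 'm"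
    and fr :: "'n \<Rightarrow> real ^ 'q ^ 'p \<Rightarrow> 'm tvec"
    and \<theta> :: "'p \<Rightarrow> 'q \<Rightarrow> 'n form1"
    and \<omega> :: "'n form1"
    and \<omega>g :: "'p \<Rightarrow> 'p \<Rightarrow> 'n form1"
    and \<omega>l :: "'q \<Rightarrow> 'q \<Rightarrow> 'n form1"
    and \<psi> :: "'q \<Rightarrow> 'p \<Rightarrow> 'n form1"
    and a :: "'q \<Rightarrow> 'p \<Rightarrow> 'p \<Rightarrow> 'p \<Rightarrow> 'q \<Rightarrow> 'q \<Rightarrow> 'n \<Rightarrow> real"
    and bg :: "'p \<Rightarrow> 'p \<Rightarrow> 'p \<Rightarrow> 'p \<Rightarrow> 'q \<Rightarrow> 'q \<Rightarrow> 'n \<Rightarrow> real"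
    and bl :: "'q \<Rightarrow> 'p \<Rightarrow> 'p \<Rightarrow> 'q \<Rightarrow> 'q \<Rightarrow> 'q \<Rightarrow> 'n \<Rightarrow> real"
    and c :: "'p \<Rightarrow> 'p \<Rightarrow> 'p \<Rightarrow> 'q \<Rightarrow> 'q \<Rightarrow> 'q \<Rightarrow> 'n \<Rightarrow> real"
  assumes pr_smooth: "smooth_map B A UNIV pr"
    and fr_adapted: "fr ` (pr -` {m}) = F m"
    \<comment> \<open>\<open>\<theta>\<close> is the dual coframe of the underlying frame:\<close>
    and soldering: "v \<in> tangent_space B x \<Longrightarrow>
          push_forward A pr x v = fr x (\<chi> \<alpha> i. \<theta> \<alpha> i x v)"
    and smooth_forms: "smooth_form B (\<theta> \<alpha> i)" "smooth_form B \<omega>" "smooth_form B (\<omega>g \<alpha> \<beta>)"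
          "smooth_form B (\<omega>l j i)" "smooth_form B (\<psi> i \<alpha>)"
    and traces: "v \<in> tangent_space B x \<Longrightarrow> (\<Sum>\<gamma>\<in>UNIV. \<omega>g \<gamma> \<gamma> x v) = 0"
          "v \<in> tangent_space B x \<Longrightarrow> (\<Sum>k\<in>UNIV. \<omega>l k k x v) = 0"
    \<comment> \<open>the forms are an absolute parallelism, with no relations other than the two traces:\<close>
    and parallelism: "(\<Sum>\<gamma>\<in>UNIV. X \<gamma> \<gamma>) = 0 \<Longrightarrow> (\<Sum>k\<in>UNIV. Y k k) = 0 \<Longrightarrow>
          \<exists>!v. v \<in> tangent_space B x \<and> (\<forall>\<alpha> i. \<theta> \<alpha> i x v = Z \<alpha> i) \<and> \<omega> x v = r \<and>
            (\<forall>\<alpha> \<beta>. \<omega>g \<alpha> \<beta> x v = X \<alpha> \<beta>) \<and> (\<forall>j i. \<omega>l j i x v = Y j i) \<and>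
            (\<forall>i \<alpha>. \<psi> i \<alpha> x v = W i \<alpha>)"
    and structure_theta: "has_ext_deriv B (\<theta> \<alpha> i) (\<lambda>x v w.
          (\<Sum>j\<in>UNIV. wedge (\<theta> \<alpha> j) (\<omega>l j i) x v w)
          + (\<Sum>\<beta>\<in>UNIV. wedge (\<omega>g \<alpha> \<beta>) (\<theta> \<beta> i) x v w)
          + wedge \<omega> (\<theta> \<alpha> i) x v w
          + (\<Sum>\<beta>\<in>UNIV. \<Sum>\<gamma>\<in>UNIV. \<Sum>j\<in>UNIV. \<Sum>k\<in>UNIV.
               a i \<beta> \<gamma> \<alpha> j k x * wedge (\<theta> \<beta> j) (\<theta> \<gamma> k) x v w))"
    and structure_omega_g: "has_ext_deriv B (\<omega>g \<alpha> \<beta>) (\<lambda>x v w.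
          (\<Sum>\<gamma>\<in>UNIV. wedge (\<omega>g \<alpha> \<gamma>) (\<omega>g \<gamma> \<beta>) x v w)
          + real CARD('q) / real (CARD('p) + CARD('q)) *
              ((if \<alpha> = \<beta> then \<Sum>\<gamma>\<in>UNIV. \<Sum>k\<in>UNIV. wedge (\<theta> \<gamma> k) (\<psi> k \<gamma>) x v w else 0)
               - real CARD('p) * (\<Sum>k\<in>UNIV. wedge (\<theta> \<alpha> k) (\<psi> k \<beta>) x v w))
          + (\<Sum>\<gamma>\<in>UNIV. \<Sum>\<delta>\<in>UNIV. \<Sum>k\<in>UNIV. \<Sum>l\<in>UNIV.
               bg \<beta> \<gamma> \<delta> \<alpha> k l x * wedge (\<theta> \<gamma> k) (\<theta> \<delta> l) x v w))"
    and structure_omega_l: "has_ext_deriv B (\<omega>l j i) (\<lambda>x v w.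
          (\<Sum>k\<in>UNIV. wedge (\<omega>l j k) (\<omega>l k i) x v w)
          + real CARD('p) / real (CARD('p) + CARD('q)) *
              ((if j = i then \<Sum>\<gamma>\<in>UNIV. \<Sum>k\<in>UNIV. wedge (\<psi> k \<gamma>) (\<theta> \<gamma> k) x v w else 0)
               - real CARD('q) * (\<Sum>\<gamma>\<in>UNIV. wedge (\<psi> j \<gamma>) (\<theta> \<gamma> i) x v w))
          + (\<Sum>\<gamma>\<in>UNIV. \<Sum>\<delta>\<in>UNIV. \<Sum>k\<in>UNIV. \<Sum>l\<in>UNIV.
               bl i \<gamma> \<delta> j k l x * wedge (\<theta> \<gamma> k) (\<theta> \<delta> l) x v w))"
    and structure_omega: "has_ext_deriv B \<omega> (\<lambda>x v w.
          \<Sum>\<alpha>\<in>UNIV. \<Sum>i\<in>UNIV. wedge (\<psi> i \<alpha>) (\<theta> \<alpha> i) x v w)"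
    and structure_psi: "has_ext_deriv B (\<psi> i \<alpha>) (\<lambda>x v w.
          (\<Sum>\<beta>\<in>UNIV. wedge (\<psi> i \<beta>) (\<omega>g \<beta> \<alpha>) x v w)
          + (\<Sum>j\<in>UNIV. wedge (\<omega>l i j) (\<psi> j \<alpha>) x v w)
          - wedge \<omega> (\<psi> i \<alpha>) x v w
          + (\<Sum>\<beta>\<in>UNIV. \<Sum>\<gamma>\<in>UNIV. \<Sum>j\<in>UNIV. \<Sum>k\<in>UNIV.
               c \<alpha> \<beta> \<gamma> i j k x * wedge (\<theta> \<gamma> k) (\<theta> \<beta> j) x v w)
          - (\<Sum>\<beta>\<in>UNIV. \<Sum>\<gamma>\<in>UNIV. \<Sum>j\<in>UNIV. \<Sum>k\<in>UNIV.
               a k \<alpha> \<beta> \<gamma> i j x * wedge (\<psi> k \<gamma>) (\<theta> \<beta> j) x v w))"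
    and a_skew: "a i \<beta> \<gamma> \<alpha> j k x = - a i \<gamma> \<beta> \<alpha> k j x"
    and a_trace_g: "(\<Sum>\<alpha>\<in>UNIV. a i \<alpha> \<gamma> \<alpha> j k x) = 0"
    and a_trace_l: "(\<Sum>i\<in>UNIV. a i \<beta> \<gamma> \<alpha> i k x) = 0"
    and bg_skew: "bg \<beta> \<gamma> \<delta> \<alpha> k l x = - bg \<beta> \<delta> \<gamma> \<alpha> l k x"
    and bl_skew: "bl i \<gamma> \<delta> j k l x = - bl i \<delta> \<gamma> j l k x"
    and bg_trace: "(\<Sum>\<alpha>\<in>UNIV. bg \<alpha> \<gamma> \<delta> \<alpha> k l x) = 0"
    and bl_trace: "(\<Sum>i\<in>UNIV. bl i \<gamma> \<delta> i k l x) = 0"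
    and b_normal: "(\<Sum>\<alpha>\<in>UNIV. bg \<gamma> \<alpha> \<delta> \<alpha> k l x) - (\<Sum>i\<in>UNIV. bl i \<gamma> \<delta> k i l x)
          + (\<Sum>\<alpha>\<in>UNIV. bg \<delta> \<alpha> \<gamma> \<alpha> l k x) - (\<Sum>i\<in>UNIV. bl i \<delta> \<gamma> l i k x) = 0"
    and c_alt: "alt3 (\<lambda>(\<alpha>, i) (\<beta>, j) (\<gamma>, k). c \<alpha> \<beta> \<gamma> i j k x) (\<alpha>, i) (\<beta>, j) (\<gamma>, k) = 0"

end

theory Submission
  imports Defs
begin

text \<open>
  Transposing the model matrices reduces (ii) to (i), so consider the generators \<open>t \<otimes> s\<close> with fixed
  \<open>s\<close>.  Around a point of the bundle, the integral curves of the fields on which the \<open>\<omega>\<^sup>i\<^sub>\<alpha>\<close> are constant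
  and all other forms vanish define a normal chart.

  If \<open>a\<^sub>\<alpha> = 0\<close> and \<open>b\<^sup>1\<^sub>\<alpha> = 0\<close>, the leaf is the image of the plane \<open>{t \<otimes> s}\<close> in the normal chart: by the
  structure equations, the components of \<open>\<omega>\<^sup>i\<^sub>\<alpha>(J)\<close> and \<open>s\<^sup>j \<omega>\<^sup>i\<^sub>j(J)\<close> transversal to \<open>s\<close>, for a Jacobi
  field \<open>J\<close> of the rays in that plane, solve a homogeneous linear system with initial value \<open>0\<close>.

  Conversely, on a leaf \<open>\<omega>\<^sup>i\<^sub>\<alpha> = s\<^sup>i \<tau>\<^sub>\<alpha>\<close>.  One exterior derivative shows that \<open>a\<^sup>i(s, s)\<close> is proportional to
  \<open>s\<^sup>i\<close>, and the traces of \<open>a\<close> vanish, so the symmetrization is \<open>0\<close>; a second one shows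
  \<open>b\<^sup>i(s, s, s) = s\<^sup>i \<mu>(s, s)\<close>.  The Bianchi identity \<open>d\<^sup>2\<omega>\<^sup>i\<^sub>\<alpha> = 0\<close> on triples of vectors of the form
  \<open>t \<otimes> s\<close> expresses the alternation of \<open>b\<^sup>\<beta>\<^sub>\<alpha>(s, s)\<close> by \<open>\<mu>\<close>, and its trace together with the
  normalization of the connection gives \<open>(p + q) \<mu> = 0\<close>.
\<close>

subsection \<open>Functions of class \<open>C\<^sup>k\<close>\<close>

text \<open>The normal chart gives an explicit candidate for every leaf, so integrability of the
  distribution turns into a uniqueness statement for one linear ODE along each ray. The analytic
  obstacle is smooth dependence of the rays on their direction. It is met by one integral equation
  in the direction variable alone; differentiating this equation yields an equation of the same
  type, so all orders of differentiability follow by induction. The structure equations are moved by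
  pullback between open subsets of Euclidean spaces of different dimensions (bundle charts, the
  normal ball, a leaf); for that reason they are formulated for forms that need not be independent.
  Smoothness of the components a and b is no axiom: they are read off from exterior derivatives on
  horizontal fields. The constant p + q arises as (p - 2) + (q + 2): the traced cyclic identity
  contributes p - 2, the divergence of the cubic vector field \<mu>(s, s) s contributes q + 2, and
  the contracted Bianchi identity makes the two contributions cancel.\<close>

lemma has_derivative_frechet:
  assumes "open S" "f differentiable_on S" "x \<in> S"
  shows "(f has_derivative frechet_derivative f (at x)) (at x)"
  using assms by (metis differentiable_on_eq_differentiable_at frechet_derivative_works)

lemma frechet_derivative_cong:
  assumes "open S" "x \<in> S" "\<And>y. y \<in> S \<Longrightarrow> f y = g y"
  shows "frechet_derivative f (at x) = frechet_derivative g (at x)"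
proof -
  have "(f has_derivative D) (at x) \<longleftrightarrow> (g has_derivative D) (at x)" for D
    using has_derivative_transform_within_open[OF _ assms(1,2), of f D UNIV g]
      has_derivative_transform_within_open[OF _ assms(1,2), of g D UNIV f] assms(3) by metis
  then show ?thesis
    by (simp add: frechet_derivative_def)
qed

lemma Ck_on_cong:
  assumes "open S" "\<And>x. x \<in> S \<Longrightarrow> f x = g x"
  shows "Ck_on k S f \<longleftrightarrow> Ck_on k S g"
  using assms(2)
proof (induction k arbitrary: f g)
  case 0
  then show ?case by (auto cong: continuous_on_cong)
next
  case (Suc k)
  have "f differentiable_on S \<longleftrightarrow> g differentiable_on S"
    using Suc.prems differentiable_transform_within[of _ _ S 1 f]
      differentiable_transform_within[of _ _ S 1 g]
    unfolding differentiable_on_def by (metis zero_less_one)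
  moreover have "Ck_on k S (\<lambda>x. frechet_derivative f (at x) v) \<longleftrightarrow>
      Ck_on k S (\<lambda>x. frechet_derivative g (at x) v)" for v
    by (rule Suc.IH) (metis frechet_derivative_cong[OF assms(1)] Suc.prems)
  ultimately show ?case by simp
qed

text \<open>The derivative enters as an explicit formula \<open>f'\<close>, which avoids computing
  with the choice operator behind \<open>frechet_derivative\<close>.\<close>

lemma Ck_on_SucI:
  assumes "open S" and d: "\<And>x. x \<in> S \<Longrightarrow> (f has_derivative f' x) (at x)"
    and "\<And>v. Ck_on k S (\<lambda>x. f' x v)"
  shows "Ck_on (Suc k) S f"
proof -
  have "f differentiable_on S"
    using d by (meson differentiable_at_withinI differentiable_def differentiable_on_def)
  moreover have "Ck_on k S (\<lambda>x. frechet_derivative f (at x) v)" for v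
    using assms(3)[of v] Ck_on_cong[OF assms(1), of "\<lambda>x. frechet_derivative f (at x) v" "\<lambda>x. f' x v"]
      frechet_derivative_at[OF d] by metis
  ultimately show ?thesis by simp
qed

lemma Ck_on_subset: "Ck_on k S f \<Longrightarrow> T \<subseteq> S \<Longrightarrow> Ck_on k T f"
  by (induction k arbitrary: f) (auto intro: continuous_on_subset differentiable_on_subset)

lemma Ck_on_lower: "Ck_on (Suc k) S f \<Longrightarrow> Ck_on k S f"
  by (induction k arbitrary: f) (auto intro: differentiable_imp_continuous_on)

lemma Ck_on_continuous: "Ck_on k S f \<Longrightarrow> continuous_on S f"
  by (induction k arbitrary: f) (auto intro: differentiable_imp_continuous_on)

lemma Ck_on_local:
  assumes "\<And>x. x \<in> S \<Longrightarrow> \<exists>T. open T \<and> x \<in> T \<and> Ck_on k T f"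
  shows "Ck_on k S f"
  using assms
proof (induction k arbitrary: f)
  case 0
  show ?case
    unfolding Ck_on.simps continuous_on_eq_continuous_within
  proof
    fix x assume "x \<in> S"
    then obtain T where "open T" "x \<in> T" "continuous_on T f"
      using 0 by (metis Ck_on.simps(1))
    then show "continuous (at x within S) f"
      by (meson continuous_at_imp_continuous_at_within continuous_on_eq_continuous_at)
  qed
next
  case (Suc k)
  have "f differentiable_on S"
    unfolding differentiable_on_def
  proof
    fix x assume "x \<in> S"
    then obtain T where "open T" "x \<in> T" "f differentiable_on T"
      using Suc.prems by (metis Ck_on.simps(2))
    then show "f differentiable (at x within S)"
      by (metis differentiable_at_withinI differentiable_on_eq_differentiable_at)
  qed
  moreover have "Ck_on k S (\<lambda>x. frechet_derivative f (at x) v)" for v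
    by (rule Suc.IH) (metis Ck_on.simps(2) Suc.prems)
  ultimately show ?case by simp
qed

lemma Ck_on_const [simp]: "Ck_on k S (\<lambda>x. c)"
  by (induction k arbitrary: c) (auto simp: frechet_derivative_const)

lemma Ck_on_linear_comp:
  assumes "open S" "bounded_linear L" "Ck_on k S f"
  shows "Ck_on k S (\<lambda>x. L (f x))"
  using assms(3)
proof (induction k arbitrary: f)
  case 0
  then show ?case
    using bounded_linear.continuous_on[OF assms(2)] by auto
next
  case (Suc k)
  show ?case
  proof (rule Ck_on_SucI[OF assms(1)])
    show "((\<lambda>x. L (f x)) has_derivative (\<lambda>v. L (frechet_derivative f (at x) v))) (at x)"
      if "x \<in> S" for x
      using has_derivative_frechet[OF assms(1) _ that] Suc.prems
      by (intro bounded_linear.has_derivative[OF assms(2)]) auto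
  qed (use Suc in auto)
qed

lemma Ck_on_add:
  assumes "open S" "Ck_on k S f" "Ck_on k S g"
  shows "Ck_on k S (\<lambda>x. f x + g x)"
  using assms(2,3)
proof (induction k arbitrary: f g)
  case 0
  then show ?case by (auto intro: continuous_on_add)
next
  case (Suc k)
  show ?case
  proof (rule Ck_on_SucI[OF assms(1)])
    show "((\<lambda>x. f x + g x) has_derivative
        (\<lambda>v. frechet_derivative f (at x) v + frechet_derivative g (at x) v)) (at x)"
      if "x \<in> S" for x
      using Suc.prems that by (intro has_derivative_add has_derivative_frechet[OF assms(1)]) auto
  qed (use Suc in auto)
qed

lemma Ck_on_sum:
  assumes "open S" "\<And>i. i \<in> I \<Longrightarrow> Ck_on k S (f i)"
  shows "Ck_on k S (\<lambda>x. \<Sum>i\<in>I. f i x)"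
  using assms(2)
  by (induction I rule: infinite_finite_induct) (auto intro: Ck_on_add[OF assms(1)])

lemma Ck_on_bilinear:
  assumes "open S" and bl: "bounded_bilinear h" and "Ck_on k S f" "Ck_on k S g"
  shows "Ck_on k S (\<lambda>x. h (f x) (g x))"
  using assms(3,4)
proof (induction k arbitrary: f g)
  case 0
  then show ?case using bounded_bilinear.continuous_on[OF bl] by auto
next
  case (Suc k)
  show ?case
  proof (rule Ck_on_SucI[OF assms(1)])
    show "((\<lambda>x. h (f x) (g x)) has_derivative
        (\<lambda>v. h (f x) (frechet_derivative g (at x) v) + h (frechet_derivative f (at x) v) (g x))) (at x)"
      if "x \<in> S" for x
      using Suc.prems that
      by (intro bounded_bilinear.FDERIV[OF bl] has_derivative_frechet[OF assms(1)]) auto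
  next
    fix v
    have "Ck_on k S f" "Ck_on k S g"
      using Suc.prems Ck_on_lower by blast+
    then show "Ck_on k S (\<lambda>x. h (f x) (frechet_derivative g (at x) v)
        + h (frechet_derivative f (at x) v) (g x))"
      using Suc by (intro Ck_on_add[OF assms(1)]) auto
  qed
qed

lemma Ck_on_ident: "open S \<Longrightarrow> Ck_on k S (\<lambda>x. x)"
proof (cases k)
  case (Suc n)
  assume "open S"
  then show ?thesis
    unfolding Suc by (rule Ck_on_SucI) (auto intro: derivative_eq_intros)
qed auto

text \<open>\<open>Ck_on\<close> controls derivatives in fixed directions only, whereas the chain
  rule evaluates the derivative of \<open>g\<close> in the moving direction Df(x) v. Expanding that
  direction in the basis leaves products of a component of Df(x) v with a partial derivative of
  \<open>g\<close> along \<open>f\<close>, and the induction hypothesis covers the latter.\<close>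

lemma Ck_on_compose:
  fixes f :: "'a::euclidean_space \<Rightarrow> 'b::euclidean_space" and g :: "'b \<Rightarrow> 'c::euclidean_space"
  assumes "open S" "open T" "Ck_on k S f" "Ck_on k T g" "f ` S \<subseteq> T"
  shows "Ck_on k S (\<lambda>x. g (f x))"
  using assms(3,4)
proof (induction k arbitrary: g)
  case 0
  then show ?case
    using continuous_on_compose2[of T g S f] assms(5) by auto
next
  case (Suc k)
  have f: "f differentiable_on S" and f': "\<And>v. Ck_on k S (\<lambda>x. frechet_derivative f (at x) v)"
    and g: "g differentiable_on T" and g': "\<And>v. Ck_on k T (\<lambda>x. frechet_derivative g (at x) v)"
    using Suc.prems by auto
  let ?D = "\<lambda>x v. \<Sum>b\<in>Basis. (frechet_derivative f (at x) v \<bullet> b) *\<^sub>R frechet_derivative g (at (f x)) b"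
  show ?case
  proof (rule Ck_on_SucI[OF assms(1), where f' = ?D])
    fix x assume x: "x \<in> S"
    have dg: "(g has_derivative frechet_derivative g (at (f x))) (at (f x))"
      using has_derivative_frechet[OF assms(2) g] x assms(5) by auto
    have "((\<lambda>x. g (f x)) has_derivative (\<lambda>v. frechet_derivative g (at (f x)) (frechet_derivative f (at x) v))) (at x)"
      using diff_chain_at[OF has_derivative_frechet[OF assms(1) f x] dg] by (simp add: o_def)
    moreover have rep: "frechet_derivative g (at (f x)) w = (\<Sum>b\<in>Basis. (w \<bullet> b) *\<^sub>R frechet_derivative g (at (f x)) b)" for w
    proof -
      have "frechet_derivative g (at (f x)) w
          = frechet_derivative g (at (f x)) (\<Sum>b\<in>Basis. (w \<bullet> b) *\<^sub>R b)"
        by (simp only: euclidean_representation)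
      then show ?thesis
        by (simp only: linear_sum[OF has_derivative_linear[OF dg]]
            linear_scale[OF has_derivative_linear[OF dg]])
    qed
    moreover have "(\<lambda>v. frechet_derivative g (at (f x)) (frechet_derivative f (at x) v)) = ?D x"
      by (rule ext) (rule rep)
    ultimately show "((\<lambda>x. g (f x)) has_derivative ?D x) (at x)"
      by metis
  next
    fix v
    show "Ck_on k S (\<lambda>x. ?D x v)"
      by (intro Ck_on_sum Ck_on_bilinear[OF _ bounded_bilinear_scaleR]
          Ck_on_linear_comp[where L = "\<lambda>y. y \<bullet> _"] Suc.IH bounded_linear_inner_left assms(1) f' g'
          Ck_on_lower[OF Suc.prems(1)])
  qed
qed

lemma Ck_on_Pair:
  fixes f :: "'a::euclidean_space \<Rightarrow> 'b::euclidean_space" and g :: "'a \<Rightarrow> 'c::euclidean_space"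
  assumes "open S" "Ck_on k S f" "Ck_on k S g"
  shows "Ck_on k S (\<lambda>x. (f x, g x))"
proof -
  have "Ck_on k S (\<lambda>x. (f x, 0) + (0, g x))"
    by (intro Ck_on_add assms Ck_on_linear_comp[where L = "\<lambda>y. (y, 0)"]
        Ck_on_linear_comp[where L = "\<lambda>y. (0, y)"] bounded_linear_Pair bounded_linear_ident
        bounded_linear_zero)
  then show ?thesis by simp
qed

lemma Ck_on_inverse:
  fixes f :: "'a::euclidean_space \<Rightarrow> real"
  assumes "open S" "Ck_on k S f" "\<And>x. x \<in> S \<Longrightarrow> f x \<noteq> 0"
  shows "Ck_on k S (\<lambda>x. inverse (f x))"
  using assms(2)
proof (induction k)
  case 0
  then show ?case using assms(3) by (auto intro: continuous_on_inverse)
next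
  case (Suc k)
  show ?case
  proof (rule Ck_on_SucI[OF assms(1)])
    show "((\<lambda>x. inverse (f x)) has_derivative
        (\<lambda>v. - (inverse (f x) * frechet_derivative f (at x) v * inverse (f x)))) (at x)"
      if "x \<in> S" for x
      using has_derivative_frechet[OF assms(1) _ that] Suc.prems assms(3)[OF that]
      by (intro Deriv.has_derivative_inverse) auto
    have "Ck_on k S (\<lambda>x. inverse (f x))"
      using Suc.IH Suc.prems Ck_on_lower by blast
    then show "Ck_on k S (\<lambda>x. - (inverse (f x) * frechet_derivative f (at x) v * inverse (f x)))" for v
      using Suc.prems
      by (intro Ck_on_linear_comp[where L = uminus] Ck_on_bilinear[OF _ bounded_bilinear_mult]
          bounded_linear_minus bounded_linear_ident assms(1)) auto
  qed
qed

section \<open>Calculus of smooth maps on open sets\<close>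

lemma smooth_on_has_derivative:
  assumes "open S" "smooth_on S f" "x \<in> S"
  shows "(f has_derivative frechet_derivative f (at x)) (at x)"
  using assms has_derivative_frechet[of S f x] by (metis smooth_on_def Ck_on.simps(2))

lemma smooth_on_continuous: "smooth_on S f \<Longrightarrow> continuous_on S f"
  by (metis smooth_on_def Ck_on.simps(1))

lemma smooth_on_derivative: "smooth_on S f \<Longrightarrow> smooth_on S (\<lambda>x. frechet_derivative f (at x) v)"
  by (metis smooth_on_def Ck_on.simps(2))

lemma smooth_on_cong:
  "open S \<Longrightarrow> (\<And>x. x \<in> S \<Longrightarrow> f x = g x) \<Longrightarrow> smooth_on S f \<longleftrightarrow> smooth_on S g"
  using Ck_on_cong unfolding smooth_on_def by blast

lemma smooth_on_subset: "smooth_on S f \<Longrightarrow> T \<subseteq> S \<Longrightarrow> smooth_on T f"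
  using Ck_on_subset unfolding smooth_on_def by blast

lemma smooth_on_local:
  assumes "\<And>x. x \<in> S \<Longrightarrow> \<exists>T. open T \<and> x \<in> T \<and> smooth_on T f"
  shows "smooth_on S f"
  using Ck_on_local assms unfolding smooth_on_def by metis

lemma smooth_on_const [simp]: "smooth_on S (\<lambda>x. c)"
  by (simp add: smooth_on_def)

lemma smooth_on_linear_comp:
  "open S \<Longrightarrow> bounded_linear L \<Longrightarrow> smooth_on S f \<Longrightarrow> smooth_on S (\<lambda>x. L (f x))"
  by (simp add: smooth_on_def Ck_on_linear_comp)

lemma smooth_on_ident: "open S \<Longrightarrow> smooth_on S (\<lambda>x. x)"
  by (simp add: smooth_on_def Ck_on_ident)

lemma smooth_on_linear: "open S \<Longrightarrow> bounded_linear L \<Longrightarrow> smooth_on S L"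
  using smooth_on_linear_comp[OF _ _ smooth_on_ident] by auto

lemma smooth_on_add:
  "open S \<Longrightarrow> smooth_on S f \<Longrightarrow> smooth_on S g \<Longrightarrow> smooth_on S (\<lambda>x. f x + g x)"
  by (simp add: smooth_on_def Ck_on_add)

lemma smooth_on_bilinear:
  "open S \<Longrightarrow> bounded_bilinear h \<Longrightarrow> smooth_on S f \<Longrightarrow> smooth_on S g \<Longrightarrow> smooth_on S (\<lambda>x. h (f x) (g x))"
  by (simp add: smooth_on_def Ck_on_bilinear)

lemma smooth_on_mult:
  fixes f g :: "'a::euclidean_space \<Rightarrow> real"
  shows "open S \<Longrightarrow> smooth_on S f \<Longrightarrow> smooth_on S g \<Longrightarrow> smooth_on S (\<lambda>x. f x * g x)"
  by (rule smooth_on_bilinear[OF _ bounded_bilinear_mult])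

lemma smooth_on_scaleR:
  "open S \<Longrightarrow> smooth_on S f \<Longrightarrow> smooth_on S g \<Longrightarrow> smooth_on S (\<lambda>x. f x *\<^sub>R g x)"
  by (rule smooth_on_bilinear[OF _ bounded_bilinear_scaleR])

lemma smooth_on_diff:
  "open S \<Longrightarrow> smooth_on S f \<Longrightarrow> smooth_on S g \<Longrightarrow> smooth_on S (\<lambda>x. f x - g x)"
  using smooth_on_add[of S f "\<lambda>x. - g x"]
    smooth_on_linear_comp[of S uminus g, OF _ bounded_linear_minus[OF bounded_linear_ident]] by simp

lemma smooth_on_sum:
  "open S \<Longrightarrow> (\<And>i. i \<in> I \<Longrightarrow> smooth_on S (f i)) \<Longrightarrow> smooth_on S (\<lambda>x. \<Sum>i\<in>I. f i x)"
  by (simp add: smooth_on_def Ck_on_sum)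

lemma smooth_on_divide:
  fixes f g :: "'a::euclidean_space \<Rightarrow> real"
  assumes "open S" "smooth_on S f" "smooth_on S g" "\<And>x. x \<in> S \<Longrightarrow> g x \<noteq> 0"
  shows "smooth_on S (\<lambda>x. f x / g x)"
  using assms smooth_on_mult[of S f "\<lambda>x. inverse (g x)"]
  by (simp add: smooth_on_def Ck_on_inverse divide_inverse)

lemma smooth_on_compose:
  fixes f :: "'a::euclidean_space \<Rightarrow> 'b::euclidean_space" and g :: "'b \<Rightarrow> 'c::euclidean_space"
  assumes "open S" "open T" "smooth_on S f" "smooth_on T g" "f ` S \<subseteq> T"
  shows "smooth_on S (\<lambda>x. g (f x))"
  unfolding smooth_on_def
proof
  show "Ck_on k S (\<lambda>x. g (f x))" for k
    by (rule Ck_on_compose[OF assms(1,2) _ _ assms(5)]) (use assms(3,4) in \<open>auto simp: smooth_on_def\<close>)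
qed

lemma frechet_derivative_compose:
  assumes "(f has_derivative f') (at x)" "(g has_derivative g') (at (f x))"
  shows "frechet_derivative (\<lambda>x. g (f x)) (at x) v = g' (f' v)"
  using fun_cong[OF frechet_derivative_at[OF diff_chain_at[OF assms, unfolded o_def]], of v] by simp

subsection \<open>Symmetry of second derivatives\<close>

text \<open>Two mean value theorems: one for \<open>g\<close>, the increment along \<open>v\<close>
  as a function of the step along \<open>u\<close>, and one for the directional derivative
  \<open>f' _ u\<close> along \<open>v\<close>.\<close>

lemma mixed_difference:
  fixes f :: "'a::euclidean_space \<Rightarrow> real"
  assumes "0 < h" and cover: "\<And>s t. 0 \<le> s \<Longrightarrow> s \<le> h \<Longrightarrow> 0 \<le> t \<Longrightarrow> t \<le> h \<Longrightarrow> x + s *\<^sub>R u + t *\<^sub>R v \<in> S"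
    and f': "\<And>y. y \<in> S \<Longrightarrow> (f has_derivative f' y) (at y)"
    and f'': "\<And>y. y \<in> S \<Longrightarrow> ((\<lambda>y. f' y u) has_derivative f'' y) (at y)"
  shows "\<exists>s\<in>{0..h}. \<exists>t\<in>{0..h}. f (x + h *\<^sub>R u + h *\<^sub>R v) - f (x + h *\<^sub>R u) - f (x + h *\<^sub>R v) + f x
    = h * h * f'' (x + s *\<^sub>R u + t *\<^sub>R v) v"
proof -
  have lin: "f' y (c *\<^sub>R e) = c * f' y e" if "y \<in> S" for y c e
    using linear_scale[OF has_derivative_linear[OF f'[OF that]]] by simp
  have lin2: "f'' y (c *\<^sub>R e) = c * f'' y e" if "y \<in> S" for y c e
    using linear_scale[OF has_derivative_linear[OF f''[OF that]]] by simp
  define g where "g s = f (x + s *\<^sub>R u + h *\<^sub>R v) - f (x + s *\<^sub>R u)" for s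
  have d1: "((\<lambda>s. f (x + s *\<^sub>R u + t *\<^sub>R v)) has_derivative (\<lambda>r. f' (x + s *\<^sub>R u + t *\<^sub>R v) (r *\<^sub>R u))) (at s within {0..h})"
    if "s \<in> {0..h}" "t \<in> {0..h}" for s t
    using cover[of s t] that
    by (intro has_derivative_compose[of "\<lambda>s. x + s *\<^sub>R u + t *\<^sub>R v", OF _ f'])
      (auto intro!: derivative_eq_intros)
  have "\<exists>s\<in>{0<..<h}. g h - g 0 = (f' (x + s *\<^sub>R u + h *\<^sub>R v) ((h - 0) *\<^sub>R u) - f' (x + s *\<^sub>R u) ((h - 0) *\<^sub>R u))"
    unfolding g_def
    using d1[of _ h] d1[of _ 0] \<open>0 < h\<close>
    by (intro mvt_simple[where f' = "\<lambda>s r. f' (x + s *\<^sub>R u + h *\<^sub>R v) (r *\<^sub>R u) - f' (x + s *\<^sub>R u) (r *\<^sub>R u)"]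
        has_derivative_diff) auto
  then obtain s where s0: "s \<in> {0<..<h}"
    and g0: "g h - g 0 = f' (x + s *\<^sub>R u + h *\<^sub>R v) ((h - 0) *\<^sub>R u) - f' (x + s *\<^sub>R u) ((h - 0) *\<^sub>R u)"
    by blast
  then have s: "s \<in> {0..h}"
    and g: "g h - g 0 = h * (f' (x + s *\<^sub>R u + h *\<^sub>R v) u - f' (x + s *\<^sub>R u) u)"
    using cover[of s h] cover[of s 0] \<open>0 < h\<close> by (auto simp: lin right_diff_distrib)
  have d2: "((\<lambda>t. f' (x + s *\<^sub>R u + t *\<^sub>R v) u) has_derivative (\<lambda>r. f'' (x + s *\<^sub>R u + t *\<^sub>R v) (r *\<^sub>R v))) (at t within {0..h})"
    if "t \<in> {0..h}" for t
    using cover[of s t] that s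
    by (intro has_derivative_compose[of "\<lambda>t. x + s *\<^sub>R u + t *\<^sub>R v", OF _ f''])
      (auto intro!: derivative_eq_intros)
  have "\<exists>t\<in>{0<..<h}. f' (x + s *\<^sub>R u + h *\<^sub>R v) u - f' (x + s *\<^sub>R u + 0 *\<^sub>R v) u = f'' (x + s *\<^sub>R u + t *\<^sub>R v) ((h - 0) *\<^sub>R v)"
    using d2 \<open>0 < h\<close>
    by (intro mvt_simple[where f' = "\<lambda>t r. f'' (x + s *\<^sub>R u + t *\<^sub>R v) (r *\<^sub>R v)"]) auto
  then obtain t where t0: "t \<in> {0<..<h}"
    and t1: "f' (x + s *\<^sub>R u + h *\<^sub>R v) u - f' (x + s *\<^sub>R u + 0 *\<^sub>R v) u = f'' (x + s *\<^sub>R u + t *\<^sub>R v) ((h - 0) *\<^sub>R v)"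
    by blast
  then have t: "t \<in> {0..h}"
    and "f' (x + s *\<^sub>R u + h *\<^sub>R v) u - f' (x + s *\<^sub>R u) u = h * f'' (x + s *\<^sub>R u + t *\<^sub>R v) v"
    using cover[of s t] s by (auto simp: lin2)
  then have "g h - g 0 = h * h * f'' (x + s *\<^sub>R u + t *\<^sub>R v) v"
    using g by simp
  with s t show ?thesis
    by (intro bexI[of _ s] bexI[of _ t]) (simp_all add: g_def)
qed

text \<open>The second difference over a parallelogram is symmetric in \<open>u\<close> and
  \<open>v\<close>. By \<open>mixed_difference\<close> the two mixed derivatives therefore coincide
  at two points near \<open>x\<close>, and continuity rules out a gap at \<open>x\<close>
  itself.\<close>

lemma smooth_on_second_derivative_symmetric_real:
  fixes f :: "'a::euclidean_space \<Rightarrow> real"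
  assumes "open S" "smooth_on S f" "x \<in> S"
  shows "frechet_derivative (\<lambda>y. frechet_derivative f (at y) u) (at x) v
    = frechet_derivative (\<lambda>y. frechet_derivative f (at y) v) (at x) u" (is "?F u v x = ?F v u x")
proof (rule ccontr)
  assume neq: "?F u v x \<noteq> ?F v u x"
  \<comment> \<open>Half the gap: two errors below \<open>e\<close> cannot close it.\<close>
  define e where "e = \<bar>?F u v x - ?F v u x\<bar> / 2"
  have "e > 0" using neq by (simp add: e_def)
  have near: "\<exists>d>0. \<forall>y\<in>ball x d. y \<in> S \<and> \<bar>?F a b y - ?F a b x\<bar> < e" for a b
  proof -
    have "continuous_on S (?F a b)"
      using assms(2) smooth_on_continuous smooth_on_derivative by blast
    then have "isCont (?F a b) x"
      using assms continuous_on_eq_continuous_at by blast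
    then obtain d1 where "d1 > 0" "\<forall>y. dist y x < d1 \<longrightarrow> dist (?F a b y) (?F a b x) < e"
      using \<open>e > 0\<close> unfolding continuous_at_eps_delta by blast
    moreover obtain d2 where "d2 > 0" "ball x d2 \<subseteq> S"
      using assms openE by blast
    ultimately show ?thesis
      by (intro exI[of _ "min d1 d2"]) (auto simp: dist_commute dist_real_def)
  qed
  obtain d where "d > 0" and d: "\<And>y. y \<in> ball x d \<Longrightarrow> y \<in> S \<and> \<bar>?F u v y - ?F u v x\<bar> < e \<and> \<bar>?F v u y - ?F v u x\<bar> < e"
  proof -
    obtain d1 d2 where "d1 > 0" "\<forall>y\<in>ball x d1. y \<in> S \<and> \<bar>?F u v y - ?F u v x\<bar> < e"
      "d2 > 0" "\<forall>y\<in>ball x d2. y \<in> S \<and> \<bar>?F v u y - ?F v u x\<bar> < e"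
      using near[of u v] near[of v u] by blast
    then show ?thesis
      by (intro that[of "min d1 d2"]) auto
  qed
  \<comment> \<open>The parallelogram with sides \<open>h\<close> times \<open>u\<close> and
    \<open>v\<close> must stay in the ball; the summand 1 keeps the denominator positive when both
    vectors vanish.\<close>
  define h where "h = d / (norm u + norm v + 1)"
  have "h > 0" using \<open>d > 0\<close> by (auto simp: h_def intro!: divide_pos_pos add_nonneg_pos)
  have hd: "h * norm u + h * norm v < d"
  proof -
    have "h * (norm u + norm v + 1) = d"
      using norm_ge_zero[of u] norm_ge_zero[of v] unfolding h_def by (auto simp: field_simps simp del: norm_ge_zero)
    then show ?thesis using \<open>h > 0\<close> by (simp add: algebra_simps)
  qed
  have inb: "x + s *\<^sub>R a + t *\<^sub>R b \<in> ball x d"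
    if "0 \<le> s" "s \<le> h" "0 \<le> t" "t \<le> h" "(a = u \<and> b = v) \<or> (a = v \<and> b = u)" for s t a b
  proof -
    have "norm (s *\<^sub>R a + t *\<^sub>R b) \<le> s * norm a + t * norm b"
      using that by (auto intro: order_trans[OF norm_triangle_ineq])
    also have "\<dots> \<le> h * norm a + h * norm b"
      using that by (intro add_mono mult_right_mono) auto
    also have "\<dots> < d" using hd that(5) by (auto simp: add.commute)
    finally show ?thesis using norm_minus_cancel[of "s *\<^sub>R a + t *\<^sub>R b"] by (simp add: dist_norm add.assoc del: norm_minus_cancel)
  qed
  have df: "(f has_derivative frechet_derivative f (at y)) (at y)"
    and df2: "((\<lambda>y. frechet_derivative f (at y) a) has_derivative (\<lambda>b. ?F a b y)) (at y)" if "y \<in> ball x d" for y a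
    using smooth_on_has_derivative[OF assms(1) assms(2)] d[OF that]
      smooth_on_has_derivative[OF assms(1) smooth_on_derivative[OF assms(2)]] by auto
  obtain s t where st: "s \<in> {0..h}" "t \<in> {0..h}"
    "f (x + h *\<^sub>R u + h *\<^sub>R v) - f (x + h *\<^sub>R u) - f (x + h *\<^sub>R v) + f x = h * h * ?F u v (x + s *\<^sub>R u + t *\<^sub>R v)"
    using mixed_difference[where u = u and v = v, OF \<open>h > 0\<close> inb df df2] by auto
  obtain s' t' where st': "s' \<in> {0..h}" "t' \<in> {0..h}"
    "f (x + h *\<^sub>R v + h *\<^sub>R u) - f (x + h *\<^sub>R v) - f (x + h *\<^sub>R u) + f x = h * h * ?F v u (x + s' *\<^sub>R v + t' *\<^sub>R u)"
    using mixed_difference[where u = v and v = u, OF \<open>h > 0\<close> inb df df2] by auto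
  have "h * h * ?F u v (x + s *\<^sub>R u + t *\<^sub>R v) = h * h * ?F v u (x + s' *\<^sub>R v + t' *\<^sub>R u)"
    using st(3) st'(3) by (simp add: algebra_simps)
  then have "?F u v (x + s *\<^sub>R u + t *\<^sub>R v) = ?F v u (x + s' *\<^sub>R v + t' *\<^sub>R u)"
    using \<open>h > 0\<close> by simp
  moreover have "\<bar>?F u v (x + s *\<^sub>R u + t *\<^sub>R v) - ?F u v x\<bar> < e"
    using d[OF inb, of s t u v] st by auto
  moreover have "\<bar>?F v u (x + s' *\<^sub>R v + t' *\<^sub>R u) - ?F v u x\<bar> < e"
    using d[OF inb, of s' t' v u] st' by auto
  ultimately show False
    unfolding e_def by (smt (verit) field_sum_of_halves)
qed

lemma smooth_on_second_derivative_symmetric: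
  fixes f :: "'a::euclidean_space \<Rightarrow> 'b::euclidean_space"
  assumes "open S" "smooth_on S f" "x \<in> S"
  shows "frechet_derivative (\<lambda>y. frechet_derivative f (at y) u) (at x) v
    = frechet_derivative (\<lambda>y. frechet_derivative f (at y) v) (at x) u"
proof (rule euclidean_eqI)
  fix b :: 'b assume "b \<in> Basis"
  have inner: "frechet_derivative (\<lambda>y. g y \<bullet> b) (at y) w = frechet_derivative g (at y) w \<bullet> b"
    if "smooth_on S g" "y \<in> S" for g :: "'a \<Rightarrow> 'b" and y w
    using frechet_derivative_compose[OF smooth_on_has_derivative[OF assms(1) that]
        bounded_linear_imp_has_derivative[OF bounded_linear_inner_left]] by simp
  have "frechet_derivative (\<lambda>y. frechet_derivative f (at y) u) (at x) v \<bullet> b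
     = frechet_derivative (\<lambda>y. frechet_derivative (\<lambda>y. f y \<bullet> b) (at y) u) (at x) v" for u v
    using inner[OF smooth_on_derivative[OF assms(2)] assms(3)]
      frechet_derivative_cong[OF assms(1,3), of "\<lambda>y. frechet_derivative (\<lambda>y. f y \<bullet> b) (at y) u"
        "\<lambda>y. frechet_derivative f (at y) u \<bullet> b"] inner[OF assms(2)] by simp
  then show "frechet_derivative (\<lambda>y. frechet_derivative f (at y) u) (at x) v \<bullet> b
     = frechet_derivative (\<lambda>y. frechet_derivative f (at y) v) (at x) u \<bullet> b"
    using smooth_on_second_derivative_symmetric_real[OF assms(1) _ assms(3), of "\<lambda>y. f y \<bullet> b" u v]
      smooth_on_linear_comp[OF assms(1) bounded_linear_inner_left assms(2)] by simp
qed

subsection \<open>Smooth solutions of linear systems and the inverse function theorem\<close>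

text \<open>A product rule in which one factor is merely continuous: since \<open>m\<close> vanishes
  at \<open>x\<close>, the error \<open>(c y - c x) *\<^sub>R m y\<close> is a factor tending to 0
  times one of order |y - x|. It is needed to differentiate a solution of a linear system that is so
  far only known to be continuous.\<close>

lemma has_derivative_scaleR_vanishing:
  fixes m :: "'a::real_normed_vector \<Rightarrow> 'b::real_normed_vector"
  assumes m: "(m has_derivative m') (at x)" and "m x = 0" and c: "isCont c x"
  shows "((\<lambda>y. c y *\<^sub>R m y) has_derivative (\<lambda>h. c x *\<^sub>R m' h)) (at x)"
proof -
  interpret m': bounded_linear m' by (rule has_derivative_bounded_linear[OF m])
  obtain K where K: "\<And>h. norm (m' h) \<le> norm h * K" "K \<ge> 0"
    using m'.nonneg_bounded by blast
  have lim: "((\<lambda>y. norm (m y - m x - m' (y - x)) / norm (y - x)) \<longlongrightarrow> 0) (at x)"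
    using m by (simp add: has_derivative_iff_norm)
  have "((\<lambda>y. (c y - c x) *\<^sub>R m y) has_derivative (\<lambda>h. 0)) (at x)"
    unfolding has_derivative_iff_norm
  proof (intro conjI)
    have "((\<lambda>y. \<bar>c y - c x\<bar> * (norm (m y - m x - m' (y - x)) / norm (y - x) + K)) \<longlongrightarrow> \<bar>c x - c x\<bar> * (0 + K)) (at x)"
      using c unfolding isCont_def by (intro tendsto_intros lim) auto
    then have *: "((\<lambda>y. \<bar>c y - c x\<bar> * (norm (m y - m x - m' (y - x)) / norm (y - x) + K)) \<longlongrightarrow> 0) (at x)"
      by simp
    show "((\<lambda>y. norm ((c y - c x) *\<^sub>R m y - (c x - c x) *\<^sub>R m x - 0) / norm (y - x)) \<longlongrightarrow> 0) (at x)"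
    proof (rule Lim_null_comparison[OF _ *])
      have "norm (norm ((c y - c x) *\<^sub>R m y - (c x - c x) *\<^sub>R m x - 0) / norm (y - x))
          \<le> \<bar>c y - c x\<bar> * (norm (m y - m x - m' (y - x)) / norm (y - x) + K)" if "y \<noteq> x" for y
      proof -
        have "norm (m y) \<le> norm (m y - m x - m' (y - x)) + norm (m' (y - x))"
          using norm_triangle_ineq[of "m y - m x - m' (y - x)" "m' (y - x)"] \<open>m x = 0\<close> by simp
        also have "\<dots> \<le> norm (m y - m x - m' (y - x)) + norm (y - x) * K"
          using K(1)[of "y - x"] by simp
        finally have "norm (m y) / norm (y - x) \<le> norm (m y - m x - m' (y - x)) / norm (y - x) + K"
          using that by (simp add: field_simps)
        then show ?thesis
          using mult_left_mono[of _ _ "\<bar>c y - c x\<bar>"] by fastforce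
      qed
      then show "\<forall>\<^sub>F y in at x. norm (norm ((c y - c x) *\<^sub>R m y - (c x - c x) *\<^sub>R m x - 0) / norm (y - x))
          \<le> \<bar>c y - c x\<bar> * (norm (m y - m x - m' (y - x)) / norm (y - x) + K)"
        by (auto simp: eventually_at_filter)
    qed
  qed auto
  then have "((\<lambda>y. c x *\<^sub>R m y + (c y - c x) *\<^sub>R m y) has_derivative (\<lambda>h. c x *\<^sub>R m' h + 0)) (at x)"
    by (intro has_derivative_add has_derivative_scaleR_right m)
  then show ?thesis by (simp add: algebra_simps)
qed

text \<open>On the right, \<open>w y\<close> occurs only multiplied by \<open>M y e - M x e\<close>,
  which vanishes as y tends to x. Continuity and differentiability of \<open>w\<close> both follow
  from this formula.\<close>

lemma linear_system_perturbation:
  fixes M :: "'a::euclidean_space \<Rightarrow> 'b::euclidean_space \<Rightarrow> 'b"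
  assumes lin: "linear (M x)" "linear (M y)" and N: "linear N" "\<And>e. N (M x e) = e"
    and eq: "M x (w x) = b x" "M y (w y) = b y"
  shows "w y - w x = N (b y - b x - (\<Sum>e\<in>Basis. (w y \<bullet> e) *\<^sub>R (M y e - M x e)))"
proof -
  have expand: "M z (w y) = (\<Sum>e\<in>Basis. (w y \<bullet> e) *\<^sub>R M z e)" if "linear (M z)" for z
  proof -
    have "M z (w y) = M z (\<Sum>e\<in>Basis. (w y \<bullet> e) *\<^sub>R e)"
      by (simp only: euclidean_representation)
    then show ?thesis
      by (simp only: linear_sum[OF that] linear_scale[OF that])
  qed
  have "b y - b x - (\<Sum>e\<in>Basis. (w y \<bullet> e) *\<^sub>R (M y e - M x e)) = M x (w y) - M x (w x)"
    using eq expand[OF lin(1)] expand[OF lin(2)]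
    by (simp add: sum_subtractf scaleR_diff_right)
  also have "\<dots> = M x (w y - w x)" by (simp add: linear_diff[OF lin(1)])
  finally show ?thesis using N(2) by simp
qed

text \<open>With K a bound for \<open>N\<close>, the term containing \<open>w y\<close> is at most K
  \<mu>(y) (|w x| + |w y - w x|). As soon as \<mu> < 1/(2K), half of |w y - w x| absorbs the last
  part, and what remains tends to 0.\<close>

lemma continuous_linear_solution:
  fixes M :: "'a::euclidean_space \<Rightarrow> 'b::euclidean_space \<Rightarrow> 'b"
  assumes "open S" "x \<in> S" and lin: "\<And>y. y \<in> S \<Longrightarrow> linear (M y)" and N: "linear N" "\<And>e. N (M x e) = e"
    and eq: "\<And>y. y \<in> S \<Longrightarrow> M y (w y) = b y"
    and M: "\<And>e. isCont (\<lambda>y. M y e) x" and b: "isCont b x"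
  shows "isCont w x"
proof -
  obtain K where K: "K > 0" "\<And>h. norm (N h) \<le> norm h * K"
    using bounded_linear.pos_bounded linear_conv_bounded_linear N(1) by blast
  define \<mu> where "\<mu> y = (\<Sum>e\<in>Basis. norm (M y e - M x e))" for y
  have \<mu>0: "(\<mu> \<longlongrightarrow> 0) (at x)"
  proof -
    have "(\<mu> \<longlongrightarrow> (\<Sum>e\<in>Basis. norm (M x e - M x e))) (at x)"
      unfolding \<mu>_def using M unfolding isCont_def by (intro tendsto_intros)
    then show ?thesis by simp
  qed
  have "\<forall>\<^sub>F y in at x. \<mu> y < 1 / (2 * K)"
    using order_tendstoD(2)[OF \<mu>0, of "1 / (2 * K)"] K by simp
  moreover have "\<forall>\<^sub>F y in at x. y \<in> S"
    using assms(1,2) by (simp add: eventually_at_topological) blast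
  ultimately have ev: "\<forall>\<^sub>F y in at x. norm (w y - w x) \<le> 2 * K * (norm (b y - b x) + norm (w x) * \<mu> y)"
  proof eventually_elim
    case (elim y)
    have \<mu>nn: "0 \<le> \<mu> y" unfolding \<mu>_def by (simp add: sum_nonneg)
    have "norm (\<Sum>e\<in>Basis. (w y \<bullet> e) *\<^sub>R (M y e - M x e)) \<le> norm (w y) * \<mu> y"
      unfolding \<mu>_def sum_distrib_left
      by (rule order_trans[OF norm_sum]) (auto intro!: sum_mono mult_right_mono simp: Basis_le_norm)
    moreover have "norm (w y) \<le> norm (w x) + norm (w y - w x)"
      by norm
    ultimately have S: "norm (\<Sum>e\<in>Basis. (w y \<bullet> e) *\<^sub>R (M y e - M x e)) \<le> norm (w x) * \<mu> y + norm (w y - w x) * \<mu> y"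
      using mult_right_mono[OF _ \<mu>nn] by (fastforce simp: distrib_right)
    have "norm (w y - w x) \<le> norm (b y - b x - (\<Sum>e\<in>Basis. (w y \<bullet> e) *\<^sub>R (M y e - M x e))) * K"
      using linear_system_perturbation[of M x y N w b] K lin[OF assms(2)] lin[OF elim(2)] N eq[OF assms(2)] eq[OF elim(2)]
      by metis
    also have "\<dots> \<le> (norm (b y - b x) + (norm (w x) * \<mu> y + norm (w y - w x) * \<mu> y)) * K"
      using S K(1) norm_triangle_ineq4[of "b y - b x" "\<Sum>e\<in>Basis. (w y \<bullet> e) *\<^sub>R (M y e - M x e)"]
      by (intro mult_right_mono) auto
    finally have "norm (w y - w x) \<le> K * (norm (b y - b x) + norm (w x) * \<mu> y) + norm (w y - w x) * (\<mu> y * K)"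
      by (simp add: algebra_simps)
    moreover have "norm (w y - w x) * (\<mu> y * K) \<le> norm (w y - w x) * (1/2)"
      using elim K(1) by (intro mult_left_mono) (auto simp: field_simps)
    ultimately show ?case by simp
  qed
  have "((\<lambda>y. 2 * K * (norm (b y - b x) + norm (w x) * \<mu> y)) \<longlongrightarrow> 2 * K * (norm (b x - b x) + norm (w x) * 0)) (at x)"
    using b unfolding isCont_def by (intro tendsto_intros \<mu>0)
  then have "((\<lambda>y. w y - w x) \<longlongrightarrow> 0) (at x)"
    using Lim_null_comparison[OF ev] by simp
  then show ?thesis
    unfolding isCont_def using Lim_null by blast
qed

text \<open>Each directional derivative of \<open>w\<close> solves a system with the same matrix and
  a right-hand side built from \<open>w\<close> and the derivatives of \<open>M\<close> and
  \<open>b\<close>. The induction over \<open>k\<close> therefore closes without any formula for the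
  inverse matrix.\<close>

lemma Ck_on_linear_solution:
  fixes M :: "'a::euclidean_space \<Rightarrow> 'b::euclidean_space \<Rightarrow> 'b"
  assumes S: "open S" and lin: "\<And>x. x \<in> S \<Longrightarrow> linear (M x)"
    and inj: "\<And>x e. x \<in> S \<Longrightarrow> M x e = 0 \<Longrightarrow> e = 0"
    and "\<And>e. Ck_on k S (\<lambda>x. M x e)" "Ck_on k S b" "\<And>x. x \<in> S \<Longrightarrow> M x (w x) = b x"
  shows "Ck_on k S w"
  using assms(4-)
proof (induction k arbitrary: b w)
  case 0
  have "isCont w x" if x: "x \<in> S" for x
  proof -
    have "inj (M x)"
      using inj[OF x] lin[OF x] linear_injective_0 by blast
    then obtain N where "linear N" "N \<circ> M x = id"
      using linear_injective_left_inverse[OF lin[OF x]] by blast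
    then show ?thesis
      using 0 x S by (intro continuous_linear_solution[where M = M and N = N and w = w and b = b, OF S x lin])
        (auto simp: continuous_on_eq_continuous_at o_def fun_eq_iff)
  qed
  then show ?case by (simp add: continuous_at_imp_continuous_on)
next
  case (Suc k)
  have w: "Ck_on k S w"
    by (rule Suc.IH[of b]) (use Suc.prems Ck_on_lower in blast)+
  \<comment> \<open>The right-hand side of the differentiated system.\<close>
  define r where "r x v = frechet_derivative b (at x) v
      - (\<Sum>e\<in>Basis. (w x \<bullet> e) *\<^sub>R frechet_derivative (\<lambda>x. M x e) (at x) v)" for x v
  have "\<exists>w'. (w has_derivative w') (at x) \<and> (\<forall>v. M x (w' v) = r x v)" if x: "x \<in> S" for x
  proof -
    have "inj (M x)"
      using inj[OF x] lin[OF x] linear_injective_0 by blast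
    then obtain N where N: "linear N" "N \<circ> M x = id"
      using linear_injective_left_inverse[OF lin[OF x]] by blast
    then have NM: "\<And>e. N (M x e) = e" by (simp add: fun_eq_iff)
    have MN: "M x (N e) = e" for e
      using linear_inverse_left[OF lin[OF x] N(1)] N(2) by (simp add: fun_eq_iff)
    have dM: "((\<lambda>y. M y e - M x e) has_derivative frechet_derivative (\<lambda>x. M x e) (at x)) (at x)" for e
      using has_derivative_frechet[OF S _ x, of "\<lambda>x. M x e"] Suc.prems(1)[of e]
      by (auto intro!: derivative_eq_intros)
    have db: "(b has_derivative frechet_derivative b (at x)) (at x)"
      using has_derivative_frechet[OF S _ x] Suc.prems(2) by auto
    have db': "((\<lambda>y. b y - b x) has_derivative frechet_derivative b (at x)) (at x)"
      using has_derivative_diff[OF db has_derivative_const[of "b x"]] by simp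
    \<comment> \<open>Continuity of \<open>w\<close> is all that the product rule with the vanishing
      factor \<open>M y e - M x e\<close> asks for.\<close>
    have "isCont w x"
      using Ck_on_continuous[OF w] x S by (simp add: continuous_on_eq_continuous_at)
    then have "((\<lambda>y. b y - b x - (\<Sum>e\<in>Basis. (w y \<bullet> e) *\<^sub>R (M y e - M x e))) has_derivative r x) (at x)"
      unfolding r_def
      by (intro has_derivative_diff[OF db'] has_derivative_sum has_derivative_scaleR_vanishing dM)
        (simp_all add: continuous_inner)
    then have "((\<lambda>y. w x + N (b y - b x - (\<Sum>e\<in>Basis. (w y \<bullet> e) *\<^sub>R (M y e - M x e)))) has_derivative (\<lambda>v. N (r x v))) (at x)"
      using has_derivative_add[OF has_derivative_const[of "w x"]
          bounded_linear.has_derivative[OF N(1)[unfolded linear_conv_bounded_linear]]] by simp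
    then have "(w has_derivative (\<lambda>v. N (r x v))) (at x)"
    proof (rule has_derivative_transform_within_open[OF _ S x])
      fix y assume y: "y \<in> S"
      show "w x + N (b y - b x - (\<Sum>e\<in>Basis. (w y \<bullet> e) *\<^sub>R (M y e - M x e))) = w y"
        using linear_system_perturbation[OF lin[OF x] lin[OF y] N(1) NM Suc.prems(3)[OF x] Suc.prems(3)[OF y]]
        by (simp add: algebra_simps)
    qed
    then show ?thesis using MN by blast
  qed
  then obtain w' where w': "\<And>x. x \<in> S \<Longrightarrow> (w has_derivative w' x) (at x)"
    "\<And>x v. x \<in> S \<Longrightarrow> M x (w' x v) = r x v"
    by metis
  have "Ck_on k S (\<lambda>x. w' x v)" for v
  proof (rule Suc.IH[where b = "\<lambda>x. r x v"])
    show "Ck_on k S (\<lambda>x. M x e)" for e using Suc.prems(1) Ck_on_lower by blast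
    have "Ck_on k S (\<lambda>x. frechet_derivative b (at x) v
      + (- 1) *\<^sub>R (\<Sum>e\<in>Basis. (w x \<bullet> e) *\<^sub>R frechet_derivative (\<lambda>x. M x e) (at x) v))"
      using Suc.prems(1,2)
      by (intro Ck_on_add[OF S] Ck_on_sum[OF S] Ck_on_bilinear[OF S bounded_bilinear_scaleR] Ck_on_const
          Ck_on_linear_comp[OF S bounded_linear_inner_left w]) auto
    then show "Ck_on k S (\<lambda>x. r x v)" by (simp add: r_def)
  qed (use w' in auto)
  then show ?case using Ck_on_SucI[OF S w'(1)] by blast
qed

lemma smooth_on_linear_solution:
  fixes M :: "'a::euclidean_space \<Rightarrow> 'b::euclidean_space \<Rightarrow> 'b"
  assumes "open S" "\<And>x. x \<in> S \<Longrightarrow> linear (M x)" "\<And>x e. x \<in> S \<Longrightarrow> M x e = 0 \<Longrightarrow> e = 0"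
    and "\<And>e. smooth_on S (\<lambda>x. M x e)" "smooth_on S b" "\<And>x. x \<in> S \<Longrightarrow> M x (w x) = b x"
  shows "smooth_on S w"
  unfolding smooth_on_def
  using Ck_on_linear_solution[OF assms(1-3), where w = w and b = b] assms(4-) by (auto simp: smooth_on_def)

text \<open>The once differentiable inverse is upgraded through the linear system Df(g y) (g' y v) =
  v: if \<open>g\<close> is of class C^k, so is the matrix of the system, and hence its solution
  g'.\<close>

theorem smooth_inverse_function:
  fixes f :: "'a::euclidean_space \<Rightarrow> 'a"
  assumes S: "open S" and f: "smooth_on S f" and "x0 \<in> S"
    and inj: "\<And>v. frechet_derivative f (at x0) v = 0 \<Longrightarrow> v = 0"
  obtains U V g where "open U" "U \<subseteq> S" "x0 \<in> U" "open V" "homeomorphism U V f g" "smooth_on V g"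
    "\<And>x v. x \<in> U \<Longrightarrow> frechet_derivative f (at x) v = 0 \<Longrightarrow> v = 0"
proof -
  define f' where "f' x = Blinfun (frechet_derivative f (at x))" for x
  have df: "(f has_derivative frechet_derivative f (at x)) (at x)" if "x \<in> S" for x
    using smooth_on_has_derivative[OF S f that] .
  have f': "blinfun_apply (f' x) = frechet_derivative f (at x)" if "x \<in> S" for x
    unfolding f'_def using df[OF that] by (simp add: bounded_linear_Blinfun_apply has_derivative_bounded_linear)
  have cont: "continuous_on S f'"
  proof (rule continuous_on_blinfun_componentwise)
    show "continuous_on S (\<lambda>x. f' x i)" for i
      using smooth_on_continuous[OF smooth_on_derivative[OF f, of i]] f' by (simp cong: continuous_on_cong)
  qed
  have lin0: "linear (frechet_derivative f (at x0))"
    using df[OF \<open>x0 \<in> S\<close>] has_derivative_linear by blast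
  then obtain N where N: "linear N" "N \<circ> frechet_derivative f (at x0) = id"
    using linear_injective_left_inverse[OF lin0] inj linear_injective_0[OF lin0] by blast
  have "Blinfun N o\<^sub>L f' x0 = id_blinfun"
    using N f'[OF \<open>x0 \<in> S\<close>]
    by (intro blinfun_eqI) (simp add: bounded_linear_Blinfun_apply linear_conv_bounded_linear fun_eq_iff)
  then obtain U V g g' where UV: "open U" "U \<subseteq> S" "x0 \<in> U" "open V" "homeomorphism U V f g"
    and g: "\<And>y. y \<in> V \<Longrightarrow> (g has_derivative (g' y)) (at y)"
      "\<And>y. y \<in> V \<Longrightarrow> g' y = inv (blinfun_apply (f'(g y)))"
      "\<And>y. y \<in> V \<Longrightarrow> bij (blinfun_apply (f'(g y)))"
    using inverse_function_theorem[OF S _ cont \<open>x0 \<in> S\<close>, of f "Blinfun N"] df f' by metis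
  have gV: "g ` V = U" and fU: "f ` U = V" and gf: "\<And>x. x \<in> U \<Longrightarrow> g (f x) = x"
    using UV(5) by (auto simp: homeomorphism_def)
  have inj': "v = 0" if "x \<in> U" "frechet_derivative f (at x) v = 0" for x v
  proof -
    have "bij (frechet_derivative f (at x))"
      using g(3)[of "f x"] fU gf that(1) UV(2) f'[of x] by auto
    then show ?thesis
      using that(2) linear_injective_0[of "frechet_derivative f (at x)"] has_derivative_linear[OF df, of x] that(1) UV(2)
      by (auto simp: bij_def)
  qed
  have "Ck_on k V g" for k
  proof (induction k)
    case 0
    show ?case using UV(5) by (simp add: homeomorphism_def)
  next
    case (Suc k)
    show ?case
    proof (rule Ck_on_SucI[OF \<open>open V\<close> g(1)])
      fix v
      show "Ck_on k V (\<lambda>y. g' y v)"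
      proof (rule Ck_on_linear_solution[OF \<open>open V\<close>, where M = "\<lambda>y. frechet_derivative f (at (g y))" and b = "\<lambda>_. v"])
        show "Ck_on k V (\<lambda>y. frechet_derivative f (at (g y)) e)" for e
          using smooth_on_derivative[OF f, of e] gV UV(2)
          by (intro Ck_on_compose[OF \<open>open V\<close> S Suc, of "\<lambda>x. frechet_derivative f (at x) e"])
            (auto simp: smooth_on_def)
        fix y assume y: "y \<in> V"
        then have gy: "g y \<in> U" using gV by blast
        show "linear (frechet_derivative f (at (g y)))"
          using gy UV(2) df has_derivative_linear by blast
        show "e = 0" if "frechet_derivative f (at (g y)) e = 0" for e
          using inj'[OF gy that] .
        show "frechet_derivative f (at (g y)) (g' y v) = v"
          using g(2,3)[OF y] f'[of "g y"] gy UV(2) by (auto simp: bij_is_surj surj_f_inv_f)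
      qed auto
    qed
  qed
  then have "smooth_on V g" by (simp add: smooth_on_def)
  then show ?thesis using that[OF UV] inj' by blast
qed

subsection \<open>Fixed points of Picard operators\<close>

lemma norm_scaled_le: "0 \<le> t \<Longrightarrow> t \<le> 1 \<Longrightarrow> norm (t *\<^sub>R z) \<le> norm z" for t :: real
  using mult_left_le_one_le[of "norm z" "\<bar>t\<bar>"] by auto

lemma continuous_on_triple:
  assumes "continuous_on (T \<times> X \<times> Y) (\<lambda>(t, z, y). G t z y)"
    "continuous_on D a" "continuous_on D b" "continuous_on D c"
    "\<And>x. x \<in> D \<Longrightarrow> a x \<in> T \<and> b x \<in> X \<and> c x \<in> Y"
  shows "continuous_on D (\<lambda>x. G (a x) (b x) (c x))"
proof -
  have "continuous_on D (\<lambda>x. (a x, b x, c x))"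
    by (intro continuous_on_Pair assms)
  moreover have "(\<lambda>x. (a x, b x, c x)) ` D \<subseteq> T \<times> X \<times> Y"
    using assms(5) by auto
  ultimately show ?thesis
    using continuous_on_compose2[OF assms(1)] by fastforce
qed

text \<open>The unknown is a function of \<open>z\<close> on the whole ball, not a curve for each
  \<open>z\<close>: the value at \<open>z\<close> uses the values on the segment from 0 to
  \<open>z\<close>. The factor 1/2 in \<open>lip\<close> makes the integral operator a contraction
  for the supremum norm.\<close>

lemma picard_fixed_point:
  fixes G :: "real \<Rightarrow> 'z::euclidean_space \<Rightarrow> 'f::banach \<Rightarrow> 'f"
  assumes "0 < r" and S: "closed S" "S \<noteq> {}"
    and cont: "continuous_on ({0..1} \<times> cball 0 r \<times> S) (\<lambda>(t, z, y). G t z y)"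
    and lip: "\<And>t z y y'. t \<in> {0..1} \<Longrightarrow> z \<in> cball 0 r \<Longrightarrow> y \<in> S \<Longrightarrow> y' \<in> S \<Longrightarrow>
      norm (G t z y - G t z y') \<le> 1/2 * norm (y - y')"
    and maps: "\<And>z y. z \<in> cball 0 r \<Longrightarrow> continuous_on {0..1} y \<Longrightarrow> y ` {0..1} \<subseteq> S \<Longrightarrow>
      integral {0..1} (\<lambda>t. G t z (y t)) \<in> S"
  obtains y where "continuous_on (cball 0 r) y" "y ` cball 0 r \<subseteq> S"
    "\<And>z. z \<in> cball 0 r \<Longrightarrow> y z = integral {0..1} (\<lambda>t. G t z (y (t *\<^sub>R z)))"
proof -
  \<comment> \<open>Retraction onto the ball. It lets the contraction act on the complete space of
    bounded continuous functions on the whole space, while only values on the ball enter the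
    operator.\<close>
  define \<pi> :: "'z \<Rightarrow> 'z" where "\<pi> = closest_point (cball 0 r)"
  have \<pi>: "\<pi> z \<in> cball 0 r" for z
    unfolding \<pi>_def using \<open>0 < r\<close> by (intro closest_point_in_set) auto
  have \<pi>_id: "\<pi> z = z" if "z \<in> cball 0 r" for z
    unfolding \<pi>_def using that by (rule closest_point_self)
  have \<pi>_cont: "continuous_on T \<pi>" for T
    unfolding \<pi>_def using \<open>0 < r\<close> by (intro continuous_on_closest_point) auto
  have scale: "t *\<^sub>R z \<in> cball 0 r" if "t \<in> {0..1}" "z \<in> cball 0 r" for t and z :: 'z
    using that mult_left_le_one_le[of "norm z" "\<bar>t\<bar>"] by auto
  define T where "T y z = integral {0..1} (\<lambda>t. G t (\<pi> z) (apply_bcontfun y (t *\<^sub>R \<pi> z)))" for y z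
  define P where "P = PiC UNIV (\<lambda>_::'z. S)"
  have PS: "apply_bcontfun y z \<in> S" if "y \<in> P" for y z
    using that unfolding P_def by (auto simp: mem_PiC_iff)
  have Gcont: "continuous_on {0..1} (\<lambda>t. G t (\<pi> z) (apply_bcontfun y (t *\<^sub>R \<pi> z)))" if "y \<in> P" for y z
    using \<pi> PS[OF that]
    by (intro continuous_on_triple[OF cont] continuous_intros continuous_on_compose2[OF continuous_on_apply_bcontfun[of UNIV]]) auto
  have T_cont: "T y \<in> bcontfun" if y: "y \<in> P" for y
  proof -
    let ?I = "\<lambda>z. integral {0..1} (\<lambda>t. G t z (apply_bcontfun y (t *\<^sub>R z)))"
    have "continuous_on (cball 0 r \<times> cbox 0 1) (\<lambda>(z, t). G t z (apply_bcontfun y (t *\<^sub>R z)))"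
      unfolding split_beta using PS[OF y]
      by (intro continuous_on_triple[OF cont] continuous_intros continuous_on_compose2[OF continuous_on_apply_bcontfun[of UNIV]]) auto
    then have c: "continuous_on (cball 0 r) ?I"
      using integral_continuous_on_param[of "cball 0 r" 0 1 "\<lambda>z t. G t z (apply_bcontfun y (t *\<^sub>R z))"] by simp
    have "T y = (\<lambda>z. ?I (\<pi> z))" by (simp add: T_def fun_eq_iff)
    moreover have "continuous_on UNIV (\<lambda>z. ?I (\<pi> z))"
      using continuous_on_compose2[OF c \<pi>_cont] \<pi> by blast
    moreover have "bounded (range (\<lambda>z. ?I (\<pi> z)))"
      by (rule bounded_subset[OF compact_imp_bounded[OF compact_continuous_image[OF c compact_cball]]])
        (use \<pi> in auto)
    ultimately show ?thesis by (simp add: bcontfun_def)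
  qed
  have T_apply: "apply_bcontfun (Bcontfun (T y)) = T y" if "y \<in> P" for y
    using T_cont[OF that] by (rule Bcontfun_inverse)
  have "\<exists>!y\<in>P. Bcontfun (T y) = y"
  proof (rule Banach_fix[where c = "1/2"])
    show "complete P"
      unfolding P_def complete_eq_closed by (intro closed_PiC S)
    obtain s where "s \<in> S" using S by blast
    then have "const_bcontfun s \<in> P" by (auto simp: P_def mem_PiC_iff const_bcontfun.rep_eq)
    then show "P \<noteq> {}" by blast
    show "(\<lambda>y. Bcontfun (T y)) ` P \<subseteq> P"
    proof (safe)
      fix y assume y: "y \<in> P"
      have "T y z \<in> S" for z
        unfolding T_def using PS[OF y] \<pi>
        by (intro maps) (auto intro!: continuous_intros continuous_on_compose2[OF continuous_on_apply_bcontfun[of UNIV]])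
      then show "Bcontfun (T y) \<in> P"
        unfolding P_def mem_PiC_iff T_apply[OF y] by auto
    qed
    fix x y assume x: "x \<in> P" and y: "y \<in> P"
    show "dist (Bcontfun (T x)) (Bcontfun (T y)) \<le> 1/2 * dist x y"
    proof (rule dist_bound)
      fix z
      have "T x z - T y z = integral {0..1} (\<lambda>t. G t (\<pi> z) (apply_bcontfun x (t *\<^sub>R \<pi> z)) - G t (\<pi> z) (apply_bcontfun y (t *\<^sub>R \<pi> z)))"
        unfolding T_def
        by (intro integral_diff[symmetric] integrable_continuous_real Gcont x y)
      moreover have "norm \<dots> \<le> (1/2 * dist x y) * (1 - 0)"
      proof (rule integral_bound)
        fix t :: real assume t: "t \<in> {0..1}"
        have "norm (G t (\<pi> z) (apply_bcontfun x (t *\<^sub>R \<pi> z)) - G t (\<pi> z) (apply_bcontfun y (t *\<^sub>R \<pi> z)))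
            \<le> 1/2 * dist (apply_bcontfun x (t *\<^sub>R \<pi> z)) (apply_bcontfun y (t *\<^sub>R \<pi> z))"
          unfolding dist_norm by (rule lip[OF t \<pi> PS[OF x] PS[OF y]])
        also have "\<dots> \<le> 1/2 * dist x y" by (simp add: dist_bounded)
        finally show "norm (G t (\<pi> z) (apply_bcontfun x (t *\<^sub>R \<pi> z)) - G t (\<pi> z) (apply_bcontfun y (t *\<^sub>R \<pi> z))) \<le> 1/2 * dist x y" .
      qed (use Gcont x y in \<open>auto intro!: continuous_intros\<close>)
      ultimately show "dist (apply_bcontfun (Bcontfun (T x)) z) (apply_bcontfun (Bcontfun (T y)) z) \<le> 1/2 * dist x y"
        by (simp add: T_apply x y dist_norm)
    qed
  qed auto
  then obtain y where y: "y \<in> P" and fix_eq: "Bcontfun (T y) = y" by blast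
  show ?thesis
  proof
    show "continuous_on (cball 0 r) (apply_bcontfun y)" by simp
    show "apply_bcontfun y ` cball 0 r \<subseteq> S" using PS[OF y] by blast
    fix z :: 'z assume "z \<in> cball 0 r"
    then have "T y z = integral {0..1} (\<lambda>t. G t z (apply_bcontfun y (t *\<^sub>R z)))"
      by (simp only: T_def \<pi>_id)
    moreover have "apply_bcontfun y z = T y z"
      by (rule fun_cong[OF T_apply[OF y, unfolded fix_eq]])
    ultimately show "apply_bcontfun y z = integral {0..1} (\<lambda>t. G t z (apply_bcontfun y (t *\<^sub>R z)))"
      by (rule trans[rotated])
  qed
qed

section \<open>Differentiability of solutions of Picard equations\<close>

lemma uniformly_differentiable_on_compact:
  fixes f :: "'a::euclidean_space \<Rightarrow> 'b::real_normed_vector"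
  assumes W: "open W" and K: "compact K" "K \<subseteq> W"
    and f': "\<And>x. x \<in> W \<Longrightarrow> (f has_derivative blinfun_apply (f' x)) (at x)"
    and cont: "continuous_on W f'" and "e > 0"
  obtains d where "d > 0" "\<And>x h. x \<in> K \<Longrightarrow> norm h \<le> d \<Longrightarrow> norm (f (x + h) - f x - f' x h) \<le> e * norm h"
proof -
  obtain d0 where "d0 > 0" and d0: "(\<Union>x\<in>K. cball x d0) \<subseteq> W"
    using compact_subset_open_imp_cball_epsilon_subset[OF K(1) W K(2)] by metis
  \<comment> \<open>A compact neighbourhood of \<open>K\<close> inside \<open>W\<close>: the
    derivative is uniformly continuous there, including the endpoints \<open>x + h\<close>.\<close>
  define K' where "K' = (\<Union>x\<in>K. cball x d0)"
  have K': "K' = {x + y |x y. x \<in> K \<and> y \<in> cball 0 d0}"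
  proof (intro equalityI subsetI)
    fix z assume "z \<in> K'"
    then obtain x where "x \<in> K" "z \<in> cball x d0" unfolding K'_def by blast
    then have "z = x + (z - x) \<and> x \<in> K \<and> z - x \<in> cball 0 d0"
      by (simp add: dist_norm norm_minus_commute)
    then show "z \<in> {x + y |x y. x \<in> K \<and> y \<in> cball 0 d0}" by blast
  next
    fix z assume "z \<in> {x + y |x y. x \<in> K \<and> y \<in> cball 0 d0}"
    then obtain x y where "z = x + y" "x \<in> K" "y \<in> cball 0 d0" by blast
    then have "x \<in> K" "z \<in> cball x d0" by (simp_all add: dist_norm)
    then show "z \<in> K'" unfolding K'_def by blast
  qed
  have "compact K'"
    unfolding K' by (intro compact_sums K compact_cball)
  then have "uniformly_continuous_on K' f'"
    using cont d0 unfolding K'_def by (metis compact_uniformly_continuous continuous_on_subset)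
  then obtain d1 where "d1 > 0" and d1: "\<And>x y. x \<in> K' \<Longrightarrow> y \<in> K' \<Longrightarrow> dist y x < d1 \<Longrightarrow> dist (f' y) (f' x) < e"
    using \<open>e > 0\<close> unfolding uniformly_continuous_on_def by metis
  show ?thesis
  proof
    \<comment> \<open>Half of \<open>d1\<close>, because uniform continuity needs a strict
      inequality and the ball used is closed.\<close>
    show "min d0 (d1/2) > 0" using \<open>d0 > 0\<close> \<open>d1 > 0\<close> by simp
    fix x h :: 'a assume x: "x \<in> K" and h: "norm h \<le> min d0 (d1/2)"
    let ?S = "cball x (min d0 (d1/2))"
    have sub: "?S \<subseteq> K'" using x unfolding K'_def by (auto)
    have "norm (f (x + h) - f x - f' x (x + h - x)) \<le> norm (x + h - x) * e"
    proof (rule differentiable_bound_linearization[where S = ?S])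
      show "x + t *\<^sub>R (x + h - x) \<in> ?S" if "t \<in> {0..1}" for t
        using h that order_trans[OF norm_scaled_le[of t h], of "min d0 (d1/2)"] by (simp add: dist_norm del: norm_scaleR)
      show "(f has_derivative blinfun_apply (f' y)) (at y within ?S)" if "y \<in> ?S" for y
        by (rule has_derivative_at_withinI[OF f'[OF subsetD[OF d0[folded K'_def] subsetD[OF sub that]]]])
      show "onorm (blinfun_apply (f' y) - blinfun_apply (f' x)) \<le> e" if "y \<in> ?S" for y
      proof -
        have "dist (f' y) (f' x) < e"
          using that sub x \<open>d0 > 0\<close> \<open>d1 > 0\<close>
          by (intro d1) (auto simp: K'_def dist_commute intro: bexI[of _ x])
        then show ?thesis
          by (simp add: dist_norm norm_blinfun.rep_eq blinfun.diff_left[abs_def] fun_diff_def)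
      qed
      show "x \<in> ?S" using \<open>d0 > 0\<close> \<open>d1 > 0\<close> by simp
    qed
    then show "norm (f (x + h) - f x - f' x h) \<le> e * norm h"
      by (simp add: mult.commute)
  qed
qed

text \<open>Absorption principle: insert the supremum for \<open>B\<close> and subtract half of it,
  which is legitimate because it is finite. Both the Lipschitz estimate and the remainder estimate
  for Picard solutions have this shape, with 1/2 the contraction constant.\<close>

lemma sup_halving:
  fixes \<phi> :: "'x \<Rightarrow> real"
  assumes bdd: "bdd_above (\<phi> ` X)" and "x \<in> X"
    and half: "\<And>x B. x \<in> X \<Longrightarrow> (\<And>x'. x' \<in> X \<Longrightarrow> \<phi> x' \<le> B) \<Longrightarrow> \<phi> x \<le> a + B/2"
  shows "\<phi> x \<le> 2 * a"
proof -
  have le: "\<phi> x' \<le> (SUP x\<in>X. \<phi> x)" if "x' \<in> X" for x'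
    using that bdd by (rule cSUP_upper)
  have "(SUP x\<in>X. \<phi> x) \<le> a + (SUP x\<in>X. \<phi> x) / 2"
    using \<open>x \<in> X\<close> half[OF _ le] by (intro cSUP_least) auto
  then show ?thesis using le[OF \<open>x \<in> X\<close>] by simp
qed

text \<open>An open set, as \<open>Ck_on\<close> requires, that contains the integration range
  \<open>{0..1}\<close> for t. The condition on \<open>t *\<^sub>R z\<close> keeps the point at
  which the solution is evaluated inside the ball even when t leaves that range.\<close>

definition picard_dom :: "real \<Rightarrow> 'f set \<Rightarrow> (real \<times> 'z::euclidean_space \<times> 'f::euclidean_space) set" where
  "picard_dom r D = {(t, z, w). norm z < r \<and> norm (t *\<^sub>R z) < r \<and> w \<in> D}"

lemma open_picard_dom: "open D \<Longrightarrow> open (picard_dom r D)"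
proof -
  assume "open D"
  have "picard_dom r D = {p. norm (fst (snd p)) < r} \<inter> {p. norm (fst p *\<^sub>R fst (snd p)) < r} \<inter> (\<lambda>p. snd (snd p)) -` D"
    by (auto simp: picard_dom_def)
  then show ?thesis
    by (rule ssubst) (intro open_Int open_Collect_less open_vimage continuous_intros \<open>open D\<close>)
qed

text \<open>A class of equations closed under differentiation: the directional derivatives of a
  solution again solve such an equation, with another \<open>G\<close> and with \<open>D\<close> the
  whole space.\<close>

locale picard_equation =
  fixes r :: real and D :: "'f::euclidean_space set"
    and G :: "real \<times> 'z::euclidean_space \<times> 'f \<Rightarrow> 'f" and y :: "'z \<Rightarrow> 'f"
  assumes openD: "open D"
    and lip: "\<And>t z w w'. t \<in> {0..1} \<Longrightarrow> norm z < r \<Longrightarrow> w \<in> D \<Longrightarrow> w' \<in> D \<Longrightarrow>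
      norm (G (t, z, w) - G (t, z, w')) \<le> 1/2 * norm (w - w')"
    and y_cont: "continuous_on (ball 0 r) y" and y_D: "y ` ball 0 r \<subseteq> D"
    and y_eq: "\<And>z. norm z < r \<Longrightarrow> y z = integral {0..1} (\<lambda>t. G (t, z, y (t *\<^sub>R z)))"

lemma lipschitz_derivative_bound:
  fixes f :: "'a::real_normed_vector \<Rightarrow> 'b::real_normed_vector"
  assumes f': "(f has_derivative f') (at x)" and "open D" "x \<in> D"
    and lip: "\<And>y. y \<in> D \<Longrightarrow> norm (f y - f x) \<le> L * norm (y - x)"
  shows "norm (f' h) \<le> L * norm h"
proof -
  have le: "norm (f' h) \<le> L * norm h + e * norm h" if "e > 0" for e
  proof -
    obtain d where "d > 0" and d: "\<And>y. norm (y - x) < d \<Longrightarrow> norm (f y - f x - f' (y - x)) \<le> e * norm (y - x)"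
      using f' \<open>e > 0\<close> unfolding has_derivative_at_alt by blast
    obtain d' where "d' > 0" "ball x d' \<subseteq> D"
      using assms openE by blast
    define c where "c = norm h + 1"
    have "c > 0" by (simp add: c_def add_nonneg_pos)
    define t where "t = min d d' / (2 * c)"
    have "t > 0" using \<open>d > 0\<close> \<open>d' > 0\<close> \<open>c > 0\<close> by (auto simp: t_def)
    have "t * norm h < min d d'"
    proof -
      have "t * norm h \<le> t * c" using \<open>t > 0\<close> by (simp add: c_def)
      also have "\<dots> = min d d' / 2"
        using \<open>c > 0\<close> by (simp add: t_def)
      also have "\<dots> < min d d'" using \<open>d > 0\<close> \<open>d' > 0\<close> by linarith
      finally show ?thesis .
    qed
    then have y: "norm (x + t *\<^sub>R h - x) < d" "x + t *\<^sub>R h \<in> D"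
      using \<open>t > 0\<close> \<open>ball x d' \<subseteq> D\<close> by (auto simp: dist_norm subset_iff)
    have "t * norm (f' h) = norm (f' (t *\<^sub>R h))"
      using linear_scale[OF has_derivative_linear[OF f']] \<open>t > 0\<close> by simp
    also have "\<dots> \<le> norm (f (x + t *\<^sub>R h) - f x) + norm (f (x + t *\<^sub>R h) - f x - f' (t *\<^sub>R h))"
      using norm_triangle_ineq4[of "f (x + t *\<^sub>R h) - f x" "f (x + t *\<^sub>R h) - f x - f' (t *\<^sub>R h)"] by simp
    also have "\<dots> \<le> L * norm (t *\<^sub>R h) + e * norm (t *\<^sub>R h)"
      using lip[OF y(2)] d[OF y(1)] by (intro add_mono) simp_all
    also have "\<dots> = t * (L * norm h + e * norm h)"
      using \<open>t > 0\<close> by (simp add: algebra_simps)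
    finally show ?thesis using \<open>t > 0\<close> by simp
  qed
  show ?thesis
  proof (cases "h = 0")
    case True
    then show ?thesis using le[of 1] by simp
  next
    case False
    have "norm (f' h) \<le> L * norm h + e" if "e > 0" for e
      using le[of "e / norm h"] False that by simp
    then show ?thesis by (rule field_le_epsilon)
  qed
qed

context picard_equation
begin

lemma y_line_D: "norm z < r \<Longrightarrow> t \<in> {0..1} \<Longrightarrow> y (t *\<^sub>R z) \<in> D"
  using y_D le_less_trans[OF norm_scaled_le[of t z]] by (auto simp: image_subset_iff simp del: norm_scaleR)

lemma in_dom: "norm z < r \<Longrightarrow> t \<in> {0..1} \<Longrightarrow> w \<in> D \<Longrightarrow> (t, z, w) \<in> picard_dom r D"
  using le_less_trans[OF norm_scaled_le[of t z]] by (simp add: picard_dom_def del: norm_scaleR)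

text \<open>Differentiating the equation formally gives an affine Picard equation for the
  derivative, with the same contraction constant; its fixed point \<open>g\<close> is the candidate.
  That \<open>g\<close> is the derivative follows by applying \<open>sup_halving\<close> first to
  the increments of \<open>y\<close> and then to the linearization error. Closed balls of radius
  below \<open>r\<close> supply the required compactness.\<close>

lemma Picard_differentiable_cball:
  fixes \<rho> :: real
  assumes G: "Ck_on 1 (picard_dom r D) G" and \<rho>: "0 < \<rho>" "\<rho> < r"
  obtains g :: "'z \<Rightarrow> 'z \<Rightarrow>\<^sub>L 'f" where "continuous_on (cball 0 \<rho>) g"
    "\<And>z. norm z < \<rho> \<Longrightarrow> (y has_derivative g z) (at z)"
    "\<And>z v. norm z < \<rho> \<Longrightarrow> g z v = integral {0..1} (\<lambda>t.
        frechet_derivative G (at (t, z, y (t *\<^sub>R z))) (0, v, 0)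
        + t *\<^sub>R frechet_derivative G (at (t, z, y (t *\<^sub>R z))) (0, 0, g (t *\<^sub>R z) v))"
proof -
  let ?W = "picard_dom r D :: (real \<times> 'z \<times> 'f) set"
  have W: "open ?W" by (rule open_picard_dom[OF openD])
  define G' where "G' p = Blinfun (frechet_derivative G (at p))" for p
  have dG0: "(G has_derivative frechet_derivative G (at p)) (at p)" if "p \<in> ?W" for p
    using G by (intro has_derivative_frechet[OF W _ that]) simp
  have G': "blinfun_apply (G' p) = frechet_derivative G (at p)" if "p \<in> ?W" for p
    unfolding G'_def using dG0[OF that] by (simp add: bounded_linear_Blinfun_apply has_derivative_bounded_linear)
  have dG: "(G has_derivative blinfun_apply (G' p)) (at p)" if "p \<in> ?W" for p
    using dG0[OF that] G'[OF that] by simp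
  have G'_cont: "continuous_on ?W G'"
  proof (rule continuous_on_blinfun_componentwise)
    fix i :: "real \<times> 'z \<times> 'f"
    have "continuous_on ?W (\<lambda>p. frechet_derivative G (at p) i)"
      using G unfolding One_nat_def Ck_on.simps by blast
    then show "continuous_on ?W (\<lambda>p. G' p i)" using G' by (simp cong: continuous_on_cong)
  qed
  have y_cont': "continuous_on (cball 0 \<rho>) y"
    using \<rho> by (intro continuous_on_subset[OF y_cont]) auto
  \<comment> \<open>A product rather than the graph of \<open>y\<close>, since the estimates vary
    \<open>z\<close> and the value of \<open>y\<close> separately.\<close>
  define K where "K = {0..1::real} \<times> cball (0::'z) \<rho> \<times> y ` cball 0 \<rho>"
  have K: "compact K" unfolding K_def
    by (intro compact_Times compact_continuous_image y_cont' compact_cball compact_Icc)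
  have KW: "K \<subseteq> ?W"
  proof
    fix p assume "p \<in> K"
    then obtain t z x where "p = (t, z, y x)" "t \<in> {0..1}" "z \<in> cball 0 \<rho>" "x \<in> cball 0 \<rho>"
      unfolding K_def by blast
    then show "p \<in> ?W"
      using \<rho> in_dom[of z t "y x"] subsetD[OF y_D imageI[of x]] by auto
  qed
  have scale: "t *\<^sub>R z \<in> cball 0 \<rho>" if "t \<in> {0..1}" "z \<in> cball 0 \<rho>" for t and z :: 'z
    using that mult_left_le_one_le[of "norm z" "\<bar>t\<bar>"] by auto
  have inK: "(t, z, y (t *\<^sub>R z')) \<in> K" if "t \<in> {0..1}" "z \<in> cball 0 \<rho>" "z' \<in> cball 0 \<rho>" for t z z'
    using that scale unfolding K_def by blast
  define Z :: "'z \<Rightarrow>\<^sub>L (real \<times> 'z \<times> 'f)" where "Z = Blinfun (\<lambda>v. (0, v, 0))"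
  define Y :: "'f \<Rightarrow>\<^sub>L (real \<times> 'z \<times> 'f)" where "Y = Blinfun (\<lambda>w. (0, 0, w))"
  have Z: "blinfun_apply Z v = (0, v, 0)" for v
    unfolding Z_def by (subst bounded_linear_Blinfun_apply) (auto intro!: bounded_linear_intros bounded_linear_Pair)
  have Y: "blinfun_apply Y w = (0, 0, w)" for w
    unfolding Y_def by (subst bounded_linear_Blinfun_apply) (auto intro!: bounded_linear_intros bounded_linear_Pair)
  \<comment> \<open>The Lipschitz constant of \<open>G\<close> in its last argument bounds the
    corresponding partial derivative; this is the source of the contraction for the derivative
    equation.\<close>
  have Y_half: "norm (G' p (0, 0, h)) \<le> 1/2 * norm h" if "p \<in> K" for p h
  proof -
    obtain t z w where p: "p = (t, z, w)" by (cases p)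
    have pD: "t \<in> {0..1}" "norm z < r" "w \<in> D"
      using that subsetD[OF KW that] unfolding p K_def picard_dom_def by auto
    have "((\<lambda>w. (t, z, w)) has_derivative (\<lambda>h. (0, 0, h))) (at w)"
      by (intro has_derivative_Pair has_derivative_const has_derivative_ident)
    from has_derivative_compose[OF this dG[OF subsetD[OF KW that], unfolded p]]
    have "((\<lambda>w. G (t, z, w)) has_derivative (\<lambda>h. G' p (0, 0, h))) (at w)"
      unfolding p .
    from lipschitz_derivative_bound[OF this openD pD(3), of "1/2"] show ?thesis
      using lip[OF pD(1,2) _ pD(3)] by simp
  qed
  \<comment> \<open>The integrand of the formally differentiated equation. The factor
    \<open>t\<close> in the second term is the inner derivative of
    \<open>t *\<^sub>R z\<close>.\<close>
  define \<Gamma> where "\<Gamma> t z L = (G' (t, z, y (t *\<^sub>R z)) o\<^sub>L Z) + t *\<^sub>R (G' (t, z, y (t *\<^sub>R z)) o\<^sub>L (Y o\<^sub>L L))"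
    for t z and L :: "'z \<Rightarrow>\<^sub>L 'f"
  have \<Gamma>_cont: "continuous_on ({0..1} \<times> cball 0 \<rho> \<times> UNIV) (\<lambda>(t, z, L). \<Gamma> t z L)"
  proof -
    have "continuous_on ({0..1} \<times> cball 0 \<rho> \<times> UNIV) (\<lambda>q::real \<times> 'z \<times> ('z \<Rightarrow>\<^sub>L 'f). G' (fst q, fst (snd q), y (fst q *\<^sub>R fst (snd q))))"
      using KW inK scale
      by (intro continuous_on_compose2[OF G'_cont] continuous_intros continuous_on_compose2[OF y_cont'])
        (auto simp: subset_iff)
    then show ?thesis
      unfolding \<Gamma>_def split_beta by (intro continuous_intros)
  qed
  obtain g where g_cont: "continuous_on (cball 0 \<rho>) g"
    and g_eq: "\<And>z. z \<in> cball 0 \<rho> \<Longrightarrow> g z = integral {0..1} (\<lambda>t. \<Gamma> t z (g (t *\<^sub>R z)))"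
  proof (rule picard_fixed_point[OF \<rho>(1) closed_UNIV _ \<Gamma>_cont])
    fix t z and L L' :: "'z \<Rightarrow>\<^sub>L 'f"
    assume t: "t \<in> {0..1::real}" and z: "z \<in> cball (0::'z) \<rho>"
    show "norm (\<Gamma> t z L - \<Gamma> t z L') \<le> 1/2 * norm (L - L')"
    proof (rule norm_blinfun_bound)
      fix v
      have "blinfun_apply (\<Gamma> t z L - \<Gamma> t z L') v = t *\<^sub>R G' (t, z, y (t *\<^sub>R z)) (0, 0, (L - L') v)"
        unfolding \<Gamma>_def by (simp add: blinfun.bilinear_simps Z Y flip: scaleR_diff_right)
          (simp flip: blinfun.diff_right)
      then have "norm (blinfun_apply (\<Gamma> t z L - \<Gamma> t z L') v) \<le> 1 * (1/2 * norm ((L - L') v))"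
        using Y_half[OF inK[OF t z z]] t by (simp only: norm_scaleR) (intro mult_mono; auto)
      also have "\<dots> \<le> 1/2 * norm (L - L') * norm v"
        using norm_blinfun[of "L - L'" v] by simp
      finally show "norm (blinfun_apply (\<Gamma> t z L - \<Gamma> t z L') v) \<le> 1/2 * norm (L - L') * norm v" .
    qed simp
  qed auto
  have \<Gamma>g_cont: "continuous_on {0..1} (\<lambda>t. \<Gamma> t z (g (t *\<^sub>R z)))" if "z \<in> cball 0 \<rho>" for z
    using that scale
    by (intro continuous_on_triple[OF \<Gamma>_cont] continuous_intros continuous_on_compose2[OF g_cont]) auto
  have g_apply: "g z v = integral {0..1} (\<lambda>t. G' (t, z, y (t *\<^sub>R z)) (0, v, 0) + t *\<^sub>R G' (t, z, y (t *\<^sub>R z)) (0, 0, g (t *\<^sub>R z) v))"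
    if "z \<in> cball 0 \<rho>" for z v
    unfolding g_eq[OF that] using blinfun_apply_integral[OF integrable_continuous_real[OF \<Gamma>g_cont[OF that]]]
    by (simp add: \<Gamma>_def blinfun.bilinear_simps Z Y)
  have Gy_cont: "continuous_on {0..1} (\<lambda>t. G (t, z', y (t *\<^sub>R z)))" if "z \<in> cball 0 \<rho>" "z' \<in> cball 0 \<rho>" for z z'
  proof -
    have sc: "(\<lambda>t. t *\<^sub>R z) ` {0..1} \<subseteq> cball 0 \<rho>"
      using scale[OF _ that(1)] by blast
    have "continuous_on {0..1} (\<lambda>t. (t, z', y (t *\<^sub>R z)))"
      by (intro continuous_intros continuous_on_compose2[OF y_cont' _ sc])
    moreover have "(\<lambda>t. (t, z', y (t *\<^sub>R z))) ` {0..1} \<subseteq> ?W"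
      using inK[OF _ that(2,1)] KW by blast
    ultimately show ?thesis
      using continuous_on_compose2[OF Ck_on_continuous[OF G]] by blast
  qed
  have y_eq': "y z = integral {0..1} (\<lambda>t. G (t, z, y (t *\<^sub>R z)))" if "z \<in> cball 0 \<rho>" for z
    using y_eq that \<rho> by simp
  have lip': "norm (G (t, z, y z1) - G (t, z, y z2)) \<le> 1/2 * norm (y z1 - y z2)"
    if "t \<in> {0..1}" "z \<in> cball 0 \<rho>" "z1 \<in> cball 0 \<rho>" "z2 \<in> cball 0 \<rho>" for t z z1 z2
    using that \<rho> y_D by (intro lip) auto
  obtain C0 where C0: "C0 > 0" "\<And>p. p \<in> K \<Longrightarrow> norm (G' p) \<le> C0"
  proof -
    have "bounded (G' ` K)"
      using compact_imp_bounded[OF compact_continuous_image[OF continuous_on_subset[OF G'_cont KW] K]] .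
    then show ?thesis using that unfolding bounded_pos by blast
  qed
  obtain C1 where C1: "\<And>z. z \<in> cball 0 \<rho> \<Longrightarrow> norm (y z) \<le> C1"
    using compact_imp_bounded[OF compact_continuous_image[OF y_cont' compact_cball]]
    unfolding bounded_iff by blast
  obtain C2 where C2: "\<And>z. z \<in> cball 0 \<rho> \<Longrightarrow> norm (g z) \<le> C2"
    using compact_imp_bounded[OF compact_continuous_image[OF g_cont compact_cball]]
    unfolding bounded_iff by blast
  have shrink: "norm (t *\<^sub>R a - t *\<^sub>R b) \<le> norm (a - b)" if "t \<in> {0..1}" for t and a b :: 'z
    using that mult_left_le_one_le[of "norm (a - b)" "\<bar>t\<bar>"] by (auto simp flip: scaleR_diff_right)
  have y_lip: "norm (y b - y a) \<le> 2 * (C0 * norm (b - a))" if ab: "a \<in> cball 0 \<rho>" "b \<in> cball 0 \<rho>" for a b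
  proof -
    \<comment> \<open>Scaling both points by t in \<open>{0..1}\<close> maps this set of pairs into
      itself, so the supremum over it bounds the scaled increments under the integral.\<close>
    let ?X = "{(z, z'). z \<in> cball 0 \<rho> \<and> z' \<in> cball 0 \<rho> \<and> norm (z' - z) \<le> norm (b - a)}"
    have "(\<lambda>(z, z'). norm (y z' - y z)) (a, b) \<le> 2 * (C0 * norm (b - a))"
    proof (rule sup_halving[where X = ?X])
      show "bdd_above ((\<lambda>(z, z'). norm (y z' - y z)) ` ?X)"
      proof (rule bdd_aboveI[of _ "2 * C1"], clarify)
        fix z z' :: 'z assume "z \<in> cball 0 \<rho>" "z' \<in> cball 0 \<rho>"
        then show "norm (y z' - y z) \<le> 2 * C1"
          using norm_triangle_ineq4[of "y z'" "y z"] C1[of z] C1[of z'] by linarith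
      qed
      show "(a, b) \<in> ?X" using ab by simp
      fix x :: "'z \<times> 'z" and B assume x: "x \<in> ?X" and B: "\<And>x'. x' \<in> ?X \<Longrightarrow> (\<lambda>(z, z'). norm (y z' - y z)) x' \<le> B"
      obtain z z' where xz: "x = (z, z')" by (cases x)
      have z: "z \<in> cball 0 \<rho>" "z' \<in> cball 0 \<rho>" "norm (z' - z) \<le> norm (b - a)" using x xz by auto
      have "y z' - y z = integral {0..1} (\<lambda>t. G (t, z', y (t *\<^sub>R z')) - G (t, z, y (t *\<^sub>R z)))"
        unfolding y_eq'[OF z(1)] y_eq'[OF z(2)]
        by (intro integral_diff[symmetric] integrable_continuous_real Gy_cont z)
      moreover have "norm \<dots> \<le> (C0 * norm (b - a) + B/2) * (1 - 0)"
      proof (rule integral_bound)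
        fix t :: real assume t: "t \<in> {0..1}"
        have pK: "p \<in> K" if "p \<in> {t} \<times> cball 0 \<rho> \<times> {y (t *\<^sub>R z')}" for p
          using that inK[OF t _ z(2)] by blast
        have "norm (G (t, z', y (t *\<^sub>R z')) - G (t, z, y (t *\<^sub>R z')))
            \<le> C0 * norm ((t, z', y (t *\<^sub>R z')) - (t, z, y (t *\<^sub>R z')))"
        proof (rule differentiable_bound[where S = "{t} \<times> cball 0 \<rho> \<times> {y (t *\<^sub>R z')}" and f' = "\<lambda>p. blinfun_apply (G' p)"])
          show "(G has_derivative blinfun_apply (G' p)) (at p within {t} \<times> cball 0 \<rho> \<times> {y (t *\<^sub>R z')})"
            if "p \<in> {t} \<times> cball 0 \<rho> \<times> {y (t *\<^sub>R z')}" for p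
            by (rule has_derivative_at_withinI[OF dG[OF subsetD[OF KW pK[OF that]]]])
          show "onorm (blinfun_apply (G' p)) \<le> C0" if "p \<in> {t} \<times> cball 0 \<rho> \<times> {y (t *\<^sub>R z')}" for p
            using C0(2)[OF pK[OF that]] by (simp add: norm_blinfun.rep_eq)
        qed (use z in \<open>auto intro!: convex_Times\<close>)
        also have "\<dots> \<le> C0 * norm (b - a)" using z(3) C0(1) by (simp add: norm_Pair)
        finally have 1: "norm (G (t, z', y (t *\<^sub>R z')) - G (t, z, y (t *\<^sub>R z'))) \<le> C0 * norm (b - a)" .
        have "norm (G (t, z, y (t *\<^sub>R z')) - G (t, z, y (t *\<^sub>R z))) \<le> 1/2 * norm (y (t *\<^sub>R z') - y (t *\<^sub>R z))"
          using t z scale by (intro lip') auto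
        also have "\<dots> \<le> B/2"
          using B[of "(t *\<^sub>R z, t *\<^sub>R z')"] scale[OF t] z shrink[OF t, of z' z] by simp
        finally show "norm (G (t, z', y (t *\<^sub>R z')) - G (t, z, y (t *\<^sub>R z))) \<le> C0 * norm (b - a) + B/2"
          using 1 norm_triangle_ineq[of "G (t, z', y (t *\<^sub>R z')) - G (t, z, y (t *\<^sub>R z'))" "G (t, z, y (t *\<^sub>R z')) - G (t, z, y (t *\<^sub>R z))"]
          by simp
      qed (auto intro!: continuous_intros Gy_cont z)
      ultimately show "(\<lambda>(z, z'). norm (y z' - y z)) x \<le> C0 * norm (b - a) + B/2"
        using xz by simp
    qed
    then show ?thesis by simp
  qed
  \<comment> \<open>Bounds the joint increment of \<open>z\<close> and \<open>y\<close> by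
    \<open>C * norm (b - a)\<close>: 1 for the change of \<open>z\<close>, \<open>2 * C0\<close> for
    the change of \<open>y\<close> by \<open>y_lip\<close>.\<close>
  define C where "C = 1 + 2 * C0"
  have "C > 0" using C0 by (simp add: C_def)
  define R where "R a b = y b - y a - g a (b - a)" for a b
  have R_small: "\<exists>d>0. \<forall>a b. a \<in> cball 0 \<rho> \<longrightarrow> b \<in> cball 0 \<rho> \<longrightarrow> norm (b - a) \<le> d \<longrightarrow>
      norm (R a b) \<le> e * norm (b - a)" if "e > 0" for e
  proof -
    \<comment> \<open>Compensates the factor \<open>C\<close> of the joint increment and the factor
      2 from \<open>sup_halving\<close>.\<close>
    define e' where "e' = e / (2 * C)"
    have "e' > 0" using \<open>e > 0\<close> \<open>C > 0\<close> by (simp add: e'_def)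
    obtain d where "d > 0" and d: "\<And>p h. p \<in> K \<Longrightarrow> norm h \<le> d \<Longrightarrow> norm (G (p + h) - G p - G' p h) \<le> e' * norm h"
      using uniformly_differentiable_on_compact[OF open_picard_dom[OF openD] K KW dG G'_cont \<open>e' > 0\<close>] by blast
    show ?thesis
    proof (intro exI[of _ "d / C"] conjI allI impI)
      show "d / C > 0" using \<open>d > 0\<close> \<open>C > 0\<close> by simp
      fix a b :: 'z
      assume ab: "a \<in> cball 0 \<rho>" "b \<in> cball 0 \<rho>" "norm (b - a) \<le> d / C"
      let ?X = "{(z, z'). z \<in> cball 0 \<rho> \<and> z' \<in> cball 0 \<rho> \<and> norm (z' - z) \<le> norm (b - a)}"
      have "(\<lambda>(z, z'). norm (R z z')) (a, b) \<le> 2 * (e' * (C * norm (b - a)))"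
      proof (rule sup_halving[where X = ?X])
        show "bdd_above ((\<lambda>(z, z'). norm (R z z')) ` ?X)"
        proof (rule bdd_aboveI[of _ "2 * C1 + C2 * norm (b - a)"], clarify)
          fix z z' :: 'z assume z: "z \<in> cball 0 \<rho>" "z' \<in> cball 0 \<rho>" "norm (z' - z) \<le> norm (b - a)"
          have "norm (g z (z' - z)) \<le> C2 * norm (b - a)"
            using norm_blinfun[of "g z" "z' - z"] C2[OF z(1)] z(3)
            by (meson mult_mono norm_ge_zero order_trans)
          then show "norm (R z z') \<le> 2 * C1 + C2 * norm (b - a)"
            using norm_triangle_ineq4[of "y z'" "y z"] norm_triangle_ineq4[of "y z' - y z" "g z (z' - z)"]
              C1[OF z(1)] C1[OF z(2)] unfolding R_def by linarith
        qed
        show "(a, b) \<in> ?X" using ab by simp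
        fix x :: "'z \<times> 'z" and B assume x: "x \<in> ?X" and B: "\<And>x'. x' \<in> ?X \<Longrightarrow> (\<lambda>(z, z'). norm (R z z')) x' \<le> B"
        obtain z z' where xz: "x = (z, z')" by (cases x)
        have z: "z \<in> cball 0 \<rho>" "z' \<in> cball 0 \<rho>" "norm (z' - z) \<le> norm (b - a)" using x xz by auto
        let ?g = "\<lambda>t. G' (t, z, y (t *\<^sub>R z)) (0, z' - z, 0) + t *\<^sub>R G' (t, z, y (t *\<^sub>R z)) (0, 0, g (t *\<^sub>R z) (z' - z))"
        have "continuous_on {0..1} (\<lambda>t. G' (t, z, y (t *\<^sub>R z)) (0, v, 0) + t *\<^sub>R G' (t, z, y (t *\<^sub>R z)) (0, 0, g (t *\<^sub>R z) v))" for v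
          using bounded_bilinear.continuous_on[OF bounded_bilinear_blinfun_apply \<Gamma>g_cont[OF z(1)] continuous_on_const[of _ v]]
          by (simp add: \<Gamma>_def blinfun.bilinear_simps Z Y)
        then have g_int: "continuous_on {0..1} ?g" .
        have "R z z' = integral {0..1} (\<lambda>t. G (t, z', y (t *\<^sub>R z')) - G (t, z, y (t *\<^sub>R z)) - ?g t)"
          unfolding R_def y_eq'[OF z(1)] y_eq'[OF z(2)] g_apply[OF z(1)]
          using z g_int Gy_cont
          by (simp add: integral_diff integrable_continuous_real continuous_on_diff)
        moreover have "norm \<dots> \<le> (e' * (C * norm (b - a)) + B/2) * (1 - 0)"
        proof (rule integral_bound)
          fix t :: real assume t: "t \<in> {0..1}"
          let ?p = "(t, z, y (t *\<^sub>R z))" and ?h = "(0::real, z' - z, y (t *\<^sub>R z') - y (t *\<^sub>R z))"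
          have "norm (y (t *\<^sub>R z') - y (t *\<^sub>R z)) \<le> 2 * (C0 * norm (t *\<^sub>R z' - t *\<^sub>R z))"
            using scale[OF t] z by (intro y_lip) auto
          also have "\<dots> \<le> 2 * (C0 * norm (b - a))"
            using shrink[OF t, of z' z] z(3) C0(1) by auto
          finally have "norm ?h \<le> norm (b - a) + 2 * (C0 * norm (b - a))"
            using z(3) norm_Pair_le[of "z' - z" "y (t *\<^sub>R z') - y (t *\<^sub>R z)"] by (simp add: norm_Pair)
          then have h: "norm ?h \<le> C * norm (b - a)"
            by (simp add: C_def algebra_simps)
          also have "\<dots> \<le> d" using ab(3) \<open>C > 0\<close> by (simp add: field_simps)
          finally have "norm (G (?p + ?h) - G ?p - G' ?p ?h) \<le> e' * norm ?h"
            using inK[OF t z(1) z(1)] by (intro d)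
          also have "\<dots> \<le> e' * (C * norm (b - a))" using h \<open>e' > 0\<close> by simp
          finally have 1: "norm (G (?p + ?h) - G ?p - G' ?p ?h) \<le> e' * (C * norm (b - a))" .
          \<comment> \<open>The integrand splits into the linearization error of \<open>G\<close>,
            which is uniformly small, and the partial derivative of \<open>G\<close> applied to the
            remainder of the scaled pair, which is at most half the supremum.\<close>
          have eq: "G (t, z', y (t *\<^sub>R z')) - G (t, z, y (t *\<^sub>R z)) - ?g t
              = (G (?p + ?h) - G ?p - G' ?p ?h) + G' ?p (0, 0, R (t *\<^sub>R z) (t *\<^sub>R z'))"
          proof -
            have "G' ?p ?h = G' ?p (0, z' - z, 0) + G' ?p (0, 0, y (t *\<^sub>R z') - y (t *\<^sub>R z))"
              by (simp flip: blinfun.add_right)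
            moreover have "G' ?p (0, 0, R (t *\<^sub>R z) (t *\<^sub>R z')) = G' ?p (0, 0, y (t *\<^sub>R z') - y (t *\<^sub>R z)) - t *\<^sub>R G' ?p (0, 0, g (t *\<^sub>R z) (z' - z))"
              unfolding R_def by (simp flip: blinfun.diff_right blinfun.scaleR_right scaleR_diff_right)
            ultimately show ?thesis by simp
          qed
          have half: "norm (G' ?p (0, 0, R (t *\<^sub>R z) (t *\<^sub>R z'))) \<le> B/2"
          proof -
            have "norm (R (t *\<^sub>R z) (t *\<^sub>R z')) \<le> B"
              using B[of "(t *\<^sub>R z, t *\<^sub>R z')"] scale[OF t] z shrink[OF t, of z' z] by simp
            then show ?thesis using Y_half[OF inK[OF t z(1) z(1)], of "R (t *\<^sub>R z) (t *\<^sub>R z')"] by linarith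
          qed
          show "norm (G (t, z', y (t *\<^sub>R z')) - G (t, z, y (t *\<^sub>R z)) - ?g t) \<le> e' * (C * norm (b - a)) + B/2"
            unfolding eq using order_trans[OF norm_triangle_ineq add_mono[OF 1 half]] .
        qed (auto intro!: continuous_on_diff Gy_cont z g_int)
        ultimately show "(\<lambda>(z, z'). norm (R z z')) x \<le> e' * (C * norm (b - a)) + B/2"
          using xz by simp
      qed
      also have "\<dots> = e * norm (b - a)" using \<open>C > 0\<close> by (simp add: e'_def)
      finally show "norm (R a b) \<le> e * norm (b - a)" by simp
    qed
  qed
  show ?thesis
  proof
    show "continuous_on (cball 0 \<rho>) g" by (rule g_cont)
    fix z :: 'z assume z: "norm z < \<rho>"
    show "(y has_derivative g z) (at z)"
      unfolding has_derivative_at_alt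
    proof (intro conjI allI impI)
      show "bounded_linear (blinfun_apply (g z))" by (rule blinfun.bounded_linear_right)
      fix e :: real assume "e > 0"
      then obtain d where "d > 0" and d: "\<And>a b. a \<in> cball 0 \<rho> \<Longrightarrow> b \<in> cball 0 \<rho> \<Longrightarrow> norm (b - a) \<le> d \<Longrightarrow>
          norm (R a b) \<le> e * norm (b - a)"
        using R_small by metis
      show "\<exists>d>0. \<forall>x. norm (x - z) < d \<longrightarrow> norm (y x - y z - g z (x - z)) \<le> e * norm (x - z)"
      proof (intro exI[of _ "min d (\<rho> - norm z)"] conjI allI impI)
        fix x assume x: "norm (x - z) < min d (\<rho> - norm z)"
        have "norm x \<le> \<rho>" using x norm_triangle_ineq[of "x - z" z] by simp
        then show "norm (y x - y z - g z (x - z)) \<le> e * norm (x - z)"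
          using d[of z x] x z unfolding R_def by simp
      qed (use \<open>d > 0\<close> z in auto)
    qed
    fix v
    have "g z v = integral {0..1} (\<lambda>t. G' (t, z, y (t *\<^sub>R z)) (0, v, 0) + t *\<^sub>R G' (t, z, y (t *\<^sub>R z)) (0, 0, g (t *\<^sub>R z) v))"
      using g_apply z by simp
    also have "\<dots> = integral {0..1} (\<lambda>t.
        frechet_derivative G (at (t, z, y (t *\<^sub>R z))) (0, v, 0)
        + t *\<^sub>R frechet_derivative G (at (t, z, y (t *\<^sub>R z))) (0, 0, g (t *\<^sub>R z) v))"
    proof (rule integral_cong)
      fix t :: real assume t: "t \<in> {0..1}"
      have "(t, z, y (t *\<^sub>R z)) \<in> ?W" using inK[OF t] z KW by auto
      then show "G' (t, z, y (t *\<^sub>R z)) (0, v, 0) + t *\<^sub>R G' (t, z, y (t *\<^sub>R z)) (0, 0, g (t *\<^sub>R z) v)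
        = frechet_derivative G (at (t, z, y (t *\<^sub>R z))) (0, v, 0)
          + t *\<^sub>R frechet_derivative G (at (t, z, y (t *\<^sub>R z))) (0, 0, g (t *\<^sub>R z) v)"
        by (simp add: G')
    qed
    finally show "g z v = \<dots>" .
  qed
qed

end

lemma Ck_on_le: "Ck_on k S f \<Longrightarrow> j \<le> k \<Longrightarrow> Ck_on j S f"
  by (induction k) (auto simp: le_Suc_eq dest: Ck_on_lower simp del: Ck_on.simps)

lemma linear_basis_expansion:
  fixes f :: "'a::euclidean_space \<Rightarrow> 'b::real_vector"
  assumes "linear f"
  shows "f x = (\<Sum>b\<in>Basis. (x \<bullet> b) *\<^sub>R f b)"
proof -
  have "f x = f (\<Sum>b\<in>Basis. (x \<bullet> b) *\<^sub>R b)"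
    by (simp only: euclidean_representation)
  then show ?thesis
    by (simp only: linear_sum[OF assms] linear_scale[OF assms])
qed

text \<open>Every point of the open ball lies in a smaller ball to which
  \<open>Picard_differentiable_cball\<close> applies, and uniqueness of derivatives makes the local
  candidates agree with \<open>frechet_derivative y\<close>.\<close>

lemma (in picard_equation) has_derivative_solution:
  assumes G: "Ck_on 1 (picard_dom r D) G"
  shows "norm z < r \<Longrightarrow> (y has_derivative frechet_derivative y (at z)) (at z)"
    and "norm z < r \<Longrightarrow> frechet_derivative y (at z) v = integral {0..1} (\<lambda>t.
        frechet_derivative G (at (t, z, y (t *\<^sub>R z))) (0, v, 0)
        + t *\<^sub>R frechet_derivative G (at (t, z, y (t *\<^sub>R z))) (0, 0, frechet_derivative y (at (t *\<^sub>R z)) v))"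
    and "continuous_on (ball 0 r) (\<lambda>z. frechet_derivative y (at z) v)"
proof -
  have *: "\<exists>\<rho> g. norm z < \<rho> \<and> \<rho> < r \<and> continuous_on (cball 0 \<rho>) g \<and>
     (\<forall>x. norm x < \<rho> \<longrightarrow> (y has_derivative blinfun_apply (g x)) (at x)) \<and>
     (\<forall>v. g z v = integral {0..1} (\<lambda>t.
        frechet_derivative G (at (t, z, y (t *\<^sub>R z))) (0, v, 0)
        + t *\<^sub>R frechet_derivative G (at (t, z, y (t *\<^sub>R z))) (0, 0, g (t *\<^sub>R z) v)))"
    if zr: "norm z < r" for z
  proof -
    obtain \<rho> where \<rho>: "norm z < \<rho>" "\<rho> < r" using dense[OF zr] by blast
    then have "0 < \<rho>" using norm_ge_zero[of z] by linarith
    show ?thesis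
      by (rule Picard_differentiable_cball[OF G \<open>0 < \<rho>\<close> \<rho>(2)]) (use \<rho> in blast)
  qed
  show 1: "(y has_derivative frechet_derivative y (at z)) (at z)" if "norm z < r" for z
    using *[OF that] frechet_derivative_at by metis
  show "frechet_derivative y (at z) v = integral {0..1} (\<lambda>t.
        frechet_derivative G (at (t, z, y (t *\<^sub>R z))) (0, v, 0)
        + t *\<^sub>R frechet_derivative G (at (t, z, y (t *\<^sub>R z))) (0, 0, frechet_derivative y (at (t *\<^sub>R z)) v))"
    if zr: "norm z < r" for z
  proof -
    obtain \<rho> and g :: "'z \<Rightarrow> 'z \<Rightarrow>\<^sub>L 'f" where g: "norm z < \<rho>"
      "\<And>x. norm x < \<rho> \<Longrightarrow> (y has_derivative blinfun_apply (g x)) (at x)"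
      "g z v = integral {0..1} (\<lambda>t.
        frechet_derivative G (at (t, z, y (t *\<^sub>R z))) (0, v, 0)
        + t *\<^sub>R frechet_derivative G (at (t, z, y (t *\<^sub>R z))) (0, 0, g (t *\<^sub>R z) v))"
      using *[OF zr] by blast
    have eq: "blinfun_apply (g x) = frechet_derivative y (at x)" if "norm x < \<rho>" for x
      using g(2)[OF that] by (rule frechet_derivative_at)
    show ?thesis
      unfolding eq[OF g(1), symmetric] g(3)
    proof (rule integral_cong)
      fix t :: real assume "t \<in> {0..1}"
      then have "norm (t *\<^sub>R z) < \<rho>" using le_less_trans[OF norm_scaled_le g(1)] by simp
      then show "frechet_derivative G (at (t, z, y (t *\<^sub>R z))) (0, v, 0)
        + t *\<^sub>R frechet_derivative G (at (t, z, y (t *\<^sub>R z))) (0, 0, g (t *\<^sub>R z) v)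
        = frechet_derivative G (at (t, z, y (t *\<^sub>R z))) (0, v, 0)
        + t *\<^sub>R frechet_derivative G (at (t, z, y (t *\<^sub>R z))) (0, 0, frechet_derivative y (at (t *\<^sub>R z)) v)"
        by (simp only: eq)
    qed
  qed
  show "continuous_on (ball 0 r) (\<lambda>z. frechet_derivative y (at z) v)"
  proof (rule continuous_at_imp_continuous_on, rule ballI)
    fix z :: 'z assume "z \<in> ball 0 r"
    then obtain \<rho> and g :: "'z \<Rightarrow> 'z \<Rightarrow>\<^sub>L 'f" where g: "norm z < \<rho>" "continuous_on (cball 0 \<rho>) g"
      "\<And>x. norm x < \<rho> \<Longrightarrow> (y has_derivative blinfun_apply (g x)) (at x)"
      using *[of z] by (auto simp: dist_norm)
    have "continuous_on (ball 0 \<rho>) (\<lambda>x. g x v)"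
      by (intro bounded_bilinear.continuous_on[OF bounded_bilinear_blinfun_apply] continuous_on_const
          continuous_on_subset[OF g(2)]) auto
    then have "continuous_on (ball 0 \<rho>) (\<lambda>x. frechet_derivative y (at x) v)"
      by (rule continuous_on_eq) (simp add: frechet_derivative_at[OF g(3)])
    then show "isCont (\<lambda>x. frechet_derivative y (at x) v) z"
      using g(1) by (simp add: continuous_on_eq_continuous_at)
  qed
qed

text \<open>Induction over \<open>k\<close> with the equation itself generalized: if
  \<open>y\<close> is of class C^k and \<open>G\<close> of class C^(k+1), the equation for a
  directional derivative of \<open>y\<close> has a right-hand side of class C^k, so the induction
  hypothesis applies to that derivative.\<close>

theorem Picard_Ck:
  fixes y :: "'a::euclidean_space \<Rightarrow> 'b::euclidean_space"
  assumes "picard_equation r D G y" "Ck_on k (picard_dom r D) G"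
  shows "Ck_on k (ball 0 r) y"
  using assms
proof (induction k arbitrary: D G y)
  case 0
  then show ?case by (simp add: picard_equation_def)
next
  case (Suc k)
  interpret picard_equation r D G y by (rule Suc.prems(1))
  let ?W = "picard_dom r D :: (real \<times> 'a \<times> 'b) set" and ?W1 = "picard_dom r UNIV :: (real \<times> 'a \<times> 'b) set"
  have W: "open ?W" "open ?W1" by (rule open_picard_dom[OF openD], simp add: open_picard_dom)
  have G1: "Ck_on 1 ?W G" by (rule Ck_on_le[OF Suc.prems(2)]) simp
  have y_k: "Ck_on k (ball 0 r) y" by (rule Suc.IH[OF Suc.prems(1) Ck_on_lower[OF Suc.prems(2)]])
  note y' = has_derivative_solution[OF G1]
  have dG: "(G has_derivative frechet_derivative G (at p)) (at p)" if "p \<in> ?W" for p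
    using G1 by (intro has_derivative_frechet[OF W(1) _ that]) simp
  have "Ck_on k (ball 0 r) (\<lambda>z. frechet_derivative y (at z) v)" for v
  proof -
    \<comment> \<open>Affine in \<open>w\<close>, with coefficients depending on the solution
      \<open>y\<close> already at hand; hence its Lipschitz bound holds for all
      \<open>w\<close>.\<close>
    define H :: "real \<times> 'a \<times> 'b \<Rightarrow> 'b" where "H = (\<lambda>(t, z, w). frechet_derivative G (at (t, z, y (t *\<^sub>R z))) (0, v, 0)
        + t *\<^sub>R frechet_derivative G (at (t, z, y (t *\<^sub>R z))) (0, 0, w))"
    have base: "(t, z, y (t *\<^sub>R z)) \<in> ?W" if "(t, z, w) \<in> ?W1" for t z w
      using that y_D unfolding picard_dom_def by auto
    have lin: "linear (\<lambda>w. frechet_derivative G (at p) (0, 0, w))" if "p \<in> ?W" for p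
    proof -
      have "linear (\<lambda>w::'b. (0::real, 0::'a, w))" by (auto intro!: linearI)
      then show ?thesis
        using linear_compose[OF _ has_derivative_linear[OF dG[OF that]]] by (simp add: o_def)
    qed
    have "picard_equation r UNIV H (\<lambda>z. frechet_derivative y (at z) v)"
    proof
      fix t :: real and z :: 'a and w w' :: 'b
      assume t: "t \<in> {0..1}" and z: "norm z < r"
      let ?p = "(t, z, y (t *\<^sub>R z))"
      have p: "?p \<in> ?W" using in_dom[OF z t y_line_D[OF z t]] .
      have "((\<lambda>w. (t, z, w)) has_derivative (\<lambda>h. (0, 0, h))) (at (y (t *\<^sub>R z)))"
        by (intro has_derivative_Pair has_derivative_const has_derivative_ident)
      from has_derivative_compose[OF this dG[OF p]]
      have d: "((\<lambda>w. G (t, z, w)) has_derivative (\<lambda>h. frechet_derivative G (at ?p) (0, 0, h))) (at (y (t *\<^sub>R z)))" .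
      have "norm (frechet_derivative G (at ?p) (0, 0, w - w')) \<le> 1/2 * norm (w - w')"
        by (rule lipschitz_derivative_bound[OF d openD y_line_D[OF z t]]) (rule lip[OF t z _ y_line_D[OF z t]])
      moreover have "H (t, z, w) - H (t, z, w') = t *\<^sub>R frechet_derivative G (at ?p) (0, 0, w - w')"
        unfolding H_def using linear_diff[OF lin[OF p], of w w'] by (simp add: scaleR_diff_right)
      ultimately show "norm (H (t, z, w) - H (t, z, w')) \<le> 1/2 * norm (w - w')"
        using t order_trans[OF norm_scaled_le[of t "frechet_derivative G (at ?p) (0, 0, w - w')"]]
        by (simp only: atLeastAtMost_iff)
    qed (use y'(2,3) in \<open>auto simp: H_def\<close>)
    moreover have "Ck_on k ?W1 H"
    proof -
      have pr: "Ck_on k ?W1 fst" "Ck_on k ?W1 (\<lambda>q. fst (snd q))" "Ck_on k ?W1 (\<lambda>q. snd (snd q))"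
        by (intro Ck_on_linear_comp[OF W(2) _ Ck_on_ident[OF W(2)]] bounded_linear_fst
            bounded_linear_compose[OF bounded_linear_fst bounded_linear_snd]
            bounded_linear_compose[OF bounded_linear_snd bounded_linear_snd])+
      have "Ck_on k ?W1 (\<lambda>q. y (fst q *\<^sub>R fst (snd q)))"
        by (intro Ck_on_compose[OF W(2) open_ball _ y_k] Ck_on_bilinear[OF W(2) bounded_bilinear_scaleR] pr)
          (auto simp: picard_dom_def)
      then have m: "Ck_on k ?W1 (\<lambda>q. (fst q, fst (snd q), y (fst q *\<^sub>R fst (snd q))))"
        by (intro Ck_on_Pair[OF W(2)] pr)
      have "Ck_on k ?W1 (\<lambda>q. frechet_derivative G (at (fst q, fst (snd q), y (fst q *\<^sub>R fst (snd q)))) e)" for e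
      proof (rule Ck_on_compose[OF W(2,1) m, of "\<lambda>p. frechet_derivative G (at p) e"])
        show "Ck_on k ?W (\<lambda>p. frechet_derivative G (at p) e)"
          using Suc.prems(2) unfolding Ck_on.simps by blast
      qed (use base in auto)
      then have "Ck_on k ?W1 (\<lambda>q. frechet_derivative G (at (fst q, fst (snd q), y (fst q *\<^sub>R fst (snd q)))) (0, v, 0)
         + fst q *\<^sub>R (\<Sum>b\<in>Basis. (snd (snd q) \<bullet> b) *\<^sub>R frechet_derivative G (at (fst q, fst (snd q), y (fst q *\<^sub>R fst (snd q)))) (0, 0, b)))"
        by (intro Ck_on_add[OF W(2)] Ck_on_bilinear[OF W(2) bounded_bilinear_scaleR] Ck_on_sum[OF W(2)] pr
            Ck_on_linear_comp[OF W(2) bounded_linear_inner_left])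
      then show ?thesis
      proof (subst Ck_on_cong[OF W(2)], safe)
        fix t z w assume q: "(t, z, w) \<in> ?W1"
        show "H (t, z, w) = frechet_derivative G (at (fst (t, z, w), fst (snd (t, z, w)), y (fst (t, z, w) *\<^sub>R fst (snd (t, z, w))))) (0, v, 0)
         + fst (t, z, w) *\<^sub>R (\<Sum>b\<in>Basis. (snd (snd (t, z, w)) \<bullet> b) *\<^sub>R frechet_derivative G (at (fst (t, z, w), fst (snd (t, z, w)), y (fst (t, z, w) *\<^sub>R fst (snd (t, z, w))))) (0, 0, b))"
          unfolding H_def fst_conv snd_conv prod.case
          by (simp only: linear_basis_expansion[OF lin[OF base[OF q]], of w])
      qed
    qed
    ultimately show ?thesis by (rule Suc.IH)
  qed
  then show ?case
    by (intro Ck_on_SucI[OF open_ball, of _ _ _ "\<lambda>z. frechet_derivative y (at z)"] y'(1)) simp_all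
qed

section \<open>Integral curves of linear families of vector fields\<close>

lemma smooth_lipschitz_on_cball:
  fixes f :: "'a::euclidean_space \<Rightarrow> 'b::euclidean_space"
  assumes S: "open S" and f: "smooth_on S f" and sub: "cball x0 \<rho> \<subseteq> S"
  obtains L where "L > 0" "\<And>x y. x \<in> cball x0 \<rho> \<Longrightarrow> y \<in> cball x0 \<rho> \<Longrightarrow> norm (f x - f y) \<le> L * norm (x - y)"
    "\<And>x. x \<in> cball x0 \<rho> \<Longrightarrow> norm (f x) \<le> L"
proof -
  define N where "N x = (\<Sum>b\<in>Basis. norm (frechet_derivative f (at x) b))" for x
  have c: "continuous_on (cball x0 \<rho>) f" "continuous_on (cball x0 \<rho>) N"
    unfolding N_def using smooth_on_continuous[OF f] smooth_on_continuous[OF smooth_on_derivative[OF f]]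
    by (auto intro!: continuous_intros intro: continuous_on_subset[OF _ sub])
  obtain L1 where L1: "\<And>x. x \<in> cball x0 \<rho> \<Longrightarrow> norm (f x) \<le> L1"
    using compact_imp_bounded[OF compact_continuous_image[OF c(1) compact_cball]] unfolding bounded_iff by blast
  obtain L2 where L2: "\<And>x. x \<in> cball x0 \<rho> \<Longrightarrow> norm (N x) \<le> L2"
    using compact_imp_bounded[OF compact_continuous_image[OF c(2) compact_cball]] unfolding bounded_iff by blast
  define L where "L = max 1 (max L1 L2)"
  show ?thesis
  proof
    show "L > 0" by (simp add: L_def)
    show "norm (f x) \<le> L" if "x \<in> cball x0 \<rho>" for x using L1[OF that] by (simp add: L_def)
    fix x y assume xy: "x \<in> cball x0 \<rho>" "y \<in> cball x0 \<rho>"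
    show "norm (f x - f y) \<le> L * norm (x - y)"
    proof (rule differentiable_bound[OF convex_cball _ _ xy(1) xy(2)])
      fix x assume x: "x \<in> cball x0 \<rho>"
      have d: "(f has_derivative frechet_derivative f (at x)) (at x)"
        using smooth_on_has_derivative[OF S f] sub x by blast
      then show "(f has_derivative frechet_derivative f (at x)) (at x within cball x0 \<rho>)"
        by (rule has_derivative_at_withinI)
      show "onorm (frechet_derivative f (at x)) \<le> L"
      proof (rule onorm_bound)
        fix h
        have "norm (frechet_derivative f (at x) h) = norm (\<Sum>b\<in>Basis. (h \<bullet> b) *\<^sub>R frechet_derivative f (at x) b)"
          using linear_basis_expansion[OF has_derivative_linear[OF d]] by metis
        also have "\<dots> \<le> (\<Sum>b\<in>Basis. norm h * norm (frechet_derivative f (at x) b))"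
          by (rule order_trans[OF norm_sum]) (auto intro!: sum_mono mult_right_mono simp: Basis_le_norm)
        also have "\<dots> = N x * norm h"
          unfolding N_def sum_distrib_right by (simp only: mult.commute)
        also have "\<dots> \<le> L * norm h"
          using L2[OF x] by (intro mult_right_mono) (auto simp: L_def)
        finally show "norm (frechet_derivative f (at x) h) \<le> L * norm h" .
      qed (simp add: L_def)
    qed
  qed
qed

text \<open>For \<open>c = exp\<close> along the fields \<open>X \<cdot> z\<close>: \<open>t \<mapsto> c (t z)\<close> is the integral curve of \<open>X \<cdot> z\<close>
  through \<open>y0\<close>.  Scaling turns the dependence on time into dependence on \<open>z\<close>, so that a single
  integral equation without initial time suffices.\<close>

theorem radial_flow:
  fixes X :: "'e::euclidean_space \<Rightarrow> 'z::euclidean_space \<Rightarrow> 'e"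
  assumes S: "open S" and y0: "y0 \<in> S" and lin: "\<And>y. y \<in> S \<Longrightarrow> linear (X y)"
    and smooth: "\<And>z. smooth_on S (\<lambda>y. X y z)"
  obtains r c where "r > 0" "smooth_on (ball 0 r) c" "c ` ball 0 r \<subseteq> S" "c 0 = y0"
    "\<And>z. norm z < r \<Longrightarrow> frechet_derivative c (at z) z = X (c z) z"
    "\<And>z. frechet_derivative c (at 0) z = X y0 z"
proof -
  obtain \<rho> where "\<rho> > 0" and \<rho>: "cball y0 \<rho> \<subseteq> S"
    using S y0 open_contains_cball by blast
  have "\<exists>L>0. \<forall>x\<in>cball y0 \<rho>. norm (X x b) \<le> L \<and> (\<forall>y\<in>cball y0 \<rho>. norm (X x b - X y b) \<le> L * norm (x - y))" for b
    by (rule smooth_lipschitz_on_cball[OF S smooth[of b] \<rho>]) blast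
  then obtain L where L: "\<And>b. L b > 0"
    "\<And>b x. x \<in> cball y0 \<rho> \<Longrightarrow> norm (X x b) \<le> L b"
    "\<And>b x y. x \<in> cball y0 \<rho> \<Longrightarrow> y \<in> cball y0 \<rho> \<Longrightarrow> norm (X x b - X y b) \<le> L b * norm (x - y)"
    by metis
  \<comment> \<open>Bounds the operator norm of \<open>X x\<close> and the Lipschitz constant of
    \<open>X\<close> in x simultaneously.\<close>
  define N where "N = (\<Sum>b\<in>Basis. L (b::'z))"
  have "N > 0" unfolding N_def using L(1) by (intro sum_pos) auto
  have Xlin: "X y z = (\<Sum>b\<in>Basis. (z \<bullet> b) *\<^sub>R X y b)" if "y \<in> S" for y z
    by (rule linear_basis_expansion[OF lin[OF that]])
  have X_bound: "norm (X x z) \<le> norm z * N" if "x \<in> cball y0 \<rho>" for x z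
  proof -
    have "norm (X x z) = norm (\<Sum>b\<in>Basis. (z \<bullet> b) *\<^sub>R X x b)"
      using Xlin that \<rho> by (metis subsetD)
    also have "\<dots> \<le> (\<Sum>b\<in>Basis. norm z * L b)"
      by (rule order_trans[OF norm_sum]) (auto intro!: sum_mono mult_mono L(2) that simp: Basis_le_norm)
    finally show ?thesis by (simp add: N_def sum_distrib_left)
  qed
  have X_lip: "norm (X x z - X y z) \<le> (norm z * N) * norm (x - y)" if "x \<in> cball y0 \<rho>" "y \<in> cball y0 \<rho>" for x y z
  proof -
    have "X x z - X y z = (\<Sum>b\<in>Basis. (z \<bullet> b) *\<^sub>R (X x b - X y b))"
      using Xlin[of x z] Xlin[of y z] that \<rho> by (simp add: sum_subtractf scaleR_diff_right subset_iff)
    also have "norm \<dots> \<le> (\<Sum>b\<in>Basis. norm z * (L b * norm (x - y)))"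
      by (rule order_trans[OF norm_sum]) (auto intro!: sum_mono mult_mono L(3) that simp: Basis_le_norm)
    finally show ?thesis by (simp add: N_def sum_distrib_left sum_distrib_right mult.assoc)
  qed
  \<comment> \<open>For |z| at most \<open>r\<close>, the field \<open>X _ z\<close> has Lipschitz
    constant at most 1/2, which gives the contraction, and size at most \<rho>/2, which keeps the
    curves in the ball of radius \<rho>/2.\<close>
  define r where "r = min 1 \<rho> / (2 * N)"
  have "r > 0" using \<open>N > 0\<close> \<open>\<rho> > 0\<close> by (simp add: r_def)
  have rN: "norm z * N \<le> 1/2" "norm z * N \<le> \<rho>/2" if "norm z \<le> r" for z :: 'z
    using that \<open>N > 0\<close> unfolding r_def by (auto simp: field_simps)
  define G where "G = (\<lambda>(t::real, z::'z, w). y0 + X w z)"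
  \<comment> \<open>A closed set for the fixed point, properly inside the open ball on which the
    regularity of \<open>G\<close> is used.\<close>
  let ?S = "cball y0 (\<rho>/2)"
  have sub: "?S \<subseteq> ball y0 \<rho>" "ball y0 \<rho> \<subseteq> cball y0 \<rho>" "ball y0 \<rho> \<subseteq> S" using \<open>\<rho> > 0\<close> \<rho> by auto
  have X_smooth: "smooth_on (picard_dom r (ball y0 \<rho>)) G"
  proof -
    let ?W = "picard_dom r (ball y0 \<rho>) :: (real \<times> 'z \<times> 'e) set"
    have W: "open ?W" by (simp add: open_picard_dom)
    have pr: "smooth_on ?W (\<lambda>q. fst (snd q))" "smooth_on ?W (\<lambda>q. snd (snd q))"
      by (intro smooth_on_linear[OF W] bounded_linear_compose[OF bounded_linear_fst bounded_linear_snd]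
          bounded_linear_compose[OF bounded_linear_snd bounded_linear_snd])+
    have "smooth_on ?W (\<lambda>q. y0 + (\<Sum>b\<in>Basis. (fst (snd q) \<bullet> b) *\<^sub>R X (snd (snd q)) b))"
    proof (intro smooth_on_add[OF W] smooth_on_const smooth_on_sum[OF W] smooth_on_scaleR[OF W]
        smooth_on_linear_comp[OF W bounded_linear_inner_left] pr)
      show "smooth_on ?W (\<lambda>q. X (snd (snd q)) b)" for b
        by (rule smooth_on_compose[OF W S pr(2) smooth[of b]]) (use sub in \<open>auto simp: picard_dom_def\<close>)
    qed
    moreover have "G q = y0 + (\<Sum>b\<in>Basis. (fst (snd q) \<bullet> b) *\<^sub>R X (snd (snd q)) b)" if "q \<in> ?W" for q
    proof -
      have "snd (snd q) \<in> S" using that sub by (auto simp: picard_dom_def)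
      from Xlin[OF this, of "fst (snd q)"] show ?thesis
        by (simp add: G_def split_beta)
    qed
    ultimately show ?thesis by (subst smooth_on_cong[OF W])
  qed
  obtain c where c_cont: "continuous_on (cball 0 r) c" and c_S: "c ` cball 0 r \<subseteq> ?S"
    and c_eq: "\<And>z. z \<in> cball 0 r \<Longrightarrow> c z = integral {0..1} (\<lambda>t. (\<lambda>t z w. y0 + X w z) t z (c (t *\<^sub>R z)))"
  proof (rule picard_fixed_point[OF \<open>r > 0\<close>])
    show "closed ?S" "?S \<noteq> {}" using \<open>\<rho> > 0\<close> by auto
    have Xc: "continuous_on ({0..1::real} \<times> cball (0::'z) r \<times> ?S) (\<lambda>q. X (snd (snd q)) b)" for b
      using sub by (intro continuous_on_compose2[OF smooth_on_continuous[OF smooth[of b]]] continuous_intros) fastforce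
    have "continuous_on ({0..1::real} \<times> cball (0::'z) r \<times> ?S) (\<lambda>q. y0 + (\<Sum>b\<in>Basis. (fst (snd q) \<bullet> b) *\<^sub>R X (snd (snd q)) b))"
      by (intro continuous_intros Xc)
    then show "continuous_on ({0..1} \<times> cball 0 r \<times> ?S) (\<lambda>(t::real, z::'z, w). y0 + X w z)"
    proof (rule continuous_on_eq, clarify)
      fix t :: real and z :: 'z and w assume "w \<in> ?S"
      then have "w \<in> S" using sub by blast
      from Xlin[OF this, of z]
      show "y0 + (\<Sum>b\<in>Basis. (fst (snd (t, z, w)) \<bullet> b) *\<^sub>R X (snd (snd (t, z, w))) b) = y0 + X w z"
        by simp
    qed
    fix t z w w' assume tz: "t \<in> {0..1::real}" "z \<in> cball (0::'z) r" and "w \<in> ?S" "w' \<in> ?S"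
    then have "w \<in> cball y0 \<rho>" "w' \<in> cball y0 \<rho>" using sub by blast+
    then have "norm (X w z - X w' z) \<le> norm z * N * norm (w - w')" "norm z * N \<le> 1/2"
      using X_lip[of w w' z] rN(1)[of z] tz by auto
    then show "norm (y0 + X w z - (y0 + X w' z)) \<le> 1/2 * norm (w - w')"
      using mult_right_mono[of "norm z * N" "1/2" "norm (w - w')"] by simp
  next
    fix z :: 'z and y assume z: "z \<in> cball 0 r" and y: "continuous_on {0..1::real} y" "y ` {0..1} \<subseteq> ?S"
    have "continuous_on {0..1} (\<lambda>t. \<Sum>b\<in>Basis. (z \<bullet> b) *\<^sub>R X (y t) b)"
      using y sub
      by (intro continuous_intros continuous_on_compose2[OF smooth_on_continuous[OF smooth]]) auto
    then have c: "continuous_on {0..1} (\<lambda>t. X (y t) z)"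
    proof (rule continuous_on_eq)
      fix t :: real assume "t \<in> {0..1}"
      then have "y t \<in> S" using y sub by blast
      from Xlin[OF this, of z] show "(\<Sum>b\<in>Basis. (z \<bullet> b) *\<^sub>R X (y t) b) = X (y t) z" by simp
    qed
    have "integral {0..1} (\<lambda>t. y0 + X (y t) z) = y0 + integral {0..1} (\<lambda>t. X (y t) z)"
      using c by (simp add: Henstock_Kurzweil_Integration.integral_add integrable_continuous_real)
    moreover have "norm (integral {0..1} (\<lambda>t. X (y t) z)) \<le> \<rho>/2 * (1 - 0)"
    proof (rule integral_bound[OF _ c])
      fix t :: real assume "t \<in> {0..1}"
      then have "y t \<in> cball y0 \<rho>" using y sub by blast
      then show "norm (X (y t) z) \<le> \<rho>/2" using order_trans[OF X_bound rN(2)] z by simp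
    qed simp
    ultimately show "integral {0..1} (\<lambda>t. y0 + X (y t) z) \<in> ?S"
      by (simp add: dist_norm)
  next
    fix y :: "'z \<Rightarrow> 'e"
    assume "continuous_on (cball 0 r) y" "y ` cball 0 r \<subseteq> ?S"
      "\<And>z. z \<in> cball 0 r \<Longrightarrow> y z = integral {0..1} (\<lambda>t. y0 + X (y (t *\<^sub>R z)) z)"
    then show thesis by (rule that)
  qed
  have "picard_equation r (ball y0 \<rho>) G c"
  proof
    fix t :: real and z :: 'z and w w' assume tz: "norm z < r" and "w \<in> ball y0 \<rho>" "w' \<in> ball y0 \<rho>"
    then have "w \<in> cball y0 \<rho>" "w' \<in> cball y0 \<rho>" using sub by blast+
    then have "norm (X w z - X w' z) \<le> norm z * N * norm (w - w')" "norm z * N \<le> 1/2"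
      using X_lip[of w w' z] rN(1)[of z] tz by auto
    then show "norm (G (t, z, w) - G (t, z, w')) \<le> 1/2 * norm (w - w')"
      using mult_right_mono[of "norm z * N" "1/2" "norm (w - w')"] by (simp add: G_def)
  next
    show "continuous_on (ball 0 r) c" by (rule continuous_on_subset[OF c_cont]) auto
    show "c ` ball 0 r \<subseteq> ball y0 \<rho>" using c_S sub by fastforce
    show "c z = integral {0..1} (\<lambda>t. G (t, z, c (t *\<^sub>R z)))" if "norm z < r" for z
      using c_eq[of z] that by (simp add: G_def)
  qed simp
  then have c_smooth: "smooth_on (ball 0 r) c"
    using Picard_Ck X_smooth unfolding smooth_on_def by blast
  have cS: "c z \<in> S" if "norm z \<le> r" for z
    using subsetD[OF sub(3) subsetD[OF sub(1) subsetD[OF c_S imageI]]] that by simp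
  have "c 0 = integral {0..1} (\<lambda>t::real. y0)"
    using c_eq[of 0] \<open>r > 0\<close> linear_0[OF lin[OF cS[of 0]]] by simp
  then have c0: "c 0 = y0" by simp
  \<comment> \<open>The range of \<open>t\<close> includes 0, where the statement yields the
    derivative of \<open>c\<close> at the origin.\<close>
  have radial: "frechet_derivative c (at (t *\<^sub>R z)) z = X (c (t *\<^sub>R z)) z" if z: "norm z < r" and t: "t \<in> {0..1}" for z t
  proof -
    define f where "f s = X (c (s *\<^sub>R z)) z" for s
    have in_ball: "norm (s *\<^sub>R z) < r" if "s \<in> {0..1}" for s
      using le_less_trans[OF norm_scaled_le z, of s] that by simp
    have cz: "continuous_on {0..1} (\<lambda>s. c (s *\<^sub>R z))"
    proof (rule continuous_on_compose2[OF c_cont])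
      show "(\<lambda>s. s *\<^sub>R z) ` {0..1} \<subseteq> cball 0 r"
        using in_ball by (simp add: image_subset_iff less_imp_le)
    qed (intro continuous_intros)
    have cz_S: "(\<lambda>s. c (s *\<^sub>R z)) ` {0..1} \<subseteq> S"
      using cS in_ball by (simp add: image_subset_iff less_imp_le)
    have "continuous_on {0..1} (\<lambda>s. \<Sum>b\<in>Basis. (z \<bullet> b) *\<^sub>R X (c (s *\<^sub>R z)) b)"
      by (intro continuous_on_sum continuous_on_scaleR continuous_on_const
          continuous_on_compose2[OF smooth_on_continuous[OF smooth] cz cz_S])
    then have f_cont: "continuous_on {0..1} f"
    proof (rule continuous_on_eq)
      fix s :: real assume "s \<in> {0..1}"
      then have "c (s *\<^sub>R z) \<in> S" using cS in_ball by (simp add: less_imp_le)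
      from Xlin[OF this, of z] show "(\<Sum>b\<in>Basis. (z \<bullet> b) *\<^sub>R X (c (s *\<^sub>R z)) b) = f s" by (simp add: f_def)
    qed
    define P where "P t = integral {0..t} f" for t
    have P': "(P has_vector_derivative f s) (at s within {0..1})" if "s \<in> {0..1}" for s
      unfolding P_def by (rule integral_has_vector_derivative[OF f_cont that])
    \<comment> \<open>Substituting s u for u in the equation at \<open>s *\<^sub>R z\<close> turns
      the integral over \<open>{0..1}\<close> into the integral of \<open>f\<close> over
      \<open>{0..s}\<close>: along the ray, \<open>c\<close> satisfies the usual integral equation
      of an integral curve.\<close>
    have cP: "c (s *\<^sub>R z) = y0 + P s" if s: "s \<in> {0..1}" for s
    proof -
      have "((\<lambda>u. s *\<^sub>R f (s * u)) has_integral (P (s * 1) - P (s * 0))) {0..1}"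
      proof (rule fundamental_theorem_of_calculus)
        fix u :: real assume u: "u \<in> {0..1}"
        have img: "(\<lambda>u. s * u) ` {0..1} \<subseteq> {0..1}" using s by (auto simp: mult_le_one)
        have "(P has_vector_derivative f (s * u)) (at (s * u) within (\<lambda>u. s * u) ` {0..1})"
          by (rule has_vector_derivative_within_subset[OF P' img]) (use img u in blast)
        moreover have "((\<lambda>u. s * u) has_vector_derivative s) (at u within {0..1})"
          by (auto intro!: derivative_eq_intros simp: has_vector_derivative_def)
        ultimately show "((\<lambda>u. P (s * u)) has_vector_derivative s *\<^sub>R f (s * u)) (at u within {0..1})"
          using vector_diff_chain_within[of "\<lambda>u. s * u" s u "{0..1}" P "f (s * u)"] by (simp add: o_def)
      qed simp
      then have "integral {0..1} (\<lambda>u. s *\<^sub>R f (s * u)) = P s"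
        by (subst integral_unique) (simp_all add: P_def)
      moreover have "X (c (u *\<^sub>R s *\<^sub>R z)) (s *\<^sub>R z) = s *\<^sub>R f (s * u)" if "u \<in> {0..1}" for u
      proof -
        have "s * u \<in> {0..1}" using s that by (auto simp: mult_le_one)
        then have "c ((s * u) *\<^sub>R z) \<in> S" using cS in_ball by (simp add: less_imp_le)
        from linear_scale[OF lin[OF this]] show ?thesis
          by (simp add: f_def mult.commute)
      qed
      ultimately have "integral {0..1} (\<lambda>u. X (c (u *\<^sub>R s *\<^sub>R z)) (s *\<^sub>R z)) = P s"
        using integral_cong by (metis (no_types, lifting))
      moreover have "continuous_on {0..1} (\<lambda>u. X (c (u *\<^sub>R s *\<^sub>R z)) (s *\<^sub>R z))"
      proof (rule continuous_on_eq)
        show "continuous_on {0..1} (\<lambda>u. s *\<^sub>R f (s * u))"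
          using s by (intro continuous_intros continuous_on_compose2[OF f_cont]) (auto simp: mult_le_one)
      qed (use \<open>\<And>u. u \<in> {0..1} \<Longrightarrow> X (c (u *\<^sub>R s *\<^sub>R z)) (s *\<^sub>R z) = s *\<^sub>R f (s * u)\<close> in simp)
      moreover have "c (s *\<^sub>R z) = integral {0..1} (\<lambda>u. y0 + X (c (u *\<^sub>R s *\<^sub>R z)) (s *\<^sub>R z))"
        using c_eq[of "s *\<^sub>R z"] less_imp_le[OF in_ball[OF s]] by simp
      ultimately show ?thesis
        by (simp add: Henstock_Kurzweil_Integration.integral_add integrable_continuous_real)
    qed
    have P0: "((\<lambda>s. y0 + P s) has_vector_derivative f t) (at t within {0..1})"
      using has_vector_derivative_add[OF has_vector_derivative_const P'[OF t], of y0] by simp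
    have 1: "((\<lambda>s. c (s *\<^sub>R z)) has_vector_derivative f t) (at t within {0..1})"
      by (rule has_vector_derivative_transform[OF t _ P0]) (simp add: cP)
    have "(c has_derivative frechet_derivative c (at (t *\<^sub>R z))) (at (t *\<^sub>R z))"
      using smooth_on_has_derivative[OF open_ball c_smooth] in_ball[OF t] by simp
    moreover have "((\<lambda>s. s *\<^sub>R z) has_derivative (\<lambda>h. h *\<^sub>R z)) (at t within {0..1})"
      by (auto intro!: derivative_eq_intros)
    ultimately have "((\<lambda>s. c (s *\<^sub>R z)) has_derivative (\<lambda>h. frechet_derivative c (at (t *\<^sub>R z)) (h *\<^sub>R z))) (at t within {0..1})"
      using has_derivative_compose by blast
    then have 2: "((\<lambda>s. c (s *\<^sub>R z)) has_vector_derivative frechet_derivative c (at (t *\<^sub>R z)) z) (at t within {0..1})"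
      using linear_scale[OF has_derivative_linear[OF \<open>(c has_derivative _) _\<close>]]
      by (simp add: has_vector_derivative_def)
    have "frechet_derivative c (at (t *\<^sub>R z)) z = f t"
      using vector_derivative_unique_within_closed_interval[of 0 1 t, OF _ _ 2[folded cbox_interval] 1[folded cbox_interval]] t
      by simp
    then show ?thesis by (simp add: f_def)
  qed
  show ?thesis
  proof (rule that[OF \<open>r > 0\<close> c_smooth _ c0])
    show "c ` ball 0 r \<subseteq> S" using cS by (auto simp: less_imp_le)
    show "frechet_derivative c (at z) z = X (c z) z" if "norm z < r" for z
      using radial[OF that, of 1] by simp
    fix z :: 'z
    \<comment> \<open>Shrinks \<open>z\<close> into the ball; both sides are linear, so the factor
      cancels at the end.\<close>
    define e where "e = r / (norm z + 1)"
    have nz: "norm z + 1 > 0" by (simp add: add_nonneg_pos)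
    have "e > 0" using \<open>r > 0\<close> nz by (simp add: e_def)
    have "e * norm z < e * (norm z + 1)" using \<open>e > 0\<close> by simp
    also have "\<dots> = r" using nz by (simp add: e_def)
    finally have "norm (e *\<^sub>R z) < r" using \<open>e > 0\<close> by simp
    from radial[OF this, of 0] have "frechet_derivative c (at 0) (e *\<^sub>R z) = X y0 (e *\<^sub>R z)"
      by (simp add: c0)
    moreover have "(c has_derivative frechet_derivative c (at 0)) (at 0)"
      using smooth_on_has_derivative[OF open_ball c_smooth] \<open>r > 0\<close> by simp
    ultimately have "e *\<^sub>R frechet_derivative c (at 0) z = e *\<^sub>R X y0 z"
      using linear_scale[OF has_derivative_linear] linear_scale[OF lin[OF y0]] by metis
    then show "frechet_derivative c (at 0) z = X y0 z" using \<open>e > 0\<close> by simp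
  qed
qed

subsection \<open>Charts and tangent vectors\<close>

lemma smooth_on_transform:
  assumes "smooth_on S f" "\<And>x. x \<in> S \<Longrightarrow> f x = g x" "open S"
  shows "smooth_on S g"
  using smooth_on_cong[of S f g, OF assms(3,2)] assms(1) by simp

lemma is_chartD:
  assumes "is_chart (U, \<phi>)"
  shows "open U" "open (\<phi> ` U)" "continuous_on U \<phi>" "continuous_on (\<phi> ` U) (inv_into U \<phi>)"
    "inj_on \<phi> U" "\<And>x. x \<in> U \<Longrightarrow> inv_into U \<phi> (\<phi> x) = x"
  using assms by (auto simp: is_chart_def homeomorphism_def intro: inj_on_inverseI)

lemma chart_image_Int:
  assumes "is_chart (U, \<phi>)"
  shows "\<phi> ` (U \<inter> V) = \<phi> ` U \<inter> inv_into U \<phi> -` V"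
  using is_chartD(6)[OF assms] by (auto simp: image_iff)

lemma chart_image_open:
  assumes "is_chart (U, \<phi>)" "open V"
  shows "open (\<phi> ` (U \<inter> V))"
  unfolding chart_image_Int[OF assms(1)]
  using continuous_open_preimage[OF is_chartD(4,2)[OF assms(1)] assms(2)] .

lemma smooth_chartD: "smooth_chart A (U, \<phi>) \<Longrightarrow> is_chart (U, \<phi>)"
  by (simp add: smooth_chart_def)

lemma smooth_map_eucl_source:
  "smooth_map eucl A S \<gamma> \<longleftrightarrow> open S \<and> continuous_on S \<gamma> \<and> (\<forall>(V, \<psi>)\<in>A. smooth_on (S \<inter> \<gamma> -` V) (\<lambda>t. \<psi> (\<gamma> t)))"
  by (simp add: smooth_map_def eucl_def o_def inv_id)

lemma smooth_map_eucl_target: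
  "smooth_map A eucl S f \<longleftrightarrow> open S \<and> continuous_on S f \<and>
    (\<forall>(U, \<phi>)\<in>A. smooth_on (\<phi> ` (U \<inter> S)) (\<lambda>y. f (inv_into U \<phi> y)))"
  by (simp add: smooth_map_def eucl_def o_def Int_commute)

context smooth_manifold
begin

lemma obtain_chart: obtains U \<phi> where "(U, \<phi>) \<in> A" "x \<in> U"
proof -
  have "x \<in> (\<Union>(U, \<phi>)\<in>A. U)" using covering by simp
  then show ?thesis using that by blast
qed

lemma atlas_smooth_chart:
  assumes "(U, \<phi>) \<in> A"
  shows "smooth_chart A (U, \<phi>)"
proof -
  have c: "is_chart (U, \<phi>)" using charts[OF assms] .
  have "smooth_on (\<phi>' ` (U' \<inter> U)) (\<lambda>y. \<phi> (inv_into U' \<phi>' y))" if "(U', \<phi>') \<in> A" for U' \<phi>'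
    using compatible[OF that assms] by (simp add: o_def)
  moreover have "smooth_on (\<phi> ` U \<inter> inv_into U \<phi> -` V) (\<lambda>t. \<psi> (inv_into U \<phi> t))" if "(V, \<psi>) \<in> A" for V \<psi>
    using compatible[OF assms that] by (simp add: o_def chart_image_Int[OF c])
  ultimately show ?thesis
    using c is_chartD[OF c]
    by (auto simp: smooth_chart_def smooth_map_eucl_source smooth_map_eucl_target)
qed

lemma smooth_chart_from_atlas:
  assumes "smooth_chart A (V, \<psi>)" "(W, \<kappa>) \<in> A"
  shows "smooth_on (\<kappa> ` (W \<inter> V)) (\<lambda>y. \<psi> (inv_into W \<kappa> y))"
    and "smooth_on (\<psi> ` (V \<inter> W)) (\<lambda>y. \<kappa> (inv_into V \<psi> y))"
  using assms
  by (auto simp: smooth_chart_def smooth_map_eucl_source smooth_map_eucl_target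
      chart_image_Int[OF smooth_chartD[OF assms(1)]])

text \<open>Charts of the maximal atlas are compared with atlas charts only, so the transition
  between two of them is factored, near each point, through an atlas chart around that
  point.\<close>

lemma smooth_transition:
  assumes U: "smooth_chart A (U, \<xi>)" and V: "smooth_chart A (V, \<psi>)"
  shows "smooth_on (\<xi> ` (U \<inter> V)) (\<lambda>y. \<psi> (inv_into U \<xi> y))"
proof (rule smooth_on_local)
  note cU = smooth_chartD[OF U] and cV = smooth_chartD[OF V]
  fix y assume "y \<in> \<xi> ` (U \<inter> V)"
  then obtain x where x: "x \<in> U" "x \<in> V" "y = \<xi> x" by blast
  obtain W \<kappa> where W: "(W, \<kappa>) \<in> A" "x \<in> W" by (rule obtain_chart)
  note cW = charts[OF W(1)]
  let ?T = "\<xi> ` (U \<inter> (V \<inter> W))"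
  have T: "open ?T" using chart_image_open[OF cU, of "V \<inter> W"] is_chartD(1)[OF cV] is_chartD(1)[OF cW] by auto
  have "smooth_on ?T (\<lambda>y. \<psi> (inv_into W \<kappa> (\<kappa> (inv_into U \<xi> y))))"
  proof (rule smooth_on_compose[where g = "\<lambda>y. \<psi> (inv_into W \<kappa> y)", OF T])
    show "open (\<kappa> ` (W \<inter> V))" using chart_image_open[OF cW] is_chartD(1)[OF cV] by auto
    show "smooth_on ?T (\<lambda>y. \<kappa> (inv_into U \<xi> y))"
      using smooth_on_subset[OF smooth_chart_from_atlas(2)[OF U W(1)], of ?T] by auto
    show "smooth_on (\<kappa> ` (W \<inter> V)) (\<lambda>y. \<psi> (inv_into W \<kappa> y))"
      using smooth_chart_from_atlas(1)[OF V W(1)] .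
  qed (use is_chartD(6)[OF cU] in auto)
  moreover have "\<psi> (inv_into W \<kappa> (\<kappa> (inv_into U \<xi> y))) = \<psi> (inv_into U \<xi> y)" if "y \<in> ?T" for y
    using that is_chartD(6)[OF cU] is_chartD(6)[OF cW] by auto
  ultimately have "smooth_on ?T (\<lambda>y. \<psi> (inv_into U \<xi> y))"
    by (rule smooth_on_transform) (assumption, rule T)
  then show "\<exists>T. open T \<and> y \<in> T \<and> smooth_on T (\<lambda>y. \<psi> (inv_into U \<xi> y))"
    using T x W(2) by blast
qed

lemma smooth_at_chart:
  assumes U: "smooth_chart A (U, \<xi>)" "x \<in> U" and f: "smooth_at A x f"
  obtains W where "open W" "x \<in> W" "W \<subseteq> U" "smooth_on (\<xi> ` W) (\<lambda>y. f (inv_into U \<xi> y))"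
proof -
  note cU = smooth_chartD[OF U(1)]
  obtain S where S: "x \<in> S" "open S"
    "\<And>W \<kappa>. (W, \<kappa>) \<in> A \<Longrightarrow> smooth_on (\<kappa> ` (W \<inter> S)) (\<lambda>y. f (inv_into W \<kappa> y))"
    using f by (auto simp: smooth_at_def smooth_map_eucl_target)
  obtain W \<kappa> where W: "(W, \<kappa>) \<in> A" "x \<in> W" by (rule obtain_chart)
  note cW = charts[OF W(1)]
  let ?T = "\<xi> ` (U \<inter> (W \<inter> S))"
  have T: "open ?T" using chart_image_open[OF cU, of "W \<inter> S"] is_chartD(1)[OF cW] S by auto
  have "smooth_on ?T (\<lambda>y. f (inv_into W \<kappa> (\<kappa> (inv_into U \<xi> y))))"
  proof (rule smooth_on_compose[where g = "\<lambda>y. f (inv_into W \<kappa> y)", OF T])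
    show "open (\<kappa> ` (W \<inter> S))" using chart_image_open[OF cW S(2)] .
    show "smooth_on ?T (\<lambda>y. \<kappa> (inv_into U \<xi> y))"
      by (rule smooth_on_subset[OF smooth_chart_from_atlas(2)[OF U(1) W(1)]]) auto
    show "smooth_on (\<kappa> ` (W \<inter> S)) (\<lambda>y. f (inv_into W \<kappa> y))"
      using S(3)[OF W(1)] .
  qed (use is_chartD(6)[OF cU] in auto)
  moreover have "f (inv_into W \<kappa> (\<kappa> (inv_into U \<xi> y))) = f (inv_into U \<xi> y)" if "y \<in> ?T" for y
    using that is_chartD(6)[OF cU] is_chartD(6)[OF cW] by auto
  ultimately have "smooth_on ?T (\<lambda>y. f (inv_into U \<xi> y))"
    by (rule smooth_on_transform) (assumption, rule T)
  then show ?thesis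
    using that[of "U \<inter> (W \<inter> S)"] S W U is_chartD(1)[OF cU] is_chartD(1)[OF cW] by auto
qed

lemma smooth_atI:
  assumes U: "smooth_chart A (U, \<xi>)" and W: "open W" "x \<in> W" "W \<subseteq> U"
    and f: "smooth_on (\<xi> ` W) (\<lambda>y. f (inv_into U \<xi> y))"
  shows "smooth_at A x f"
  unfolding smooth_at_def smooth_map_eucl_target
proof (intro exI[of _ W] conjI ballI W)
  note cU = smooth_chartD[OF U]
  have oW: "open (\<xi> ` W)" using chart_image_open[OF cU W(1)] W(3) by (simp add: Int_absorb1)
  have "continuous_on W (\<lambda>x. f (inv_into U \<xi> (\<xi> x)))"
    by (rule continuous_on_compose2[OF smooth_on_continuous[OF f] continuous_on_subset[OF is_chartD(3)[OF cU] W(3)]]) auto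
  then show "continuous_on W f"
    by (rule continuous_on_eq) (use W(3) is_chartD(6)[OF cU] in auto)
  fix c assume "c \<in> A"
  obtain V \<psi> where c: "c = (V, \<psi>)" by (cases c)
  then have V: "(V, \<psi>) \<in> A" using \<open>c \<in> A\<close> by simp
  note cV = charts[OF V]
  let ?T = "\<psi> ` (V \<inter> W)"
  have T: "open ?T" using chart_image_open[OF cV W(1)] .
  have "smooth_on ?T (\<lambda>y. f (inv_into U \<xi> (\<xi> (inv_into V \<psi> y))))"
  proof (rule smooth_on_compose[where g = "\<lambda>y. f (inv_into U \<xi> y)", OF T oW _ f])
    show "smooth_on ?T (\<lambda>y. \<xi> (inv_into V \<psi> y))"
      by (rule smooth_on_subset[OF smooth_chart_from_atlas(1)[OF U V]]) (use W in auto)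
  qed (use is_chartD(6)[OF cV] in auto)
  moreover have "f (inv_into U \<xi> (\<xi> (inv_into V \<psi> y))) = f (inv_into V \<psi> y)" if "y \<in> ?T" for y
  proof -
    obtain m where "m \<in> V" "m \<in> W" "y = \<psi> m" using \<open>y \<in> ?T\<close> by auto
    then show ?thesis using is_chartD(6)[OF cU, of m] is_chartD(6)[OF cV, of m] W(3) by auto
  qed
  ultimately have "smooth_on ?T (\<lambda>y. f (inv_into V \<psi> y))"
    by (rule smooth_on_transform) (assumption, rule T)
  then show "case c of (U, \<phi>) \<Rightarrow> smooth_on (\<phi> ` (U \<inter> W)) (\<lambda>y. f (inv_into U \<phi> y))"
    by (simp add: c)
qed

section \<open>Coordinate fields, velocities and tangent spaces\<close>

lemma smooth_at_coordinate:
  assumes "smooth_chart A (U, \<xi>)" "x \<in> U"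
  shows "smooth_at A x (\<lambda>m. \<xi> m \<bullet> b)"
proof (rule smooth_atI[OF assms(1) _ assms(2) subset_refl])
  note c = is_chartD[OF smooth_chartD[OF assms(1)]]
  show "open U" by (rule c)
  have "smooth_on (\<xi> ` U) (\<lambda>y. y \<bullet> b)"
    by (intro smooth_on_linear c bounded_linear_inner_left)
  then show "smooth_on (\<xi> ` U) (\<lambda>y. \<xi> (inv_into U \<xi> y) \<bullet> b)"
    by (subst smooth_on_cong[OF c(2), where g = "\<lambda>y. y \<bullet> b"]) (auto simp: c)
qed

lemma coord_field_apply:
  "smooth_at A x f \<Longrightarrow> coord_field A (U, \<xi>) z x f = frechet_derivative (\<lambda>y. f (inv_into U \<xi> y)) (at (\<xi> x)) z"
  by (simp add: coord_field_def o_def)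

lemma coord_field_not_smooth: "\<not> smooth_at A x f \<Longrightarrow> coord_field A (U, \<xi>) z x f = 0"
  by (simp add: coord_field_def)

lemma has_derivative_chart:
  assumes U: "smooth_chart A (U, \<xi>)" "x \<in> U" and f: "smooth_at A x f"
  shows "((\<lambda>y. f (inv_into U \<xi> y)) has_derivative (\<lambda>z. coord_field A (U, \<xi>) z x f)) (at (\<xi> x))"
proof -
  note cU = smooth_chartD[OF U(1)]
  obtain W where W: "open W" "x \<in> W" "W \<subseteq> U" "smooth_on (\<xi> ` W) (\<lambda>y. f (inv_into U \<xi> y))"
    by (rule smooth_at_chart[OF assms])
  have "open (\<xi> ` W)" using chart_image_open[OF cU W(1)] W(3) by (simp add: Int_absorb1)
  from smooth_on_has_derivative[OF this W(4)] W(2) show ?thesis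
    by (simp add: coord_field_apply[OF f])
qed

lemma linear_coord_field:
  assumes "smooth_chart A (U, \<xi>)" "x \<in> U"
  shows "linear (\<lambda>z. coord_field A (U, \<xi>) z x f)"
proof (cases "smooth_at A x f")
  case True
  then show ?thesis using has_derivative_chart[OF assms True] has_derivative_linear by blast
next
  case False
  then show ?thesis by (simp add: coord_field_not_smooth linear_zero)
qed

lemma coord_field_coordinate:
  assumes "smooth_chart A (U, \<xi>)" "x \<in> U"
  shows "coord_field A (U, \<xi>) z x (\<lambda>m. \<xi> m \<bullet> b) = z \<bullet> b"
proof -
  note c = is_chartD[OF smooth_chartD[OF assms(1)]]
  have "frechet_derivative (\<lambda>y. \<xi> (inv_into U \<xi> y) \<bullet> b) (at (\<xi> x)) = frechet_derivative (\<lambda>y. y \<bullet> b) (at (\<xi> x))"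
    by (rule frechet_derivative_cong[OF c(2)]) (use assms c in auto)
  also have "\<dots> = (\<lambda>y. y \<bullet> b)"
    using frechet_derivative_at[OF bounded_linear_imp_has_derivative[OF bounded_linear_inner_left]] by metis
  finally show ?thesis
    by (simp add: coord_field_apply[OF smooth_at_coordinate[OF assms]])
qed

lemma coord_field_inject:
  assumes "smooth_chart A (U, \<xi>)" "x \<in> U" "coord_field A (U, \<xi>) z x = coord_field A (U, \<xi>) w x"
  shows "z = w"
  by (rule euclidean_eqI) (metis coord_field_coordinate[OF assms(1,2)] assms(3))

text \<open>One chain rule for a map \<sigma> from a Euclidean space into the manifold; changes of
  charts, velocities of curves and push-forwards are its instances.\<close>

lemma has_derivative_through_chart:
  assumes V: "smooth_chart A (V, \<psi>)" and T: "open T" "y \<in> T" "\<sigma> ` T \<subseteq> V"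
    and D: "((\<lambda>y. \<psi> (\<sigma> y)) has_derivative D) (at y)" and f: "smooth_at A (\<sigma> y) f"
  shows "((\<lambda>y. f (\<sigma> y)) has_derivative (\<lambda>w. coord_field A (V, \<psi>) (D w) (\<sigma> y) f)) (at y)"
proof -
  note c = is_chartD[OF smooth_chartD[OF V]]
  have "\<sigma> y \<in> V" using T by auto
  from has_derivative_compose[OF D has_derivative_chart[OF V this f]]
  have "((\<lambda>y. f (inv_into V \<psi> (\<psi> (\<sigma> y)))) has_derivative (\<lambda>w. coord_field A (V, \<psi>) (D w) (\<sigma> y) f)) (at y)" .
  then show ?thesis
    by (rule has_derivative_transform_within_open[OF _ T(1,2)]) (use T(3) c(6) in auto)
qed

lemma coord_field_change:
  assumes U: "smooth_chart A (U, \<xi>)" and V: "smooth_chart A (V, \<psi>)" and x: "x \<in> U" "x \<in> V"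
  shows "coord_field A (U, \<xi>) w x = coord_field A (V, \<psi>) (frechet_derivative (\<lambda>y. \<psi> (inv_into U \<xi> y)) (at (\<xi> x)) w) x"
proof
  fix f
  note cU = is_chartD[OF smooth_chartD[OF U]] and cV = is_chartD[OF smooth_chartD[OF V]]
  have o: "open (\<xi> ` (U \<inter> V))" by (rule chart_image_open[OF smooth_chartD[OF U] cV(1)])
  show "coord_field A (U, \<xi>) w x f = coord_field A (V, \<psi>) (frechet_derivative (\<lambda>y. \<psi> (inv_into U \<xi> y)) (at (\<xi> x)) w) x f"
  proof (cases "smooth_at A x f")
    case True
    have "((\<lambda>y. f (inv_into U \<xi> y)) has_derivative
      (\<lambda>w. coord_field A (V, \<psi>) (frechet_derivative (\<lambda>y. \<psi> (inv_into U \<xi> y)) (at (\<xi> x)) w) (inv_into U \<xi> (\<xi> x)) f)) (at (\<xi> x))"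
      by (rule has_derivative_through_chart[OF V o])
        (use x cU smooth_on_has_derivative[OF o smooth_transition[OF U V]] True in auto)
    from frechet_derivative_at[OF this] show ?thesis
      using x cU(6) by (simp add: coord_field_apply[OF True, of U]) metis
  qed (simp add: coord_field_not_smooth)
qed

lemma smooth_curve_in_chart:
  assumes V: "smooth_chart A (V, \<psi>)" and \<gamma>: "smooth_map eucl A S \<gamma>"
  shows "open (S \<inter> \<gamma> -` V)" "smooth_on (S \<inter> \<gamma> -` V) (\<lambda>t. \<psi> (\<gamma> t))"
proof -
  note cV = smooth_chartD[OF V]
  have S: "open S" "continuous_on S \<gamma>"
    and sm: "\<And>W \<kappa>. (W, \<kappa>) \<in> A \<Longrightarrow> smooth_on (S \<inter> \<gamma> -` W) (\<lambda>t. \<kappa> (\<gamma> t))"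
    using \<gamma> by (auto simp: smooth_map_eucl_source)
  have op: "open (S \<inter> \<gamma> -` W)" if "open W" for W
    by (rule continuous_open_preimage[OF S(2,1) that])
  then show "open (S \<inter> \<gamma> -` V)" using is_chartD(1)[OF cV] .
  show "smooth_on (S \<inter> \<gamma> -` V) (\<lambda>t. \<psi> (\<gamma> t))"
  proof (rule smooth_on_local)
    fix t assume t: "t \<in> S \<inter> \<gamma> -` V"
    obtain W \<kappa> where W: "(W, \<kappa>) \<in> A" "\<gamma> t \<in> W" by (rule obtain_chart)
    note cW = charts[OF W(1)]
    let ?T = "S \<inter> \<gamma> -` (V \<inter> W)"
    have T: "open ?T" using op is_chartD(1)[OF cV] is_chartD(1)[OF cW] by blast
    have "smooth_on ?T (\<lambda>y. \<psi> (inv_into W \<kappa> (\<kappa> (\<gamma> y))))"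
    proof (rule smooth_on_compose[where g = "\<lambda>y. \<psi> (inv_into W \<kappa> y)", OF T])
      show "open (\<kappa> ` (W \<inter> V))" using chart_image_open[OF cW] is_chartD(1)[OF cV] by auto
      show "smooth_on ?T (\<lambda>y. \<kappa> (\<gamma> y))"
        by (rule smooth_on_subset[OF sm[OF W(1)]]) auto
      show "smooth_on (\<kappa> ` (W \<inter> V)) (\<lambda>y. \<psi> (inv_into W \<kappa> y))"
        using smooth_chart_from_atlas(1)[OF V W(1)] .
    qed auto
    moreover have "\<psi> (inv_into W \<kappa> (\<kappa> (\<gamma> y))) = \<psi> (\<gamma> y)" if "y \<in> ?T" for y
      using that is_chartD(6)[OF cW] by auto
    ultimately have "smooth_on ?T (\<lambda>y. \<psi> (\<gamma> y))"
      by (rule smooth_on_transform) (assumption, rule T)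
    then show "\<exists>T. open T \<and> t \<in> T \<and> smooth_on T (\<lambda>y. \<psi> (\<gamma> y))"
      using T t W(2) by blast
  qed
qed

lemma velocity_in_chart:
  assumes V: "smooth_chart A (V, \<psi>)" and \<gamma>: "smooth_map eucl A S \<gamma>" "0 \<in> S" "\<gamma> 0 \<in> V"
  shows "velocity A \<gamma> = coord_field A (V, \<psi>) (frechet_derivative (\<lambda>t. \<psi> (\<gamma> t)) (at 0) 1) (\<gamma> 0)"
proof
  fix f
  note o = smooth_curve_in_chart[OF V \<gamma>(1)]
  show "velocity A \<gamma> f = coord_field A (V, \<psi>) (frechet_derivative (\<lambda>t. \<psi> (\<gamma> t)) (at 0) 1) (\<gamma> 0) f"
  proof (cases "smooth_at A (\<gamma> 0) f")
    case True
    let ?L = "\<lambda>w. coord_field A (V, \<psi>) (frechet_derivative (\<lambda>t. \<psi> (\<gamma> t)) (at 0) w) (\<gamma> 0) f"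
    have D: "((\<lambda>t. f (\<gamma> t)) has_derivative ?L) (at 0)"
      by (rule has_derivative_through_chart[OF V o(1)])
        (use \<gamma> smooth_on_has_derivative[OF o] True in auto)
    have "?L = (*) (?L 1)"
    proof
      fix w show "?L w = ?L 1 * w"
        using linear_scale[OF has_derivative_linear[OF D], of w 1] by (simp add: mult.commute)
    qed
    from has_derivative_eq_rhs[OF D this]
    have "((\<lambda>t. f (\<gamma> t)) has_field_derivative ?L 1) (at 0)"
      unfolding has_field_derivative_def .
    then show ?thesis
      using True by (simp add: velocity_def o_def DERIV_imp_deriv)
  qed (simp add: velocity_def coord_field_not_smooth)
qed

text \<open>For one inclusion, the difference quotients of a curve in \<open>V\<close> lie in the
  subspace \<open>L\<close>, and so does their limit. For the other, a vector of \<open>L\<close> is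
  the velocity of the curve whose coordinate expression is a straight line.\<close>

lemma tangent_of_slice:
  assumes U: "smooth_chart A (U, \<xi>)" and x: "x \<in> U" "x \<in> V" and L: "subspace L"
    and slice: "\<xi> ` (V \<inter> U) = \<xi> ` U \<inter> L"
  shows "tangent_of A V x = (\<lambda>w. coord_field A (U, \<xi>) w x) ` L"
proof (intro equalityI subsetI)
  note cU = is_chartD[OF smooth_chartD[OF U]]
  fix v assume "v \<in> tangent_of A V x"
  then obtain \<gamma> \<epsilon> where \<gamma>: "v = velocity A \<gamma>" "\<epsilon> > 0" "smooth_map eucl A {-\<epsilon><..<\<epsilon>} \<gamma>" "\<gamma> 0 = x" "\<gamma> ` {-\<epsilon><..<\<epsilon>} \<subseteq> V"
    by (auto simp: tangent_of_def)
  let ?S = "{-\<epsilon><..<\<epsilon>} \<inter> \<gamma> -` U"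
  note o = smooth_curve_in_chart[OF U \<gamma>(3)]
  let ?d = "frechet_derivative (\<lambda>t. \<xi> (\<gamma> t)) (at 0) 1"
  have v: "v = coord_field A (U, \<xi>) ?d x"
    using velocity_in_chart[OF U \<gamma>(3)] \<gamma> x by simp
  have inL: "\<xi> (\<gamma> t) \<in> L" if "t \<in> ?S" for t
    using that \<gamma>(5) slice by blast
  have d: "((\<lambda>t. \<xi> (\<gamma> t)) has_derivative frechet_derivative (\<lambda>t. \<xi> (\<gamma> t)) (at 0)) (at 0)"
    using smooth_on_has_derivative[OF o] \<gamma> x by simp
  have "frechet_derivative (\<lambda>t. \<xi> (\<gamma> t)) (at 0) = (\<lambda>t. t *\<^sub>R ?d)"
  proof
    fix t show "frechet_derivative (\<lambda>t. \<xi> (\<gamma> t)) (at 0) t = t *\<^sub>R ?d"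
      using linear_scale[OF has_derivative_linear[OF d], of t 1] by simp
  qed
  from has_derivative_eq_rhs[OF d this]
  have "((\<lambda>t. \<xi> (\<gamma> t)) has_vector_derivative ?d) (at 0)"
    unfolding has_vector_derivative_def .
  then have lim: "((\<lambda>t. (\<xi> (\<gamma> t) - \<xi> (\<gamma> 0)) /\<^sub>R t) \<longlongrightarrow> ?d) (at 0)"
  proof -
    assume "((\<lambda>t. \<xi> (\<gamma> t)) has_vector_derivative ?d) (at 0)"
    then have "((\<lambda>t. norm ((\<xi> (\<gamma> t) - \<xi> (\<gamma> 0) - t *\<^sub>R ?d) /\<^sub>R norm t)) \<longlongrightarrow> 0) (at 0)"
      by (intro tendsto_norm_zero) (simp add: has_vector_derivative_def has_derivative_def)
    note lim0 = this
    have eq: "norm ((\<xi> (\<gamma> t) - \<xi> (\<gamma> 0) - t *\<^sub>R ?d) /\<^sub>R norm t) = norm ((\<xi> (\<gamma> t) - \<xi> (\<gamma> 0)) /\<^sub>R t - ?d)"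
      if "t \<noteq> 0" for t
    proof -
      have "(\<xi> (\<gamma> t) - \<xi> (\<gamma> 0)) /\<^sub>R t - ?d = (\<xi> (\<gamma> t) - \<xi> (\<gamma> 0) - t *\<^sub>R ?d) /\<^sub>R t"
        using that by (simp add: scaleR_diff_right)
      then show ?thesis by simp
    qed
    have "((\<lambda>t. norm ((\<xi> (\<gamma> t) - \<xi> (\<gamma> 0)) /\<^sub>R t - ?d)) \<longlongrightarrow> 0) (at 0)"
      by (rule Lim_transform_eventually[OF lim0]) (use eq in \<open>simp add: eventually_at_filter del: norm_scaleR\<close>)
    from LIM_zero_cancel[OF tendsto_norm_zero_cancel[OF this]] show ?thesis .
  qed
  have "\<forall>\<^sub>F t in at 0. t \<in> ?S"
    by (rule eventually_at_in_open'[OF o(1)]) (use \<gamma> x in simp)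
  then have "\<forall>\<^sub>F t in at 0. (\<xi> (\<gamma> t) - \<xi> (\<gamma> 0)) /\<^sub>R t \<in> L"
    by eventually_elim (intro subspace_scale subspace_diff L inL, use \<gamma> x in auto)
  \<comment> \<open>A subspace of a Euclidean space is closed, so it contains the limit of the
    quotients.\<close>
  then have "?d \<in> L"
    using Lim_in_closed_set[OF closed_subspace[OF L] _ _ lim] by simp
  then show "v \<in> (\<lambda>w. coord_field A (U, \<xi>) w x) ` L" using v by blast
next
  note cU = is_chartD[OF smooth_chartD[OF U]]
  fix v assume "v \<in> (\<lambda>w. coord_field A (U, \<xi>) w x) ` L"
  then obtain w where w: "w \<in> L" "v = coord_field A (U, \<xi>) w x" by blast
  have x_L: "\<xi> x \<in> L" using x slice by blast
  \<comment> \<open>The segment stays in \<open>L\<close> because the base point lies in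
    \<open>L\<close> as well, and in the chart image for small t because that image is open.\<close>
  define l where "l t = \<xi> x + t *\<^sub>R w" for t :: real
  have "isCont l 0" unfolding l_def by (intro continuous_intros)
  moreover have "l 0 \<in> \<xi> ` U" using x by (simp add: l_def)
  ultimately obtain \<epsilon> where "\<epsilon> > 0" and \<epsilon>: "\<And>t. \<bar>t\<bar> < \<epsilon> \<Longrightarrow> l t \<in> \<xi> ` U"
    using cU(2) unfolding continuous_at_open by (metis (no_types, lifting) abs_0 dist_0_norm mem_ball open_contains_ball real_norm_def subset_iff)
  have lU: "l ` {-\<epsilon><..<\<epsilon>} \<subseteq> \<xi> ` U" using \<epsilon> by auto
  have l_smooth: "smooth_on {-\<epsilon><..<\<epsilon>} l"
    unfolding l_def
    by (intro smooth_on_add smooth_on_const smooth_on_linear_comp[where L = "\<lambda>t. t *\<^sub>R w"] smooth_on_ident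
        bounded_linear_scaleR_left) auto
  define \<gamma> where "\<gamma> t = inv_into U \<xi> (l t)" for t
  have \<gamma>U: "\<gamma> t \<in> U" and \<xi>\<gamma>: "\<xi> (\<gamma> t) = l t" if "\<bar>t\<bar> < \<epsilon>" for t
    using \<epsilon>[OF that] by (auto simp: \<gamma>_def inv_into_into f_inv_into_f)
  have inv_smooth: "smooth_map eucl A (\<xi> ` U) (inv_into U \<xi>)"
    using U by (simp add: smooth_chart_def)
  have "smooth_map eucl A {-\<epsilon><..<\<epsilon>} \<gamma>"
    unfolding smooth_map_eucl_source
  proof (intro conjI ballI)
    show c\<gamma>: "continuous_on {-\<epsilon><..<\<epsilon>} \<gamma>"
      unfolding \<gamma>_def by (rule continuous_on_compose2[OF cU(4) smooth_on_continuous[OF l_smooth] lU])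
    fix c assume "c \<in> A"
    obtain W \<kappa> where c: "c = (W, \<kappa>)" by (cases c)
    then have W: "(W, \<kappa>) \<in> A" using \<open>c \<in> A\<close> by simp
    have o1: "open ({-\<epsilon><..<\<epsilon>} \<inter> \<gamma> -` W)"
      by (rule continuous_open_preimage[OF c\<gamma> open_greaterThanLessThan is_chartD(1)[OF charts[OF W]]])
    have o2: "open (\<xi> ` (U \<inter> W))" by (rule chart_image_open[OF smooth_chartD[OF U] is_chartD(1)[OF charts[OF W]]])
    have "smooth_on ({-\<epsilon><..<\<epsilon>} \<inter> \<gamma> -` W) (\<lambda>t. \<kappa> (inv_into U \<xi> (l t)))"
      by (rule smooth_on_compose[OF o1 o2 smooth_on_subset[OF l_smooth] smooth_chart_from_atlas(2)[OF U W]])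
        (use lU in \<open>auto simp: chart_image_Int[OF smooth_chartD[OF U]] \<gamma>_def\<close>)
    then show "case c of (V, \<psi>) \<Rightarrow> smooth_on ({-\<epsilon><..<\<epsilon>} \<inter> \<gamma> -` V) (\<lambda>t. \<psi> (\<gamma> t))"
      by (simp add: c \<gamma>_def)
  qed auto
  moreover have "\<gamma> 0 = x" using x cU by (simp add: \<gamma>_def l_def)
  moreover have "\<gamma> ` {-\<epsilon><..<\<epsilon>} \<subseteq> V"
  proof clarify
    fix t assume "t \<in> {-\<epsilon><..<\<epsilon>}"
    then have t: "\<bar>t\<bar> < \<epsilon>" by auto
    have "l t \<in> L" unfolding l_def by (intro subspace_add subspace_scale L x_L w)
    then have "\<xi> (\<gamma> t) \<in> \<xi> ` (V \<inter> U)" using \<gamma>U[OF t] \<xi>\<gamma>[OF t] slice by (metis IntI imageI)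
    then show "\<gamma> t \<in> V" using \<gamma>U[OF t] cU(5) by (auto simp: inj_on_def)
  qed
  moreover have "velocity A \<gamma> = v"
  proof -
    have "frechet_derivative (\<lambda>t. \<xi> (\<gamma> t)) (at 0) = frechet_derivative l (at 0)"
      by (rule frechet_derivative_cong[of "{-\<epsilon><..<\<epsilon>}"]) (use \<open>\<epsilon> > 0\<close> \<xi>\<gamma> in auto)
    moreover have "(l has_derivative (\<lambda>t. t *\<^sub>R w)) (at 0)"
      unfolding l_def by (auto intro!: derivative_eq_intros)
    ultimately have "frechet_derivative (\<lambda>t. \<xi> (\<gamma> t)) (at 0) 1 = w"
      using frechet_derivative_at by (metis scaleR_one)
    then show ?thesis
      using velocity_in_chart[OF U \<open>smooth_map eucl A _ \<gamma>\<close>] \<open>\<epsilon> > 0\<close> \<open>\<gamma> 0 = x\<close> x w by simp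
  qed
  ultimately show "v \<in> tangent_of A V x"
    using \<open>\<epsilon> > 0\<close> unfolding tangent_of_def by blast
qed

lemma tangent_space_chart:
  assumes "smooth_chart A (U, \<xi>)" "x \<in> U"
  shows "tangent_space A x = range (\<lambda>w. coord_field A (U, \<xi>) w x)"
  using tangent_of_slice[OF assms _ subspace_UNIV] by simp

text \<open>Turns a local diffeomorphism of the coordinate space, as delivered by the inverse
  function theorem, into a chart of the maximal atlas; the normal charts are built this way.\<close>

lemma smooth_chart_compose:
  assumes V: "smooth_chart A (V, \<psi>)" and hom: "homeomorphism V' U' g h"
    and V': "open V'" "V' \<subseteq> \<psi> ` V" and U': "open U'" and g: "smooth_on V' g" and h: "smooth_on U' h"
  shows "smooth_chart A (inv_into V \<psi> ` V', \<lambda>m. g (\<psi> m))"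
    and "(\<lambda>m. g (\<psi> m)) ` (inv_into V \<psi> ` V') = U'"
    and "\<And>z. z \<in> U' \<Longrightarrow> inv_into (inv_into V \<psi> ` V') (\<lambda>m. g (\<psi> m)) z = inv_into V \<psi> (h z)"
proof -
  note cV = is_chartD[OF smooth_chartD[OF V]]
  let ?W = "inv_into V \<psi> ` V'" and ?\<xi> = "\<lambda>m. g (\<psi> m)"
  have inv: "\<psi> (inv_into V \<psi> y) = y" "inv_into V \<psi> y \<in> V" if "y \<in> V'" for y
    using that V'(2) by (auto simp: f_inv_into_f inv_into_into)
  have W: "?W = V \<inter> \<psi> -` V'"
    using inv cV(6) V'(2) by (auto simp: image_iff) metis
  have W_open: "open ?W"
    unfolding W by (rule continuous_open_preimage[OF cV(3,1) V'(1)])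
  have hg: "g ` V' = U'" "h ` U' = V'" "\<And>y. y \<in> V' \<Longrightarrow> h (g y) = y" "\<And>z. z \<in> U' \<Longrightarrow> g (h z) = z"
    "continuous_on V' g" "continuous_on U' h"
    using hom by (auto simp: homeomorphism_def)
  show img: "?\<xi> ` ?W = U'"
    unfolding image_image using inv hg(1) by simp
  have inj: "inj_on ?\<xi> ?W"
  proof (rule inj_on_inverseI[where g = "\<lambda>z. inv_into V \<psi> (h z)"])
    show "inv_into V \<psi> (h (g (\<psi> m))) = m" if "m \<in> ?W" for m
      using that hg(3) cV(6) unfolding W by simp
  qed
  have mem: "inv_into V \<psi> (h z) \<in> ?W" "?\<xi> (inv_into V \<psi> (h z)) = z" if "z \<in> U'" for z
    using that hg inv by auto
  show inv_\<xi>: "inv_into ?W ?\<xi> z = inv_into V \<psi> (h z)" if "z \<in> U'" for z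
    by (rule inv_into_f_eq[OF inj mem[OF that]])
  have c1: "continuous_on ?W ?\<xi>"
    by (rule continuous_on_compose2[OF hg(5) continuous_on_subset[OF cV(3)]]) (use W in auto)
  have "continuous_on U' (\<lambda>z. inv_into V \<psi> (h z))"
    by (rule continuous_on_compose2[OF cV(4) hg(6)]) (use hg V' in auto)
  then have c2: "continuous_on U' (inv_into ?W ?\<xi>)"
    by (rule continuous_on_eq) (simp add: inv_\<xi>)
  have "homeomorphism ?W U' ?\<xi> (inv_into ?W ?\<xi>)"
  proof (rule homeomorphismI[OF c1 c2])
    show "inv_into ?W ?\<xi> ` U' \<subseteq> ?W" using inv_\<xi> mem(1) by auto
    show "inv_into ?W ?\<xi> (?\<xi> m) = m" if "m \<in> ?W" for m
      by (rule inv_into_f_f[OF inj that])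
    show "?\<xi> (inv_into ?W ?\<xi> z) = z" if "z \<in> U'" for z
      by (rule f_inv_into_f) (simp only: img that)
  qed (use img in auto)
  then have chart: "is_chart (?W, ?\<xi>)"
    using W_open U' img by (simp add: is_chart_def)
  have "smooth_on (\<kappa> ` (Y \<inter> ?W)) (\<lambda>y. ?\<xi> (inv_into Y \<kappa> y))" if Y: "(Y, \<kappa>) \<in> A" for Y \<kappa>
  proof -
    note cY = is_chartD[OF charts[OF Y]]
    have "open (\<kappa> ` (Y \<inter> ?W))" by (rule chart_image_open[OF charts[OF Y] W_open])
    then show ?thesis
      by (rule smooth_on_compose[OF _ V'(1) smooth_on_subset[OF smooth_chart_from_atlas(1)[OF V Y]] g])
        (use cY(6) in \<open>auto simp: W\<close>)
  qed
  moreover have "smooth_on (U' \<inter> inv_into ?W ?\<xi> -` Y) (\<lambda>z. \<kappa> (inv_into ?W ?\<xi> z))" if Y: "(Y, \<kappa>) \<in> A" for Y \<kappa>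
  proof -
    note cY = is_chartD[OF charts[OF Y]]
    let ?T = "U' \<inter> inv_into ?W ?\<xi> -` Y"
    have T: "open ?T" by (rule continuous_open_preimage[OF c2 U' cY(1)])
    have "smooth_on ?T (\<lambda>z. \<kappa> (inv_into V \<psi> (h z)))"
    proof (rule smooth_on_compose[OF T _ smooth_on_subset[OF h] smooth_chart_from_atlas(2)[OF V Y]])
      show "open (\<psi> ` (V \<inter> Y))" by (rule chart_image_open[OF smooth_chartD[OF V] cY(1)])
      show "h ` ?T \<subseteq> \<psi> ` (V \<inter> Y)"
        using inv_\<xi> hg(2) V'(2) by (auto simp: chart_image_Int[OF smooth_chartD[OF V]])
    qed auto
    then show ?thesis
      by (subst smooth_on_cong[OF T, where g = "\<lambda>z. \<kappa> (inv_into V \<psi> (h z))"]) (auto simp: inv_\<xi>)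
  qed
  ultimately show "smooth_chart A (?W, ?\<xi>)"
    using chart W_open U' c1 c2 img
    by (auto simp: smooth_chart_def smooth_map_eucl_source smooth_map_eucl_target)
qed

end

text \<open>Brings the soldering condition, stated for abstract tangent vectors, into coordinates:
  the projection acts on coordinate fields through the derivative of its coordinate
  expression.\<close>

lemma push_forward_coord_field:
  fixes A :: "('m::{t2_space, second_countable_topology}, 'a::euclidean_space) atlas"
    and B :: "('n::{t2_space, second_countable_topology}, 'e::euclidean_space) atlas"
  assumes A: "smooth_manifold A" and B: "smooth_manifold B" and h: "smooth_map B A UNIV h"
    and U: "(U, \<phi>) \<in> B" "x \<in> U" and V: "(V, \<psi>) \<in> A" "h x \<in> V"
  shows "push_forward A h x (coord_field B (U, \<phi>) w x)
    = coord_field A (V, \<psi>) (frechet_derivative (\<lambda>y. \<psi> (h (inv_into U \<phi> y))) (at (\<phi> x)) w) (h x)"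
    and "open (\<phi> ` (U \<inter> h -` V))" "smooth_on (\<phi> ` (U \<inter> h -` V)) (\<lambda>y. \<psi> (h (inv_into U \<phi> y)))"
proof -
  interpret A: smooth_manifold A by (rule A)
  interpret B: smooth_manifold B by (rule B)
  note cU = is_chartD[OF B.charts[OF U(1)]] and cV = is_chartD[OF A.charts[OF V(1)]]
  note sU = B.atlas_smooth_chart[OF U(1)] and sV = A.atlas_smooth_chart[OF V(1)]
  have cont: "continuous_on UNIV h" using h by (simp add: smooth_map_def)
  have hV: "open (h -` V)" using cont cV(1) open_vimage by blast
  then show T: "open (\<phi> ` (U \<inter> h -` V))" by (rule chart_image_open[OF B.charts[OF U(1)]])
  show sm: "smooth_on (\<phi> ` (U \<inter> h -` V)) (\<lambda>y. \<psi> (h (inv_into U \<phi> y)))"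
    using h U(1) V(1) by (force simp: smooth_map_def o_def)
  have x: "\<phi> x \<in> \<phi> ` (U \<inter> h -` V)" using U V by auto
  show "push_forward A h x (coord_field B (U, \<phi>) w x)
    = coord_field A (V, \<psi>) (frechet_derivative (\<lambda>y. \<psi> (h (inv_into U \<phi> y))) (at (\<phi> x)) w) (h x)"
  proof
    fix f
    show "push_forward A h x (coord_field B (U, \<phi>) w x) f
      = coord_field A (V, \<psi>) (frechet_derivative (\<lambda>y. \<psi> (h (inv_into U \<phi> y))) (at (\<phi> x)) w) (h x) f"
    proof (cases "smooth_at A (h x) f")
      case True
      obtain W where W: "open W" "h x \<in> W" "W \<subseteq> V" "smooth_on (\<psi> ` W) (\<lambda>y. f (inv_into V \<psi> y))"
        by (rule A.smooth_at_chart[OF sV V(2) True])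
      have W': "open (\<psi> ` W)" using chart_image_open[OF A.charts[OF V(1)] W(1)] W(3) by (simp add: Int_absorb1)
      have hW: "open (h -` W)" using cont W(1) open_vimage by blast
      let ?T = "\<phi> ` (U \<inter> h -` W)"
      have T': "open ?T" by (rule chart_image_open[OF B.charts[OF U(1)] hW])
      have "smooth_on ?T (\<lambda>y. f (inv_into V \<psi> (\<psi> (h (inv_into U \<phi> y)))))"
        by (rule smooth_on_compose[OF T' W' smooth_on_subset[OF sm] W(4)]) (use W(3) cU(6) in auto)
      moreover have "f (inv_into V \<psi> (\<psi> (h (inv_into U \<phi> y)))) = f (h (inv_into U \<phi> y))" if "y \<in> ?T" for y
      proof -
        have "h (inv_into U \<phi> y) \<in> V" using that cU(6) W(3) by auto
        then show ?thesis by (simp add: cV(6))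
      qed
      ultimately have "smooth_on ?T (\<lambda>y. f (h (inv_into U \<phi> y)))"
        by (rule smooth_on_transform) (assumption, rule T')
      then have fh: "smooth_at B x (\<lambda>n. f (h n))"
        using W U hW cU(1) by (intro B.smooth_atI[OF sU, of "U \<inter> h -` W"]) auto
      have "((\<lambda>y. f (h (inv_into U \<phi> y))) has_derivative (\<lambda>w. coord_field A (V, \<psi>)
          (frechet_derivative (\<lambda>y. \<psi> (h (inv_into U \<phi> y))) (at (\<phi> x)) w) (h (inv_into U \<phi> (\<phi> x))) f)) (at (\<phi> x))"
        by (rule A.has_derivative_through_chart[OF sV T x])
          (use cU(6) U(2) smooth_on_has_derivative[OF T sm x] True in auto)
      from fun_cong[OF frechet_derivative_at[OF this], of w] show ?thesis
        using True U cU(6)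
        by (simp add: push_forward_def o_def B.coord_field_apply[OF fh])
    qed (simp add: push_forward_def A.coord_field_not_smooth)
  qed
qed

subsection \<open>Differential forms on open subsets of Euclidean spaces\<close>

definition smooth_1form :: "'a::euclidean_space set \<Rightarrow> ('a \<Rightarrow> 'a \<Rightarrow> real) \<Rightarrow> bool" where
  "smooth_1form S \<eta> \<longleftrightarrow> (\<forall>y\<in>S. linear (\<eta> y)) \<and> (\<forall>w. smooth_on S (\<lambda>y. \<eta> y w))"

text \<open>The exterior derivative on constant vector fields, whose bracket vanishes.\<close>

definition ext_d :: "('a::euclidean_space \<Rightarrow> 'a \<Rightarrow> real) \<Rightarrow> 'a \<Rightarrow> 'a \<Rightarrow> 'a \<Rightarrow> real" where
  "ext_d \<eta> y u v = frechet_derivative (\<lambda>y. \<eta> y v) (at y) u - frechet_derivative (\<lambda>y. \<eta> y u) (at y) v"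

definition wedge1 :: "('a \<Rightarrow> 'v \<Rightarrow> real) \<Rightarrow> ('a \<Rightarrow> 'v \<Rightarrow> real) \<Rightarrow> 'a \<Rightarrow> 'v \<Rightarrow> 'v \<Rightarrow> real" where
  "wedge1 \<alpha> \<beta> y u v = \<alpha> y u * \<beta> y v - \<alpha> y v * \<beta> y u"

definition pullback :: "('a::euclidean_space \<Rightarrow> 'b::euclidean_space) \<Rightarrow> ('b \<Rightarrow> 'b \<Rightarrow> real) \<Rightarrow> 'a \<Rightarrow> 'a \<Rightarrow> real" where
  "pullback f \<eta> y v = \<eta> (f y) (frechet_derivative f (at y) v)"

lemma smooth_1formD:
  assumes "smooth_1form S \<eta>"
  shows "y \<in> S \<Longrightarrow> linear (\<eta> y)" "smooth_on S (\<lambda>y. \<eta> y w)"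
  using assms by (auto simp: smooth_1form_def)

text \<open>A product rule for the pairing of a form with a vector field: differentiate the form
  with the vector frozen, then the vector. Expanding in the basis reduces it to products of real
  functions.\<close>

lemma has_derivative_form_apply:
  assumes T: "open T" "smooth_1form T \<eta>" and S: "open S" "y \<in> S" "f ` S \<subseteq> T"
    and f: "(f has_derivative f') (at y)" and w: "(w has_derivative w') (at y)"
  shows "((\<lambda>x. \<eta> (f x) (w x)) has_derivative
    (\<lambda>h. frechet_derivative (\<lambda>x. \<eta> x (w y)) (at (f y)) (f' h) + \<eta> (f y) (w' h))) (at y)"
proof -
  note lin = smooth_1formD(1)[OF T(2)] and sm = smooth_1formD(2)[OF T(2)]
  have fy: "f y \<in> T" using S by auto
  have d: "((\<lambda>x. \<eta> x v) has_derivative frechet_derivative (\<lambda>x. \<eta> x v) (at (f y))) (at (f y))" for v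
    by (rule smooth_on_has_derivative[OF T(1) sm fy])
  have D: "((\<lambda>x. \<Sum>b\<in>Basis. (w x \<bullet> b) *\<^sub>R \<eta> (f x) b) has_derivative
      (\<lambda>h. \<Sum>b\<in>Basis. (w y \<bullet> b) *\<^sub>R frechet_derivative (\<lambda>x. \<eta> x b) (at (f y)) (f' h) + (w' h \<bullet> b) *\<^sub>R \<eta> (f y) b)) (at y)"
    by (intro has_derivative_sum has_derivative_scaleR has_derivative_inner_left w
        has_derivative_compose[OF f d])
  have "frechet_derivative (\<lambda>x. \<eta> x (w y)) (at (f y)) u = (\<Sum>b\<in>Basis. (w y \<bullet> b) *\<^sub>R frechet_derivative (\<lambda>x. \<eta> x b) (at (f y)) u)" for u
  proof -
    have "((\<lambda>x. \<Sum>b\<in>Basis. (w y \<bullet> b) *\<^sub>R \<eta> x b) has_derivative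
        (\<lambda>u. \<Sum>b\<in>Basis. (w y \<bullet> b) *\<^sub>R frechet_derivative (\<lambda>x. \<eta> x b) (at (f y)) u)) (at (f y))"
      by (intro has_derivative_sum has_derivative_scaleR_right d)
    moreover have "(\<Sum>b\<in>Basis. (w y \<bullet> b) *\<^sub>R \<eta> x b) = \<eta> x (w y)" if "x \<in> T" for x
      by (rule linear_basis_expansion[OF lin[OF that], symmetric])
    ultimately have "((\<lambda>x. \<eta> x (w y)) has_derivative
        (\<lambda>u. \<Sum>b\<in>Basis. (w y \<bullet> b) *\<^sub>R frechet_derivative (\<lambda>x. \<eta> x b) (at (f y)) u)) (at (f y))"
      by (rule has_derivative_transform_within_open[OF _ T(1) fy])
    from fun_cong[OF frechet_derivative_at[OF this], of u] show ?thesis by simp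
  qed
  moreover have "\<eta> (f y) (w' h) = (\<Sum>b\<in>Basis. (w' h \<bullet> b) *\<^sub>R \<eta> (f y) b)" for h
    by (rule linear_basis_expansion[OF lin[OF fy]])
  ultimately have eq: "(\<lambda>h. \<Sum>b\<in>Basis. (w y \<bullet> b) *\<^sub>R frechet_derivative (\<lambda>x. \<eta> x b) (at (f y)) (f' h) + (w' h \<bullet> b) *\<^sub>R \<eta> (f y) b)
      = (\<lambda>h. frechet_derivative (\<lambda>x. \<eta> x (w y)) (at (f y)) (f' h) + \<eta> (f y) (w' h))"
    by (simp only: sum.distrib)
  show ?thesis
  proof (rule has_derivative_transform_within_open[OF D[unfolded eq] S(1,2)])
    fix x assume "x \<in> S"
    then have "f x \<in> T" using S by auto
    from linear_basis_expansion[OF lin[OF this], of "w x"]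
    show "(\<Sum>b\<in>Basis. (w x \<bullet> b) *\<^sub>R \<eta> (f x) b) = \<eta> (f x) (w x)" by (rule sym)
  qed
qed

lemma smooth_on_form_apply:
  assumes T: "open T" "smooth_1form T \<eta>" and S: "open S" "f ` S \<subseteq> T"
    and f: "smooth_on S f" and w: "smooth_on S w"
  shows "smooth_on S (\<lambda>x. \<eta> (f x) (w x))"
proof -
  note lin = smooth_1formD(1)[OF T(2)] and sm = smooth_1formD(2)[OF T(2)]
  have "smooth_on S (\<lambda>x. \<Sum>b\<in>Basis. (w x \<bullet> b) *\<^sub>R \<eta> (f x) b)"
    by (intro smooth_on_sum[OF S(1)] smooth_on_scaleR[OF S(1)] smooth_on_compose[OF S(1) T(1) f sm S(2)]
        smooth_on_linear_comp[OF S(1) bounded_linear_inner_left w])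
  moreover have "(\<Sum>b\<in>Basis. (w x \<bullet> b) *\<^sub>R \<eta> (f x) b) = \<eta> (f x) (w x)" if "x \<in> S" for x
    by (rule linear_basis_expansion[OF lin, symmetric]) (use that S in auto)
  ultimately show ?thesis by (rule smooth_on_transform) (assumption, rule S(1))
qed

lemma smooth_1form_pullback:
  assumes T: "open T" "smooth_1form T \<eta>" and S: "open S" "f ` S \<subseteq> T" and f: "smooth_on S f"
  shows "smooth_1form S (pullback f \<eta>)"
  unfolding smooth_1form_def pullback_def
proof (intro conjI ballI allI)
  show "smooth_on S (\<lambda>y. \<eta> (f y) (frechet_derivative f (at y) w))" for w
    by (rule smooth_on_form_apply[OF T S f smooth_on_derivative[OF f]])
  fix y assume y: "y \<in> S"
  then have "f y \<in> T" using S by auto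
  from linear_compose[OF has_derivative_linear[OF smooth_on_has_derivative[OF S(1) f y]] smooth_1formD(1)[OF T(2) this]]
  show "linear (\<lambda>v. \<eta> (f y) (frechet_derivative f (at y) v))" by (simp add: o_def)
qed

text \<open>Differentiating the pulled back form produces a second derivative of \<open>f\<close>,
  which is symmetric and therefore disappears in the alternation.\<close>

lemma ext_d_pullback:
  assumes T: "open T" "smooth_1form T \<eta>" and S: "open S" "f ` S \<subseteq> T" and f: "smooth_on S f" and y: "y \<in> S"
  shows "ext_d (pullback f \<eta>) y u v
    = ext_d \<eta> (f y) (frechet_derivative f (at y) u) (frechet_derivative f (at y) v)"
proof -
  have "frechet_derivative (\<lambda>y. pullback f \<eta> y v) (at y) u
    = frechet_derivative (\<lambda>x. \<eta> x (frechet_derivative f (at y) v)) (at (f y)) (frechet_derivative f (at y) u)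
      + \<eta> (f y) (frechet_derivative (\<lambda>x. frechet_derivative f (at x) v) (at y) u)" for u v
    unfolding pullback_def
    using fun_cong[OF frechet_derivative_at[OF has_derivative_form_apply[OF T S(1) y S(2)
          smooth_on_has_derivative[OF S(1) f y] smooth_on_has_derivative[OF S(1) smooth_on_derivative[OF f] y]]], of v u]
    by simp
  then show ?thesis
    unfolding ext_d_def using smooth_on_second_derivative_symmetric[OF S(1) f y, of u v] by simp
qed

text \<open>d d = 0 on constant fields: the cyclic sum consists of six second derivatives that
  cancel in pairs by symmetry.\<close>

lemma ext_d_closed:
  assumes S: "open S" "smooth_1form S \<eta>" "y \<in> S"
  shows "frechet_derivative (\<lambda>y. ext_d \<eta> y v w) (at y) u + frechet_derivative (\<lambda>y. ext_d \<eta> y w u) (at y) v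
    + frechet_derivative (\<lambda>y. ext_d \<eta> y u v) (at y) w = 0"
proof -
  note sm = smooth_1formD(2)[OF S(2)]
  have "frechet_derivative (\<lambda>y. ext_d \<eta> y v w) (at y) u
      = frechet_derivative (\<lambda>y. frechet_derivative (\<lambda>y. \<eta> y w) (at y) v) (at y) u
      - frechet_derivative (\<lambda>y. frechet_derivative (\<lambda>y. \<eta> y v) (at y) w) (at y) u" for u v w
  proof -
    have "((\<lambda>y. ext_d \<eta> y v w) has_derivative (\<lambda>u. frechet_derivative (\<lambda>y. frechet_derivative (\<lambda>y. \<eta> y w) (at y) v) (at y) u
      - frechet_derivative (\<lambda>y. frechet_derivative (\<lambda>y. \<eta> y v) (at y) w) (at y) u)) (at y)"
      unfolding ext_d_def
      by (intro has_derivative_diff smooth_on_has_derivative[OF S(1) smooth_on_derivative[OF sm] S(3)])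
    from fun_cong[OF frechet_derivative_at[OF this], of u] show ?thesis by simp
  qed
  then show ?thesis
    using smooth_on_second_derivative_symmetric[OF S(1) sm S(3)] by simp
qed

text \<open>The Leibniz rule. On constant fields the cyclic sum of derivatives is the exterior
  derivative of a 2-form.\<close>

lemma ext_d_wedge:
  assumes S: "open S" "smooth_1form S \<alpha>" "smooth_1form S \<beta>" "y \<in> S"
  shows "frechet_derivative (\<lambda>y. wedge1 \<alpha> \<beta> y v w) (at y) u + frechet_derivative (\<lambda>y. wedge1 \<alpha> \<beta> y w u) (at y) v
    + frechet_derivative (\<lambda>y. wedge1 \<alpha> \<beta> y u v) (at y) w
    = ext_d \<alpha> y u v * \<beta> y w + ext_d \<alpha> y v w * \<beta> y u + ext_d \<alpha> y w u * \<beta> y v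
      - \<alpha> y u * ext_d \<beta> y v w - \<alpha> y v * ext_d \<beta> y w u - \<alpha> y w * ext_d \<beta> y u v"
proof -
  note sma = smooth_1formD(2)[OF S(2)] and smb = smooth_1formD(2)[OF S(3)]
  have D: "frechet_derivative (\<lambda>y. wedge1 \<alpha> \<beta> y v w) (at y) u
      = \<alpha> y v * frechet_derivative (\<lambda>y. \<beta> y w) (at y) u + frechet_derivative (\<lambda>y. \<alpha> y v) (at y) u * \<beta> y w
      - (\<alpha> y w * frechet_derivative (\<lambda>y. \<beta> y v) (at y) u + frechet_derivative (\<lambda>y. \<alpha> y w) (at y) u * \<beta> y v)" for u v w
  proof -
    have "((\<lambda>y. wedge1 \<alpha> \<beta> y v w) has_derivative (\<lambda>u. \<alpha> y v * frechet_derivative (\<lambda>y. \<beta> y w) (at y) u + frechet_derivative (\<lambda>y. \<alpha> y v) (at y) u * \<beta> y w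
      - (\<alpha> y w * frechet_derivative (\<lambda>y. \<beta> y v) (at y) u + frechet_derivative (\<lambda>y. \<alpha> y w) (at y) u * \<beta> y v))) (at y)"
      unfolding wedge1_def
      by (intro has_derivative_diff has_derivative_mult smooth_on_has_derivative[OF S(1) sma S(4)] smooth_on_has_derivative[OF S(1) smb S(4)])
    from fun_cong[OF frechet_derivative_at[OF this], of u] show ?thesis by simp
  qed
  show ?thesis unfolding D ext_d_def by (simp add: algebra_simps)
qed

lemma smooth_on_ext_d:
  assumes S: "open S" "smooth_1form S \<eta>"
  shows "smooth_on S (\<lambda>y. ext_d \<eta> y u v)"
  unfolding ext_d_def
  by (intro smooth_on_diff[OF S(1)] smooth_on_derivative smooth_1formD(2)[OF S(2)])

lemma smooth_on_wedge1:
  assumes S: "open S" "smooth_1form S \<alpha>" "smooth_1form S \<beta>"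
  shows "smooth_on S (\<lambda>y. wedge1 \<alpha> \<beta> y u v)"
  unfolding wedge1_def
  by (intro smooth_on_diff[OF S(1)] smooth_on_mult[OF S(1)] smooth_1formD(2)[OF S(2)] smooth_1formD(2)[OF S(3)])

lemma linear_ext_d:
  assumes S: "open S" "smooth_1form S \<eta>" "y \<in> S"
  shows "linear (ext_d \<eta> y u)" and "linear (\<lambda>v. ext_d \<eta> y v u)"
proof -
  have lin1: "linear (\<lambda>v. frechet_derivative (\<lambda>y. \<eta> y u) (at y) v)" for u
    using has_derivative_linear[OF smooth_on_has_derivative[OF S(1) smooth_1formD(2)[OF S(2)] S(3)]] .
  have lin2: "linear (\<lambda>v. frechet_derivative (\<lambda>y. \<eta> y v) (at y) u)"
  proof (rule linearI)
    note d = smooth_on_has_derivative[OF S(1) smooth_1formD(2)[OF S(2)] S(3)]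
    have "frechet_derivative (\<lambda>x. \<eta> x (v + w)) (at y) = frechet_derivative (\<lambda>x. \<eta> x v + \<eta> x w) (at y)" for v w
      by (rule frechet_derivative_cong[OF S(1,3)]) (simp add: linear_add[OF smooth_1formD(1)[OF S(2)]])
    also have "\<dots> v w = (\<lambda>h. frechet_derivative (\<lambda>x. \<eta> x v) (at y) h + frechet_derivative (\<lambda>x. \<eta> x w) (at y) h)" for v w
      using frechet_derivative_at[OF has_derivative_add[OF d d]] by metis
    finally show "frechet_derivative (\<lambda>x. \<eta> x (v + w)) (at y) u
        = frechet_derivative (\<lambda>x. \<eta> x v) (at y) u + frechet_derivative (\<lambda>x. \<eta> x w) (at y) u" for v w
      by simp
    have "frechet_derivative (\<lambda>x. \<eta> x (c *\<^sub>R w)) (at y) = frechet_derivative (\<lambda>x. c *\<^sub>R \<eta> x w) (at y)" for c w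
      by (rule frechet_derivative_cong[OF S(1,3)]) (simp add: linear_scale[OF smooth_1formD(1)[OF S(2)]])
    also have "\<dots> c w = (\<lambda>h. c *\<^sub>R frechet_derivative (\<lambda>x. \<eta> x w) (at y) h)" for c w
      using frechet_derivative_at[OF has_derivative_scaleR_right[OF d]] by metis
    finally show "frechet_derivative (\<lambda>x. \<eta> x (c *\<^sub>R w)) (at y) u = c *\<^sub>R frechet_derivative (\<lambda>x. \<eta> x w) (at y) u" for c w
      by simp
  qed
  show "linear (ext_d \<eta> y u)"
    using linear_compose_sub[OF lin2 lin1[of u]] unfolding ext_d_def by simp
  then show "linear (\<lambda>v. ext_d \<eta> y v u)"
    using linear_compose_neg unfolding ext_d_def by fastforce
qed

subsection \<open>Structure equations on open subsets of Euclidean spaces\<close>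

text \<open>For skew coefficients \<open>c\<close>, half the value of the 2-form with these
  coefficients on two vectors whose \<theta>-components are \<open>Z\<close> and
  \<open>W\<close>.\<close>

definition quad :: "('p::finite \<Rightarrow> 'p \<Rightarrow> 'q::finite \<Rightarrow> 'q \<Rightarrow> real) \<Rightarrow> ('p \<Rightarrow> 'q \<Rightarrow> real) \<Rightarrow> ('p \<Rightarrow> 'q \<Rightarrow> real) \<Rightarrow> real" where
  "quad c Z W = (\<Sum>\<beta>\<in>UNIV. \<Sum>\<gamma>\<in>UNIV. \<Sum>j\<in>UNIV. \<Sum>k\<in>UNIV. c \<beta> \<gamma> j k * (Z \<beta> j * W \<gamma> k))"

lemma quad_swap:
  assumes "\<And>\<beta> \<gamma> j k. c \<beta> \<gamma> j k = - c \<gamma> \<beta> k j"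
  shows "quad c Z W = - quad c W Z"
proof -
  have "quad c Z W = (\<Sum>\<gamma>\<in>UNIV. \<Sum>\<beta>\<in>UNIV. \<Sum>k\<in>UNIV. \<Sum>j\<in>UNIV. c \<beta> \<gamma> j k * (Z \<beta> j * W \<gamma> k))"
    unfolding quad_def by (rule trans[OF sum.swap], rule sum.cong[OF refl], rule sum.cong[OF refl], rule sum.swap)
  also have "\<dots> = - quad c W Z"
    unfolding quad_def sum_negf[symmetric]
  proof (intro sum.cong refl)
    fix \<beta> \<gamma> j k
    show "c \<beta> \<gamma> j k * (Z \<beta> j * W \<gamma> k) = - (c \<gamma> \<beta> k j * (W \<gamma> k * Z \<beta> j))"
      by (simp add: assms[of \<beta> \<gamma> j k] mult.commute)
  qed
  finally show ?thesis .
qed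

text \<open>The two terms of the wedge product give \<open>quad c Z W - quad c W Z\<close>, which
  skewness of \<open>c\<close> doubles; hence the factor 2 in front of every \<open>quad\<close> in
  the structure equations.\<close>

lemma quad_wedge:
  assumes "\<And>\<beta> \<gamma> j k. c \<beta> \<gamma> j k = - c \<gamma> \<beta> k j"
  shows "(\<Sum>\<beta>\<in>UNIV. \<Sum>\<gamma>\<in>UNIV. \<Sum>j\<in>UNIV. \<Sum>k\<in>UNIV. c \<beta> \<gamma> j k * wedge1 (th \<beta> j) (th \<gamma> k) y u v)
    = 2 * quad c (\<lambda>\<beta> j. th \<beta> j y u) (\<lambda>\<gamma> k. th \<gamma> k y v)"
proof -
  have "(\<Sum>\<beta>\<in>UNIV. \<Sum>\<gamma>\<in>UNIV. \<Sum>j\<in>UNIV. \<Sum>k\<in>UNIV. c \<beta> \<gamma> j k * wedge1 (th \<beta> j) (th \<gamma> k) y u v)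
    = quad c (\<lambda>\<beta> j. th \<beta> j y u) (\<lambda>\<gamma> k. th \<gamma> k y v) - quad c (\<lambda>\<beta> j. th \<beta> j y v) (\<lambda>\<gamma> k. th \<gamma> k y u)"
    unfolding quad_def sum_subtractf[symmetric] by (simp add: wedge1_def right_diff_distrib)
  then show ?thesis using quad_swap[of c "\<lambda>\<beta> j. th \<beta> j y v", OF assms] by simp
qed

text \<open>The structure equations on an open set of any Euclidean space. The forms need not be
  independent and the dimension is free, so the same locale serves a chart of the bundle, the normal
  ball and a leaf of dimension p.\<close>

locale cartan_forms =
  fixes S :: "'z::euclidean_space set"
    and \<theta> :: "'p::finite \<Rightarrow> 'q::finite \<Rightarrow> 'z \<Rightarrow> 'z \<Rightarrow> real"
    and \<omega> :: "'z \<Rightarrow> 'z \<Rightarrow> real"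
    and \<omega>g :: "'p \<Rightarrow> 'p \<Rightarrow> 'z \<Rightarrow> 'z \<Rightarrow> real"
    and \<omega>l :: "'q \<Rightarrow> 'q \<Rightarrow> 'z \<Rightarrow> 'z \<Rightarrow> real"
    and \<psi> :: "'q \<Rightarrow> 'p \<Rightarrow> 'z \<Rightarrow> 'z \<Rightarrow> real"
    and a :: "'q \<Rightarrow> 'p \<Rightarrow> 'p \<Rightarrow> 'p \<Rightarrow> 'q \<Rightarrow> 'q \<Rightarrow> 'z \<Rightarrow> real"
    and bg :: "'p \<Rightarrow> 'p \<Rightarrow> 'p \<Rightarrow> 'p \<Rightarrow> 'q \<Rightarrow> 'q \<Rightarrow> 'z \<Rightarrow> real"
    and bl :: "'q \<Rightarrow> 'p \<Rightarrow> 'p \<Rightarrow> 'q \<Rightarrow> 'q \<Rightarrow> 'q \<Rightarrow> 'z \<Rightarrow> real"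
  assumes open_S: "open S"
    and smooth_forms: "smooth_1form S (\<theta> \<alpha> i)" "smooth_1form S \<omega>" "smooth_1form S (\<omega>g \<alpha> \<beta>)"
          "smooth_1form S (\<omega>l j i)" "smooth_1form S (\<psi> i \<alpha>)"
    and d_theta: "y \<in> S \<Longrightarrow> ext_d (\<theta> \<alpha> i) y u v =
          (\<Sum>j\<in>UNIV. wedge1 (\<theta> \<alpha> j) (\<omega>l j i) y u v)
          + (\<Sum>\<beta>\<in>UNIV. wedge1 (\<omega>g \<alpha> \<beta>) (\<theta> \<beta> i) y u v)
          + wedge1 \<omega> (\<theta> \<alpha> i) y u v
          + 2 * quad (\<lambda>\<beta> \<gamma> j k. a i \<beta> \<gamma> \<alpha> j k y) (\<lambda>\<beta> j. \<theta> \<beta> j y u) (\<lambda>\<gamma> k. \<theta> \<gamma> k y v)"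
    and d_omega_g: "y \<in> S \<Longrightarrow> ext_d (\<omega>g \<alpha> \<beta>) y u v =
          (\<Sum>\<gamma>\<in>UNIV. wedge1 (\<omega>g \<alpha> \<gamma>) (\<omega>g \<gamma> \<beta>) y u v)
          + real CARD('q) / real (CARD('p) + CARD('q)) *
              ((if \<alpha> = \<beta> then \<Sum>\<gamma>\<in>UNIV. \<Sum>k\<in>UNIV. wedge1 (\<theta> \<gamma> k) (\<psi> k \<gamma>) y u v else 0)
               - real CARD('p) * (\<Sum>k\<in>UNIV. wedge1 (\<theta> \<alpha> k) (\<psi> k \<beta>) y u v))
          + 2 * quad (\<lambda>\<gamma> \<delta> k l. bg \<beta> \<gamma> \<delta> \<alpha> k l y) (\<lambda>\<beta> j. \<theta> \<beta> j y u) (\<lambda>\<gamma> k. \<theta> \<gamma> k y v)"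
    and d_omega_l: "y \<in> S \<Longrightarrow> ext_d (\<omega>l j i) y u v =
          (\<Sum>k\<in>UNIV. wedge1 (\<omega>l j k) (\<omega>l k i) y u v)
          + real CARD('p) / real (CARD('p) + CARD('q)) *
              ((if j = i then \<Sum>\<gamma>\<in>UNIV. \<Sum>k\<in>UNIV. wedge1 (\<psi> k \<gamma>) (\<theta> \<gamma> k) y u v else 0)
               - real CARD('q) * (\<Sum>\<gamma>\<in>UNIV. wedge1 (\<psi> j \<gamma>) (\<theta> \<gamma> i) y u v))
          + 2 * quad (\<lambda>\<gamma> \<delta> k l. bl i \<gamma> \<delta> j k l y) (\<lambda>\<beta> j. \<theta> \<beta> j y u) (\<lambda>\<gamma> k. \<theta> \<gamma> k y v)"
    and d_omega: "y \<in> S \<Longrightarrow> ext_d \<omega> y u v = (\<Sum>\<alpha>\<in>UNIV. \<Sum>i\<in>UNIV. wedge1 (\<psi> i \<alpha>) (\<theta> \<alpha> i) y u v)"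
    and smooth_coeffs: "smooth_on S (a i \<beta> \<gamma> \<alpha> j k)" "smooth_on S (bl i \<gamma> \<delta> j k l)"
    and a_skew: "a i \<beta> \<gamma> \<alpha> j k y = - a i \<gamma> \<beta> \<alpha> k j y"
    and a_trace_g: "(\<Sum>\<alpha>\<in>UNIV. a i \<alpha> \<gamma> \<alpha> j k y) = 0"
    and a_trace_l: "(\<Sum>i\<in>UNIV. a i \<beta> \<gamma> \<alpha> i k y) = 0"
    and bg_skew: "bg \<beta> \<gamma> \<delta> \<alpha> k l y = - bg \<beta> \<delta> \<gamma> \<alpha> l k y"
    and bl_skew: "bl i \<gamma> \<delta> j k l y = - bl i \<delta> \<gamma> j l k y"
    and bg_trace: "(\<Sum>\<alpha>\<in>UNIV. bg \<alpha> \<gamma> \<delta> \<alpha> k l y) = 0"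
    and bl_trace: "(\<Sum>i\<in>UNIV. bl i \<gamma> \<delta> i k l y) = 0"
    and b_normal: "(\<Sum>\<alpha>\<in>UNIV. bg \<gamma> \<alpha> \<delta> \<alpha> k l y) - (\<Sum>i\<in>UNIV. bl i \<gamma> \<delta> k i l y)
          + (\<Sum>\<alpha>\<in>UNIV. bg \<delta> \<alpha> \<gamma> \<alpha> l k y) - (\<Sum>i\<in>UNIV. bl i \<delta> \<gamma> l i k y) = 0"
begin

lemma wedge1_pullback:
  "wedge1 (pullback f \<alpha>) (pullback f \<beta>) y u v
    = wedge1 \<alpha> \<beta> (f y) (frechet_derivative f (at y) u) (frechet_derivative f (at y) v)"
  by (simp add: wedge1_def pullback_def)

text \<open>Exterior derivative and wedge product commute with pullback, and the component
  identities hold pointwise.\<close>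

lemma cartan_forms_pullback:
  fixes f :: "'y::euclidean_space \<Rightarrow> 'z"
  assumes T: "open T" and f: "smooth_on T f" and sub: "f ` T \<subseteq> S"
  shows "cartan_forms T (\<lambda>\<alpha> i. pullback f (\<theta> \<alpha> i)) (pullback f \<omega>) (\<lambda>\<alpha> \<beta>. pullback f (\<omega>g \<alpha> \<beta>))
    (\<lambda>j i. pullback f (\<omega>l j i)) (\<lambda>i \<alpha>. pullback f (\<psi> i \<alpha>)) (\<lambda>i \<beta> \<gamma> \<alpha> j k y. a i \<beta> \<gamma> \<alpha> j k (f y))
    (\<lambda>\<beta> \<gamma> \<delta> \<alpha> k l y. bg \<beta> \<gamma> \<delta> \<alpha> k l (f y)) (\<lambda>i \<gamma> \<delta> j k l y. bl i \<gamma> \<delta> j k l (f y))"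
proof
  note pb = smooth_1form_pullback[OF open_S _ T sub f]
  show "smooth_1form T (pullback f (\<theta> \<alpha> i))" "smooth_1form T (pullback f \<omega>)"
    "smooth_1form T (pullback f (\<omega>g \<alpha> \<beta>))" "smooth_1form T (pullback f (\<omega>l j i))"
    "smooth_1form T (pullback f (\<psi> i \<alpha>))" for \<alpha> \<beta> i j
    by (intro pb smooth_forms)+
  fix y u v assume y: "y \<in> T"
  then have fy: "f y \<in> S" using sub by auto
  note dp = ext_d_pullback[OF open_S _ T sub f y]
  show "ext_d (pullback f (\<theta> \<alpha> i)) y u v =
          (\<Sum>j\<in>UNIV. wedge1 (pullback f (\<theta> \<alpha> j)) (pullback f (\<omega>l j i)) y u v)
          + (\<Sum>\<beta>\<in>UNIV. wedge1 (pullback f (\<omega>g \<alpha> \<beta>)) (pullback f (\<theta> \<beta> i)) y u v)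
          + wedge1 (pullback f \<omega>) (pullback f (\<theta> \<alpha> i)) y u v
          + 2 * quad (\<lambda>\<beta> \<gamma> j k. a i \<beta> \<gamma> \<alpha> j k (f y)) (\<lambda>\<beta> j. pullback f (\<theta> \<beta> j) y u) (\<lambda>\<gamma> k. pullback f (\<theta> \<gamma> k) y v)" for \<alpha> i
    unfolding dp[OF smooth_forms(1)] d_theta[OF fy] wedge1_pullback by (simp add: pullback_def)
  show "ext_d (pullback f (\<omega>g \<alpha> \<beta>)) y u v =
          (\<Sum>\<gamma>\<in>UNIV. wedge1 (pullback f (\<omega>g \<alpha> \<gamma>)) (pullback f (\<omega>g \<gamma> \<beta>)) y u v)
          + real CARD('q) / real (CARD('p) + CARD('q)) *
              ((if \<alpha> = \<beta> then \<Sum>\<gamma>\<in>UNIV. \<Sum>k\<in>UNIV. wedge1 (pullback f (\<theta> \<gamma> k)) (pullback f (\<psi> k \<gamma>)) y u v else 0)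
               - real CARD('p) * (\<Sum>k\<in>UNIV. wedge1 (pullback f (\<theta> \<alpha> k)) (pullback f (\<psi> k \<beta>)) y u v))
          + 2 * quad (\<lambda>\<gamma> \<delta> k l. bg \<beta> \<gamma> \<delta> \<alpha> k l (f y)) (\<lambda>\<beta> j. pullback f (\<theta> \<beta> j) y u) (\<lambda>\<gamma> k. pullback f (\<theta> \<gamma> k) y v)" for \<alpha> \<beta>
    unfolding dp[OF smooth_forms(3)] d_omega_g[OF fy] wedge1_pullback by (simp add: pullback_def)
  show "ext_d (pullback f (\<omega>l j i)) y u v =
          (\<Sum>k\<in>UNIV. wedge1 (pullback f (\<omega>l j k)) (pullback f (\<omega>l k i)) y u v)
          + real CARD('p) / real (CARD('p) + CARD('q)) *
              ((if j = i then \<Sum>\<gamma>\<in>UNIV. \<Sum>k\<in>UNIV. wedge1 (pullback f (\<psi> k \<gamma>)) (pullback f (\<theta> \<gamma> k)) y u v else 0)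
               - real CARD('q) * (\<Sum>\<gamma>\<in>UNIV. wedge1 (pullback f (\<psi> j \<gamma>)) (pullback f (\<theta> \<gamma> i)) y u v))
          + 2 * quad (\<lambda>\<gamma> \<delta> k l. bl i \<gamma> \<delta> j k l (f y)) (\<lambda>\<beta> j. pullback f (\<theta> \<beta> j) y u) (\<lambda>\<gamma> k. pullback f (\<theta> \<gamma> k) y v)" for i j
    unfolding dp[OF smooth_forms(4)] d_omega_l[OF fy] wedge1_pullback by (simp add: pullback_def)
  show "ext_d (pullback f \<omega>) y u v = (\<Sum>\<alpha>\<in>UNIV. \<Sum>i\<in>UNIV. wedge1 (pullback f (\<psi> i \<alpha>)) (pullback f (\<theta> \<alpha> i)) y u v)"
    unfolding dp[OF smooth_forms(2)] d_omega[OF fy] wedge1_pullback by simp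
next
  show "smooth_on T (\<lambda>y. a i \<beta> \<gamma> \<alpha> j k (f y))" "smooth_on T (\<lambda>y. bl i \<gamma> \<delta> j k l (f y))" for i \<beta> \<gamma> \<delta> \<alpha> j k l
    by (rule smooth_on_compose[OF T open_S f smooth_coeffs(1) sub], rule smooth_on_compose[OF T open_S f smooth_coeffs(2) sub])
qed (rule T a_skew a_trace_g a_trace_l bg_skew bl_skew bg_trace bl_trace b_normal)+

end

subsection \<open>Leaves through radial curves\<close>

text \<open>Gronwall's argument for the sum of squares \<open>u\<close>: with \<open>C\<close>
  bounding the coefficients and \<open>n\<close> equations, u' is at most 2 C n u, and u vanishes at
  0.\<close>

lemma linear_ode_zero:
  fixes k :: "'i::finite \<Rightarrow> real \<Rightarrow> real"
  assumes d: "\<And>i t. t \<in> {0..1} \<Longrightarrow> (k i has_real_derivative (\<Sum>j\<in>UNIV. M i j t * k j t)) (at t)"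
    and M: "\<And>i j. continuous_on {0..1} (M i j)" and init: "\<And>i. k i 0 = 0" and t: "t \<in> {0..1}"
  shows "k i t = 0"
proof -
  have "\<exists>C. \<forall>t\<in>{0..1}. \<bar>M i j t\<bar> \<le> C" for i j
    using compact_imp_bounded[OF compact_continuous_image[OF M compact_Icc]] by (auto simp: bounded_iff)
  then obtain C0 where C0: "\<And>i j t. t \<in> {0..1} \<Longrightarrow> \<bar>M i j t\<bar> \<le> C0 i j" by metis
  define C where "C = (\<Sum>i\<in>UNIV. \<Sum>j\<in>UNIV. C0 i j)"
  have C0_nn: "0 \<le> C0 i j" for i j using C0[of 0 i j] by simp
  have C: "\<bar>M i j t\<bar> \<le> C" if "t \<in> {0..1}" for i j t
  proof -
    have "C0 i j \<le> (\<Sum>j\<in>UNIV. C0 i j)" by (rule member_le_sum) (use C0_nn in auto)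
    also have "\<dots> \<le> C" unfolding C_def by (rule member_le_sum) (use C0_nn in \<open>auto intro: sum_nonneg\<close>)
    finally show ?thesis using C0[OF that, of i j] by simp
  qed
  have "C \<ge> 0" using C[of 0] by (meson abs_ge_zero atLeastAtMost_iff order_trans zero_le_one order_refl)
  define n where "n = real CARD('i)"
  define u where "u t = (\<Sum>i\<in>UNIV. (k i t)\<^sup>2)" for t
  define u' where "u' t = (\<Sum>i\<in>UNIV. 2 * k i t * (\<Sum>j\<in>UNIV. M i j t * k j t))" for t
  have du: "(u has_real_derivative u' t) (at t)" if "t \<in> {0..1}" for t
    unfolding u_def[abs_def] u'_def
    by (intro DERIV_sum) (auto intro!: derivative_eq_intros d[OF that])
  have u'_le: "u' t \<le> 2 * C * n * u t" if "t \<in> {0..1}" for t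
  proof -
    have "u' t = (\<Sum>i\<in>UNIV. \<Sum>j\<in>UNIV. 2 * (M i j t * (k i t * k j t)))"
      unfolding u'_def sum_distrib_left by (simp add: algebra_simps)
    also have "\<dots> \<le> (\<Sum>i\<in>UNIV. \<Sum>j\<in>UNIV. C * ((k i t)\<^sup>2 + (k j t)\<^sup>2))"
    proof (intro sum_mono)
      fix i j
      have "M i j t * (k i t * k j t) \<le> \<bar>M i j t\<bar> * \<bar>k i t * k j t\<bar>"
        by (metis abs_ge_self abs_mult)
      also have "\<dots> \<le> C * \<bar>k i t * k j t\<bar>" using C[OF that] by (intro mult_right_mono) auto
      finally have "2 * (M i j t * (k i t * k j t)) \<le> C * (2 * \<bar>k i t * k j t\<bar>)" by simp
      also have "2 * \<bar>k i t * k j t\<bar> \<le> (k i t)\<^sup>2 + (k j t)\<^sup>2"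
        using sum_squares_bound[of "\<bar>k i t\<bar>" "\<bar>k j t\<bar>"] by (simp add: abs_mult)
      then have "C * (2 * \<bar>k i t * k j t\<bar>) \<le> C * ((k i t)\<^sup>2 + (k j t)\<^sup>2)"
        using \<open>C \<ge> 0\<close> by (rule mult_left_mono)
      finally show "2 * (M i j t * (k i t * k j t)) \<le> C * ((k i t)\<^sup>2 + (k j t)\<^sup>2)" .
    qed
    also have "\<dots> = 2 * C * n * u t"
      by (simp add: u_def n_def distrib_left sum.distrib sum_distrib_left[symmetric] algebra_simps)
    finally show ?thesis .
  qed
  \<comment> \<open>The integrating factor makes the inequality for \<open>u'\<close> say that
    \<open>g\<close> does not increase.\<close>
  define g where "g t = exp (- (2 * C * n) * t) * u t" for t
  have dg: "(g has_real_derivative exp (- (2 * C * n) * t) * (u' t - 2 * C * n * u t)) (at t)" if "t \<in> {0..1}" for t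
    unfolding g_def[abs_def]
    by (auto intro!: derivative_eq_intros du[OF that] simp: algebra_simps)
  have "g t \<le> g 0"
  proof (rule DERIV_nonpos_imp_nonincreasing[where a = 0 and b = t and f = g])
    show "0 \<le> t" using t by simp
    fix s assume "0 \<le> s" "s \<le> t"
    then have s: "s \<in> {0..1}" using t by simp
    show "\<exists>y. (g has_real_derivative y) (at s) \<and> y \<le> 0"
      using dg[OF s] u'_le[OF s] by (intro exI conjI) (auto intro: mult_nonneg_nonpos)
  qed
  moreover have "g 0 = 0" by (simp add: g_def u_def init)
  ultimately have "u t \<le> 0" by (simp add: g_def mult_le_0_iff)
  moreover have "(k i t)\<^sup>2 \<le> u t" unfolding u_def by (rule member_le_sum) auto
  ultimately show ?thesis by (metis order_trans power2_less_eq_zero_iff)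
qed

text \<open>The derivative of \<open>\<eta> (J)\<close> along a ray for the Jacobi field \<open>J(t) = t w\<close> of the rays.\<close>

lemma radial_form_derivative:
  assumes S: "open S" "smooth_1form S \<eta>" and radial: "\<And>y. y \<in> S \<Longrightarrow> \<eta> y y = \<kappa> y" and \<kappa>: "linear \<kappa>"
    and tz: "t *\<^sub>R z \<in> S"
  shows "((\<lambda>t. \<eta> (t *\<^sub>R z) (t *\<^sub>R w)) has_real_derivative (ext_d \<eta> (t *\<^sub>R z) z (t *\<^sub>R w) + \<kappa> w)) (at t)"
proof -
  let ?y = "t *\<^sub>R z"
  let ?T = "{t. t *\<^sub>R z \<in> S}"
  have T: "open ?T"
    using open_vimage[OF S(1), of "\<lambda>t. t *\<^sub>R z"] by (simp add: vimage_def continuous_on_scaleR continuous_on_id continuous_on_const)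
  note lin = smooth_1formD(1)[OF S(2) tz]
  have d: "((\<lambda>y. \<eta> y v) has_derivative frechet_derivative (\<lambda>y. \<eta> y v) (at ?y)) (at ?y)" for v
    by (rule smooth_on_has_derivative[OF S(1) smooth_1formD(2)[OF S(2)] tz])
  have D1: "((\<lambda>t. \<eta> (t *\<^sub>R z) (t *\<^sub>R w)) has_derivative
      (\<lambda>h. frechet_derivative (\<lambda>x. \<eta> x (t *\<^sub>R w)) (at ?y) (h *\<^sub>R z) + \<eta> ?y (h *\<^sub>R w))) (at t)"
    by (rule has_derivative_form_apply[OF S T]) (use tz in \<open>auto intro!: derivative_eq_intros\<close>)
  \<comment> \<open>Differentiating the radial identity in direction \<open>w\<close> trades the
    value of the form on \<open>w\<close> for a derivative of the form along \<open>w\<close>, which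
    is the second term of \<open>ext_d\<close>.\<close>
  have D2: "((\<lambda>y. \<eta> y y) has_derivative (\<lambda>h. frechet_derivative (\<lambda>x. \<eta> x ?y) (at ?y) h + \<eta> ?y h)) (at ?y)"
    by (rule has_derivative_form_apply[OF S S(1) tz]) (auto intro!: derivative_eq_intros)
  have "((\<lambda>y. \<eta> y y) has_derivative \<kappa>) (at ?y)"
    by (rule has_derivative_transform_within_open[OF linear_imp_has_derivative[OF \<kappa>] S(1) tz]) (simp add: radial)
  from has_derivative_unique[OF D2 this]
  have E: "frechet_derivative (\<lambda>x. \<eta> x ?y) (at ?y) w + \<eta> ?y w = \<kappa> w" by metis
  have "((\<lambda>x. \<eta> x ?y) has_derivative (\<lambda>h. t *\<^sub>R frechet_derivative (\<lambda>x. \<eta> x z) (at ?y) h)) (at ?y)"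
    by (rule has_derivative_transform_within_open[OF has_derivative_scaleR_right[OF d] S(1) tz])
      (simp add: linear_scale[OF smooth_1formD(1)[OF S(2)]])
  from frechet_derivative_at[OF this]
  have F: "frechet_derivative (\<lambda>x. \<eta> x ?y) (at ?y) w = t * frechet_derivative (\<lambda>x. \<eta> x z) (at ?y) w"
    by (metis real_scaleR_def)
  have "(\<lambda>h. frechet_derivative (\<lambda>x. \<eta> x (t *\<^sub>R w)) (at ?y) (h *\<^sub>R z) + \<eta> ?y (h *\<^sub>R w))
    = (*) (ext_d \<eta> ?y z (t *\<^sub>R w) + \<kappa> w)"
  proof
    fix h
    show "frechet_derivative (\<lambda>x. \<eta> x (t *\<^sub>R w)) (at ?y) (h *\<^sub>R z) + \<eta> ?y (h *\<^sub>R w)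
      = (ext_d \<eta> ?y z (t *\<^sub>R w) + \<kappa> w) * h"
      unfolding ext_d_def E[symmetric] F
      by (simp add: linear_scale[OF has_derivative_linear[OF d]] linear_scale[OF lin] algebra_simps)
  qed
  from has_derivative_eq_rhs[OF D1 this] show ?thesis
    unfolding has_field_derivative_def .
qed


text \<open>Away from the origin the factor t cancels by linearity. At the origin it cannot, and the
  radial identity is differentiated there instead; the other term of that derivative vanishes
  because every form is 0 on the zero vector.\<close>

lemma radial_form_direction:
  assumes S: "open S" "smooth_1form S \<eta>" and radial: "\<And>y. y \<in> S \<Longrightarrow> \<eta> y y = \<kappa> y" and \<kappa>: "linear \<kappa>"
    and tz: "t *\<^sub>R z \<in> S"
  shows "\<eta> (t *\<^sub>R z) z = \<kappa> z"
proof (cases "t = 0")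
  case True
  then have 0: "0 \<in> S" using tz by simp
  have D: "((\<lambda>y. \<eta> y y) has_derivative (\<lambda>h. frechet_derivative (\<lambda>x. \<eta> x 0) (at 0) h + \<eta> 0 h)) (at 0)"
    by (rule has_derivative_form_apply[OF S S(1) 0]) (auto intro!: derivative_eq_intros)
  have "((\<lambda>y. \<eta> y y) has_derivative \<kappa>) (at 0)"
    by (rule has_derivative_transform_within_open[OF linear_imp_has_derivative[OF \<kappa>] S(1) 0]) (simp add: radial)
  from has_derivative_unique[OF D this]
  have "frechet_derivative (\<lambda>x. \<eta> x 0) (at 0) z + \<eta> 0 z = \<kappa> z" by metis
  moreover have "frechet_derivative (\<lambda>x. \<eta> x 0) (at 0) = frechet_derivative (\<lambda>x. 0::real) (at 0)"
    by (rule frechet_derivative_cong[OF S(1) 0]) (simp add: linear_0[OF smooth_1formD(1)[OF S(2)]])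
  ultimately show ?thesis using True by (simp add: frechet_derivative_const)
next
  case False
  have "t * \<eta> (t *\<^sub>R z) z = t * \<kappa> z"
    using radial[OF tz] linear_scale[OF smooth_1formD(1)[OF S(2) tz], of t z] linear_scale[OF \<kappa>, of t z] by simp
  then show ?thesis using False by simp
qed

section \<open>Contractions with symmetric arguments and the transversal equations\<close>

lemma quad_add_right: "quad c Z (\<lambda>\<gamma> k. W \<gamma> k + V \<gamma> k) = quad c Z W + quad c Z V"
  by (simp add: quad_def distrib_left sum.distrib)

lemma sum_sym2_zero:
  assumes "\<And>j k. sym2 f j k = 0"
  shows "(\<Sum>j\<in>UNIV. \<Sum>k\<in>UNIV. f j k * (s j * s k)) = 0"
proof -
  have "(\<Sum>j\<in>UNIV. \<Sum>k\<in>UNIV. f j k * (s j * s k)) = (\<Sum>j\<in>UNIV. \<Sum>k\<in>UNIV. f k j * (s j * s k))"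
    by (subst sum.swap) (simp only: mult.commute)
  also have "\<dots> = - (\<Sum>j\<in>UNIV. \<Sum>k\<in>UNIV. f j k * (s j * s k))"
    unfolding sum_negf[symmetric]
  proof (intro sum.cong refl)
    fix j k
    have "f k j = - f j k" using assms[of j k] by (simp add: sym2_def)
    then show "f k j * (s j * s k) = - (f j k * (s j * s k))" by simp
  qed
  finally show ?thesis by simp
qed

text \<open>The contraction is invariant under two transpositions of the indices of
  \<open>f\<close>, hence under all six permutations, and may be averaged over them.\<close>

lemma sum_sym3:
  "(\<Sum>j\<in>UNIV. \<Sum>k\<in>UNIV. \<Sum>l\<in>UNIV. f j k l * (s j * s k * s l))
    = (\<Sum>j\<in>UNIV. \<Sum>k\<in>UNIV. \<Sum>l\<in>UNIV. sym3 f j k l * (s j * s k * s l))" (is "?A f = _")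
  for s :: "'i::finite \<Rightarrow> real"
proof -
  have 1: "?A (\<lambda>j k l. f j l k) = ?A f" for f
  proof -
    have "?A (\<lambda>j k l. f j l k) = (\<Sum>j\<in>UNIV. \<Sum>l\<in>UNIV. \<Sum>k\<in>UNIV. f j l k * (s j * s k * s l))"
      by (rule sum.cong[OF refl], rule sum.swap)
    then show ?thesis by (simp add: mult.assoc mult.commute mult.left_commute)
  qed
  have 2: "?A (\<lambda>j k l. f k j l) = ?A f" for f
  proof -
    have "?A (\<lambda>j k l. f k j l) = (\<Sum>k\<in>UNIV. \<Sum>j\<in>UNIV. \<Sum>l\<in>UNIV. f k j l * (s j * s k * s l))"
      by (rule sum.swap)
    then show ?thesis by (simp add: mult.assoc mult.commute mult.left_commute)
  qed
  have "?A (\<lambda>j k l. f k l j) = ?A f" "?A (\<lambda>j k l. f l j k) = ?A f" "?A (\<lambda>j k l. f l k j) = ?A f"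
    using 1[of "\<lambda>j k l. f k j l"] 2[of "\<lambda>j k l. f j l k"] 1[of f] 2[of f]
      2[of "\<lambda>j k l. f l j k"] 1[of "\<lambda>j k l. f k l j"] by simp_all
  then have "6 * ?A f = ?A f + ?A (\<lambda>j k l. f k l j) + ?A (\<lambda>j k l. f l j k) + ?A (\<lambda>j k l. f j l k)
      + ?A (\<lambda>j k l. f l k j) + ?A (\<lambda>j k l. f k j l)"
    using 1[of f] 2[of f] by simp
  also have "\<dots> = 6 * ?A (sym3 f)"
    unfolding sum.distrib[symmetric] sum_distrib_left
    by (intro sum.cong refl) (simp add: sym3_def field_simps)
  finally show ?thesis by simp
qed

lemma sum_sym3_zero:
  fixes s :: "'i::finite \<Rightarrow> real"
  assumes "\<And>j k l. sym3 f j k l = 0"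
  shows "(\<Sum>j\<in>UNIV. \<Sum>k\<in>UNIV. \<Sum>l\<in>UNIV. f j k l * (s j * s k * s l)) = 0"
  by (subst sum_sym3) (simp add: assms)


text \<open>Normal coordinates: each ray through the origin is an integral curve along which the
  \<theta>-components are constant and the other forms vanish. The conditions prescribe the forms at
  y only on the vector y itself.\<close>

locale radial_cartan_forms = cartan_forms "ball 0 r" \<theta> \<omega> \<omega>g \<omega>l \<psi> a bg bl
  for r :: real and \<theta> :: "'p::finite \<Rightarrow> 'q::finite \<Rightarrow> real ^ 'q ^ 'p \<Rightarrow> real ^ 'q ^ 'p \<Rightarrow> real"
    and \<omega> \<omega>g \<omega>l \<psi> a bg bl +
  assumes radial: "y \<in> ball 0 r \<Longrightarrow> \<theta> \<alpha> i y y = y $ \<alpha> $ i" "y \<in> ball 0 r \<Longrightarrow> \<omega> y y = 0"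
    "y \<in> ball 0 r \<Longrightarrow> \<omega>g \<alpha> \<beta> y y = 0" "y \<in> ball 0 r \<Longrightarrow> \<omega>l j i y y = 0" "y \<in> ball 0 r \<Longrightarrow> \<psi> i \<alpha> y y = 0"
begin

text \<open>Split the \<theta>-components of the Jacobi field into a multiple of \<open>s\<close>
  and a transversal rest. The multiple enters the torsion term as a(s, s) and the curvature term as
  b(s, s, s), both 0 by the assumed symmetries. The remaining inhomogeneous terms are multiples of
  \<open>s $ i\<close> and are removed by the transversal projection, so the transversal parts
  satisfy a closed homogeneous system.\<close>

theorem radial_planes:
  assumes a_sym: "\<And>i \<beta> \<gamma> \<alpha> j k y. y \<in> ball 0 r \<Longrightarrow> sym2 (\<lambda>j k. a i \<beta> \<gamma> \<alpha> j k y) j k = 0"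
    and b_sym: "\<And>i \<gamma> \<delta> j k l y. y \<in> ball 0 r \<Longrightarrow> sym3 (\<lambda>j k l. bl i \<gamma> \<delta> j k l y) j k l = 0"
    and z: "outer t s \<in> ball 0 r" and i0: "s $ i0 \<noteq> 0"
  shows "\<theta> \<alpha> i (outer t s) (outer t' s) * s $ i0 = \<theta> \<alpha> i0 (outer t s) (outer t' s) * s $ i"
proof -
  define z where "z = outer t s"
  define w where "w = outer t' s"
  have z_comp: "z $ \<alpha> $ i = t $ \<alpha> * s $ i" and w_comp: "w $ \<alpha> $ i = t' $ \<alpha> * s $ i" for \<alpha> i
    by (simp_all add: z_def w_def outer_def)
  have lin_comp: "linear (\<lambda>y::real ^ 'q ^ 'p. y $ \<alpha> $ i)" for \<alpha> i
    by (rule linearI) simp_all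
  have \<tau>z: "\<tau> *\<^sub>R z \<in> ball 0 r" if "\<tau> \<in> {0..1}" for \<tau>
    using le_less_trans[OF norm_scaled_le[of \<tau> z], of r] that z by (simp add: z_def)
  note dir = radial_form_direction[OF open_S _ _ _ \<tau>z]
  have dir_simps: "\<theta> \<alpha> i (\<tau> *\<^sub>R z) z = t $ \<alpha> * s $ i" "\<omega> (\<tau> *\<^sub>R z) z = 0" "\<omega>g \<alpha> \<beta> (\<tau> *\<^sub>R z) z = 0"
      "\<omega>l j i (\<tau> *\<^sub>R z) z = 0" "\<psi> i \<alpha> (\<tau> *\<^sub>R z) z = 0"
    if "\<tau> \<in> {0..1}" for \<tau> \<alpha> \<beta> i j
    using dir[OF smooth_forms(1) radial(1) lin_comp that, of \<alpha> i] dir[OF smooth_forms(2) radial(2) linear_zero that]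
      dir[OF smooth_forms(3) radial(3) linear_zero that] dir[OF smooth_forms(4) radial(4) linear_zero that]
      dir[OF smooth_forms(5) radial(5) linear_zero that] by (simp_all add: z_comp)
  note deriv = radial_form_derivative[OF open_S _ _ _ \<tau>z, where w = w]
  define P where "P \<alpha> i \<tau> = \<theta> \<alpha> i (\<tau> *\<^sub>R z) (\<tau> *\<^sub>R w)" for \<alpha> i \<tau>
  define L where "L j i \<tau> = \<omega>l j i (\<tau> *\<^sub>R z) (\<tau> *\<^sub>R w)" for j i \<tau>
  define c where "c i \<beta> \<gamma> \<alpha> j k \<tau> = a i \<beta> \<gamma> \<alpha> j k (\<tau> *\<^sub>R z)" for i \<beta> \<gamma> \<alpha> j k \<tau>
  define b where "b i \<gamma> \<delta> j k l \<tau> = bl i \<gamma> \<delta> j k l (\<tau> *\<^sub>R z)" for i \<gamma> \<delta> j k l \<tau>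
  \<comment> \<open>The forms \<omega>g and \<omega> enter only through this vector; it is
    multiplied by \<open>s $ i\<close> and therefore tangential.\<close>
  define G where "G \<alpha> \<tau> = (\<Sum>\<beta>\<in>UNIV. \<omega>g \<alpha> \<beta> (\<tau> *\<^sub>R z) (\<tau> *\<^sub>R w) * t $ \<beta>) + \<omega> (\<tau> *\<^sub>R z) (\<tau> *\<^sub>R w) * t $ \<alpha>" for \<alpha> \<tau>
  define \<Psi> where "\<Psi> j \<tau> = (\<Sum>\<gamma>\<in>UNIV. \<psi> j \<gamma> (\<tau> *\<^sub>R z) (\<tau> *\<^sub>R w) * t $ \<gamma>)" for j \<tau>
  define E where "E \<tau> = (\<Sum>\<gamma>\<in>UNIV. \<Sum>k\<in>UNIV. wedge1 (\<psi> k \<gamma>) (\<theta> \<gamma> k) (\<tau> *\<^sub>R z) z (\<tau> *\<^sub>R w))" for \<tau>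
  let ?r = "real CARD('p) / real (CARD('p) + CARD('q))"
  have dP: "(P \<alpha> i has_real_derivative
      (t $ \<alpha> * (\<Sum>j\<in>UNIV. s $ j * L j i \<tau>) - G \<alpha> \<tau> * s $ i
      + 2 * quad (\<lambda>\<beta> \<gamma> j k. c i \<beta> \<gamma> \<alpha> j k \<tau>) (\<lambda>\<beta> j. t $ \<beta> * s $ j) (\<lambda>\<gamma> k. P \<gamma> k \<tau>) + t' $ \<alpha> * s $ i)) (at \<tau>)"
    if \<tau>: "\<tau> \<in> {0..1}" for \<alpha> i \<tau>
  proof -
    have "ext_d (\<theta> \<alpha> i) (\<tau> *\<^sub>R z) z (\<tau> *\<^sub>R w) =
      t $ \<alpha> * (\<Sum>j\<in>UNIV. s $ j * L j i \<tau>) - G \<alpha> \<tau> * s $ i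
      + 2 * quad (\<lambda>\<beta> \<gamma> j k. c i \<beta> \<gamma> \<alpha> j k \<tau>) (\<lambda>\<beta> j. t $ \<beta> * s $ j) (\<lambda>\<gamma> k. P \<gamma> k \<tau>)"
      unfolding d_theta[OF \<tau>z[OF \<tau>]] wedge1_def dir_simps[OF \<tau>] c_def[symmetric] P_def[symmetric] L_def[symmetric] G_def
      by (simp add: sum_distrib_left sum_distrib_right sum_negf algebra_simps)
    moreover have "w $ \<alpha> $ i = t' $ \<alpha> * s $ i" by (rule w_comp)
    ultimately show ?thesis
      using deriv[OF smooth_forms(1) radial(1) lin_comp \<tau>, of \<alpha> i] by (simp add: P_def[abs_def])
  qed
  have dL: "(L j i has_real_derivative
      (?r * ((if j = i then E \<tau> else 0) + real CARD('q) * (\<Psi> j \<tau> * s $ i))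
      + 2 * quad (\<lambda>\<gamma> \<delta> k l. b i \<gamma> \<delta> j k l \<tau>) (\<lambda>\<beta> j. t $ \<beta> * s $ j) (\<lambda>\<gamma> k. P \<gamma> k \<tau>))) (at \<tau>)"
    if \<tau>: "\<tau> \<in> {0..1}" for j i \<tau>
  proof -
    have "(\<Sum>\<gamma>\<in>UNIV. wedge1 (\<psi> j \<gamma>) (\<theta> \<gamma> i) (\<tau> *\<^sub>R z) z (\<tau> *\<^sub>R w)) = - (\<Psi> j \<tau> * s $ i)"
      unfolding wedge1_def dir_simps[OF \<tau>] \<Psi>_def
      by (simp add: sum_distrib_right sum_negf mult.assoc)
    moreover have "(\<Sum>k\<in>UNIV. wedge1 (\<omega>l j k) (\<omega>l k i) (\<tau> *\<^sub>R z) z (\<tau> *\<^sub>R w)) = 0"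
      unfolding wedge1_def dir_simps[OF \<tau>] by simp
    ultimately have "ext_d (\<omega>l j i) (\<tau> *\<^sub>R z) z (\<tau> *\<^sub>R w) =
      ?r * ((if j = i then E \<tau> else 0) + real CARD('q) * (\<Psi> j \<tau> * s $ i))
      + 2 * quad (\<lambda>\<gamma> \<delta> k l. b i \<gamma> \<delta> j k l \<tau>) (\<lambda>\<beta> j. t $ \<beta> * s $ j) (\<lambda>\<gamma> k. P \<gamma> k \<tau>)"
      unfolding d_omega_l[OF \<tau>z[OF \<tau>]] dir_simps[OF \<tau>] b_def[symmetric] P_def[symmetric] E_def[symmetric] by simp
    then show ?thesis
      using deriv[OF smooth_forms(4) radial(4) linear_zero \<tau>, of j i] by (simp add: L_def[abs_def])
  qed
  \<comment> \<open>A projection with kernel spanned by \<open>s\<close>, normalized by the nonzero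
    coordinate \<open>s $ i0\<close>; vanishing of all \<open>K\<close> is exactly the claim at
    \<tau> = 1.\<close>
  define K where "K \<alpha> i \<tau> = P \<alpha> i \<tau> - (s $ i / s $ i0) * P \<alpha> i0 \<tau>" for \<alpha> i \<tau>
  define N where "N i \<tau> = (\<Sum>j\<in>UNIV. s $ j * (L j i \<tau> - (s $ i / s $ i0) * L j i0 \<tau>))" for i \<tau>
  have PK: "P \<gamma> k \<tau> = K \<gamma> k \<tau> + (P \<gamma> i0 \<tau> / s $ i0) * s $ k" for \<gamma> k \<tau>
    by (simp add: K_def)
  have quad_a: "quad (\<lambda>\<beta> \<gamma> j k. c i \<beta> \<gamma> \<alpha> j k \<tau>) (\<lambda>\<beta> j. t $ \<beta> * s $ j) (\<lambda>\<gamma> k. P \<gamma> k \<tau>)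
    = quad (\<lambda>\<beta> \<gamma> j k. c i \<beta> \<gamma> \<alpha> j k \<tau>) (\<lambda>\<beta> j. t $ \<beta> * s $ j) (\<lambda>\<gamma> k. K \<gamma> k \<tau>)" if \<tau>: "\<tau> \<in> {0..1}" for i \<alpha> \<tau>
  proof -
    have "quad (\<lambda>\<beta> \<gamma> j k. c i \<beta> \<gamma> \<alpha> j k \<tau>) (\<lambda>\<beta> j. t $ \<beta> * s $ j) (\<lambda>\<gamma> k. (P \<gamma> i0 \<tau> / s $ i0) * s $ k)
      = (\<Sum>\<beta>\<in>UNIV. \<Sum>\<gamma>\<in>UNIV. (t $ \<beta> * (P \<gamma> i0 \<tau> / s $ i0)) * (\<Sum>j\<in>UNIV. \<Sum>k\<in>UNIV. c i \<beta> \<gamma> \<alpha> j k \<tau> * (s $ j * s $ k)))"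
      unfolding quad_def sum_distrib_left by (intro sum.cong refl) simp
    also have "\<dots> = 0"
      using sum_sym2_zero[where s = "\<lambda>j. s $ j", OF a_sym[OF \<tau>z[OF \<tau>]]] by (simp add: c_def)
    finally show ?thesis
      by (subst PK) (simp only: quad_add_right add_0_right)
  qed
  have quad_b: "(\<Sum>j\<in>UNIV. s $ j * quad (\<lambda>\<gamma> \<delta> k l. b i \<gamma> \<delta> j k l \<tau>) (\<lambda>\<beta> j. t $ \<beta> * s $ j) (\<lambda>\<gamma> k. P \<gamma> k \<tau>))
    = (\<Sum>j\<in>UNIV. s $ j * quad (\<lambda>\<gamma> \<delta> k l. b i \<gamma> \<delta> j k l \<tau>) (\<lambda>\<beta> j. t $ \<beta> * s $ j) (\<lambda>\<gamma> k. K \<gamma> k \<tau>))" if \<tau>: "\<tau> \<in> {0..1}" for i \<tau>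
  proof -
    have "(\<Sum>j\<in>UNIV. s $ j * quad (\<lambda>\<gamma> \<delta> k l. b i \<gamma> \<delta> j k l \<tau>) (\<lambda>\<beta> j. t $ \<beta> * s $ j) (\<lambda>\<gamma> k. (P \<gamma> i0 \<tau> / s $ i0) * s $ k))
      = (\<Sum>j\<in>UNIV. \<Sum>\<gamma>\<in>UNIV. \<Sum>\<delta>\<in>UNIV. (t $ \<gamma> * (P \<delta> i0 \<tau> / s $ i0)) * (\<Sum>k\<in>UNIV. \<Sum>l\<in>UNIV. b i \<gamma> \<delta> j k l \<tau> * (s $ j * s $ k * s $ l)))"
      unfolding quad_def sum_distrib_left by (intro sum.cong refl) simp
    also have "\<dots> = (\<Sum>\<gamma>\<in>UNIV. \<Sum>\<delta>\<in>UNIV. \<Sum>j\<in>UNIV. (t $ \<gamma> * (P \<delta> i0 \<tau> / s $ i0)) * (\<Sum>k\<in>UNIV. \<Sum>l\<in>UNIV. b i \<gamma> \<delta> j k l \<tau> * (s $ j * s $ k * s $ l)))"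
      by (rule trans[OF sum.swap], rule sum.cong[OF refl], rule sum.swap)
    also have "\<dots> = 0"
      using sum_sym3_zero[where s = "\<lambda>j. s $ j", OF b_sym[OF \<tau>z[OF \<tau>]]]
      by (simp only: b_def sum_distrib_left[symmetric] mult_zero_right sum.neutral_const)
    finally show ?thesis
      by (subst PK) (simp add: quad_add_right distrib_left sum.distrib)
  qed
  \<comment> \<open>The matrix entries of the linear system, obtained by collecting the coefficient
    of each \<open>K\<close> in the torsion and curvature terms.\<close>
  define MK where "MK \<alpha> i \<gamma> k \<tau> = (\<Sum>\<beta>\<in>UNIV. \<Sum>j\<in>UNIV. 2 * (c i \<beta> \<gamma> \<alpha> j k \<tau> - (s $ i / s $ i0) * c i0 \<beta> \<gamma> \<alpha> j k \<tau>) * (t $ \<beta> * s $ j))" for \<alpha> i \<gamma> k \<tau>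
  define MN where "MN i \<delta> l \<tau> = (\<Sum>j\<in>UNIV. \<Sum>\<gamma>\<in>UNIV. \<Sum>k\<in>UNIV. 2 * s $ j * (b i \<gamma> \<delta> j k l \<tau> - (s $ i / s $ i0) * b i0 \<gamma> \<delta> j k l \<tau>) * (t $ \<gamma> * s $ k))" for i \<delta> l \<tau>
  have dK: "(K \<alpha> i has_real_derivative (\<Sum>\<gamma>\<in>UNIV. \<Sum>k\<in>UNIV. MK \<alpha> i \<gamma> k \<tau> * K \<gamma> k \<tau>) + t $ \<alpha> * N i \<tau>) (at \<tau>)"
    if \<tau>: "\<tau> \<in> {0..1}" for \<alpha> i \<tau>
  proof -
    have "(\<Sum>\<gamma>\<in>UNIV. \<Sum>k\<in>UNIV. MK \<alpha> i \<gamma> k \<tau> * K \<gamma> k \<tau>)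
      = (\<Sum>\<gamma>\<in>UNIV. \<Sum>k\<in>UNIV. \<Sum>\<beta>\<in>UNIV. \<Sum>j\<in>UNIV. 2 * (c i \<beta> \<gamma> \<alpha> j k \<tau> - (s $ i / s $ i0) * c i0 \<beta> \<gamma> \<alpha> j k \<tau>) * (t $ \<beta> * s $ j * K \<gamma> k \<tau>))"
      unfolding MK_def sum_distrib_right by (intro sum.cong refl) simp
    also have "\<dots> = (\<Sum>\<beta>\<in>UNIV. \<Sum>\<gamma>\<in>UNIV. \<Sum>j\<in>UNIV. \<Sum>k\<in>UNIV. 2 * (c i \<beta> \<gamma> \<alpha> j k \<tau> - (s $ i / s $ i0) * c i0 \<beta> \<gamma> \<alpha> j k \<tau>) * (t $ \<beta> * s $ j * K \<gamma> k \<tau>))"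
    proof -
      have "(\<Sum>\<gamma>\<in>UNIV. \<Sum>k\<in>UNIV. \<Sum>\<beta>\<in>UNIV. \<Sum>j\<in>UNIV. f \<beta> \<gamma> j k) = (\<Sum>\<beta>\<in>UNIV. \<Sum>\<gamma>\<in>UNIV. \<Sum>j\<in>UNIV. \<Sum>k\<in>UNIV. f \<beta> \<gamma> j k)" for f :: "'p \<Rightarrow> 'p \<Rightarrow> 'q \<Rightarrow> 'q \<Rightarrow> real"
      proof -
        have "(\<Sum>\<gamma>\<in>UNIV. \<Sum>k\<in>UNIV. \<Sum>\<beta>\<in>UNIV. \<Sum>j\<in>UNIV. f \<beta> \<gamma> j k) = (\<Sum>\<gamma>\<in>UNIV. \<Sum>\<beta>\<in>UNIV. \<Sum>j\<in>UNIV. \<Sum>k\<in>UNIV. f \<beta> \<gamma> j k)"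
          by (rule sum.cong[OF refl], rule trans[OF sum.swap], rule sum.cong[OF refl], rule sum.swap)
        also have "\<dots> = (\<Sum>\<beta>\<in>UNIV. \<Sum>\<gamma>\<in>UNIV. \<Sum>j\<in>UNIV. \<Sum>k\<in>UNIV. f \<beta> \<gamma> j k)" by (rule sum.swap)
        finally show ?thesis .
      qed
      then show ?thesis .
    qed
    also have "\<dots> = 2 * quad (\<lambda>\<beta> \<gamma> j k. c i \<beta> \<gamma> \<alpha> j k \<tau>) (\<lambda>\<beta> j. t $ \<beta> * s $ j) (\<lambda>\<gamma> k. K \<gamma> k \<tau>)
       - (s $ i / s $ i0) * (2 * quad (\<lambda>\<beta> \<gamma> j k. c i0 \<beta> \<gamma> \<alpha> j k \<tau>) (\<lambda>\<beta> j. t $ \<beta> * s $ j) (\<lambda>\<gamma> k. K \<gamma> k \<tau>))"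
      unfolding quad_def sum_distrib_left sum_subtractf[symmetric]
      by (intro sum.cong refl) (simp add: algebra_simps)
    finally have 1: "(\<Sum>\<gamma>\<in>UNIV. \<Sum>k\<in>UNIV. MK \<alpha> i \<gamma> k \<tau> * K \<gamma> k \<tau>) = \<dots>" .
    have 2: "t $ \<alpha> * N i \<tau> = t $ \<alpha> * (\<Sum>j\<in>UNIV. s $ j * L j i \<tau>) - (s $ i / s $ i0) * (t $ \<alpha> * (\<Sum>j\<in>UNIV. s $ j * L j i0 \<tau>))"
      unfolding N_def sum_distrib_left sum_subtractf[symmetric]
      by (intro sum.cong refl) (simp add: algebra_simps)
    show ?thesis
      unfolding K_def[abs_def]
    proof (rule DERIV_cong[OF DERIV_diff[OF dP[OF \<tau>] DERIV_cmult[OF dP[OF \<tau>]]]])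
      show "t $ \<alpha> * (\<Sum>j\<in>UNIV. s $ j * L j i \<tau>) - G \<alpha> \<tau> * s $ i
          + 2 * quad (\<lambda>\<beta> \<gamma> j k. c i \<beta> \<gamma> \<alpha> j k \<tau>) (\<lambda>\<beta> j. t $ \<beta> * s $ j) (\<lambda>\<gamma> k. P \<gamma> k \<tau>) + t' $ \<alpha> * s $ i
        - s $ i / s $ i0 * (t $ \<alpha> * (\<Sum>j\<in>UNIV. s $ j * L j i0 \<tau>) - G \<alpha> \<tau> * s $ i0
          + 2 * quad (\<lambda>\<beta> \<gamma> j k. c i0 \<beta> \<gamma> \<alpha> j k \<tau>) (\<lambda>\<beta> j. t $ \<beta> * s $ j) (\<lambda>\<gamma> k. P \<gamma> k \<tau>) + t' $ \<alpha> * s $ i0)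
        = (\<Sum>\<gamma>\<in>UNIV. \<Sum>k\<in>UNIV. MK \<alpha> i \<gamma> k \<tau> * (P \<gamma> k \<tau> - s $ k / s $ i0 * P \<gamma> i0 \<tau>)) + t $ \<alpha> * N i \<tau>"
        unfolding K_def[symmetric] 1 2 quad_a[OF \<tau>] using i0 by (simp add: field_simps)
    qed
  qed
  have dN: "(N i has_real_derivative (\<Sum>\<delta>\<in>UNIV. \<Sum>l\<in>UNIV. MN i \<delta> l \<tau> * K \<delta> l \<tau>)) (at \<tau>)"
    if \<tau>: "\<tau> \<in> {0..1}" for i \<tau>
  proof -
    let ?Q = "\<lambda>i j K. quad (\<lambda>\<gamma> \<delta> k l. b i \<gamma> \<delta> j k l \<tau>) (\<lambda>\<beta> j. t $ \<beta> * s $ j) K"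
    have "(\<Sum>\<delta>\<in>UNIV. \<Sum>l\<in>UNIV. MN i \<delta> l \<tau> * K \<delta> l \<tau>)
      = (\<Sum>\<delta>\<in>UNIV. \<Sum>l\<in>UNIV. \<Sum>j\<in>UNIV. \<Sum>\<gamma>\<in>UNIV. \<Sum>k\<in>UNIV. 2 * s $ j * (b i \<gamma> \<delta> j k l \<tau> - (s $ i / s $ i0) * b i0 \<gamma> \<delta> j k l \<tau>) * (t $ \<gamma> * s $ k * K \<delta> l \<tau>))"
      unfolding MN_def sum_distrib_right by (intro sum.cong refl) simp
    also have "\<dots> = (\<Sum>j\<in>UNIV. \<Sum>\<gamma>\<in>UNIV. \<Sum>\<delta>\<in>UNIV. \<Sum>k\<in>UNIV. \<Sum>l\<in>UNIV. 2 * s $ j * (b i \<gamma> \<delta> j k l \<tau> - (s $ i / s $ i0) * b i0 \<gamma> \<delta> j k l \<tau>) * (t $ \<gamma> * s $ k * K \<delta> l \<tau>))"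
    proof -
      have "(\<Sum>\<delta>\<in>UNIV. \<Sum>l\<in>UNIV. \<Sum>j\<in>UNIV. \<Sum>\<gamma>\<in>UNIV. \<Sum>k\<in>UNIV. f j \<gamma> \<delta> k l) = (\<Sum>j\<in>UNIV. \<Sum>\<gamma>\<in>UNIV. \<Sum>\<delta>\<in>UNIV. \<Sum>k\<in>UNIV. \<Sum>l\<in>UNIV. f j \<gamma> \<delta> k l)" for f :: "'q \<Rightarrow> 'p \<Rightarrow> 'p \<Rightarrow> 'q \<Rightarrow> 'q \<Rightarrow> real"
      proof -
        have "(\<Sum>\<delta>\<in>UNIV. \<Sum>l\<in>UNIV. \<Sum>j\<in>UNIV. \<Sum>\<gamma>\<in>UNIV. \<Sum>k\<in>UNIV. f j \<gamma> \<delta> k l)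
          = (\<Sum>\<delta>\<in>UNIV. \<Sum>j\<in>UNIV. \<Sum>\<gamma>\<in>UNIV. \<Sum>k\<in>UNIV. \<Sum>l\<in>UNIV. f j \<gamma> \<delta> k l)"
          by (rule sum.cong[OF refl], rule trans[OF sum.swap], rule sum.cong[OF refl],
              rule trans[OF sum.swap], rule sum.cong[OF refl], rule sum.swap)
        also have "\<dots> = (\<Sum>j\<in>UNIV. \<Sum>\<gamma>\<in>UNIV. \<Sum>\<delta>\<in>UNIV. \<Sum>k\<in>UNIV. \<Sum>l\<in>UNIV. f j \<gamma> \<delta> k l)"
          by (rule trans[OF sum.swap], rule sum.cong[OF refl], rule sum.swap)
        finally show ?thesis .
      qed
      then show ?thesis .
    qed
    also have "\<dots> = 2 * (\<Sum>j\<in>UNIV. s $ j * ?Q i j (\<lambda>\<gamma> k. K \<gamma> k \<tau>))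
        - (s $ i / s $ i0) * (2 * (\<Sum>j\<in>UNIV. s $ j * ?Q i0 j (\<lambda>\<gamma> k. K \<gamma> k \<tau>)))"
      unfolding quad_def sum_distrib_left sum_subtractf[symmetric]
      by (intro sum.cong refl) (simp add: algebra_simps)
    finally have 1: "(\<Sum>\<delta>\<in>UNIV. \<Sum>l\<in>UNIV. MN i \<delta> l \<tau> * K \<delta> l \<tau>) = \<dots>" .
    let ?R = "\<lambda>j i. ?r * ((if j = i then E \<tau> else 0) + real CARD('q) * (\<Psi> j \<tau> * s $ i))"
    \<comment> \<open>After contraction with \<open>s\<close> the \<psi>-terms are a multiple of
      \<open>s $ i\<close>, so they cancel in the difference that defines \<open>N\<close>.\<close>
    have 2: "(\<Sum>j\<in>UNIV. s $ j * ?R j i) = s $ i * (?r * (E \<tau> + real CARD('q) * (\<Sum>j\<in>UNIV. s $ j * \<Psi> j \<tau>)))" for i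
    proof -
      have "(\<Sum>j\<in>UNIV. s $ j * ?R j i) = ?r * (\<Sum>j\<in>UNIV. (if j = i then s $ j * E \<tau> else 0) + real CARD('q) * s $ i * (s $ j * \<Psi> j \<tau>))"
        unfolding sum_distrib_left by (intro sum.cong refl) (simp add: algebra_simps)
      also have "\<dots> = ?r * (s $ i * E \<tau> + real CARD('q) * s $ i * (\<Sum>j\<in>UNIV. s $ j * \<Psi> j \<tau>))"
        by (simp only: sum.distrib sum_distrib_left[symmetric]) simp
      finally show ?thesis by (simp add: algebra_simps)
    qed
    have 3: "(\<Sum>j\<in>UNIV. s $ j * (?R j i + 2 * ?Q i j (\<lambda>\<gamma> k. P \<gamma> k \<tau>)))
      = s $ i * (?r * (E \<tau> + real CARD('q) * (\<Sum>j\<in>UNIV. s $ j * \<Psi> j \<tau>))) + 2 * (\<Sum>j\<in>UNIV. s $ j * ?Q i j (\<lambda>\<gamma> k. K \<gamma> k \<tau>))" for i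
    proof -
      have "(\<Sum>j\<in>UNIV. s $ j * (?R j i + 2 * ?Q i j (\<lambda>\<gamma> k. P \<gamma> k \<tau>)))
        = (\<Sum>j\<in>UNIV. s $ j * ?R j i) + 2 * (\<Sum>j\<in>UNIV. s $ j * ?Q i j (\<lambda>\<gamma> k. P \<gamma> k \<tau>))"
        unfolding sum_distrib_left sum.distrib[symmetric] by (intro sum.cong refl) (simp add: algebra_simps)
      then show ?thesis unfolding 2 quad_b[OF \<tau>] .
    qed
    have "(N i has_real_derivative (\<Sum>j\<in>UNIV. s $ j * (?R j i + 2 * ?Q i j (\<lambda>\<gamma> k. P \<gamma> k \<tau>) - s $ i / s $ i0 * (?R j i0 + 2 * ?Q i0 j (\<lambda>\<gamma> k. P \<gamma> k \<tau>))))) (at \<tau>)"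
      unfolding N_def[abs_def]
      by (intro DERIV_sum DERIV_cmult DERIV_diff dL[OF \<tau>])
    also have "(\<Sum>j\<in>UNIV. s $ j * (?R j i + 2 * ?Q i j (\<lambda>\<gamma> k. P \<gamma> k \<tau>) - s $ i / s $ i0 * (?R j i0 + 2 * ?Q i0 j (\<lambda>\<gamma> k. P \<gamma> k \<tau>))))
      = (\<Sum>j\<in>UNIV. s $ j * (?R j i + 2 * ?Q i j (\<lambda>\<gamma> k. P \<gamma> k \<tau>))) - s $ i / s $ i0 * (\<Sum>j\<in>UNIV. s $ j * (?R j i0 + 2 * ?Q i0 j (\<lambda>\<gamma> k. P \<gamma> k \<tau>)))"
      unfolding sum_distrib_left sum_subtractf[symmetric] by (intro sum.cong refl) (simp only: right_diff_distrib mult.left_commute)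
    also have "\<dots> = (\<Sum>\<delta>\<in>UNIV. \<Sum>l\<in>UNIV. MN i \<delta> l \<tau> * K \<delta> l \<tau>)"
      unfolding 3 1 using i0 by (simp add: field_simps)
    finally show ?thesis .
  qed
  \<comment> \<open>Both families of unknowns are indexed by one finite type so that a single system
    results; \<open>N\<close> feeds into the equation of \<open>K\<close> through the block
    \<open>t $ \<alpha>\<close>.\<close>
  define k where "k x \<tau> = (case x of Inl (\<alpha>, i) \<Rightarrow> K \<alpha> i \<tau> | Inr i \<Rightarrow> N i \<tau>)" for x :: "'p \<times> 'q + 'q" and \<tau>
  define M where "M x x' \<tau> = (case x of
      Inl (\<alpha>, i) \<Rightarrow> (case x' of Inl (\<gamma>, k) \<Rightarrow> MK \<alpha> i \<gamma> k \<tau> | Inr i' \<Rightarrow> if i' = i then t $ \<alpha> else 0)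
    | Inr i \<Rightarrow> (case x' of Inl (\<gamma>, k) \<Rightarrow> MN i \<gamma> k \<tau> | Inr i' \<Rightarrow> 0))" for x x' :: "'p \<times> 'q + 'q" and \<tau>
  have sum_UNIV: "(\<Sum>x\<in>UNIV. f x) = (\<Sum>\<gamma>\<in>UNIV. \<Sum>k\<in>UNIV. f (Inl (\<gamma>, k))) + (\<Sum>i\<in>UNIV. f (Inr i))" for f :: "'p \<times> 'q + 'q \<Rightarrow> real"
  proof -
    have "(\<Sum>x\<in>UNIV. f x) = (\<Sum>x\<in>UNIV. f (Inl x)) + (\<Sum>i\<in>UNIV. f (Inr i))"
      unfolding UNIV_Plus_UNIV[symmetric] by (simp add: sum.Plus o_def del: UNIV_Plus_UNIV)
    moreover have "(\<Sum>x\<in>UNIV. f (Inl x)) = (\<Sum>\<gamma>\<in>UNIV. \<Sum>k\<in>UNIV. f (Inl (\<gamma>, k)))"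
      by (simp add: sum.cartesian_product)
    ultimately show ?thesis by simp
  qed
  have c_cont: "continuous_on {0..1} (c i \<beta> \<gamma> \<alpha> j l)" and b_cont: "continuous_on {0..1} (b i \<beta> \<gamma> j l m)" for i \<beta> \<gamma> \<alpha> j l m
    unfolding c_def[abs_def] b_def[abs_def] using \<tau>z
    by (auto intro!: continuous_on_compose2[OF smooth_on_continuous[OF smooth_coeffs(1)], of _ "\<lambda>\<tau>. \<tau> *\<^sub>R z"]
        continuous_on_compose2[OF smooth_on_continuous[OF smooth_coeffs(2)], of _ "\<lambda>\<tau>. \<tau> *\<^sub>R z"] continuous_intros
        simp del: mem_ball)
  have zero: "k x 1 = 0" for x
  proof (rule linear_ode_zero[where k = k and M = M])
    show "(k x has_real_derivative (\<Sum>x'\<in>UNIV. M x x' \<tau> * k x' \<tau>)) (at \<tau>)" if \<tau>: "\<tau> \<in> {0..1}" for x \<tau>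
    proof (cases x)
      case (Inl ai)
      obtain \<alpha> i where ai: "ai = (\<alpha>, i)" by (cases ai)
      have "(\<Sum>i'\<in>UNIV. (if i' = i then t $ \<alpha> else 0) * N i' \<tau>) = t $ \<alpha> * N i \<tau>"
        by (simp add: if_distrib[of "\<lambda>u. u * _"] cong: if_cong)
      then show ?thesis
        using dK[OF \<tau>, of \<alpha> i] by (simp add: sum_UNIV k_def[abs_def] M_def Inl ai)
    next
      case (Inr i)
      then show ?thesis
        using dN[OF \<tau>, of i] by (simp add: sum_UNIV k_def[abs_def] M_def)
    qed
    show "continuous_on {0..1} (M x x')" for x x'
      unfolding M_def[abs_def] MK_def[abs_def] MN_def[abs_def]
      using i0 by (cases x; cases x') (auto split: prod.split intro!: continuous_intros c_cont b_cont)
    \<comment> \<open>The Jacobi field \<open>\<tau> *\<^sub>R w\<close> vanishes at the origin of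
      the ray.\<close>
    have "P \<alpha> i 0 = 0" "L j i 0 = 0" for \<alpha> i j
      using linear_0[OF smooth_1formD(1)[OF smooth_forms(1)]] linear_0[OF smooth_1formD(1)[OF smooth_forms(4)]] \<tau>z[of 0]
      by (simp_all add: P_def L_def)
    then show "k x 0 = 0" for x
      by (auto simp: k_def K_def N_def split: sum.split)
  qed simp
  have "K \<alpha> i 1 = 0" using zero[of "Inl (\<alpha>, i)"] by (simp add: k_def)
  then show ?thesis
    using i0 by (simp add: K_def P_def z_def w_def field_simps)
qed

end

subsection \<open>Identities on the leaves\<close>

lemma ext_d_cong:
  assumes "open S" "y \<in> S" "\<And>y v. y \<in> S \<Longrightarrow> \<eta> y v = \<eta>' y v"
  shows "ext_d \<eta> y u v = ext_d \<eta>' y u v"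
  unfolding ext_d_def
  using frechet_derivative_cong[OF assms(1,2), of "\<lambda>y. \<eta> y u" "\<lambda>y. \<eta>' y u"]
    frechet_derivative_cong[OF assms(1,2), of "\<lambda>y. \<eta> y v" "\<lambda>y. \<eta>' y v"] assms(3) by simp

lemma ext_d_scale:
  assumes S: "open S" "smooth_on S f" "smooth_1form S \<eta>" "y \<in> S"
  shows "ext_d (\<lambda>y v. f y * \<eta> y v) y u v
    = frechet_derivative f (at y) u * \<eta> y v - frechet_derivative f (at y) v * \<eta> y u + f y * ext_d \<eta> y u v"
proof -
  note d = smooth_on_has_derivative[OF S(1) _ S(4)] and sm = smooth_1formD(2)[OF S(3)]
  have "frechet_derivative (\<lambda>y. f y * \<eta> y v) (at y) u
    = f y * frechet_derivative (\<lambda>y. \<eta> y v) (at y) u + frechet_derivative f (at y) u * \<eta> y v" for u v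
    using fun_cong[OF frechet_derivative_at[OF has_derivative_mult[OF d[OF S(2)] d[OF sm]]], of v u] by simp
  then show ?thesis by (simp add: ext_d_def algebra_simps)
qed

lemma ext_d_add:
  assumes S: "open S" "smooth_1form S \<alpha>" "smooth_1form S \<beta>" "y \<in> S"
  shows "ext_d (\<lambda>y v. \<alpha> y v + \<beta> y v) y u v = ext_d \<alpha> y u v + ext_d \<beta> y u v"
proof -
  note d = smooth_on_has_derivative[OF S(1) _ S(4)]
  have "frechet_derivative (\<lambda>y. \<alpha> y v + \<beta> y v) (at y) u
    = frechet_derivative (\<lambda>y. \<alpha> y v) (at y) u + frechet_derivative (\<lambda>y. \<beta> y v) (at y) u" for u v
  proof -
    have "((\<lambda>y. \<alpha> y v + \<beta> y v) has_derivative (\<lambda>u. frechet_derivative (\<lambda>y. \<alpha> y v) (at y) u + frechet_derivative (\<lambda>y. \<beta> y v) (at y) u)) (at y)"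
      by (intro has_derivative_add d smooth_1formD(2)[OF S(2)] smooth_1formD(2)[OF S(3)])
    from fun_cong[OF frechet_derivative_at[OF this], of u] show ?thesis by simp
  qed
  then show ?thesis by (simp add: ext_d_def)
qed

lemma ext_d_sum:
  assumes S: "open S" "\<And>i. smooth_1form S (\<eta> i)" "y \<in> S"
  shows "ext_d (\<lambda>y v. \<Sum>i\<in>I. \<eta> i y v) y u v = (\<Sum>i\<in>I. ext_d (\<eta> i) y u v)"
proof -
  have D: "frechet_derivative (\<lambda>y. \<Sum>i\<in>I. \<eta> i y v) (at y) u = (\<Sum>i\<in>I. frechet_derivative (\<lambda>y. \<eta> i y v) (at y) u)" for u v
  proof -
    have "((\<lambda>y. \<Sum>i\<in>I. \<eta> i y v) has_derivative (\<lambda>u. \<Sum>i\<in>I. frechet_derivative (\<lambda>y. \<eta> i y v) (at y) u)) (at y)"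
      by (intro has_derivative_sum smooth_on_has_derivative[OF S(1) smooth_1formD(2)[OF S(2)] S(3)])
    from fun_cong[OF frechet_derivative_at[OF this], of u] show ?thesis by simp
  qed
  show ?thesis unfolding ext_d_def D by (simp add: sum_subtractf)
qed

lemma smooth_1form_scale:
  assumes "open S" "smooth_on S f" "smooth_1form S \<eta>"
  shows "smooth_1form S (\<lambda>y v. f y * \<eta> y v)"
  using assms linear_compose_scale_right[of "\<eta> _" "f _"]
  by (auto simp: smooth_1form_def intro!: smooth_on_mult)

lemma smooth_1form_sum:
  assumes "open S" "\<And>i. smooth_1form S (\<eta> i)"
  shows "smooth_1form S (\<lambda>y v. \<Sum>i\<in>I. \<eta> i y v)"
  using assms by (auto simp: smooth_1form_def intro!: smooth_on_sum linear_compose_sum)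

lemma smooth_1form_exact:
  assumes "open S" "smooth_on S f"
  shows "smooth_1form S (\<lambda>y v. frechet_derivative f (at y) v)"
  using smooth_on_has_derivative[OF assms] has_derivative_linear smooth_on_derivative[OF assms(2)]
  unfolding smooth_1form_def by metis

lemma smooth_1form_subset: "smooth_1form S \<eta> \<Longrightarrow> T \<subseteq> S \<Longrightarrow> smooth_1form T \<eta>"
  unfolding smooth_1form_def using smooth_on_subset by blast

lemma ext_d_exact:
  assumes "open S" "smooth_on S f" "y \<in> S"
  shows "ext_d (\<lambda>y v. frechet_derivative f (at y) v) y u v = 0"
  unfolding ext_d_def using smooth_on_second_derivative_symmetric[OF assms, of u v] by simp

lemma sum_diff_delta:
  fixes h :: "'p::finite \<Rightarrow> real"
  shows "(\<Sum>\<alpha>\<in>UNIV. h \<beta> - (if \<alpha> = \<beta> then h \<alpha> else 0)) = (real CARD('p) - 1) * h \<beta>"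
  by (simp add: sum_subtractf algebra_simps)

text \<open>Normalizing the direction of the planes to have coordinate 1 at \<open>i0\<close> gives
  a smooth direction field \<sigma> with
  \<open>\<theta> \<alpha> i = \<sigma> i * \<theta> \<alpha> i0\<close>. The exterior derivative of
  this relation involves the form \<open>d\<sigma> i + m i - \<sigma> i * m i0\<close>, and the
  trace condition on the torsion forces that form to vanish when p is at least 2. Its own exterior
  derivative is then the condition on the curvature.\<close>

lemma (in cartan_forms) leaf_identities:
  fixes s :: "real ^ 'q"
  assumes card: "CARD('p) \<ge> 2" and y0: "y0 \<in> S"
    and planes: "\<And>y. y \<in> S \<Longrightarrow> \<exists>s'. s' \<noteq> 0 \<and> range (\<lambda>v. \<chi> \<alpha> i. \<theta> \<alpha> i y v) = range (\<lambda>t. outer t s')"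
    and plane0: "range (\<lambda>v. \<chi> \<alpha> i. \<theta> \<alpha> i y0 v) = range (\<lambda>t. outer t s)" and s: "s $ i0 = 1"
  shows "(\<Sum>j\<in>UNIV. \<Sum>k\<in>UNIV. a i \<beta> \<gamma> \<alpha> j k y0 * (s $ j * s $ k))
      = s $ i * (\<Sum>j\<in>UNIV. \<Sum>k\<in>UNIV. a i0 \<beta> \<gamma> \<alpha> j k y0 * (s $ j * s $ k))"
    and "(\<Sum>j\<in>UNIV. \<Sum>k\<in>UNIV. \<Sum>l\<in>UNIV. bl i \<gamma> \<delta> j k l y0 * (s $ j * s $ k * s $ l))
      = s $ i * (\<Sum>j\<in>UNIV. \<Sum>k\<in>UNIV. \<Sum>l\<in>UNIV. bl i0 \<gamma> \<delta> j k l y0 * (s $ j * s $ k * s $ l))"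
proof -
  \<comment> \<open>Any row index will do; it serves to recover the direction from one vector
    \<open>v0\<close>.\<close>
  define \<alpha>0 :: 'p where "\<alpha>0 = undefined"
  have "outer (axis \<alpha>0 1) s \<in> range (\<lambda>v. \<chi> \<alpha> i. \<theta> \<alpha> i y0 v)"
    unfolding plane0 by blast
  then obtain v0 where v0: "(\<chi> \<alpha> i. \<theta> \<alpha> i y0 v0) = outer (axis \<alpha>0 1) s" by auto
  have v0_comp: "\<theta> \<alpha> i y0 v0 = axis \<alpha>0 1 $ \<alpha> * s $ i" for \<alpha> i
    using arg_cong[OF v0, of "\<lambda>z. z $ \<alpha> $ i"] by (simp add: outer_def)
  define D where "D y = \<theta> \<alpha>0 i0 y v0" for y
  have D0: "D y0 = 1" by (simp add: D_def v0_comp s axis_def)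
  \<comment> \<open>The neighbourhood of \<open>y0\<close> on which the direction can be normalized
    at \<open>i0\<close>; there \<open>D\<close> takes the value 1 at \<open>y0\<close>.\<close>
  define S1 where "S1 = S \<inter> D -` (- {0})"
  have D_smooth: "smooth_on S D" unfolding D_def[abs_def] using smooth_1formD(2)[OF smooth_forms(1)] .
  have S1: "open S1" "S1 \<subseteq> S" "y0 \<in> S1"
    unfolding S1_def using y0 D0 continuous_open_preimage[OF smooth_on_continuous[OF D_smooth] open_S, of "- {0}"]
    by auto
  define \<sigma> where "\<sigma> i y = \<theta> \<alpha>0 i y v0 / D y" for i y
  have \<sigma>_smooth: "smooth_on S1 (\<sigma> i)" for i
    unfolding \<sigma>_def[abs_def]
    by (intro smooth_on_divide[OF S1(1)] smooth_on_subset[OF smooth_1formD(2)[OF smooth_forms(1)] S1(2)]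
        smooth_on_subset[OF D_smooth S1(2)]) (simp add: S1_def)
  have \<sigma>_i0: "\<sigma> i0 y = 1" if "y \<in> S1" for y using that by (simp add: \<sigma>_def D_def S1_def)
  have \<sigma>0: "\<sigma> i y0 = s $ i" for i by (simp add: \<sigma>_def D0 v0_comp axis_def)
  have form1: "smooth_1form S1 (\<theta> \<alpha> i)" "smooth_1form S1 (\<omega>l j i)" for \<alpha> i j
    by (intro smooth_1form_subset[OF _ S1(2)] smooth_forms)+
  have plane: "\<theta> \<alpha> i y v = \<sigma> i y * \<theta> \<alpha> i0 y v" "\<exists>v. \<forall>\<alpha>. \<theta> \<alpha> i0 y v = tt \<alpha>" if y: "y \<in> S1" for y \<alpha> i v tt
  proof -
    have yS: "y \<in> S" "D y \<noteq> 0" using y by (auto simp: S1_def)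
    obtain s' where s': "range (\<lambda>v. \<chi> \<alpha> i. \<theta> \<alpha> i y v) = range (\<lambda>t. outer t s')"
      using planes[OF yS(1)] by blast
    have "\<exists>t. \<forall>\<alpha> i. \<theta> \<alpha> i y v = t $ \<alpha> * s' $ i" for v
    proof -
      have "(\<chi> \<alpha> i. \<theta> \<alpha> i y v) \<in> range (\<lambda>t. outer t s')" using s' by blast
      then obtain t where t: "(\<chi> \<alpha> i. \<theta> \<alpha> i y v) = outer t s'" by blast
      have "\<theta> \<alpha> i y v = t $ \<alpha> * s' $ i" for \<alpha> i
        using arg_cong[OF t, of "\<lambda>z. z $ \<alpha> $ i"] by (simp add: outer_def)
      then show ?thesis by blast
    qed
    then obtain t where t: "\<And>v \<alpha> i. \<theta> \<alpha> i y v = t v $ \<alpha> * s' $ i" by metis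
    have "t v0 $ \<alpha>0 * s' $ i0 \<noteq> 0" using yS(2) by (simp add: D_def t)
    then have nz: "t v0 $ \<alpha>0 \<noteq> 0" "s' $ i0 \<noteq> 0" by auto
    show "\<theta> \<alpha> i y v = \<sigma> i y * \<theta> \<alpha> i0 y v"
      using nz by (simp add: \<sigma>_def D_def t)
    have "outer (\<chi> \<alpha>. tt \<alpha> / s' $ i0) s' \<in> range (\<lambda>v. \<chi> \<alpha> i. \<theta> \<alpha> i y v)"
      unfolding s' by blast
    then obtain v where v: "outer (\<chi> \<alpha>. tt \<alpha> / s' $ i0) s' = (\<chi> \<alpha> i. \<theta> \<alpha> i y v)" by auto
    have "\<theta> \<alpha> i0 y v = tt \<alpha>" for \<alpha>
      using arg_cong[OF v, of "\<lambda>z. z $ \<alpha> $ i0"] nz by (simp add: outer_def)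
    then show "\<exists>v. \<forall>\<alpha>. \<theta> \<alpha> i0 y v = tt \<alpha>" by blast
  qed
  \<comment> \<open>The connection form \<omega>l contracted with the direction; d\<sigma> + m is
    the covariant differential of \<sigma>.\<close>
  define m where "m i y v = (\<Sum>j\<in>UNIV. \<sigma> j y * \<omega>l j i y v)" for i y v
  define E where "E i \<beta> \<gamma> \<alpha> y = (\<Sum>j\<in>UNIV. \<Sum>k\<in>UNIV. a i \<beta> \<gamma> \<alpha> j k y * (\<sigma> j y * \<sigma> k y))" for i \<beta> \<gamma> \<alpha> y
  define d\<sigma> where "d\<sigma> i y v = frechet_derivative (\<sigma> i) (at y) v" for i y v
  let ?\<tau> = "\<lambda>\<alpha>. \<theta> \<alpha> i0"
  have quad_leaf: "quad c (\<lambda>\<beta> j. \<theta> \<beta> j y u) (\<lambda>\<gamma> k. \<theta> \<gamma> k y v)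
      = (\<Sum>\<beta>\<in>UNIV. \<Sum>\<gamma>\<in>UNIV. (\<Sum>j\<in>UNIV. \<Sum>k\<in>UNIV. c \<beta> \<gamma> j k * (\<sigma> j y * \<sigma> k y)) * (?\<tau> \<beta> y u * ?\<tau> \<gamma> y v))"
    if y: "y \<in> S1" for y u v and c :: "'p \<Rightarrow> 'p \<Rightarrow> 'q \<Rightarrow> 'q \<Rightarrow> real"
    unfolding quad_def sum_distrib_right
  proof (intro sum.cong refl)
    fix \<beta> \<gamma> j k
    show "c \<beta> \<gamma> j k * (\<theta> \<beta> j y u * \<theta> \<gamma> k y v) = c \<beta> \<gamma> j k * (\<sigma> j y * \<sigma> k y) * (?\<tau> \<beta> y u * ?\<tau> \<gamma> y v)"
      unfolding plane(1)[OF y, of \<beta> j u] plane(1)[OF y, of \<gamma> k v] by simp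
  qed
  \<comment> \<open>The derivative of \<open>\<theta> \<alpha> i\<close> is computed twice, from the
    structure equation and from \<open>\<sigma> i * \<theta> \<alpha> i0\<close>. The terms with
    \<omega>g and \<omega> are multiples of \<sigma> and cancel against those of the equation for
    \<open>i0\<close>.\<close>
  have eq1: "?\<tau> \<alpha> y v * (d\<sigma> i y u + m i y u - \<sigma> i y * m i0 y u) - ?\<tau> \<alpha> y u * (d\<sigma> i y v + m i y v - \<sigma> i y * m i0 y v)
      = 2 * (\<Sum>\<beta>\<in>UNIV. \<Sum>\<gamma>\<in>UNIV. (E i \<beta> \<gamma> \<alpha> y - \<sigma> i y * E i0 \<beta> \<gamma> \<alpha> y) * (?\<tau> \<beta> y u * ?\<tau> \<gamma> y v))"
    if y: "y \<in> S1" for y u v \<alpha> i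
  proof -
    have yS: "y \<in> S" using y S1 by blast
    define \<Gamma> where "\<Gamma> = (\<Sum>\<beta>\<in>UNIV. wedge1 (\<omega>g \<alpha> \<beta>) (?\<tau> \<beta>) y u v) + wedge1 \<omega> (?\<tau> \<alpha>) y u v"
    have X: "ext_d (\<theta> \<alpha> i) y u v = ?\<tau> \<alpha> y u * m i y v - ?\<tau> \<alpha> y v * m i y u + \<sigma> i y * \<Gamma>
        + 2 * (\<Sum>\<beta>\<in>UNIV. \<Sum>\<gamma>\<in>UNIV. E i \<beta> \<gamma> \<alpha> y * (?\<tau> \<beta> y u * ?\<tau> \<gamma> y v))" for i
    proof -
      have "(\<Sum>j\<in>UNIV. wedge1 (\<theta> \<alpha> j) (\<omega>l j i) y u v) = (\<Sum>j\<in>UNIV. ?\<tau> \<alpha> y u * (\<sigma> j y * \<omega>l j i y v) - ?\<tau> \<alpha> y v * (\<sigma> j y * \<omega>l j i y u))"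
      proof (intro sum.cong refl)
        fix j show "wedge1 (\<theta> \<alpha> j) (\<omega>l j i) y u v = ?\<tau> \<alpha> y u * (\<sigma> j y * \<omega>l j i y v) - ?\<tau> \<alpha> y v * (\<sigma> j y * \<omega>l j i y u)"
          unfolding wedge1_def plane(1)[OF y, of \<alpha> j u] plane(1)[OF y, of \<alpha> j v] by simp
      qed
      then have 1: "(\<Sum>j\<in>UNIV. wedge1 (\<theta> \<alpha> j) (\<omega>l j i) y u v) = ?\<tau> \<alpha> y u * m i y v - ?\<tau> \<alpha> y v * m i y u"
        by (simp only: sum_subtractf sum_distrib_left[symmetric] m_def)
      have w: "wedge1 \<eta> (\<theta> \<beta> i) y u v = \<sigma> i y * wedge1 \<eta> (?\<tau> \<beta>) y u v" for \<eta> \<beta>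
        unfolding wedge1_def plane(1)[OF y, of \<beta> i u] plane(1)[OF y, of \<beta> i v] by (simp add: algebra_simps)
      show ?thesis
        unfolding d_theta[OF yS] 1 w quad_leaf[OF y] E_def \<Gamma>_def by (simp add: sum_distrib_left distrib_left)
    qed
    have Y: "ext_d (\<theta> \<alpha> i) y u v = d\<sigma> i y u * ?\<tau> \<alpha> y v - d\<sigma> i y v * ?\<tau> \<alpha> y u + \<sigma> i y * ext_d (?\<tau> \<alpha>) y u v"
      unfolding d\<sigma>_def ext_d_scale[OF S1(1) \<sigma>_smooth form1(1) y, symmetric]
      by (rule ext_d_cong[OF S1(1) y plane(1)])
    have "(\<Sum>\<beta>\<in>UNIV. \<Sum>\<gamma>\<in>UNIV. (E i \<beta> \<gamma> \<alpha> y - \<sigma> i y * E i0 \<beta> \<gamma> \<alpha> y) * (?\<tau> \<beta> y u * ?\<tau> \<gamma> y v))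
      = (\<Sum>\<beta>\<in>UNIV. \<Sum>\<gamma>\<in>UNIV. E i \<beta> \<gamma> \<alpha> y * (?\<tau> \<beta> y u * ?\<tau> \<gamma> y v))
        - \<sigma> i y * (\<Sum>\<beta>\<in>UNIV. \<Sum>\<gamma>\<in>UNIV. E i0 \<beta> \<gamma> \<alpha> y * (?\<tau> \<beta> y u * ?\<tau> \<gamma> y v))"
      unfolding sum_distrib_left sum_subtractf[symmetric] by (intro sum.cong refl) (simp add: algebra_simps)
    then show ?thesis
      using Y unfolding X[of i] X[of i0] \<sigma>_i0[OF y] by (simp add: algebra_simps)
  qed
  have dual: "\<exists>e. \<forall>\<alpha> \<beta>. ?\<tau> \<alpha> y (e \<beta>) = (if \<alpha> = \<beta> then 1 else 0)" if y: "y \<in> S1" for y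
    using plane(2)[OF y, of "\<lambda>\<alpha>. if \<alpha> = _ then 1 else 0"] by metis
  have dual_sum: "(\<Sum>\<beta>\<in>UNIV. \<Sum>\<gamma>\<in>UNIV. f \<beta> \<gamma> * (?\<tau> \<beta> y (e \<mu>) * ?\<tau> \<gamma> y (e \<nu>))) = f \<mu> \<nu>"
    if "\<forall>\<alpha> \<beta>. ?\<tau> \<alpha> y (e \<beta>) = (if \<alpha> = \<beta> then 1 else 0)" for y e f \<mu> \<nu>
    using that by (simp add: if_distrib[of "\<lambda>u. _ * u"] if_distrib[of "\<lambda>u. u * _"] cong: if_cong)
  have E0: "E i \<beta> \<gamma> \<alpha> y = \<sigma> i y * E i0 \<beta> \<gamma> \<alpha> y" and h0: "d\<sigma> i y v + m i y v = \<sigma> i y * m i0 y v"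
    if y: "y \<in> S1" for y i \<beta> \<gamma> \<alpha> v
  proof -
    obtain e where e: "\<forall>\<alpha> \<beta>. ?\<tau> \<alpha> y (e \<beta>) = (if \<alpha> = \<beta> then 1 else 0)" using dual[OF y] by blast
    define h where "h v = d\<sigma> i y v + m i y v - \<sigma> i y * m i0 y v" for v
    define \<epsilon> where "\<epsilon> \<beta> \<gamma> \<alpha> = E i \<beta> \<gamma> \<alpha> y - \<sigma> i y * E i0 \<beta> \<gamma> \<alpha> y" for \<beta> \<gamma> \<alpha>
    \<comment> \<open>Evaluation on a dual basis. Setting \<gamma> = \<alpha> and summing over
      \<alpha> gives (p - 1) h(e \<beta>) on the left, and traces of the torsion, that is 0, on the
      right.\<close>
    have eq2: "(if \<alpha> = \<gamma> then h (e \<beta>) else 0) - (if \<alpha> = \<beta> then h (e \<gamma>) else 0) = 2 * \<epsilon> \<beta> \<gamma> \<alpha>" for \<alpha> \<beta> \<gamma>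
      using eq1[OF y, of \<alpha> "e \<gamma>" i "e \<beta>"] unfolding h_def[symmetric] \<epsilon>_def[symmetric] dual_sum[OF e]
      using e by (cases "\<beta> = \<gamma>") auto
    have trace: "(\<Sum>\<alpha>\<in>UNIV. E i \<beta> \<alpha> \<alpha> y) = 0" for i \<beta>
    proof -
      have "(\<Sum>\<alpha>\<in>UNIV. E i \<beta> \<alpha> \<alpha> y) = (\<Sum>j\<in>UNIV. \<Sum>k\<in>UNIV. (\<Sum>\<alpha>\<in>UNIV. a i \<beta> \<alpha> \<alpha> j k y) * (\<sigma> j y * \<sigma> k y))"
        unfolding E_def sum_distrib_right by (rule trans[OF sum.swap], rule sum.cong[OF refl], rule sum.swap)
      moreover have "(\<Sum>\<alpha>\<in>UNIV. a i \<beta> \<alpha> \<alpha> j k y) = 0" for j k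
        using a_trace_g[of i \<beta> k j y] by (subst a_skew) (simp add: sum_negf)
      ultimately show ?thesis by simp
    qed
    have "(real CARD('p) - 1) * h (e \<beta>) = 0" for \<beta>
    proof -
      have "(real CARD('p) - 1) * h (e \<beta>) = (\<Sum>\<alpha>\<in>UNIV. 2 * \<epsilon> \<beta> \<alpha> \<alpha>)"
        unfolding eq2[symmetric] sum_diff_delta[of "\<lambda>\<beta>. h (e \<beta>)", symmetric] by simp
      also have "\<dots> = 2 * (\<Sum>\<alpha>\<in>UNIV. E i \<beta> \<alpha> \<alpha> y) - 2 * (\<sigma> i y * (\<Sum>\<alpha>\<in>UNIV. E i0 \<beta> \<alpha> \<alpha> y))"
        by (simp add: \<epsilon>_def sum_distrib_left sum_subtractf algebra_simps)
      finally show ?thesis by (simp add: trace)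
    qed
    then have he: "h (e \<beta>) = 0" for \<beta> using card by simp
    then have \<epsilon>0: "\<epsilon> \<beta> \<gamma> \<alpha> = 0" for \<beta> \<gamma> \<alpha>
      using eq2[of \<alpha> \<gamma> \<beta>] unfolding he by simp
    then show "E i \<beta> \<gamma> \<alpha> y = \<sigma> i y * E i0 \<beta> \<gamma> \<alpha> y" by (simp add: \<epsilon>_def)
    \<comment> \<open>A general vector is reached by pairing it with one member of the dual basis,
      on which \<open>h\<close> is already known to vanish.\<close>
    have "?\<tau> \<alpha>0 y v * h (e \<alpha>0) - ?\<tau> \<alpha>0 y (e \<alpha>0) * h v = 0"
      using eq1[OF y, of \<alpha>0 v i "e \<alpha>0"] unfolding h_def[symmetric] \<epsilon>_def[symmetric] by (simp add: \<epsilon>0)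
    then show "d\<sigma> i y v + m i y v = \<sigma> i y * m i0 y v"
      using e he by (simp add: h_def)
  qed
  show "(\<Sum>j\<in>UNIV. \<Sum>k\<in>UNIV. a i \<beta> \<gamma> \<alpha> j k y0 * (s $ j * s $ k))
      = s $ i * (\<Sum>j\<in>UNIV. \<Sum>k\<in>UNIV. a i0 \<beta> \<gamma> \<alpha> j k y0 * (s $ j * s $ k))"
    using E0[OF S1(3), of i \<beta> \<gamma> \<alpha>] by (simp add: E_def \<sigma>0)
  define F where "F i \<gamma> \<delta> y = (\<Sum>j\<in>UNIV. \<sigma> j y * (\<Sum>k\<in>UNIV. \<Sum>l\<in>UNIV. bl i \<gamma> \<delta> j k l y * (\<sigma> k y * \<sigma> l y)))" for i \<gamma> \<delta> y
  define Q where "Q i y u v = (\<Sum>\<gamma>\<in>UNIV. \<Sum>\<delta>\<in>UNIV. F i \<gamma> \<delta> y * (?\<tau> \<gamma> y u * ?\<tau> \<delta> y v))" for i y u v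
  \<comment> \<open>The curvature 2-form of \<omega>l contracted with the direction.\<close>
  define C where "C i y u v = (\<Sum>j\<in>UNIV. \<sigma> j y * (ext_d (\<omega>l j i) y u v - (\<Sum>k\<in>UNIV. wedge1 (\<omega>l j k) (\<omega>l k i) y u v)))" for i y u v
  have m_form: "smooth_1form S1 (m i)" for i
    unfolding m_def[abs_def] by (intro smooth_1form_sum[OF S1(1)] smooth_1form_scale[OF S1(1) \<sigma>_smooth form1(2)])
  have dm: "ext_d (m i) y u v = (\<Sum>j\<in>UNIV. d\<sigma> j y u * \<omega>l j i y v - d\<sigma> j y v * \<omega>l j i y u + \<sigma> j y * ext_d (\<omega>l j i) y u v)"
    if y: "y \<in> S1" for i y u v
    unfolding m_def[abs_def] d\<sigma>_def
    by (simp only: ext_d_sum[OF S1(1) smooth_1form_scale[OF S1(1) \<sigma>_smooth form1(2)] y] ext_d_scale[OF S1(1) \<sigma>_smooth form1(2) y])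
  have d\<sigma>_eq: "d\<sigma> j y v = \<sigma> j y * m i0 y v - m j y v" if "y \<in> S1" for j y v
    using h0[OF that, of j v] by simp
  have dm2: "ext_d (m i) y u v = m i0 y u * m i y v - m i0 y v * m i y u + C i y u v" if y: "y \<in> S1" for i y u v
  proof -
    have "(\<Sum>j\<in>UNIV. \<sigma> j y * (\<Sum>k\<in>UNIV. wedge1 (\<omega>l j k) (\<omega>l k i) y u v)) = (\<Sum>j\<in>UNIV. \<Sum>k\<in>UNIV. \<sigma> j y * wedge1 (\<omega>l j k) (\<omega>l k i) y u v)"
      by (simp add: sum_distrib_left)
    also have "\<dots> = (\<Sum>k\<in>UNIV. \<Sum>j\<in>UNIV. \<sigma> j y * wedge1 (\<omega>l j k) (\<omega>l k i) y u v)"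
      by (rule sum.swap)
    also have "\<dots> = (\<Sum>k\<in>UNIV. m k y u * \<omega>l k i y v - m k y v * \<omega>l k i y u)"
      unfolding m_def sum_distrib_right sum_subtractf[symmetric]
      by (intro sum.cong refl) (simp add: wedge1_def algebra_simps)
    finally have 1: "(\<Sum>j\<in>UNIV. \<sigma> j y * (\<Sum>k\<in>UNIV. wedge1 (\<omega>l j k) (\<omega>l k i) y u v)) = \<dots>" .
    have "C i y u v = (\<Sum>j\<in>UNIV. \<sigma> j y * ext_d (\<omega>l j i) y u v) - (\<Sum>j\<in>UNIV. \<sigma> j y * (\<Sum>k\<in>UNIV. wedge1 (\<omega>l j k) (\<omega>l k i) y u v))"
      unfolding C_def by (simp add: right_diff_distrib sum_subtractf)
    then have 2: "(\<Sum>j\<in>UNIV. \<sigma> j y * ext_d (\<omega>l j i) y u v) = C i y u v + (\<Sum>k\<in>UNIV. m k y u * \<omega>l k i y v - m k y v * \<omega>l k i y u)"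
      unfolding 1 by simp
    have "ext_d (m i) y u v = (\<Sum>j\<in>UNIV. d\<sigma> j y u * \<omega>l j i y v - d\<sigma> j y v * \<omega>l j i y u) + (\<Sum>j\<in>UNIV. \<sigma> j y * ext_d (\<omega>l j i) y u v)"
      unfolding dm[OF y] by (simp only: sum.distrib)
    also have "(\<Sum>j\<in>UNIV. d\<sigma> j y u * \<omega>l j i y v - d\<sigma> j y v * \<omega>l j i y u)
      = m i0 y u * m i y v - m i0 y v * m i y u - (\<Sum>k\<in>UNIV. m k y u * \<omega>l k i y v - m k y v * \<omega>l k i y u)"
      unfolding d\<sigma>_eq[OF y] m_def[of i] sum_distrib_left sum_subtractf[symmetric]
      by (intro sum.cong refl) (simp add: algebra_simps)
    finally show ?thesis unfolding 2 by simp
  qed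
  \<comment> \<open>The exterior derivative of \<open>d\<sigma> i + m i = \<sigma> i * m i0\<close>;
    once d\<sigma> is eliminated, the products of the forms \<open>m\<close> cancel and only
    curvature is left.\<close>
  have C_eq: "C i y u v = \<sigma> i y * C i0 y u v" if y: "y \<in> S1" for i y u v
  proof -
    have "ext_d (\<lambda>y v. d\<sigma> i y v + m i y v) y u v = ext_d (\<lambda>y v. \<sigma> i y * m i0 y v) y u v"
      by (rule ext_d_cong[OF S1(1) y h0])
    moreover have "ext_d (\<lambda>y v. d\<sigma> i y v + m i y v) y u v = 0 + ext_d (m i) y u v"
      unfolding d\<sigma>_def
      by (simp only: ext_d_add[OF S1(1) smooth_1form_exact[OF S1(1) \<sigma>_smooth] m_form y] ext_d_exact[OF S1(1) \<sigma>_smooth y])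
    ultimately have "ext_d (m i) y u v = d\<sigma> i y u * m i0 y v - d\<sigma> i y v * m i0 y u + \<sigma> i y * ext_d (m i0) y u v"
      unfolding d\<sigma>_def by (simp add: ext_d_scale[OF S1(1) \<sigma>_smooth m_form y])
    then show ?thesis
      unfolding dm2[OF y] d\<sigma>_eq[OF y] by (simp add: algebra_simps)
  qed
  \<comment> \<open>In the structure equation for \<omega>l the \<psi>-terms contribute only a
    multiple \<open>B\<close> of \<sigma>, so the proportionality of \<open>C\<close> passes to its
    curvature part \<open>Q\<close>.\<close>
  have C_Q: "C i y u v = \<sigma> i y * B + 2 * Q i y u v"
    if y: "y \<in> S1" and B: "B = real CARD('p) / real (CARD('p) + CARD('q)) *
        ((\<Sum>\<gamma>\<in>UNIV. \<Sum>k\<in>UNIV. wedge1 (\<psi> k \<gamma>) (\<theta> \<gamma> k) y u v) - real CARD('q) * (\<Sum>j\<in>UNIV. \<sigma> j y * (\<Sum>\<gamma>\<in>UNIV. wedge1 (\<psi> j \<gamma>) (?\<tau> \<gamma>) y u v)))" for i y u v B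
  proof -
    let ?r = "real CARD('p) / real (CARD('p) + CARD('q))"
    let ?X = "\<Sum>\<gamma>\<in>UNIV. \<Sum>k\<in>UNIV. wedge1 (\<psi> k \<gamma>) (\<theta> \<gamma> k) y u v"
    have yS: "y \<in> S" using y S1 by blast
    have w: "wedge1 \<eta> (\<theta> \<beta> i) y u v = \<sigma> i y * wedge1 \<eta> (?\<tau> \<beta>) y u v" for \<eta> \<beta>
      unfolding wedge1_def plane(1)[OF y, of \<beta> i u] plane(1)[OF y, of \<beta> i v] by (simp add: algebra_simps)
    have "C i y u v = (\<Sum>j\<in>UNIV. \<sigma> j y * (?r * ((if j = i then ?X else 0) - real CARD('q) * (\<Sum>\<gamma>\<in>UNIV. wedge1 (\<psi> j \<gamma>) (\<theta> \<gamma> i) y u v))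
        + 2 * quad (\<lambda>\<gamma> \<delta> k l. bl i \<gamma> \<delta> j k l y) (\<lambda>\<beta> j. \<theta> \<beta> j y u) (\<lambda>\<gamma> k. \<theta> \<gamma> k y v)))"
      unfolding C_def d_omega_l[OF yS] by simp
    also have "\<dots> = ?r * (\<Sum>j\<in>UNIV. (if j = i then \<sigma> j y * ?X else 0)) - ?r * (real CARD('q) * (\<sigma> i y * (\<Sum>j\<in>UNIV. \<sigma> j y * (\<Sum>\<gamma>\<in>UNIV. wedge1 (\<psi> j \<gamma>) (?\<tau> \<gamma>) y u v))))
        + 2 * (\<Sum>j\<in>UNIV. \<sigma> j y * quad (\<lambda>\<gamma> \<delta> k l. bl i \<gamma> \<delta> j k l y) (\<lambda>\<beta> j. \<theta> \<beta> j y u) (\<lambda>\<gamma> k. \<theta> \<gamma> k y v))"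
      unfolding w sum_distrib_left[of "\<sigma> i y" _ "UNIV :: 'p set", symmetric]
      unfolding sum_distrib_left[of _ _ "UNIV :: 'q set"] sum.distrib[symmetric] sum_subtractf[symmetric]
      by (intro sum.cong refl) (simp add: algebra_simps)
    also have "(\<Sum>j\<in>UNIV. \<sigma> j y * quad (\<lambda>\<gamma> \<delta> k l. bl i \<gamma> \<delta> j k l y) (\<lambda>\<beta> j. \<theta> \<beta> j y u) (\<lambda>\<gamma> k. \<theta> \<gamma> k y v)) = Q i y u v"
    proof -
      have "(\<Sum>j\<in>UNIV. \<sigma> j y * quad (\<lambda>\<gamma> \<delta> k l. bl i \<gamma> \<delta> j k l y) (\<lambda>\<beta> j. \<theta> \<beta> j y u) (\<lambda>\<gamma> k. \<theta> \<gamma> k y v))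
        = (\<Sum>j\<in>UNIV. \<Sum>\<gamma>\<in>UNIV. \<Sum>\<delta>\<in>UNIV. \<sigma> j y * ((\<Sum>k\<in>UNIV. \<Sum>l\<in>UNIV. bl i \<gamma> \<delta> j k l y * (\<sigma> k y * \<sigma> l y)) * (?\<tau> \<gamma> y u * ?\<tau> \<delta> y v)))"
        unfolding quad_leaf[OF y] by (simp only: sum_distrib_left)
      also have "\<dots> = (\<Sum>\<gamma>\<in>UNIV. \<Sum>\<delta>\<in>UNIV. \<Sum>j\<in>UNIV. \<sigma> j y * ((\<Sum>k\<in>UNIV. \<Sum>l\<in>UNIV. bl i \<gamma> \<delta> j k l y * (\<sigma> k y * \<sigma> l y)) * (?\<tau> \<gamma> y u * ?\<tau> \<delta> y v)))"
        by (rule trans[OF sum.swap], rule sum.cong[OF refl], rule sum.swap)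
      also have "\<dots> = Q i y u v"
        unfolding Q_def F_def
        by (rule sum.cong[OF refl], rule sum.cong[OF refl], rule trans[OF _ sum_distrib_right[symmetric]])
          (simp only: mult.assoc)
      finally show ?thesis .
    qed
    finally show ?thesis unfolding B by (simp add: algebra_simps)
  qed
  obtain e where e: "\<forall>\<alpha> \<beta>. ?\<tau> \<alpha> y0 (e \<beta>) = (if \<alpha> = \<beta> then 1 else 0)" using dual[OF S1(3)] by blast
  have "Q i y0 (e \<gamma>) (e \<delta>) = \<sigma> i y0 * Q i0 y0 (e \<gamma>) (e \<delta>)"
    using C_eq[OF S1(3), of i "e \<gamma>" "e \<delta>"] C_Q[OF S1(3) refl, of i "e \<gamma>" "e \<delta>"] C_Q[OF S1(3) refl, of i0 "e \<gamma>" "e \<delta>"]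
      \<sigma>_i0[OF S1(3)] by (simp add: algebra_simps)
  then have "F i \<gamma> \<delta> y0 = \<sigma> i y0 * F i0 \<gamma> \<delta> y0"
    unfolding Q_def dual_sum[OF e] .
  moreover have "F i \<gamma> \<delta> y0 = (\<Sum>j\<in>UNIV. \<Sum>k\<in>UNIV. \<Sum>l\<in>UNIV. bl i \<gamma> \<delta> j k l y0 * (s $ j * s $ k * s $ l))" for i
    unfolding F_def \<sigma>0 sum_distrib_left by (intro sum.cong refl) simp
  ultimately show "(\<Sum>j\<in>UNIV. \<Sum>k\<in>UNIV. \<Sum>l\<in>UNIV. bl i \<gamma> \<delta> j k l y0 * (s $ j * s $ k * s $ l))
      = s $ i * (\<Sum>j\<in>UNIV. \<Sum>k\<in>UNIV. \<Sum>l\<in>UNIV. bl i0 \<gamma> \<delta> j k l y0 * (s $ j * s $ k * s $ l))"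
    by (simp add: \<sigma>0)
qed

subsection \<open>The Bianchi identity\<close>

text \<open>The identity d d \<theta> = 0 on vectors annihilated by all forms except \<theta> at the
  point considered. Products with an undifferentiated connection form drop out, the derivatives of
  \<omega>l and \<omega>g reduce to the components \<open>bl\<close> and \<open>bg\<close>, and the
  torsion contributes its derivative and a term quadratic in itself. A common factor 2 has been
  divided out.\<close>

lemma (in cartan_forms) bianchi:
  fixes y u v w :: 'z
  defines "Z \<equiv> \<lambda>x \<alpha> i. \<theta> \<alpha> i y x"
    and "A \<equiv> \<lambda>i \<alpha> \<beta> \<gamma> j k. a i \<beta> \<gamma> \<alpha> j k y"
    and "dA \<equiv> \<lambda>x i \<alpha> \<beta> \<gamma> j k. frechet_derivative (a i \<beta> \<gamma> \<alpha> j k) (at y) x"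
    and "L \<equiv> \<lambda>i j \<gamma> \<delta> k l. bl i \<gamma> \<delta> j k l y"
    and "H \<equiv> \<lambda>\<beta> \<alpha> \<gamma> \<delta> k l. bg \<beta> \<gamma> \<delta> \<alpha> k l y"
  assumes y: "y \<in> S"
    and hor: "\<And>x \<alpha> \<beta> i j. x \<in> {u, v, w} \<Longrightarrow> \<omega> y x = 0 \<and> \<omega>g \<alpha> \<beta> y x = 0 \<and> \<omega>l i j y x = 0 \<and> \<psi> i \<alpha> y x = 0"
  shows "quad (dA u i \<alpha>) (Z v) (Z w) + quad (dA v i \<alpha>) (Z w) (Z u) + quad (dA w i \<alpha>) (Z u) (Z v)
    + 2 * (quad (A i \<alpha>) (\<lambda>\<beta> j. quad (A j \<beta>) (Z u) (Z v)) (Z w)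
         + quad (A i \<alpha>) (\<lambda>\<beta> j. quad (A j \<beta>) (Z v) (Z w)) (Z u)
         + quad (A i \<alpha>) (\<lambda>\<beta> j. quad (A j \<beta>) (Z w) (Z u)) (Z v))
    - (\<Sum>j\<in>UNIV. Z u \<alpha> j * quad (L i j) (Z v) (Z w) + Z v \<alpha> j * quad (L i j) (Z w) (Z u) + Z w \<alpha> j * quad (L i j) (Z u) (Z v))
    + (\<Sum>\<beta>\<in>UNIV. quad (H \<beta> \<alpha>) (Z u) (Z v) * Z w \<beta> i + quad (H \<beta> \<alpha>) (Z v) (Z w) * Z u \<beta> i + quad (H \<beta> \<alpha>) (Z w) (Z u) * Z v \<beta> i) = 0"
proof -
  let ?D = "\<lambda>f x. frechet_derivative f (at y) x"
  let ?wl = "\<lambda>j. wedge1 (\<theta> \<alpha> j) (\<omega>l j i)"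
  let ?wg = "\<lambda>\<beta>. wedge1 (\<omega>g \<alpha> \<beta>) (\<theta> \<beta> i)"
  let ?wo = "wedge1 \<omega> (\<theta> \<alpha> i)"
  let ?wt = "\<lambda>\<beta> \<gamma> j k. wedge1 (\<theta> \<beta> j) (\<theta> \<gamma> k)"
  have sd: "(f has_derivative frechet_derivative f (at y)) (at y)" if "smooth_on S f" for f :: "'z \<Rightarrow> real"
    by (rule smooth_on_has_derivative[OF open_S that y])
  have sw: "smooth_on S (\<lambda>y. ?wl j y p q)" "smooth_on S (\<lambda>y. ?wg \<beta> y p q)" "smooth_on S (\<lambda>y. ?wo y p q)"
    "smooth_on S (\<lambda>y. ?wt \<beta> \<gamma> j k y p q)" for \<beta> \<gamma> j k p q
    by (intro smooth_on_wedge1[OF open_S] smooth_forms)+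
  have D: "?D (\<lambda>y. ext_d (\<theta> \<alpha> i) y p q) x = (\<Sum>j\<in>UNIV. ?D (\<lambda>y. ?wl j y p q) x) + (\<Sum>\<beta>\<in>UNIV. ?D (\<lambda>y. ?wg \<beta> y p q) x)
      + ?D (\<lambda>y. ?wo y p q) x
      + (\<Sum>\<beta>\<in>UNIV. \<Sum>\<gamma>\<in>UNIV. \<Sum>j\<in>UNIV. \<Sum>k\<in>UNIV. A i \<alpha> \<beta> \<gamma> j k * ?D (\<lambda>y. ?wt \<beta> \<gamma> j k y p q) x + dA x i \<alpha> \<beta> \<gamma> j k * ?wt \<beta> \<gamma> j k y p q)" for p q x
  proof -
    have "((\<lambda>y. (\<Sum>j\<in>UNIV. ?wl j y p q) + (\<Sum>\<beta>\<in>UNIV. ?wg \<beta> y p q) + ?wo y p q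
        + (\<Sum>\<beta>\<in>UNIV. \<Sum>\<gamma>\<in>UNIV. \<Sum>j\<in>UNIV. \<Sum>k\<in>UNIV. a i \<beta> \<gamma> \<alpha> j k y * ?wt \<beta> \<gamma> j k y p q)) has_derivative
        (\<lambda>x. (\<Sum>j\<in>UNIV. ?D (\<lambda>y. ?wl j y p q) x) + (\<Sum>\<beta>\<in>UNIV. ?D (\<lambda>y. ?wg \<beta> y p q) x)
      + ?D (\<lambda>y. ?wo y p q) x
      + (\<Sum>\<beta>\<in>UNIV. \<Sum>\<gamma>\<in>UNIV. \<Sum>j\<in>UNIV. \<Sum>k\<in>UNIV. A i \<alpha> \<beta> \<gamma> j k * ?D (\<lambda>y. ?wt \<beta> \<gamma> j k y p q) x + dA x i \<alpha> \<beta> \<gamma> j k * ?wt \<beta> \<gamma> j k y p q))) (at y)"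
      unfolding A_def dA_def
      by (intro has_derivative_add has_derivative_sum has_derivative_mult sd sw smooth_coeffs)
    then have "((\<lambda>y. ext_d (\<theta> \<alpha> i) y p q) has_derivative
        (\<lambda>x. (\<Sum>j\<in>UNIV. ?D (\<lambda>y. ?wl j y p q) x) + (\<Sum>\<beta>\<in>UNIV. ?D (\<lambda>y. ?wg \<beta> y p q) x)
      + ?D (\<lambda>y. ?wo y p q) x
      + (\<Sum>\<beta>\<in>UNIV. \<Sum>\<gamma>\<in>UNIV. \<Sum>j\<in>UNIV. \<Sum>k\<in>UNIV. A i \<alpha> \<beta> \<gamma> j k * ?D (\<lambda>y. ?wt \<beta> \<gamma> j k y p q) x + dA x i \<alpha> \<beta> \<gamma> j k * ?wt \<beta> \<gamma> j k y p q))) (at y)"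
      by (rule has_derivative_transform_within_open[OF _ open_S y])
        (simp only: d_theta quad_wedge[of "\<lambda>\<beta> \<gamma> j k. a i \<beta> \<gamma> \<alpha> j k _", OF a_skew])
    from fun_cong[OF frechet_derivative_at[OF this], of x] show ?thesis by (rule sym)
  qed
  let ?E = "\<lambda>\<eta> p q. ext_d \<eta> y p q"
  have cyc: "?D (\<lambda>y. wedge1 \<xi> \<eta> y v w) u + ?D (\<lambda>y. wedge1 \<xi> \<eta> y w u) v + ?D (\<lambda>y. wedge1 \<xi> \<eta> y u v) w
    = ?E \<xi> u v * \<eta> y w + ?E \<xi> v w * \<eta> y u + ?E \<xi> w u * \<eta> y v
      - \<xi> y u * ?E \<eta> v w - \<xi> y v * ?E \<eta> w u - \<xi> y w * ?E \<eta> u v" if "smooth_1form S \<xi>" "smooth_1form S \<eta>" for \<xi> \<eta>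
    by (rule ext_d_wedge[OF open_S that y])
  have h0: "\<omega> y u = 0" "\<omega> y v = 0" "\<omega> y w = 0" "\<omega>g \<alpha> \<beta> y u = 0" "\<omega>g \<alpha> \<beta> y v = 0" "\<omega>g \<alpha> \<beta> y w = 0"
    "\<omega>l j k y u = 0" "\<omega>l j k y v = 0" "\<omega>l j k y w = 0" "\<psi> j \<alpha> y u = 0" "\<psi> j \<alpha> y v = 0" "\<psi> j \<alpha> y w = 0" for \<alpha> \<beta> j k
    using hor by auto
  have dT: "?E (\<theta> \<beta> j) p q = 2 * quad (A j \<beta>) (Z p) (Z q)"
    and dL: "?E (\<omega>l k j) p q = 2 * quad (L j k) (Z p) (Z q)"
    and dG: "?E (\<omega>g \<gamma> \<beta>) p q = 2 * quad (H \<beta> \<gamma>) (Z p) (Z q)"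
    and dO: "?E \<omega> p q = 0" if "p \<in> {u, v, w}" "q \<in> {u, v, w}" for p q \<beta> \<gamma> j k
    using hor[OF that(1)] hor[OF that(2)]
    by (simp_all add: d_theta[OF y] d_omega_l[OF y] d_omega_g[OF y] d_omega[OF y] wedge1_def Z_def A_def L_def H_def)
  \<comment> \<open>The minus sign comes from moving d past the first factor \<theta>; in the
    products with \<omega>g the connection form is the first factor and the sign is plus.\<close>
  have cl: "(\<Sum>j\<in>UNIV. ?D (\<lambda>y. ?wl j y v w) u) + (\<Sum>j\<in>UNIV. ?D (\<lambda>y. ?wl j y w u) v) + (\<Sum>j\<in>UNIV. ?D (\<lambda>y. ?wl j y u v) w)
    = - 2 * (\<Sum>j\<in>UNIV. Z u \<alpha> j * quad (L i j) (Z v) (Z w) + Z v \<alpha> j * quad (L i j) (Z w) (Z u) + Z w \<alpha> j * quad (L i j) (Z u) (Z v))"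
    unfolding sum.distrib[symmetric] sum_distrib_left cyc[OF smooth_forms(1,4)]
    by (intro sum.cong refl) (simp add: h0 dL Z_def algebra_simps)
  have cg: "(\<Sum>\<beta>\<in>UNIV. ?D (\<lambda>y. ?wg \<beta> y v w) u) + (\<Sum>\<beta>\<in>UNIV. ?D (\<lambda>y. ?wg \<beta> y w u) v) + (\<Sum>\<beta>\<in>UNIV. ?D (\<lambda>y. ?wg \<beta> y u v) w)
    = 2 * (\<Sum>\<beta>\<in>UNIV. quad (H \<beta> \<alpha>) (Z u) (Z v) * Z w \<beta> i + quad (H \<beta> \<alpha>) (Z v) (Z w) * Z u \<beta> i + quad (H \<beta> \<alpha>) (Z w) (Z u) * Z v \<beta> i)"
    unfolding sum.distrib[symmetric] sum_distrib_left cyc[OF smooth_forms(3,1)]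
    by (intro sum.cong refl) (simp add: h0 dG Z_def algebra_simps)
  have co: "?D (\<lambda>y. ?wo y v w) u + ?D (\<lambda>y. ?wo y w u) v + ?D (\<lambda>y. ?wo y u v) w = 0"
    unfolding cyc[OF smooth_forms(2,1)] by (simp add: h0 dO)
  have A_skew: "A i \<alpha> \<beta> \<gamma> j k = - A i \<alpha> \<gamma> \<beta> k j" for \<beta> \<gamma> j k
    unfolding A_def by (rule a_skew)
  have dA_skew: "dA x i \<alpha> \<beta> \<gamma> j k = - dA x i \<alpha> \<gamma> \<beta> k j" for x \<beta> \<gamma> j k
  proof -
    have "a i \<beta> \<gamma> \<alpha> j k = (\<lambda>y. - a i \<gamma> \<beta> \<alpha> k j y)" using a_skew by blast
    then show ?thesis
      unfolding dA_def using fun_cong[OF frechet_derivative_at[OF has_derivative_minus[OF sd[OF smooth_coeffs(1)[of i \<gamma> \<beta> \<alpha> k j]]]], of x]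
      by simp
  qed
  \<comment> \<open>The factor 4 has two sources: 2 from the exterior derivative of \<theta>, and 2
    because skewness of \<open>A\<close> makes both factors of the wedge product contribute
    equally.\<close>
  have ct: "(\<Sum>\<beta>\<in>UNIV. \<Sum>\<gamma>\<in>UNIV. \<Sum>j\<in>UNIV. \<Sum>k\<in>UNIV. A i \<alpha> \<beta> \<gamma> j k * ?D (\<lambda>y. ?wt \<beta> \<gamma> j k y v w) u)
    + (\<Sum>\<beta>\<in>UNIV. \<Sum>\<gamma>\<in>UNIV. \<Sum>j\<in>UNIV. \<Sum>k\<in>UNIV. A i \<alpha> \<beta> \<gamma> j k * ?D (\<lambda>y. ?wt \<beta> \<gamma> j k y w u) v)
    + (\<Sum>\<beta>\<in>UNIV. \<Sum>\<gamma>\<in>UNIV. \<Sum>j\<in>UNIV. \<Sum>k\<in>UNIV. A i \<alpha> \<beta> \<gamma> j k * ?D (\<lambda>y. ?wt \<beta> \<gamma> j k y u v) w)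
    = 4 * (quad (A i \<alpha>) (\<lambda>\<beta> j. quad (A j \<beta>) (Z u) (Z v)) (Z w)
         + quad (A i \<alpha>) (\<lambda>\<beta> j. quad (A j \<beta>) (Z v) (Z w)) (Z u)
         + quad (A i \<alpha>) (\<lambda>\<beta> j. quad (A j \<beta>) (Z w) (Z u)) (Z v))" (is "?lhs = _")
  proof -
    let ?T = "\<lambda>p q \<beta> j. quad (A j \<beta>) (Z p) (Z q)"
    have "?lhs = 2 * (quad (A i \<alpha>) (?T u v) (Z w) + quad (A i \<alpha>) (?T v w) (Z u) + quad (A i \<alpha>) (?T w u) (Z v)
        - quad (A i \<alpha>) (Z u) (?T v w) - quad (A i \<alpha>) (Z v) (?T w u) - quad (A i \<alpha>) (Z w) (?T u v))"
    proof -
      have "?lhs = (\<Sum>\<beta>\<in>UNIV. \<Sum>\<gamma>\<in>UNIV. \<Sum>j\<in>UNIV. \<Sum>k\<in>UNIV. A i \<alpha> \<beta> \<gamma> j k * (?D (\<lambda>y. ?wt \<beta> \<gamma> j k y v w) u + ?D (\<lambda>y. ?wt \<beta> \<gamma> j k y w u) v + ?D (\<lambda>y. ?wt \<beta> \<gamma> j k y u v) w))"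
        by (simp only: sum.distrib distrib_left)
      also have "\<dots> = 2 * (quad (A i \<alpha>) (?T u v) (Z w) + quad (A i \<alpha>) (?T v w) (Z u) + quad (A i \<alpha>) (?T w u) (Z v)
        - quad (A i \<alpha>) (Z u) (?T v w) - quad (A i \<alpha>) (Z v) (?T w u) - quad (A i \<alpha>) (Z w) (?T u v))"
        unfolding cyc[OF smooth_forms(1,1)] quad_def[of "A i \<alpha>"] sum_subtractf[symmetric] sum.distrib[symmetric] sum_distrib_left
        by (intro sum.cong refl) (simp add: dT Z_def algebra_simps)
      finally show ?thesis .
    qed
    then show ?thesis
      using quad_swap[of "A i \<alpha>" "Z u" "?T v w", OF A_skew] quad_swap[of "A i \<alpha>" "Z v" "?T w u", OF A_skew]
        quad_swap[of "A i \<alpha>" "Z w" "?T u v", OF A_skew] by simp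
  qed
  have cd: "(\<Sum>\<beta>\<in>UNIV. \<Sum>\<gamma>\<in>UNIV. \<Sum>j\<in>UNIV. \<Sum>k\<in>UNIV. dA x i \<alpha> \<beta> \<gamma> j k * ?wt \<beta> \<gamma> j k y p q) = 2 * quad (dA x i \<alpha>) (Z p) (Z q)" for x p q
    unfolding Z_def by (rule quad_wedge[OF dA_skew])
  have D2: "?D (\<lambda>y. ext_d (\<theta> \<alpha> i) y p q) x = (\<Sum>j\<in>UNIV. ?D (\<lambda>y. ?wl j y p q) x) + (\<Sum>\<beta>\<in>UNIV. ?D (\<lambda>y. ?wg \<beta> y p q) x)
      + ?D (\<lambda>y. ?wo y p q) x
      + ((\<Sum>\<beta>\<in>UNIV. \<Sum>\<gamma>\<in>UNIV. \<Sum>j\<in>UNIV. \<Sum>k\<in>UNIV. A i \<alpha> \<beta> \<gamma> j k * ?D (\<lambda>y. ?wt \<beta> \<gamma> j k y p q) x) + 2 * quad (dA x i \<alpha>) (Z p) (Z q))" for p q x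
    unfolding D cd[symmetric] by (simp only: sum.distrib)
  have "?D (\<lambda>y. ext_d (\<theta> \<alpha> i) y v w) u + ?D (\<lambda>y. ext_d (\<theta> \<alpha> i) y w u) v + ?D (\<lambda>y. ext_d (\<theta> \<alpha> i) y u v) w = 0"
    by (rule ext_d_closed[OF open_S smooth_forms(1) y])
  then show ?thesis
    unfolding D2 using cl cg co ct by linarith
qed

subsection \<open>Consequences of the Bianchi identity\<close>

text \<open>The matrix \<open>outer t s\<close> for t the basis vector with index \<gamma>, written
  as an index function to match the arguments of \<open>quad\<close>.\<close>

definition single_row :: "'p \<Rightarrow> ('q \<Rightarrow> real) \<Rightarrow> 'p \<Rightarrow> 'q \<Rightarrow> real" where
  "single_row \<gamma> s = (\<lambda>\<beta> j. if \<beta> = \<gamma> then s j else 0)"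

lemma quad_single_row_left:
  "quad c (single_row \<gamma> s) W = (\<Sum>\<delta>\<in>UNIV. \<Sum>j\<in>UNIV. \<Sum>k\<in>UNIV. c \<gamma> \<delta> j k * (s j * W \<delta> k))"
proof -
  have "quad c (single_row \<gamma> s) W = (\<Sum>\<beta>\<in>UNIV. if \<beta> = \<gamma> then (\<Sum>\<delta>\<in>UNIV. \<Sum>j\<in>UNIV. \<Sum>k\<in>UNIV. c \<beta> \<delta> j k * (s j * W \<delta> k)) else 0)"
    unfolding quad_def by (rule sum.cong[OF refl]) (simp add: single_row_def)
  then show ?thesis by simp
qed

lemma quad_single_row_right:
  "quad c Z (single_row \<delta> s) = (\<Sum>\<beta>\<in>UNIV. \<Sum>j\<in>UNIV. \<Sum>k\<in>UNIV. c \<beta> \<delta> j k * (Z \<beta> j * s k))"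
proof -
  have "quad c Z (single_row \<delta> s) = (\<Sum>\<beta>\<in>UNIV. \<Sum>\<gamma>\<in>UNIV. if \<gamma> = \<delta> then (\<Sum>j\<in>UNIV. \<Sum>k\<in>UNIV. c \<beta> \<gamma> j k * (Z \<beta> j * s k)) else 0)"
    unfolding quad_def by (rule sum.cong[OF refl], rule sum.cong[OF refl]) (simp add: single_row_def)
  then show ?thesis by simp
qed

lemma quad_single_rows:
  "quad c (single_row \<gamma> s) (single_row \<delta> s') = (\<Sum>j\<in>UNIV. \<Sum>k\<in>UNIV. c \<gamma> \<delta> j k * (s j * s' k))"
proof -
  have "quad c (single_row \<gamma> s) (single_row \<delta> s')
    = (\<Sum>\<beta>\<in>UNIV. if \<beta> = \<delta> then (\<Sum>j\<in>UNIV. \<Sum>k\<in>UNIV. c \<gamma> \<beta> j k * (s j * s' k)) else 0)"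
    unfolding quad_single_row_left by (rule sum.cong[OF refl]) (simp add: single_row_def)
  then show ?thesis by simp
qed

lemma quad_zero [simp]: "quad c (\<lambda>_ _. 0) W = 0" "quad c Z (\<lambda>_ _. 0) = 0"
  by (simp_all add: quad_def)

section \<open>Homogeneous forms in one vector variable\<close>

lemma sum_indicator [simp]:
  fixes f :: "'i::finite \<Rightarrow> real"
  shows "(\<Sum>j\<in>UNIV. f j * ((if j = i then 1 else 0) * c)) = f i * c"
    "(\<Sum>j\<in>UNIV. f j * (c * (if j = i then 1 else 0))) = f i * c"
proof -
  have "(\<Sum>j\<in>UNIV. f j * ((if j = i then 1 else 0) * c)) = (\<Sum>j\<in>UNIV. if j = i then f j * c else 0)"
    "(\<Sum>j\<in>UNIV. f j * (c * (if j = i then 1 else 0))) = (\<Sum>j\<in>UNIV. if j = i then f j * c else 0)"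
    by (intro sum.cong refl; simp)+
  then show "(\<Sum>j\<in>UNIV. f j * ((if j = i then 1 else 0) * c)) = f i * c"
    "(\<Sum>j\<in>UNIV. f j * (c * (if j = i then 1 else 0))) = f i * c" by simp_all
qed

text \<open>A vector-valued form that is everywhere proportional to its argument is determined by its
  divergence: differentiate \<open>P\<^sup>i(s) s\<^sup>l = P\<^sup>l(s) s\<^sup>i\<close> in direction \<open>i\<close>, sum over \<open>i\<close> and use Euler's identity.\<close>

lemma proportional_quadratic_form:
  fixes f :: "'q::finite \<Rightarrow> 'q \<Rightarrow> 'q \<Rightarrow> real"
  defines "P \<equiv> \<lambda>i s. \<Sum>j\<in>UNIV. \<Sum>k\<in>UNIV. f i j k * (s j * s k)"
  assumes proportional: "\<And>i l s. P i s * s l = P l s * s i"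
  shows "(\<Sum>i\<in>UNIV. \<Sum>k\<in>UNIV. (f i i k + f i k i) * s k) * s l = (real CARD('q) + 1) * P l s"
proof -
  define dP where "dP l i = (\<Sum>k\<in>UNIV. (f l i k + f l k i) * s k)" for l i
  define e :: "'q \<Rightarrow> 'q \<Rightarrow> real" where "e i j = (if j = i then 1 else 0)" for i j
  have dP: "((\<lambda>x. P l (\<lambda>j. s j + x * e i j)) has_real_derivative dP l i) (at 0)" for l i
  proof -
    have "((\<lambda>x. P l (\<lambda>j. s j + x * e i j)) has_real_derivative
        (\<Sum>j\<in>UNIV. \<Sum>k\<in>UNIV. f l j k * (e i j * s k + s j * e i k))) (at 0)"
      unfolding P_def by (intro DERIV_sum) (auto intro!: derivative_eq_intros simp: algebra_simps)
    also have "(\<Sum>j\<in>UNIV. \<Sum>k\<in>UNIV. f l j k * (e i j * s k + s j * e i k))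
        = (\<Sum>k\<in>UNIV. \<Sum>j\<in>UNIV. f l j k * (e i j * s k)) + (\<Sum>j\<in>UNIV. \<Sum>k\<in>UNIV. f l j k * (s j * e i k))"
      unfolding distrib_left sum.distrib by (simp add: sum.swap[of "\<lambda>j k. f l j k * (e i j * s k)"])
    also have "\<dots> = dP l i"
      by (simp add: e_def dP_def distrib_right sum.distrib)
    finally show ?thesis .
  qed
  have "dP i i * s l + P i s * e i l = dP l i * s i + P l s" for i
  proof -
    have "((\<lambda>x. P i (\<lambda>j. s j + x * e i j) * (s l + x * e i l)) has_real_derivative dP i i * s l + P i s * e i l) (at 0)"
      by (rule DERIV_cong[OF DERIV_mult[OF dP]]) (auto intro!: derivative_eq_intros)
    moreover have "((\<lambda>x. P l (\<lambda>j. s j + x * e i j) * (s i + x * e i i)) has_real_derivative dP l i * s i + P l s * e i i) (at 0)"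
      by (rule DERIV_cong[OF DERIV_mult[OF dP]]) (auto intro!: derivative_eq_intros)
    moreover have "(\<lambda>x. P i (\<lambda>j. s j + x * e i j) * (s l + x * e i l)) = (\<lambda>x. P l (\<lambda>j. s j + x * e i j) * (s i + x * e i i))"
      using proportional by auto
    ultimately show ?thesis using DERIV_unique by (fastforce simp: e_def)
  qed
  then have "(\<Sum>i\<in>UNIV. dP i i * s l + P i s * e i l) = (\<Sum>i\<in>UNIV. dP l i * s i + P l s)" by simp
  \<comment> \<open>The sum over i yields q copies of \<open>P l s\<close> on the right and one on
    the left; with Euler's factor 2 the constant is q + 2 - 1.\<close>
  then have "(\<Sum>i\<in>UNIV. dP i i) * s l + P l s = (\<Sum>i\<in>UNIV. dP l i * s i) + real CARD('q) * P l s"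
    by (simp add: sum.distrib sum_distrib_right e_def if_distrib[of "\<lambda>u. _ * u"] cong: if_cong)
  moreover have "(\<Sum>i\<in>UNIV. dP l i * s i) = 2 * P l s"
  proof -
    have "(\<Sum>i\<in>UNIV. dP l i * s i) = (\<Sum>i\<in>UNIV. \<Sum>k\<in>UNIV. f l i k * (s i * s k)) + (\<Sum>i\<in>UNIV. \<Sum>k\<in>UNIV. f l k i * (s k * s i))"
      unfolding dP_def sum_distrib_right sum.distrib[symmetric] by (intro sum.cong refl) (simp add: algebra_simps)
    also have "(\<Sum>i\<in>UNIV. \<Sum>k\<in>UNIV. f l k i * (s k * s i)) = P l s"
      unfolding P_def by (rule sum.swap)
    finally show ?thesis by (simp add: P_def)
  qed
  ultimately show ?thesis by (simp add: dP_def algebra_simps)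
qed

text \<open>The same differentiation in degree three: Euler's factor is now 3, and the constant
  becomes q + 3 - 1.\<close>

lemma proportional_cubic_form:
  fixes f :: "'q::finite \<Rightarrow> 'q \<Rightarrow> 'q \<Rightarrow> 'q \<Rightarrow> real"
  defines "P \<equiv> \<lambda>i s. \<Sum>j\<in>UNIV. \<Sum>k\<in>UNIV. \<Sum>m\<in>UNIV. f i j k m * (s j * s k * s m)"
  assumes proportional: "\<And>i l s. P i s * s l = P l s * s i"
  shows "(\<Sum>i\<in>UNIV. \<Sum>j\<in>UNIV. \<Sum>k\<in>UNIV. (f i i j k + f i j i k + f i j k i) * (s j * s k)) * s l = (real CARD('q) + 2) * P l s"
proof -
  define dP where "dP l i = (\<Sum>j\<in>UNIV. \<Sum>k\<in>UNIV. (f l i j k + f l j i k + f l j k i) * (s j * s k))" for l i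
  define e :: "'q \<Rightarrow> 'q \<Rightarrow> real" where "e i j = (if j = i then 1 else 0)" for i j
  have dP: "((\<lambda>x. P l (\<lambda>j. s j + x * e i j)) has_real_derivative dP l i) (at 0)" for l i
  proof -
    have "((\<lambda>x. P l (\<lambda>j. s j + x * e i j)) has_real_derivative
        (\<Sum>j\<in>UNIV. \<Sum>k\<in>UNIV. \<Sum>m\<in>UNIV. f l j k m * (e i j * (s k * s m)) + f l j k m * (e i k * (s j * s m)) + f l j k m * (e i m * (s j * s k)))) (at 0)"
      unfolding P_def by (intro DERIV_sum) (auto intro!: derivative_eq_intros simp: algebra_simps)
    also have "(\<Sum>j\<in>UNIV. \<Sum>k\<in>UNIV. \<Sum>m\<in>UNIV. f l j k m * (e i j * (s k * s m)) + f l j k m * (e i k * (s j * s m)) + f l j k m * (e i m * (s j * s k)))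
        = (\<Sum>k\<in>UNIV. \<Sum>m\<in>UNIV. \<Sum>j\<in>UNIV. f l j k m * (e i j * (s k * s m)))
        + (\<Sum>j\<in>UNIV. \<Sum>m\<in>UNIV. \<Sum>k\<in>UNIV. f l j k m * (e i k * (s j * s m)))
        + (\<Sum>j\<in>UNIV. \<Sum>k\<in>UNIV. \<Sum>m\<in>UNIV. f l j k m * (e i m * (s j * s k)))"
    proof -
      have "(\<Sum>j\<in>UNIV. \<Sum>k\<in>UNIV. \<Sum>m\<in>UNIV. f l j k m * (e i j * (s k * s m))) = (\<Sum>k\<in>UNIV. \<Sum>m\<in>UNIV. \<Sum>j\<in>UNIV. f l j k m * (e i j * (s k * s m)))"
        by (rule trans[OF sum.swap], rule sum.cong[OF refl], rule sum.swap)
      moreover have "(\<Sum>j\<in>UNIV. \<Sum>k\<in>UNIV. \<Sum>m\<in>UNIV. f l j k m * (e i k * (s j * s m))) = (\<Sum>j\<in>UNIV. \<Sum>m\<in>UNIV. \<Sum>k\<in>UNIV. f l j k m * (e i k * (s j * s m)))"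
        by (rule sum.cong[OF refl], rule sum.swap)
      ultimately show ?thesis by (simp only: sum.distrib)
    qed
    also have "\<dots> = dP l i"
      unfolding e_def sum_indicator dP_def sum.distrib[symmetric] by (intro sum.cong refl) (simp add: algebra_simps)
    finally show ?thesis .
  qed
  have "dP i i * s l + P i s * e i l = dP l i * s i + P l s" for i
  proof -
    have "((\<lambda>x. P i (\<lambda>j. s j + x * e i j) * (s l + x * e i l)) has_real_derivative dP i i * s l + P i s * e i l) (at 0)"
      by (rule DERIV_cong[OF DERIV_mult[OF dP]]) (auto intro!: derivative_eq_intros)
    moreover have "((\<lambda>x. P l (\<lambda>j. s j + x * e i j) * (s i + x * e i i)) has_real_derivative dP l i * s i + P l s * e i i) (at 0)"
      by (rule DERIV_cong[OF DERIV_mult[OF dP]]) (auto intro!: derivative_eq_intros)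
    moreover have "(\<lambda>x. P i (\<lambda>j. s j + x * e i j) * (s l + x * e i l)) = (\<lambda>x. P l (\<lambda>j. s j + x * e i j) * (s i + x * e i i))"
      using proportional by auto
    ultimately show ?thesis using DERIV_unique by (fastforce simp: e_def)
  qed
  then have "(\<Sum>i\<in>UNIV. dP i i * s l + P i s * e i l) = (\<Sum>i\<in>UNIV. dP l i * s i + P l s)" by simp
  then have "(\<Sum>i\<in>UNIV. dP i i) * s l + P l s = (\<Sum>i\<in>UNIV. dP l i * s i) + real CARD('q) * P l s"
    by (simp add: sum.distrib sum_distrib_right e_def if_distrib[of "\<lambda>u. _ * u"] cong: if_cong)
  moreover have "(\<Sum>i\<in>UNIV. dP l i * s i) = 3 * P l s"
  proof -
    have "(\<Sum>i\<in>UNIV. dP l i * s i) = (\<Sum>i\<in>UNIV. \<Sum>j\<in>UNIV. \<Sum>k\<in>UNIV. f l i j k * (s i * s j * s k))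
        + (\<Sum>i\<in>UNIV. \<Sum>j\<in>UNIV. \<Sum>k\<in>UNIV. f l j i k * (s j * s i * s k)) + (\<Sum>i\<in>UNIV. \<Sum>j\<in>UNIV. \<Sum>k\<in>UNIV. f l j k i * (s j * s k * s i))"
      unfolding dP_def sum_distrib_right sum.distrib[symmetric] by (intro sum.cong refl) (simp add: algebra_simps)
    also have "(\<Sum>i\<in>UNIV. \<Sum>j\<in>UNIV. \<Sum>k\<in>UNIV. f l j i k * (s j * s i * s k)) = P l s"
      unfolding P_def by (rule sum.swap)
    also have "(\<Sum>i\<in>UNIV. \<Sum>j\<in>UNIV. \<Sum>k\<in>UNIV. f l j k i * (s j * s k * s i)) = P l s"
      unfolding P_def by (rule trans[OF sum.swap], rule sum.cong[OF refl], rule sum.swap)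
    finally show ?thesis by (simp add: P_def)
  qed
  ultimately show ?thesis by (simp add: dP_def algebra_simps)
qed

text \<open>Polarization on basis vectors: the value at a sum of two of them minus the values at
  each.\<close>

lemma quadratic_form_zero:
  fixes f :: "'q::finite \<Rightarrow> 'q \<Rightarrow> real"
  assumes "\<And>s. (\<Sum>j\<in>UNIV. \<Sum>k\<in>UNIV. f j k * (s j * s k)) = 0"
  shows "f j k + f k j = 0"
proof -
  define Q where "Q s = (\<Sum>j\<in>UNIV. \<Sum>k\<in>UNIV. f j k * (s j * s k))" for s :: "'q \<Rightarrow> real"
  define e :: "'q \<Rightarrow> 'q \<Rightarrow> real" where "e i j = (if j = i then 1 else 0)" for i j
  have "Q (\<lambda>i. e j i + e k i) - Q (e j) - Q (e k) = (\<Sum>j'\<in>UNIV. \<Sum>k'\<in>UNIV. f j' k' * (e j j' * e k k' + e k j' * e j k'))"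
    unfolding Q_def sum_subtractf[symmetric] by (intro sum.cong refl) (simp add: algebra_simps)
  also have "\<dots> = f j k + f k j"
  proof -
    have "(\<Sum>j'\<in>UNIV. \<Sum>k'\<in>UNIV. f j' k' * (e a j' * e b k')) = f a b" for a b
      using sum_indicator(1)[of "\<lambda>j'. f j' b" a 1] by (simp add: e_def)
    then show ?thesis by (simp add: distrib_left sum.distrib)
  qed
  finally show ?thesis using assms by (simp add: Q_def)
qed

text \<open>Polarization by inclusion and exclusion over the nonempty subsets of three basis vectors
  isolates the part linear in each of them, which is 6 times the symmetrization.\<close>

lemma cubic_form_zero:
  fixes f :: "'q::finite \<Rightarrow> 'q \<Rightarrow> 'q \<Rightarrow> real"
  assumes zero: "\<And>s. (\<Sum>j\<in>UNIV. \<Sum>k\<in>UNIV. \<Sum>l\<in>UNIV. f j k l * (s j * s k * s l)) = 0"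
  shows "sym3 f j k l = 0"
proof -
  define T where "T u v w = (\<Sum>j\<in>UNIV. \<Sum>k\<in>UNIV. \<Sum>l\<in>UNIV. f j k l * (u j * v k * w l))" for u v w :: "'q \<Rightarrow> real"
  define e :: "'q \<Rightarrow> 'q \<Rightarrow> real" where "e i j = (if j = i then 1 else 0)" for i j
  have Tadd: "T (\<lambda>i. u i + x i) v w = T u v w + T x v w" "T u (\<lambda>i. v i + x i) w = T u v w + T u x w"
      "T u v (\<lambda>i. w i + x i) = T u v w + T u v x" for u v w x
    unfolding T_def sum.distrib[symmetric] by (intro sum.cong refl, simp add: algebra_simps)+
  have T0: "T s s s = 0" for s using zero by (simp add: T_def)
  have Te: "T (e a) (e b) (e c) = f a b c" for a b c
    using sum_indicator(1)[of "\<lambda>j'. f j' b c" a 1] by (simp add: e_def T_def)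
  have "T (\<lambda>i. e j i + e k i + e l i) (\<lambda>i. e j i + e k i + e l i) (\<lambda>i. e j i + e k i + e l i)
    - T (\<lambda>i. e j i + e k i) (\<lambda>i. e j i + e k i) (\<lambda>i. e j i + e k i)
    - T (\<lambda>i. e j i + e l i) (\<lambda>i. e j i + e l i) (\<lambda>i. e j i + e l i)
    - T (\<lambda>i. e k i + e l i) (\<lambda>i. e k i + e l i) (\<lambda>i. e k i + e l i)
    + T (e j) (e j) (e j) + T (e k) (e k) (e k) + T (e l) (e l) (e l)
    = 6 * sym3 f j k l"
    by (simp only: Tadd) (simp add: Te sym3_def)
  then show ?thesis unfolding T0 by simp
qed

section \<open>Pointwise algebra of torsion and curvature\<close>

lemma sum_single_row_row: "(\<Sum>j\<in>UNIV. single_row \<gamma> s \<alpha> j * f j) = (if \<alpha> = \<gamma> then \<Sum>j\<in>UNIV. s j * f j else 0)"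
  by (simp add: single_row_def)

lemma sum_single_row_column: "(\<Sum>\<beta>\<in>UNIV. f \<beta> * single_row \<gamma> s \<beta> i) = f \<gamma> * s i"
  for f :: "'p::finite \<Rightarrow> real"
proof -
  have "(\<Sum>\<beta>\<in>UNIV. f \<beta> * single_row \<gamma> s \<beta> i) = (\<Sum>\<beta>\<in>UNIV. if \<beta> = \<gamma> then f \<beta> * s i else 0)"
    by (rule sum.cong[OF refl]) (simp add: single_row_def)
  then show ?thesis by simp
qed

text \<open>The content of the structure equations at one point once the torsion alternates in its
  lower Latin indices. The Bianchi identity is available for arbitrary matrices because each of them
  has a horizontal lift; \<open>dA U\<close> stands for the derivative of the torsion along the lift
  of \<open>U\<close>.\<close>

locale curvature_data =
  fixes A :: "'q::finite \<Rightarrow> 'p::finite \<Rightarrow> 'p \<Rightarrow> 'p \<Rightarrow> 'q \<Rightarrow> 'q \<Rightarrow> real"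
    and dA :: "('p \<Rightarrow> 'q \<Rightarrow> real) \<Rightarrow> 'q \<Rightarrow> 'p \<Rightarrow> 'p \<Rightarrow> 'p \<Rightarrow> 'q \<Rightarrow> 'q \<Rightarrow> real"
    and L :: "'q \<Rightarrow> 'q \<Rightarrow> 'p \<Rightarrow> 'p \<Rightarrow> 'q \<Rightarrow> 'q \<Rightarrow> real"
    and H :: "'p \<Rightarrow> 'p \<Rightarrow> 'p \<Rightarrow> 'p \<Rightarrow> 'q \<Rightarrow> 'q \<Rightarrow> real"
  assumes bianchi: "quad (dA U i \<alpha>) V W + quad (dA V i \<alpha>) W U + quad (dA W i \<alpha>) U V
    + 2 * (quad (A i \<alpha>) (\<lambda>\<beta> j. quad (A j \<beta>) U V) W
         + quad (A i \<alpha>) (\<lambda>\<beta> j. quad (A j \<beta>) V W) U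
         + quad (A i \<alpha>) (\<lambda>\<beta> j. quad (A j \<beta>) W U) V)
    - (\<Sum>j\<in>UNIV. U \<alpha> j * quad (L i j) V W + V \<alpha> j * quad (L i j) W U + W \<alpha> j * quad (L i j) U V)
    + (\<Sum>\<beta>\<in>UNIV. quad (H \<beta> \<alpha>) U V * W \<beta> i + quad (H \<beta> \<alpha>) V W * U \<beta> i + quad (H \<beta> \<alpha>) W U * V \<beta> i) = 0"
    and A_alt: "A i \<alpha> \<beta> \<gamma> j k = - A i \<alpha> \<beta> \<gamma> k j"
    and A_skew: "A i \<alpha> \<beta> \<gamma> j k = - A i \<alpha> \<gamma> \<beta> k j"
    and dA_alt: "dA U i \<alpha> \<beta> \<gamma> j k = - dA U i \<alpha> \<beta> \<gamma> k j"
    and dA_trace_g: "(\<Sum>\<alpha>\<in>UNIV. dA U i \<alpha> \<alpha> \<gamma> j k) = 0"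
    and dA_trace_l: "(\<Sum>i\<in>UNIV. dA U i \<alpha> \<beta> \<gamma> i k) = 0"
    and L_skew: "L i j \<gamma> \<delta> k l = - L i j \<delta> \<gamma> l k"
    and L_trace: "(\<Sum>i\<in>UNIV. L i i \<gamma> \<delta> k l) = 0"
    and H_skew: "H \<beta> \<alpha> \<gamma> \<delta> k l = - H \<beta> \<alpha> \<delta> \<gamma> l k"
    and H_trace: "(\<Sum>\<alpha>\<in>UNIV. H \<alpha> \<alpha> \<gamma> \<delta> k l) = 0"
    and normal: "(\<Sum>\<alpha>\<in>UNIV. H \<gamma> \<alpha> \<alpha> \<delta> k l) - (\<Sum>i\<in>UNIV. L i k \<gamma> \<delta> i l)
          + (\<Sum>\<alpha>\<in>UNIV. H \<delta> \<alpha> \<alpha> \<gamma> l k) - (\<Sum>i\<in>UNIV. L i l \<delta> \<gamma> i k) = 0"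
begin

definition cubic_L :: "'q \<Rightarrow> 'p \<Rightarrow> 'p \<Rightarrow> ('q \<Rightarrow> real) \<Rightarrow> real" where
  "cubic_L i \<gamma> \<delta> s = (\<Sum>j\<in>UNIV. \<Sum>k\<in>UNIV. \<Sum>l\<in>UNIV. L i j \<gamma> \<delta> k l * (s j * s k * s l))"

definition quad_H :: "'p \<Rightarrow> 'p \<Rightarrow> 'p \<Rightarrow> 'p \<Rightarrow> ('q \<Rightarrow> real) \<Rightarrow> real" where
  "quad_H \<beta> \<gamma> \<delta> \<alpha> s = (\<Sum>k\<in>UNIV. \<Sum>l\<in>UNIV. H \<beta> \<alpha> \<gamma> \<delta> k l * (s k * s l))"

text \<open>A contraction of Ricci type, evaluated twice on \<open>s\<close>; \<open>trace_L\<close>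
  is its counterpart for the Latin curvature, and both appear in the normalization of the
  connection.\<close>

definition trace_H :: "'p \<Rightarrow> 'p \<Rightarrow> ('q \<Rightarrow> real) \<Rightarrow> real" where
  "trace_H \<gamma> \<delta> s = (\<Sum>\<alpha>\<in>UNIV. quad_H \<gamma> \<alpha> \<delta> \<alpha> s)"

definition trace_L :: "'p \<Rightarrow> 'p \<Rightarrow> ('q \<Rightarrow> real) \<Rightarrow> real" where
  "trace_L \<gamma> \<delta> s = (\<Sum>i\<in>UNIV. \<Sum>k\<in>UNIV. \<Sum>l\<in>UNIV. L i k \<gamma> \<delta> i l * (s k * s l))"

lemma quad_H_skew: "quad_H \<beta> \<gamma> \<delta> \<alpha> s = - quad_H \<beta> \<delta> \<gamma> \<alpha> s"
proof -
  have "quad_H \<beta> \<gamma> \<delta> \<alpha> s = (\<Sum>l\<in>UNIV. \<Sum>k\<in>UNIV. H \<beta> \<alpha> \<gamma> \<delta> k l * (s k * s l))"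
    unfolding quad_H_def by (rule sum.swap)
  also have "\<dots> = - quad_H \<beta> \<delta> \<gamma> \<alpha> s"
    unfolding quad_H_def sum_negf[symmetric] by (intro sum.cong refl) (subst H_skew, simp)
  finally show ?thesis .
qed

lemma quad_H_trace: "(\<Sum>\<alpha>\<in>UNIV. quad_H \<alpha> \<gamma> \<delta> \<alpha> s) = 0"
proof -
  have "(\<Sum>\<alpha>\<in>UNIV. quad_H \<alpha> \<gamma> \<delta> \<alpha> s) = (\<Sum>k\<in>UNIV. \<Sum>l\<in>UNIV. (\<Sum>\<alpha>\<in>UNIV. H \<alpha> \<alpha> \<gamma> \<delta> k l) * (s k * s l))"
    unfolding quad_H_def sum_distrib_right by (rule trans[OF sum.swap], rule sum.cong[OF refl], rule sum.swap)
  then show ?thesis by (simp add: H_trace)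
qed

lemma cubic_L_skew: "cubic_L i \<gamma> \<delta> s = - cubic_L i \<delta> \<gamma> s"
proof -
  have "cubic_L i \<gamma> \<delta> s = (\<Sum>j\<in>UNIV. \<Sum>l\<in>UNIV. \<Sum>k\<in>UNIV. L i j \<gamma> \<delta> k l * (s j * s k * s l))"
    unfolding cubic_L_def by (rule sum.cong[OF refl], rule sum.swap)
  also have "\<dots> = - cubic_L i \<delta> \<gamma> s"
    unfolding cubic_L_def sum_negf[symmetric] by (intro sum.cong refl) (subst L_skew, simp)
  finally show ?thesis .
qed

lemma normal_traces: "trace_H \<gamma> \<delta> s - trace_L \<gamma> \<delta> s + trace_H \<delta> \<gamma> s - trace_L \<delta> \<gamma> s = 0"
proof -
  have tH: "trace_H \<gamma> \<delta> s = (\<Sum>k\<in>UNIV. \<Sum>l\<in>UNIV. (\<Sum>\<alpha>\<in>UNIV. H \<gamma> \<alpha> \<alpha> \<delta> k l) * (s k * s l))" for \<gamma> \<delta>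
    unfolding trace_H_def quad_H_def sum_distrib_right by (rule trans[OF sum.swap], rule sum.cong[OF refl], rule sum.swap)
  have tH': "trace_H \<gamma> \<delta> s = (\<Sum>k\<in>UNIV. \<Sum>l\<in>UNIV. (\<Sum>\<alpha>\<in>UNIV. H \<gamma> \<alpha> \<alpha> \<delta> l k) * (s k * s l))" for \<gamma> \<delta>
    unfolding tH by (subst sum.swap) (simp add: mult.commute)
  have tL: "trace_L \<gamma> \<delta> s = (\<Sum>k\<in>UNIV. \<Sum>l\<in>UNIV. (\<Sum>i\<in>UNIV. L i k \<gamma> \<delta> i l) * (s k * s l))" for \<gamma> \<delta>
    unfolding trace_L_def sum_distrib_right by (rule trans[OF sum.swap], rule sum.cong[OF refl], rule sum.swap)
  have tL': "trace_L \<gamma> \<delta> s = (\<Sum>k\<in>UNIV. \<Sum>l\<in>UNIV. (\<Sum>i\<in>UNIV. L i l \<gamma> \<delta> i k) * (s k * s l))" for \<gamma> \<delta>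
    unfolding tL by (subst sum.swap) (simp add: mult.commute)
  show ?thesis
    unfolding tH[of \<gamma> \<delta>] tH'[of \<delta> \<gamma>] tL[of \<gamma> \<delta>] tL'[of \<delta> \<gamma>]
      sum.distrib[symmetric] sum_subtractf[symmetric] left_diff_distrib[symmetric] distrib_right[symmetric]
    by (simp add: normal)
qed

lemma alt_form_zero: "(\<And>j k. f j k = - f k j) \<Longrightarrow> (\<Sum>j\<in>UNIV. \<Sum>k\<in>UNIV. f j k * (s j * s k)) = 0"
  for f :: "'q \<Rightarrow> 'q \<Rightarrow> real"
proof (rule sum_sym2_zero)
  fix j k assume "\<And>j k. f j k = - f k j"
  then have "f j k = - f k j" .
  then show "sym2 f j k = 0" by (simp add: sym2_def)
qed

lemma A_row_zero: "quad (A j \<beta>) (single_row \<gamma> s) (single_row \<delta> s) = 0"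
  unfolding quad_single_rows by (rule alt_form_zero) (rule A_alt)

lemma dA_row_zero: "quad (dA U j \<beta>) (single_row \<gamma> s) (single_row \<delta> s) = 0"
  unfolding quad_single_rows by (rule alt_form_zero) (rule dA_alt)

lemma quad_L_row: "(\<Sum>j\<in>UNIV. s j * quad (L i j) (single_row \<gamma> s) (single_row \<delta> s)) = cubic_L i \<gamma> \<delta> s"
  unfolding quad_single_rows cubic_L_def sum_distrib_left by (intro sum.cong refl) simp

lemma quad_H_row: "quad (H \<beta> \<alpha>) (single_row \<gamma> s) (single_row \<delta> s) = quad_H \<beta> \<gamma> \<delta> \<alpha> s"
  unfolding quad_single_rows quad_H_def ..

text \<open>On three matrices with the same \<open>s\<close>, an alternating torsion and its
  derivative vanish identically, so the Bianchi identity reduces to a relation between the two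
  curvatures.\<close>

lemma bianchi_rows:
  "s i * (quad_H \<delta> \<beta> \<gamma> \<alpha> s + quad_H \<beta> \<gamma> \<delta> \<alpha> s + quad_H \<gamma> \<delta> \<beta> \<alpha> s)
    = (if \<alpha> = \<beta> then cubic_L i \<gamma> \<delta> s else 0) + (if \<alpha> = \<gamma> then cubic_L i \<delta> \<beta> s else 0) + (if \<alpha> = \<delta> then cubic_L i \<beta> \<gamma> s else 0)"
  using bianchi[of "single_row \<beta> s" i \<alpha> "single_row \<gamma> s" "single_row \<delta> s"]
  unfolding A_row_zero dA_row_zero quad_zero sum.distrib sum_single_row_row sum_single_row_column quad_L_row quad_H_row
  by (simp add: algebra_simps)

text \<open>Contraction of the Bianchi identity: the first matrix runs through the matrix units,
  paired with the free indices. The derivative terms vanish by alternation or by the trace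
  conditions, and the terms quadratic in the torsion are traces of products of two endomorphisms in
  opposite orders with opposite signs.\<close>

lemma bianchi_trace: "trace_L \<gamma> \<delta> s - trace_L \<delta> \<gamma> s + trace_H \<delta> \<gamma> s - trace_H \<gamma> \<delta> s = 0"
proof -
  define \<epsilon> where "\<epsilon> i = (\<lambda>j::'q. if j = i then 1 else (0::real))" for i
  \<comment> \<open>The endomorphism of the model space that inserts
    \<open>single_row \<delta> s\<close> into the second slot of the torsion.\<close>
  define M where "M \<delta> i \<alpha> j \<beta> = (\<Sum>l\<in>UNIV. A i \<alpha> \<beta> \<delta> j l * s l)" for \<delta> i \<alpha> j \<beta>
  let ?E = "\<lambda>\<alpha> i. single_row \<alpha> (\<epsilon> i)" and ?V = "single_row \<gamma> s" and ?W = "single_row \<delta> s"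
  have sum4: "(\<Sum>\<alpha>\<in>UNIV. \<Sum>i\<in>UNIV. f \<alpha> i) = (\<Sum>i\<in>UNIV. \<Sum>\<alpha>\<in>UNIV. f \<alpha> i)" for f :: "'p \<Rightarrow> 'q \<Rightarrow> real"
    by (rule sum.swap)
  have eps: "(\<Sum>j\<in>UNIV. \<Sum>k\<in>UNIV. c j k * (\<epsilon> i j * s k)) = (\<Sum>k\<in>UNIV. c i k * s k)"
      "(\<Sum>j\<in>UNIV. \<Sum>k\<in>UNIV. c j k * (s j * \<epsilon> i k)) = (\<Sum>j\<in>UNIV. c j i * s j)" for c :: "'q \<Rightarrow> 'q \<Rightarrow> real" and i
  proof -
    have "(\<Sum>j\<in>UNIV. \<Sum>k\<in>UNIV. c j k * (\<epsilon> i j * s k)) = (\<Sum>k\<in>UNIV. \<Sum>j\<in>UNIV. c j k * (\<epsilon> i j * s k))"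
      by (rule sum.swap)
    then show "(\<Sum>j\<in>UNIV. \<Sum>k\<in>UNIV. c j k * (\<epsilon> i j * s k)) = (\<Sum>k\<in>UNIV. c i k * s k)"
      by (simp add: \<epsilon>_def)
    show "(\<Sum>j\<in>UNIV. \<Sum>k\<in>UNIV. c j k * (s j * \<epsilon> i k)) = (\<Sum>j\<in>UNIV. c j i * s j)"
      by (simp add: \<epsilon>_def)
  qed
  have dA_skew': "(\<Sum>\<alpha>\<in>UNIV. \<Sum>i\<in>UNIV. quad (dA ?V i \<alpha>) ?W (?E \<alpha> i)) = 0"
  proof -
    have "(\<Sum>i\<in>UNIV. quad (dA ?V i \<alpha>) ?W (?E \<alpha> i)) = (\<Sum>j\<in>UNIV. (\<Sum>i\<in>UNIV. dA ?V i \<alpha> \<delta> \<alpha> j i) * s j)" for \<alpha>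
      unfolding quad_single_rows eps sum_distrib_right by (rule sum.swap)
    moreover have "(\<Sum>i\<in>UNIV. dA ?V i \<alpha> \<delta> \<alpha> j i) = 0" for j \<alpha>
      using dA_trace_l[of ?V \<alpha> \<delta> \<alpha> j] by (subst dA_alt) (simp add: sum_negf)
    ultimately show ?thesis by simp
  qed
  have dA_tr: "(\<Sum>\<alpha>\<in>UNIV. \<Sum>i\<in>UNIV. quad (dA ?W i \<alpha>) (?E \<alpha> i) ?V) = 0"
  proof -
    have "(\<Sum>\<alpha>\<in>UNIV. quad (dA ?W i \<alpha>) (?E \<alpha> i) ?V) = (\<Sum>k\<in>UNIV. (\<Sum>\<alpha>\<in>UNIV. dA ?W i \<alpha> \<alpha> \<gamma> i k) * s k)" for i
      unfolding quad_single_rows eps sum_distrib_right by (rule sum.swap)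
    then show ?thesis unfolding sum4 by (simp add: dA_trace_g)
  qed
  have factor: "(\<Sum>k\<in>UNIV. c k * (X * s k)) = (\<Sum>k\<in>UNIV. c k * s k) * X" for c :: "'q \<Rightarrow> real" and X
    unfolding sum_distrib_right by (intro sum.cong refl) simp
  have T1: "(\<Sum>\<alpha>\<in>UNIV. \<Sum>i\<in>UNIV. quad (A i \<alpha>) (\<lambda>\<beta> j. quad (A j \<beta>) (?E \<alpha> i) ?V) ?W)
    = (\<Sum>\<alpha>\<in>UNIV. \<Sum>i\<in>UNIV. \<Sum>\<beta>\<in>UNIV. \<Sum>j\<in>UNIV. M \<delta> i \<alpha> j \<beta> * M \<gamma> j \<beta> i \<alpha>)"
    unfolding quad_single_row_right[of "A _ _"] quad_single_rows eps M_def
    by (rule sum.cong[OF refl], rule sum.cong[OF refl], rule sum.cong[OF refl], rule sum.cong[OF refl], rule factor)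
  have T2: "(\<Sum>\<alpha>\<in>UNIV. \<Sum>i\<in>UNIV. quad (A i \<alpha>) (\<lambda>\<beta> j. quad (A j \<beta>) ?W (?E \<alpha> i)) ?V)
    = - (\<Sum>\<alpha>\<in>UNIV. \<Sum>i\<in>UNIV. \<Sum>\<beta>\<in>UNIV. \<Sum>j\<in>UNIV. M \<gamma> i \<alpha> j \<beta> * M \<delta> j \<beta> i \<alpha>)"
  proof -
    have "quad (A j \<beta>) ?W (?E \<alpha> i) = - quad (A j \<beta>) (?E \<alpha> i) ?W" for j \<beta> \<alpha> i
      by (rule quad_swap) (rule A_skew)
    then have "(\<Sum>\<alpha>\<in>UNIV. \<Sum>i\<in>UNIV. quad (A i \<alpha>) (\<lambda>\<beta> j. quad (A j \<beta>) ?W (?E \<alpha> i)) ?V)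
      = - (\<Sum>\<alpha>\<in>UNIV. \<Sum>i\<in>UNIV. quad (A i \<alpha>) (\<lambda>\<beta> j. quad (A j \<beta>) (?E \<alpha> i) ?W) ?V)"
      unfolding quad_single_row_right[of "A _ _"] by (simp add: sum_negf)
    also have "(\<Sum>\<alpha>\<in>UNIV. \<Sum>i\<in>UNIV. quad (A i \<alpha>) (\<lambda>\<beta> j. quad (A j \<beta>) (?E \<alpha> i) ?W) ?V)
      = (\<Sum>\<alpha>\<in>UNIV. \<Sum>i\<in>UNIV. \<Sum>\<beta>\<in>UNIV. \<Sum>j\<in>UNIV. M \<gamma> i \<alpha> j \<beta> * M \<delta> j \<beta> i \<alpha>)"
      unfolding quad_single_row_right[of "A _ _"] quad_single_rows eps M_def
      by (rule sum.cong[OF refl], rule sum.cong[OF refl], rule sum.cong[OF refl], rule sum.cong[OF refl], rule factor)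
    finally show ?thesis .
  qed
  \<comment> \<open>Invariance of the trace under exchange of the factors, written with double
    indices.\<close>
  have T12: "(\<Sum>\<alpha>\<in>UNIV. \<Sum>i\<in>UNIV. \<Sum>\<beta>\<in>UNIV. \<Sum>j\<in>UNIV. M \<delta> i \<alpha> j \<beta> * M \<gamma> j \<beta> i \<alpha>)
    = (\<Sum>\<alpha>\<in>UNIV. \<Sum>i\<in>UNIV. \<Sum>\<beta>\<in>UNIV. \<Sum>j\<in>UNIV. M \<gamma> i \<alpha> j \<beta> * M \<delta> j \<beta> i \<alpha>)"
  proof -
    have "(\<Sum>\<alpha>\<in>UNIV. \<Sum>i\<in>UNIV. \<Sum>\<beta>\<in>UNIV. \<Sum>j\<in>UNIV. M \<delta> i \<alpha> j \<beta> * M \<gamma> j \<beta> i \<alpha>)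
      = (\<Sum>\<alpha>\<in>UNIV. \<Sum>\<beta>\<in>UNIV. \<Sum>j\<in>UNIV. \<Sum>i\<in>UNIV. M \<delta> i \<alpha> j \<beta> * M \<gamma> j \<beta> i \<alpha>)"
      by (rule sum.cong[OF refl], rule trans[OF sum.swap], rule sum.cong[OF refl], rule sum.swap)
    also have "\<dots> = (\<Sum>\<beta>\<in>UNIV. \<Sum>j\<in>UNIV. \<Sum>\<alpha>\<in>UNIV. \<Sum>i\<in>UNIV. M \<delta> i \<alpha> j \<beta> * M \<gamma> j \<beta> i \<alpha>)"
      by (rule trans[OF sum.swap], rule sum.cong[OF refl], rule sum.swap)
    finally show ?thesis by (simp only: mult.commute)
  qed
  have L1: "(\<Sum>\<alpha>\<in>(UNIV::'p set). \<Sum>i\<in>UNIV. \<Sum>j\<in>UNIV. ?E \<alpha> i \<alpha> j * quad (L i j) ?V ?W) = 0"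
  proof -
    have "(\<Sum>i\<in>UNIV. quad (L i i) ?V ?W) = (\<Sum>j\<in>UNIV. \<Sum>k\<in>UNIV. (\<Sum>i\<in>UNIV. L i i \<gamma> \<delta> j k) * (s j * s k))"
      unfolding quad_single_rows sum_distrib_right by (rule trans[OF sum.swap], rule sum.cong[OF refl], rule sum.swap)
    then have 0: "(\<Sum>i\<in>UNIV. quad (L i i) ?V ?W) = 0" by (simp add: L_trace)
    have row: "(\<Sum>j\<in>UNIV. ?E \<alpha> i \<alpha> j * quad (L i j) ?V ?W) = quad (L i i) ?V ?W" for \<alpha> :: 'p and i
      unfolding sum_single_row_row by (simp add: \<epsilon>_def if_distrib[of "\<lambda>u. u * _"] cong: if_cong)
    show ?thesis unfolding row 0 by simp
  qed
  have L3: "(\<Sum>\<alpha>\<in>UNIV. \<Sum>i\<in>UNIV. \<Sum>j\<in>UNIV. single_row \<delta> s \<alpha> j * quad (L i j) (?E \<alpha> i) (single_row \<gamma> s)) = trace_L \<delta> \<gamma> s" for \<gamma> \<delta>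
  proof -
    have "(\<Sum>\<alpha>\<in>UNIV. \<Sum>i\<in>UNIV. \<Sum>j\<in>UNIV. single_row \<delta> s \<alpha> j * quad (L i j) (?E \<alpha> i) (single_row \<gamma> s))
      = (\<Sum>i\<in>UNIV. \<Sum>\<alpha>\<in>UNIV. if \<alpha> = \<delta> then (\<Sum>j\<in>UNIV. s j * (\<Sum>k\<in>UNIV. L i j \<alpha> \<gamma> i k * s k)) else 0)"
      unfolding sum4 sum_single_row_row quad_single_rows eps ..
    also have "\<dots> = (\<Sum>i\<in>UNIV. \<Sum>j\<in>UNIV. s j * (\<Sum>k\<in>UNIV. L i j \<delta> \<gamma> i k * s k))" by simp
    also have "\<dots> = trace_L \<delta> \<gamma> s"
      unfolding trace_L_def sum_distrib_left by (intro sum.cong refl) simp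
    finally show ?thesis .
  qed
  have L2: "(\<Sum>\<alpha>\<in>UNIV. \<Sum>i\<in>UNIV. \<Sum>j\<in>UNIV. ?V \<alpha> j * quad (L i j) ?W (?E \<alpha> i)) = - trace_L \<gamma> \<delta> s"
  proof -
    have "quad (L i j) ?W (?E \<alpha> i) = - quad (L i j) (?E \<alpha> i) ?W" for j \<alpha> i
      by (rule quad_swap) (rule L_skew)
    then show ?thesis using L3[of \<gamma> \<delta>] by (simp add: sum_negf)
  qed
  have H1: "(\<Sum>\<alpha>\<in>UNIV. \<Sum>i\<in>UNIV. \<Sum>\<beta>\<in>UNIV. quad (H \<beta> \<alpha>) (?E \<alpha> i) (single_row \<gamma> s) * single_row \<delta> s \<beta> i) = trace_H \<delta> \<gamma> s" for \<gamma> \<delta>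
    unfolding sum_single_row_column unfolding quad_single_rows eps trace_H_def quad_H_def sum_distrib_right
    by (intro sum.cong refl) simp
  have H2: "(\<Sum>\<alpha>\<in>UNIV. \<Sum>i\<in>UNIV. \<Sum>\<beta>\<in>UNIV. quad (H \<beta> \<alpha>) ?V ?W * ?E \<alpha> i \<beta> i) = 0"
  proof -
    have "(\<Sum>\<alpha>\<in>UNIV. \<Sum>i\<in>UNIV. \<Sum>\<beta>\<in>UNIV. quad (H \<beta> \<alpha>) ?V ?W * ?E \<alpha> i \<beta> i) = (\<Sum>i\<in>(UNIV::'q set). \<Sum>\<alpha>\<in>UNIV. quad_H \<alpha> \<gamma> \<delta> \<alpha> s)"
      unfolding sum_single_row_column quad_H_row by (subst sum.swap) (simp add: \<epsilon>_def)
    then show ?thesis by (simp add: quad_H_trace)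
  qed
  have H3: "(\<Sum>\<alpha>\<in>UNIV. \<Sum>i\<in>UNIV. \<Sum>\<beta>\<in>UNIV. quad (H \<beta> \<alpha>) ?W (?E \<alpha> i) * ?V \<beta> i) = - trace_H \<gamma> \<delta> s"
  proof -
    have "quad (H \<beta> \<alpha>) ?W (?E \<alpha> i) = - quad (H \<beta> \<alpha>) (?E \<alpha> i) ?W" for \<beta> \<alpha> i
      by (rule quad_swap) (rule H_skew)
    then show ?thesis using H1[of \<delta> \<gamma>] by (simp add: sum_negf)
  qed
  have "(\<Sum>\<alpha>\<in>UNIV. \<Sum>i\<in>UNIV. quad (dA (?E \<alpha> i) i \<alpha>) ?V ?W + quad (dA ?V i \<alpha>) ?W (?E \<alpha> i) + quad (dA ?W i \<alpha>) (?E \<alpha> i) ?V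
    + 2 * (quad (A i \<alpha>) (\<lambda>\<beta> j. quad (A j \<beta>) (?E \<alpha> i) ?V) ?W
         + quad (A i \<alpha>) (\<lambda>\<beta> j. quad (A j \<beta>) ?V ?W) (?E \<alpha> i)
         + quad (A i \<alpha>) (\<lambda>\<beta> j. quad (A j \<beta>) ?W (?E \<alpha> i)) ?V)
    - (\<Sum>j\<in>UNIV. ?E \<alpha> i \<alpha> j * quad (L i j) ?V ?W + ?V \<alpha> j * quad (L i j) ?W (?E \<alpha> i) + ?W \<alpha> j * quad (L i j) (?E \<alpha> i) ?V)
    + (\<Sum>\<beta>\<in>UNIV. quad (H \<beta> \<alpha>) (?E \<alpha> i) ?V * ?W \<beta> i + quad (H \<beta> \<alpha>) ?V ?W * ?E \<alpha> i \<beta> i + quad (H \<beta> \<alpha>) ?W (?E \<alpha> i) * ?V \<beta> i)) = 0"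
    by (simp only: bianchi sum.neutral_const)
  then show ?thesis
    unfolding A_row_zero dA_row_zero quad_zero sum.distrib sum_subtractf sum_distrib_left[symmetric] dA_skew' dA_tr T1 T2 T12 L1 L2 L3 H1 H2 H3
    by simp
qed

text \<open>For s not 0, proportionality means that the cubic form is
  \<open>s i * \<mu> \<gamma> \<delta>\<close> with \<mu> skew. Two contractions express \<mu>, once
  through \<open>trace_H\<close> and once through \<open>trace_L\<close>, and the contracted Bianchi
  identity adds them to 0. With \<mu> = 0 the relation on rows becomes the vanishing of the cyclic
  sum of \<open>quad_H\<close>.\<close>

theorem curvature_vanishes:
  assumes L_prop: "\<And>i l \<gamma> \<delta> s. cubic_L i \<gamma> \<delta> s * s l = cubic_L l \<gamma> \<delta> s * s i"
  shows "cubic_L i \<gamma> \<delta> s = 0" and "quad_H \<delta> \<beta> \<gamma> \<alpha> s + quad_H \<beta> \<gamma> \<delta> \<alpha> s + quad_H \<gamma> \<delta> \<beta> \<alpha> s = 0"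
proof -
  have "cubic_L i \<gamma> \<delta> s = 0 \<and> quad_H \<delta> \<beta> \<gamma> \<alpha> s + quad_H \<beta> \<gamma> \<delta> \<alpha> s + quad_H \<gamma> \<delta> \<beta> \<alpha> s = 0"
  proof (cases "\<exists>l. s l \<noteq> 0")
    case True
    then obtain l where l: "s l \<noteq> 0" by blast
    define \<mu> where "\<mu> \<gamma> \<delta> = cubic_L l \<gamma> \<delta> s / s l" for \<gamma> \<delta>
    have \<mu>: "cubic_L i \<gamma> \<delta> s = s i * \<mu> \<gamma> \<delta>" for i \<gamma> \<delta>
      using L_prop[of i \<gamma> \<delta> s l] l by (simp add: \<mu>_def field_simps)
    have \<mu>_skew: "\<mu> \<gamma> \<delta> = - \<mu> \<delta> \<gamma>" for \<gamma> \<delta>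
      unfolding \<mu>_def by (subst cubic_L_skew) simp
    have rows: "quad_H \<delta> \<beta> \<gamma> \<alpha> s + quad_H \<beta> \<gamma> \<delta> \<alpha> s + quad_H \<gamma> \<delta> \<beta> \<alpha> s
      = (if \<alpha> = \<beta> then \<mu> \<gamma> \<delta> else 0) + (if \<alpha> = \<gamma> then \<mu> \<delta> \<beta> else 0) + (if \<alpha> = \<delta> then \<mu> \<beta> \<gamma> else 0)" for \<alpha> \<beta> \<gamma> \<delta>
    proof -
      have "s l * (quad_H \<delta> \<beta> \<gamma> \<alpha> s + quad_H \<beta> \<gamma> \<delta> \<alpha> s + quad_H \<gamma> \<delta> \<beta> \<alpha> s)
        = s l * ((if \<alpha> = \<beta> then \<mu> \<gamma> \<delta> else 0) + (if \<alpha> = \<gamma> then \<mu> \<delta> \<beta> else 0) + (if \<alpha> = \<delta> then \<mu> \<beta> \<gamma> else 0))"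
        unfolding bianchi_rows \<mu> by (simp add: distrib_left)
      then show ?thesis using l by simp
    qed
    \<comment> \<open>Setting \<beta> = \<alpha> and summing: the first delta term gives p copies of
      \<mu>, the other two give \<mu> with exchanged indices, that is -1 each.\<close>
    have tH: "(real CARD('p) - 2) * \<mu> \<gamma> \<delta> = trace_H \<delta> \<gamma> s - trace_H \<gamma> \<delta> s" for \<gamma> \<delta>
    proof -
      have "trace_H \<delta> \<gamma> s - trace_H \<gamma> \<delta> s = (\<Sum>\<alpha>\<in>UNIV. quad_H \<delta> \<alpha> \<gamma> \<alpha> s + quad_H \<alpha> \<gamma> \<delta> \<alpha> s + quad_H \<gamma> \<delta> \<alpha> \<alpha> s)"
      proof -
        have "(\<Sum>\<alpha>\<in>UNIV. quad_H \<gamma> \<delta> \<alpha> \<alpha> s) = - trace_H \<gamma> \<delta> s"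
          unfolding trace_H_def sum_negf[symmetric] by (intro sum.cong refl quad_H_skew)
        then show ?thesis by (simp add: sum.distrib quad_H_trace trace_H_def)
      qed
      also have "\<dots> = (\<Sum>\<alpha>\<in>UNIV. \<mu> \<gamma> \<delta> + (if \<alpha> = \<gamma> then \<mu> \<delta> \<alpha> else 0) + (if \<alpha> = \<delta> then \<mu> \<alpha> \<gamma> else 0))"
        by (simp only: rows if_True refl)
      also have "\<dots> = real CARD('p) * \<mu> \<gamma> \<delta> + 2 * \<mu> \<delta> \<gamma>"
        by (simp add: sum.distrib)
      finally show ?thesis using \<mu>_skew[of \<delta> \<gamma>] by (simp add: algebra_simps)
    qed
    \<comment> \<open>The divergence of the cubic form, computed by
      \<open>proportional_cubic_form\<close>. Of its three traces one vanishes and skewness of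
      \<open>L\<close> turns the other two into \<open>trace_L\<close> in both orders.\<close>
    have tL: "(real CARD('q) + 2) * \<mu> \<gamma> \<delta> = trace_L \<gamma> \<delta> s - trace_L \<delta> \<gamma> s" for \<gamma> \<delta>
    proof -
      have f1: "(\<Sum>i\<in>UNIV. \<Sum>j\<in>UNIV. \<Sum>k\<in>UNIV. (L i i \<gamma> \<delta> j k + L i j \<gamma> \<delta> i k + L i j \<gamma> \<delta> k i) * (s j * s k)) * s l
          = (real CARD('q) + 2) * cubic_L l \<gamma> \<delta> s"
        unfolding cubic_L_def by (rule proportional_cubic_form) (rule L_prop[unfolded cubic_L_def])
      have f2: "(\<Sum>i\<in>UNIV. \<Sum>j\<in>UNIV. \<Sum>k\<in>UNIV. (L i i \<gamma> \<delta> j k + L i j \<gamma> \<delta> i k + L i j \<gamma> \<delta> k i) * (s j * s k))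
          = trace_L \<gamma> \<delta> s - trace_L \<delta> \<gamma> s"
      proof -
        have 1: "(\<Sum>i\<in>UNIV. \<Sum>j\<in>UNIV. \<Sum>k\<in>UNIV. L i i \<gamma> \<delta> j k * (s j * s k)) = 0"
        proof -
          have "(\<Sum>i\<in>UNIV. \<Sum>j\<in>UNIV. \<Sum>k\<in>UNIV. L i i \<gamma> \<delta> j k * (s j * s k)) = (\<Sum>j\<in>UNIV. \<Sum>k\<in>UNIV. (\<Sum>i\<in>UNIV. L i i \<gamma> \<delta> j k) * (s j * s k))"
            unfolding sum_distrib_right by (rule trans[OF sum.swap], rule sum.cong[OF refl], rule sum.swap)
          then show ?thesis by (simp add: L_trace)
        qed
        have 2: "(\<Sum>i\<in>UNIV. \<Sum>j\<in>UNIV. \<Sum>k\<in>UNIV. L i j \<gamma> \<delta> k i * (s j * s k)) = - trace_L \<delta> \<gamma> s"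
          unfolding trace_L_def sum_negf[symmetric] by (intro sum.cong refl) (subst L_skew, simp)
        show ?thesis
          unfolding distrib_right sum.distrib 1 2 by (simp add: trace_L_def)
      qed
      have "s l * ((real CARD('q) + 2) * \<mu> \<gamma> \<delta>) = s l * (trace_L \<gamma> \<delta> s - trace_L \<delta> \<gamma> s)"
        using f1[unfolded f2 \<mu>] by (auto simp: mult.commute mult.left_commute)
      then show ?thesis using l by simp
    qed
    have \<mu>0: "\<mu> \<gamma> \<delta> = 0" for \<gamma> \<delta>
    proof -
      \<comment> \<open>(p - 2) + (q + 2): the right-hand sides of \<open>tH\<close> and
        \<open>tL\<close> add up to the expression in \<open>bianchi_trace\<close>.\<close>
      have "(real CARD('p) + real CARD('q)) * \<mu> \<gamma> \<delta> = 0"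
        using tH[of \<gamma> \<delta>] tL[of \<gamma> \<delta>] bianchi_trace[of \<gamma> \<delta> s] normal_traces[of \<gamma> \<delta> s] by (simp add: algebra_simps)
      then show ?thesis by (simp add: add_nonneg_eq_0_iff)
    qed
    show ?thesis unfolding \<mu> rows \<mu>0 by simp
  next
    case False
    then have "s = (\<lambda>_. 0)" by auto
    then show ?thesis by (simp add: cubic_L_def quad_H_def)
  qed
  then show "cubic_L i \<gamma> \<delta> s = 0" "quad_H \<delta> \<beta> \<gamma> \<alpha> s + quad_H \<beta> \<gamma> \<delta> \<alpha> s + quad_H \<gamma> \<delta> \<beta> \<alpha> s = 0"
    by blast+
qed

end

text \<open>The divergence that determines a proportional quadratic form is here a combination of
  the two vanishing traces, so the form is 0 and polarization gives the claim.\<close>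

lemma traceless_proportional_sym2:
  fixes f :: "'q::finite \<Rightarrow> 'q \<Rightarrow> 'q \<Rightarrow> real"
  assumes prop_s: "\<And>i l s. (\<Sum>j\<in>UNIV. \<Sum>k\<in>UNIV. f i j k * (s j * s k)) * s l = (\<Sum>j\<in>UNIV. \<Sum>k\<in>UNIV. f l j k * (s j * s k)) * s i"
    and trace1: "\<And>k. (\<Sum>i\<in>UNIV. f i i k) = 0" and trace2: "\<And>k. (\<Sum>i\<in>UNIV. f i k i) = 0"
  shows "sym2 (f l) j k = 0"
proof -
  have "(\<Sum>j\<in>UNIV. \<Sum>k\<in>UNIV. f l j k * (s j * s k)) = 0" for s
  proof -
    have "(\<Sum>i\<in>UNIV. \<Sum>k\<in>UNIV. (f i i k + f i k i) * s k) = (\<Sum>k\<in>UNIV. ((\<Sum>i\<in>UNIV. f i i k) + (\<Sum>i\<in>UNIV. f i k i)) * s k)"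
      unfolding sum.distrib[symmetric] sum_distrib_right by (rule sum.swap)
    then have "(real CARD('q) + 1) * (\<Sum>j\<in>UNIV. \<Sum>k\<in>UNIV. f l j k * (s j * s k)) = 0"
      using proportional_quadratic_form[of f s l, OF prop_s] by (simp add: trace1 trace2)
    then show ?thesis by (simp add: add_nonneg_eq_0_iff)
  qed
  from quadratic_form_zero[of "f l", OF this] show ?thesis by (simp add: sym2_def)
qed

context cartan_forms
begin

text \<open>Passes from forms to the algebra at one point. The torsion condition is required on all
  of \<open>S\<close>, because the derivative of the torsion must alternate as well.\<close>

lemma curvature_symmetries:
  assumes y: "y \<in> S"
    and lift: "\<And>Z. \<exists>x. (\<forall>\<alpha> i. \<theta> \<alpha> i y x = Z \<alpha> i) \<and> \<omega> y x = 0 \<and> (\<forall>\<alpha> \<beta>. \<omega>g \<alpha> \<beta> y x = 0)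
      \<and> (\<forall>i j. \<omega>l i j y x = 0) \<and> (\<forall>i \<alpha>. \<psi> i \<alpha> y x = 0)"
    and a_sym: "\<And>i \<beta> \<gamma> \<alpha> j k x. x \<in> S \<Longrightarrow> sym2 (\<lambda>j k. a i \<beta> \<gamma> \<alpha> j k x) j k = 0"
    and bl_prop: "\<And>i l \<gamma> \<delta> s. (\<Sum>j\<in>UNIV. \<Sum>k\<in>UNIV. \<Sum>m\<in>UNIV. bl i \<gamma> \<delta> j k m y * (s j * s k * s m)) * s l
      = (\<Sum>j\<in>UNIV. \<Sum>k\<in>UNIV. \<Sum>m\<in>UNIV. bl l \<gamma> \<delta> j k m y * (s j * s k * s m)) * s i"
  shows "sym3 (\<lambda>j k l. bl i \<gamma> \<delta> j k l y) j k l = 0"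
    and "alt3 (\<lambda>\<beta> \<gamma> \<delta>. bg \<beta> \<gamma> \<delta> \<alpha> k l y) \<beta> \<gamma> \<delta> = 0"
proof -
  obtain X where X: "\<And>Z \<alpha> i. \<theta> \<alpha> i y (X Z) = Z \<alpha> i" "\<And>Z. \<omega> y (X Z) = 0" "\<And>Z \<alpha> \<beta>. \<omega>g \<alpha> \<beta> y (X Z) = 0"
    "\<And>Z i j. \<omega>l i j y (X Z) = 0" "\<And>Z i \<alpha>. \<psi> i \<alpha> y (X Z) = 0"
    using lift by metis
  let ?A = "\<lambda>i \<alpha> \<beta> \<gamma> j k. a i \<beta> \<gamma> \<alpha> j k y"
  let ?dA = "\<lambda>Z i \<alpha> \<beta> \<gamma> j k. frechet_derivative (a i \<beta> \<gamma> \<alpha> j k) (at y) (X Z)"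
  let ?L = "\<lambda>i j \<gamma> \<delta> k l. bl i \<gamma> \<delta> j k l y"
  let ?H = "\<lambda>\<beta> \<alpha> \<gamma> \<delta> k l. bg \<beta> \<gamma> \<delta> \<alpha> k l y"
  have da: "(a i \<beta> \<gamma> \<alpha> j k has_derivative frechet_derivative (a i \<beta> \<gamma> \<alpha> j k) (at y)) (at y)" for i \<beta> \<gamma> \<alpha> j k
    by (rule smooth_on_has_derivative[OF open_S smooth_coeffs(1) y])
  \<comment> \<open>The trace identities hold identically, so they may be differentiated.\<close>
  have dsum: "(\<Sum>x\<in>UNIV. frechet_derivative (f x) (at y) v) = 0"
    if f: "\<And>x. (f x has_derivative frechet_derivative (f x) (at y)) (at y)" and 0: "\<And>y. (\<Sum>x\<in>UNIV. f x y) = 0"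
    for f :: "'i::finite \<Rightarrow> 'z \<Rightarrow> real" and v
  proof -
    have "((\<lambda>y. \<Sum>x\<in>UNIV. f x y) has_derivative (\<lambda>v. \<Sum>x\<in>UNIV. frechet_derivative (f x) (at y) v)) (at y)"
      by (intro has_derivative_sum f)
    then have "((\<lambda>y. 0) has_derivative (\<lambda>v. \<Sum>x\<in>UNIV. frechet_derivative (f x) (at y) v)) (at y)"
      unfolding 0 .
    from fun_cong[OF has_derivative_unique[OF this has_derivative_const], of v] show ?thesis .
  qed
  have alt: "a i \<beta> \<gamma> \<alpha> j k x = - a i \<beta> \<gamma> \<alpha> k j x" if "x \<in> S" for i \<beta> \<gamma> \<alpha> j k x
    using a_sym[OF that, of i \<beta> \<gamma> \<alpha> j k] by (simp add: sym2_def)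
  interpret curvature_data ?A ?dA ?L ?H
  proof
    fix U V W i \<alpha>
    have "\<omega> y x = 0 \<and> \<omega>g \<alpha> \<beta> y x = 0 \<and> \<omega>l i j y x = 0 \<and> \<psi> i \<alpha> y x = 0" if "x \<in> {X U, X V, X W}" for x \<alpha> \<beta> i j
      using that X by auto
    from bianchi[where u = "X U" and v = "X V" and w = "X W" and i = i and \<alpha> = \<alpha>, OF y this]
    show "quad (?dA U i \<alpha>) V W + quad (?dA V i \<alpha>) W U + quad (?dA W i \<alpha>) U V
      + 2 * (quad (?A i \<alpha>) (\<lambda>\<beta> j. quad (?A j \<beta>) U V) W
         + quad (?A i \<alpha>) (\<lambda>\<beta> j. quad (?A j \<beta>) V W) U
         + quad (?A i \<alpha>) (\<lambda>\<beta> j. quad (?A j \<beta>) W U) V)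
      - (\<Sum>j\<in>UNIV. U \<alpha> j * quad (?L i j) V W + V \<alpha> j * quad (?L i j) W U + W \<alpha> j * quad (?L i j) U V)
      + (\<Sum>\<beta>\<in>UNIV. quad (?H \<beta> \<alpha>) U V * W \<beta> i + quad (?H \<beta> \<alpha>) V W * U \<beta> i + quad (?H \<beta> \<alpha>) W U * V \<beta> i) = 0"
      unfolding X(1) .
  next
    fix U i \<alpha> \<beta> \<gamma> j k
    have "((\<lambda>x. - a i \<beta> \<gamma> \<alpha> k j x) has_derivative (\<lambda>v. - frechet_derivative (a i \<beta> \<gamma> \<alpha> k j) (at y) v)) (at y)"
      by (intro has_derivative_minus da)
    then have "(a i \<beta> \<gamma> \<alpha> j k has_derivative (\<lambda>v. - frechet_derivative (a i \<beta> \<gamma> \<alpha> k j) (at y) v)) (at y)"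
      by (rule has_derivative_transform_within_open[OF _ open_S y]) (rule alt[symmetric])
    from fun_cong[OF has_derivative_unique[OF da this], of "X U"]
    show "?dA U i \<alpha> \<beta> \<gamma> j k = - ?dA U i \<alpha> \<beta> \<gamma> k j" .
  next
    show "(\<Sum>\<alpha>\<in>UNIV. ?dA U i \<alpha> \<alpha> \<gamma> j k) = 0" for U i \<gamma> j k
      by (rule dsum[OF da a_trace_g])
    show "(\<Sum>i\<in>UNIV. ?dA U i \<alpha> \<beta> \<gamma> i k) = 0" for U \<alpha> \<beta> \<gamma> k
      by (rule dsum[OF da a_trace_l])
  qed (rule a_skew bl_skew bl_trace bg_skew bg_trace b_normal alt[OF y])+
  note zero = curvature_vanishes[unfolded cubic_L_def, OF bl_prop]
  show "sym3 (\<lambda>j k l. bl i \<gamma> \<delta> j k l y) j k l = 0"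
    by (rule cubic_form_zero) (rule zero(1))
  have "(\<Sum>k\<in>UNIV. \<Sum>l\<in>UNIV. (?H \<delta> \<alpha> \<beta> \<gamma> k l + ?H \<beta> \<alpha> \<gamma> \<delta> k l + ?H \<gamma> \<alpha> \<delta> \<beta> k l) * (s k * s l)) = 0" for s
    using zero(2)[of \<delta> \<beta> \<gamma> \<alpha> s] by (simp add: quad_H_def sum.distrib distrib_right)
  \<comment> \<open>Polarization adds the values with \<open>k\<close> and \<open>l\<close>
    exchanged. By \<open>bg_skew\<close> these are minus the values with the last two upper indices
    exchanged, and so supply the odd permutations of \<open>alt3\<close>.\<close>
  from quadratic_form_zero[OF this, of k l]
  show "alt3 (\<lambda>\<beta> \<gamma> \<delta>. bg \<beta> \<gamma> \<delta> \<alpha> k l y) \<beta> \<gamma> \<delta> = 0"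
    using bg_skew[of \<beta> \<delta> \<gamma> \<alpha> k l y] bg_skew[of \<delta> \<gamma> \<beta> \<alpha> k l y] bg_skew[of \<gamma> \<beta> \<delta> \<alpha> k l y]
    by (simp add: alt3_def)
qed

end

subsection \<open>Structure equations in charts\<close>

text \<open>The forms outnumber the dimension, since the two blocks of the connection satisfy trace
  relations, so they do not give a square system. The normal equations do: pairing their left-hand
  side with \<open>e\<close> yields the sum of the squares of the values
  \<open>\<eta> i y e\<close>, which shows injectivity.\<close>

lemma smooth_on_dual_field:
  fixes \<eta> :: "'i::finite \<Rightarrow> 'e::euclidean_space \<Rightarrow> 'e \<Rightarrow> real"
  assumes S: "open S" and \<eta>: "\<And>i. smooth_1form S (\<eta> i)"
    and inj: "\<And>y e. y \<in> S \<Longrightarrow> (\<And>i. \<eta> i y e = 0) \<Longrightarrow> e = 0"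
    and f: "\<And>i. smooth_on S (f i)" and w: "\<And>i y. y \<in> S \<Longrightarrow> \<eta> i y (w y) = f i y"
  shows "smooth_on S w"
proof -
  \<comment> \<open>The vector that represents the form \<open>\<eta> i\<close> by the inner
    product.\<close>
  define g where "g i y = (\<Sum>b\<in>Basis. \<eta> i y b *\<^sub>R b)" for i y
  have g: "g i y \<bullet> e = \<eta> i y e" if "y \<in> S" for i y e
    using linear_basis_expansion[OF smooth_1formD(1)[OF \<eta> that], of i e]
    by (simp only: g_def inner_sum_left inner_scaleR_left) (simp add: inner_commute mult.commute)
  have g_smooth: "smooth_on S (g i)" for i
    unfolding g_def[abs_def]
    by (intro smooth_on_sum[OF S] smooth_on_scaleR[OF S] smooth_on_const smooth_1formD(2)[OF \<eta>])
  show ?thesis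
  proof (rule smooth_on_linear_solution[OF S, where M = "\<lambda>y e. \<Sum>i\<in>UNIV. \<eta> i y e *\<^sub>R g i y" and b = "\<lambda>y. \<Sum>i\<in>UNIV. f i y *\<^sub>R g i y"])
    fix y assume y: "y \<in> S"
    show "linear (\<lambda>e. \<Sum>i\<in>UNIV. \<eta> i y e *\<^sub>R g i y)"
      using smooth_1formD(1)[OF \<eta> y]
      by (intro linear_compose_sum ballI) (auto intro!: linearI simp: linear_add linear_scale scaleR_left_distrib)
    show "(\<Sum>i\<in>UNIV. \<eta> i y (w y) *\<^sub>R g i y) = (\<Sum>i\<in>UNIV. f i y *\<^sub>R g i y)" by (simp add: w[OF y])
    fix e assume 0: "(\<Sum>i\<in>UNIV. \<eta> i y e *\<^sub>R g i y) = 0"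
    have "(\<Sum>i\<in>UNIV. (\<eta> i y e)\<^sup>2) = (\<Sum>i\<in>UNIV. \<eta> i y e *\<^sub>R g i y) \<bullet> e"
      by (simp add: inner_sum_left g[OF y] power2_eq_square)
    then have "(\<Sum>i\<in>UNIV. (\<eta> i y e)\<^sup>2) = 0" by (simp add: 0)
    then have "\<eta> i y e = 0" for i by (simp add: sum_nonneg_eq_0_iff)
    then show "e = 0" by (rule inj[OF y])
  qed (intro smooth_on_sum[OF S] smooth_on_scaleR[OF S] g_smooth f smooth_1formD(2)[OF \<eta>])+
qed

lemma linear_bij_inv:
  assumes "linear f" "bij f"
  shows "linear (inv f)"
proof (rule linearI)
  have inv: "inv f (f x) = x" "f (inv f y) = y" for x y
    using assms(2) by (simp_all add: bij_is_inj bij_is_surj surj_f_inv_f)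
  fix u v r
  have "inv f (u + v) = inv f (f (inv f u + inv f v))" "inv f (r *\<^sub>R u) = inv f (f (r *\<^sub>R inv f u))"
    by (simp_all only: linear_add[OF assms(1)] linear_scale[OF assms(1)] inv(2))
  then show "inv f (u + v) = inv f u + inv f v" "inv f (r *\<^sub>R u) = r *\<^sub>R inv f u" by (simp_all only: inv(1))
qed

lemma smooth_on_ext_d_fields:
  assumes S: "open S" and \<eta>: "smooth_1form S \<eta>" and u: "smooth_on S u" and v: "smooth_on S v"
  shows "smooth_on S (\<lambda>y. ext_d \<eta> y (u y) (v y))"
proof -
  have "smooth_on S (\<lambda>y. \<Sum>b\<in>Basis. (u y \<bullet> b) *\<^sub>R (\<Sum>c\<in>Basis. (v y \<bullet> c) *\<^sub>R ext_d \<eta> y b c))"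
    by (intro smooth_on_sum[OF S] smooth_on_scaleR[OF S] smooth_on_ext_d[OF S \<eta>]
        smooth_on_linear_comp[OF S bounded_linear_inner_left] u v)
  then show ?thesis
  proof (rule smooth_on_transform[OF _ _ S])
    fix y assume y: "y \<in> S"
    show "(\<Sum>b\<in>Basis. (u y \<bullet> b) *\<^sub>R (\<Sum>c\<in>Basis. (v y \<bullet> c) *\<^sub>R ext_d \<eta> y b c)) = ext_d \<eta> y (u y) (v y)"
      using linear_basis_expansion[OF linear_ext_d(2)[OF S \<eta> y], of "u y" "v y"]
        linear_basis_expansion[OF linear_ext_d(1)[OF S \<eta> y], of _ "v y"] by simp
  qed
qed

section \<open>Forms and frames in charts\<close>

definition chart_form :: "('n::topological_space, 'e::euclidean_space) atlas \<Rightarrow> 'n set \<Rightarrow> ('n \<Rightarrow> 'e) \<Rightarrow> 'n form1 \<Rightarrow> 'e \<Rightarrow> 'e \<Rightarrow> real" where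
  "chart_form B U \<phi> \<eta> y w = \<eta> (inv_into U \<phi> y) (coord_field B (U, \<phi>) w (inv_into U \<phi> y))"

lemma wedge_chart_form:
  "wedge \<eta> \<kappa> (inv_into U \<phi> y) (coord_field B (U, \<phi>) u (inv_into U \<phi> y)) (coord_field B (U, \<phi>) v (inv_into U \<phi> y))
    = wedge1 (chart_form B U \<phi> \<eta>) (chart_form B U \<phi> \<kappa>) y u v"
  by (simp add: wedge_def wedge1_def chart_form_def)

context smooth_manifold
begin

lemma smooth_chart_form:
  assumes U: "(U, \<phi>) \<in> A" and \<eta>: "smooth_form A \<eta>"
  shows "smooth_1form (\<phi> ` U) (chart_form A U \<phi> \<eta>)"
  unfolding smooth_1form_def chart_form_def
proof (intro conjI ballI allI)
  have *: "\<And>x. x \<in> U \<Longrightarrow> linear (\<lambda>z. \<eta> x (coord_field A (U, \<phi>) z x))"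
    "\<And>z. smooth_map A eucl U (\<lambda>x. \<eta> x (coord_field A (U, \<phi>) z x))"
    using \<eta> U by (auto simp: smooth_form_def)
  show "linear (\<lambda>w. \<eta> (inv_into U \<phi> y) (coord_field A (U, \<phi>) w (inv_into U \<phi> y)))" if "y \<in> \<phi> ` U" for y
    by (rule *) (use that in \<open>rule inv_into_into\<close>)
  show "smooth_on (\<phi> ` U) (\<lambda>y. \<eta> (inv_into U \<phi> y) (coord_field A (U, \<phi>) w (inv_into U \<phi> y)))" for w
    using *(2)[of w] U unfolding smooth_map_eucl_target by force
qed

text \<open>\<open>has_ext_deriv\<close> is a condition on coordinate fields, and these become the
  constant fields of the chart on which \<open>ext_d\<close> is defined.\<close>

lemma ext_d_chart_form:
  assumes U: "(U, \<phi>) \<in> A" and \<eta>: "smooth_form A \<eta>" "has_ext_deriv A \<eta> \<Theta>" and y: "y \<in> \<phi> ` U"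
  shows "ext_d (chart_form A U \<phi> \<eta>) y u v = \<Theta> (inv_into U \<phi> y)
    (coord_field A (U, \<phi>) u (inv_into U \<phi> y)) (coord_field A (U, \<phi>) v (inv_into U \<phi> y))"
proof -
  define x where "x = inv_into U \<phi> y"
  have x: "x \<in> U" "\<phi> x = y" using y by (auto simp: x_def inv_into_into f_inv_into_f)
  have "smooth_at A x (\<lambda>m. \<eta> m (coord_field A (U, \<phi>) z m))" for z
    unfolding smooth_at_def
    by (rule exI[of _ U]) (use \<eta>(1) U x(1) in \<open>auto simp: smooth_form_def\<close>)
  from coord_field_apply[OF this, of U \<phi>]
  have "coord_field A (U, \<phi>) w x (\<lambda>m. \<eta> m (coord_field A (U, \<phi>) z m))
    = frechet_derivative (\<lambda>y. chart_form A U \<phi> \<eta> y z) (at y) w" for z w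
    by (simp add: chart_form_def x)
  moreover have "coord_field A (U, \<phi>) u x (\<lambda>m. \<eta> m (coord_field A (U, \<phi>) v m))
    - coord_field A (U, \<phi>) v x (\<lambda>m. \<eta> m (coord_field A (U, \<phi>) u m))
    = \<Theta> x (coord_field A (U, \<phi>) u x) (coord_field A (U, \<phi>) v x)"
    using \<eta>(2) U x(1) unfolding has_ext_deriv_def Let_def by blast
  ultimately show ?thesis by (simp add: ext_d_def x_def)
qed

text \<open>\<rho> is read off by applying frame vectors to the coordinate functions. It also
  identifies the matrices with the model space of \<open>A\<close>, which need not be the same
  type.\<close>

lemma frame_in_chart:
  assumes u: "is_frame A x (u :: real ^ 'q::finite ^ 'p::finite \<Rightarrow> 'm tvec)" and V: "smooth_chart A (V, \<xi>)" "x \<in> V"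
  obtains \<rho> where "linear \<rho>" "bij \<rho>" "\<And>z. coord_field A (V, \<xi>) (\<rho> z) x = u z"
proof -
  have lin: "linear (\<lambda>z. u z f)" for f using u by (simp add: is_frame_def)
  have bij: "bij_betw u UNIV (tangent_space A x)" using u by (simp add: is_frame_def)
  define \<rho> where "\<rho> z = (\<Sum>b\<in>Basis. u z (\<lambda>m. \<xi> m \<bullet> b) *\<^sub>R b)" for z
  have eq: "coord_field A (V, \<xi>) (\<rho> z) x = u z" for z
  proof -
    have "u z \<in> tangent_space A x" using bij by (auto simp: bij_betw_def)
    then obtain e where e: "u z = coord_field A (V, \<xi>) e x"
      unfolding tangent_space_chart[OF V] by auto
    have "\<rho> z = e"
      unfolding \<rho>_def e coord_field_coordinate[OF V] by (rule euclidean_representation)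
    then show ?thesis by (simp add: e)
  qed
  show ?thesis
  proof (rule that[of \<rho>])
    show "linear \<rho>"
      unfolding \<rho>_def by (rule linearI) (simp_all add: linear_add[OF lin] linear_scale[OF lin] scaleR_left_distrib sum.distrib scaleR_sum_right)
    have "inj \<rho>"
    proof (rule injI)
      fix z w assume "\<rho> z = \<rho> w"
      then have "u z = u w" using eq[of z] eq[of w] by simp
      then show "z = w" using bij by (auto simp: bij_betw_def inj_on_def)
    qed
    moreover have "e \<in> range \<rho>" for e
    proof -
      have "coord_field A (V, \<xi>) e x \<in> tangent_space A x" unfolding tangent_space_chart[OF V] by simp
      then obtain z where "coord_field A (V, \<xi>) e x = u z" using bij by (auto simp: bij_betw_def)
      then have "coord_field A (V, \<xi>) e x = coord_field A (V, \<xi>) (\<rho> z) x" by (simp add: eq)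
      from coord_field_inject[OF V this] show ?thesis by simp
    qed
    ultimately show "bij \<rho>" by (auto simp: bij_def)
  qed (rule eq)
qed

end

lemma ex1_unique: "\<exists>!x. P x \<Longrightarrow> P x \<Longrightarrow> P y \<Longrightarrow> x = y"
  by blast

text \<open>The data for one family of generators in a form that transposition preserves. The model
  space of the atlas \<open>A\<close> is left arbitrary since the atlas stays fixed when the frames
  are transposed, and \<open>fibre\<close> retains from the structure group only that it permutes
  the planes of the family.\<close>

locale segre_connection = A: smooth_manifold A + B: smooth_manifold B
  for A :: "('m::{t2_space, second_countable_topology}, 'a::euclidean_space) atlas"
    and B :: "('n::{t2_space, second_countable_topology}, 'e::euclidean_space) atlas" +
  fixes pr :: "'n \<Rightarrow> 'm"
    and fr :: "'n \<Rightarrow> real ^ 'q::finite ^ 'p::finite \<Rightarrow> 'm tvec"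
    and \<theta> :: "'p \<Rightarrow> 'q \<Rightarrow> 'n form1"
    and \<omega> :: "'n form1"
    and \<omega>g :: "'p \<Rightarrow> 'p \<Rightarrow> 'n form1"
    and \<omega>l :: "'q \<Rightarrow> 'q \<Rightarrow> 'n form1"
    and \<psi> :: "'q \<Rightarrow> 'p \<Rightarrow> 'n form1"
    and a :: "'q \<Rightarrow> 'p \<Rightarrow> 'p \<Rightarrow> 'p \<Rightarrow> 'q \<Rightarrow> 'q \<Rightarrow> 'n \<Rightarrow> real"
    and bg :: "'p \<Rightarrow> 'p \<Rightarrow> 'p \<Rightarrow> 'p \<Rightarrow> 'q \<Rightarrow> 'q \<Rightarrow> 'n \<Rightarrow> real"
    and bl :: "'q \<Rightarrow> 'p \<Rightarrow> 'p \<Rightarrow> 'q \<Rightarrow> 'q \<Rightarrow> 'q \<Rightarrow> 'n \<Rightarrow> real"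
  assumes pr_smooth: "smooth_map B A UNIV pr"
    and frame: "is_frame A (pr x) (fr x)"
    and fibre: "pr x' = pr x \<Longrightarrow> s \<noteq> 0 \<Longrightarrow> \<exists>s'. s' \<noteq> 0 \<and> fr x' ` range (\<lambda>t. outer t s) = fr x ` range (\<lambda>t. outer t s')"
    and soldering: "v \<in> tangent_space B x \<Longrightarrow> push_forward A pr x v = fr x (\<chi> \<alpha> i. \<theta> \<alpha> i x v)"
    and smooth_forms: "smooth_form B (\<theta> \<alpha> i)" "smooth_form B \<omega>" "smooth_form B (\<omega>g \<alpha> \<beta>)"
          "smooth_form B (\<omega>l j i)" "smooth_form B (\<psi> i \<alpha>)"
    and parallelism: "(\<Sum>\<gamma>\<in>UNIV. X \<gamma> \<gamma>) = 0 \<Longrightarrow> (\<Sum>k\<in>UNIV. Y k k) = 0 \<Longrightarrow>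
          \<exists>!v. v \<in> tangent_space B x \<and> (\<forall>\<alpha> i. \<theta> \<alpha> i x v = Z \<alpha> i) \<and> \<omega> x v = r \<and>
            (\<forall>\<alpha> \<beta>. \<omega>g \<alpha> \<beta> x v = X \<alpha> \<beta>) \<and> (\<forall>j i. \<omega>l j i x v = Y j i) \<and>
            (\<forall>i \<alpha>. \<psi> i \<alpha> x v = W i \<alpha>)"
    and structure_theta: "has_ext_deriv B (\<theta> \<alpha> i) (\<lambda>x v w.
          (\<Sum>j\<in>UNIV. wedge (\<theta> \<alpha> j) (\<omega>l j i) x v w)
          + (\<Sum>\<beta>\<in>UNIV. wedge (\<omega>g \<alpha> \<beta>) (\<theta> \<beta> i) x v w)
          + wedge \<omega> (\<theta> \<alpha> i) x v w
          + (\<Sum>\<beta>\<in>UNIV. \<Sum>\<gamma>\<in>UNIV. \<Sum>j\<in>UNIV. \<Sum>k\<in>UNIV.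
               a i \<beta> \<gamma> \<alpha> j k x * wedge (\<theta> \<beta> j) (\<theta> \<gamma> k) x v w))"
    and structure_omega_g: "has_ext_deriv B (\<omega>g \<alpha> \<beta>) (\<lambda>x v w.
          (\<Sum>\<gamma>\<in>UNIV. wedge (\<omega>g \<alpha> \<gamma>) (\<omega>g \<gamma> \<beta>) x v w)
          + real CARD('q) / real (CARD('p) + CARD('q)) *
              ((if \<alpha> = \<beta> then \<Sum>\<gamma>\<in>UNIV. \<Sum>k\<in>UNIV. wedge (\<theta> \<gamma> k) (\<psi> k \<gamma>) x v w else 0)
               - real CARD('p) * (\<Sum>k\<in>UNIV. wedge (\<theta> \<alpha> k) (\<psi> k \<beta>) x v w))
          + (\<Sum>\<gamma>\<in>UNIV. \<Sum>\<delta>\<in>UNIV. \<Sum>k\<in>UNIV. \<Sum>l\<in>UNIV.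
               bg \<beta> \<gamma> \<delta> \<alpha> k l x * wedge (\<theta> \<gamma> k) (\<theta> \<delta> l) x v w))"
    and structure_omega_l: "has_ext_deriv B (\<omega>l j i) (\<lambda>x v w.
          (\<Sum>k\<in>UNIV. wedge (\<omega>l j k) (\<omega>l k i) x v w)
          + real CARD('p) / real (CARD('p) + CARD('q)) *
              ((if j = i then \<Sum>\<gamma>\<in>UNIV. \<Sum>k\<in>UNIV. wedge (\<psi> k \<gamma>) (\<theta> \<gamma> k) x v w else 0)
               - real CARD('q) * (\<Sum>\<gamma>\<in>UNIV. wedge (\<psi> j \<gamma>) (\<theta> \<gamma> i) x v w))
          + (\<Sum>\<gamma>\<in>UNIV. \<Sum>\<delta>\<in>UNIV. \<Sum>k\<in>UNIV. \<Sum>l\<in>UNIV.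
               bl i \<gamma> \<delta> j k l x * wedge (\<theta> \<gamma> k) (\<theta> \<delta> l) x v w))"
    and structure_omega: "has_ext_deriv B \<omega> (\<lambda>x v w.
          \<Sum>\<alpha>\<in>UNIV. \<Sum>i\<in>UNIV. wedge (\<psi> i \<alpha>) (\<theta> \<alpha> i) x v w)"
    and a_skew: "a i \<beta> \<gamma> \<alpha> j k x = - a i \<gamma> \<beta> \<alpha> k j x"
    and a_trace_g: "(\<Sum>\<alpha>\<in>UNIV. a i \<alpha> \<gamma> \<alpha> j k x) = 0"
    and a_trace_l: "(\<Sum>i\<in>UNIV. a i \<beta> \<gamma> \<alpha> i k x) = 0"
    and bg_skew: "bg \<beta> \<gamma> \<delta> \<alpha> k l x = - bg \<beta> \<delta> \<gamma> \<alpha> l k x"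
    and bl_skew: "bl i \<gamma> \<delta> j k l x = - bl i \<delta> \<gamma> j l k x"
    and bg_trace: "(\<Sum>\<alpha>\<in>UNIV. bg \<alpha> \<gamma> \<delta> \<alpha> k l x) = 0"
    and bl_trace: "(\<Sum>i\<in>UNIV. bl i \<gamma> \<delta> i k l x) = 0"
    and b_normal: "(\<Sum>\<alpha>\<in>UNIV. bg \<gamma> \<alpha> \<delta> \<alpha> k l x) - (\<Sum>i\<in>UNIV. bl i \<gamma> \<delta> k i l x)
          + (\<Sum>\<alpha>\<in>UNIV. bg \<delta> \<alpha> \<gamma> \<alpha> l k x) - (\<Sum>i\<in>UNIV. bl i \<delta> \<gamma> l i k x) = 0"
begin

text \<open>Indexed by the points of the bundle rather than by a set of frames; both families of
  generators of the structure are recovered since \<open>fr\<close> maps each fibre onto the adapted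
  frames.\<close>

definition generators :: "'m \<Rightarrow> 'm tvec set set" where
  "generators m = {fr x ` range (\<lambda>t. outer t s) | x s. pr x = m \<and> s \<noteq> 0}"

text \<open>The absolute parallelism makes the field with prescribed \<theta>-components unique,
  hence linear in \<open>z\<close>, and smooth because it solves a linear system whose coefficients
  are smooth forms.\<close>

lemma horizontal_fields:
  assumes U: "(U, \<phi>) \<in> B"
  obtains X where
    "\<And>y z \<alpha> i. y \<in> \<phi> ` U \<Longrightarrow> chart_form B U \<phi> (\<theta> \<alpha> i) y (X y z) = z $ \<alpha> $ i"
    "\<And>y z. y \<in> \<phi> ` U \<Longrightarrow> chart_form B U \<phi> \<omega> y (X y z) = 0"
    "\<And>y z \<alpha> \<beta>. y \<in> \<phi> ` U \<Longrightarrow> chart_form B U \<phi> (\<omega>g \<alpha> \<beta>) y (X y z) = 0"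
    "\<And>y z j i. y \<in> \<phi> ` U \<Longrightarrow> chart_form B U \<phi> (\<omega>l j i) y (X y z) = 0"
    "\<And>y z i \<alpha>. y \<in> \<phi> ` U \<Longrightarrow> chart_form B U \<phi> (\<psi> i \<alpha>) y (X y z) = 0"
    "\<And>y. y \<in> \<phi> ` U \<Longrightarrow> linear (X y)" "\<And>z. smooth_on (\<phi> ` U) (\<lambda>y. X y z)"
proof -
  note sU = B.atlas_smooth_chart[OF U] and cU = is_chartD[OF B.charts[OF U]]
  let ?c = "chart_form B U \<phi>"
  let ?P = "\<lambda>y z e. (\<forall>\<alpha> i. ?c (\<theta> \<alpha> i) y e = z $ \<alpha> $ i) \<and> ?c \<omega> y e = 0 \<and> (\<forall>\<alpha> \<beta>. ?c (\<omega>g \<alpha> \<beta>) y e = 0) \<and>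
    (\<forall>j i. ?c (\<omega>l j i) y e = 0) \<and> (\<forall>i \<alpha>. ?c (\<psi> i \<alpha>) y e = 0)"
  have par: "\<exists>!e. ?P y z e" if y: "y \<in> \<phi> ` U" for y z
  proof -
    let ?x = "inv_into U \<phi> y"
    have x: "?x \<in> U" using y by (rule inv_into_into)
    have ts: "tangent_space B ?x = range (\<lambda>w. coord_field B (U, \<phi>) w ?x)"
      by (rule B.tangent_space_chart[OF sU x])
    have ex: "\<exists>!v. v \<in> tangent_space B ?x \<and> (\<forall>\<alpha> i. \<theta> \<alpha> i ?x v = z $ \<alpha> $ i) \<and> \<omega> ?x v = 0 \<and>
            (\<forall>\<alpha> \<beta>. \<omega>g \<alpha> \<beta> ?x v = 0) \<and> (\<forall>j i. \<omega>l j i ?x v = 0) \<and> (\<forall>i \<alpha>. \<psi> i \<alpha> ?x v = 0)" (is "\<exists>!v. ?Q v")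
      by (rule parallelism[of "\<lambda>_ _. 0" "\<lambda>_ _. 0" ?x "\<lambda>\<alpha> i. z $ \<alpha> $ i" 0 "\<lambda>_ _. 0"]) simp_all
    from ex1_implies_ex[OF ex] obtain v where v: "?Q v" by (rule exE)
    have uniq: "v' = v" if "?Q v'" for v' by (rule ex1_unique[of ?Q, OF ex that v])
    have Q: "?Q (coord_field B (U, \<phi>) e ?x) \<longleftrightarrow> ?P y z e" for e
      unfolding ts chart_form_def by simp
    from v ts obtain e where e: "v = coord_field B (U, \<phi>) e ?x" by auto
    show ?thesis
    proof (rule ex1I[of _ e])
      show "?P y z e" using v unfolding e Q .
      fix e' assume "?P y z e'"
      then have "?Q (coord_field B (U, \<phi>) e' ?x)" unfolding Q .
      from uniq[OF this] show "e' = e" unfolding e by (rule B.coord_field_inject[OF sU x])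
    qed
  qed
  note sf = B.smooth_chart_form[OF U]
  note lin = smooth_1formD(1)[OF sf]
  define X where "X y z = (THE e. ?P y z e)" for y z
  have X: "?P y z (X y z)" if "y \<in> \<phi> ` U" for y z
    unfolding X_def by (rule theI'[OF par[OF that]])
  have unique: "e = X y z" if "y \<in> \<phi> ` U" "?P y z e" for y z e
    using ex1_unique[of "?P y z", OF par[OF that(1)] that(2) X[OF that(1)]] .
  have lin_X: "linear (X y)" if y: "y \<in> \<phi> ` U" for y
  proof (rule linearI)
    note l = lin[OF _ y]
    fix z w r
    show "X y (z + w) = X y z + X y w"
      by (rule sym, rule unique[OF y]) (simp add: linear_add[OF l] smooth_forms X[OF y])
    show "X y (r *\<^sub>R z) = r *\<^sub>R X y z"
      by (rule sym, rule unique[OF y]) (simp add: linear_scale[OF l] smooth_forms X[OF y])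
  qed
  have smooth_X: "smooth_on (\<phi> ` U) (\<lambda>y. X y z)" for z
  proof -
    \<comment> \<open>All forms of the parallelism in one finite family, as
      \<open>smooth_on_dual_field\<close> expects.\<close>
    let ?\<eta> = "case_sum (\<lambda>(\<alpha>, i). ?c (\<theta> \<alpha> i)) (case_sum (\<lambda>_::unit. ?c \<omega>) (case_sum (\<lambda>(\<alpha>, \<beta>). ?c (\<omega>g \<alpha> \<beta>))
      (case_sum (\<lambda>(j, i). ?c (\<omega>l j i)) (\<lambda>(i, \<alpha>). ?c (\<psi> i \<alpha>)))))"
    let ?f = "case_sum (\<lambda>(\<alpha>, i) _. z $ \<alpha> $ i) (\<lambda>_ _. 0)"
    show ?thesis
    proof (rule smooth_on_dual_field[of "\<phi> ` U" ?\<eta> ?f])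
      show "open (\<phi> ` U)" by (rule cU)
      show "smooth_1form (\<phi> ` U) (?\<eta> k)" for k
        by (auto split: sum.split intro!: sf smooth_forms)
      show "smooth_on (\<phi> ` U) (?f k)" for k
        by (auto split: sum.split intro!: smooth_on_const cU)
      show "?\<eta> k y (X y z) = ?f k y" if "y \<in> \<phi> ` U" for k y
        using X[OF that, of z] by (auto split: sum.split)
      fix y e assume y: "y \<in> \<phi> ` U" and e: "\<And>k. ?\<eta> k y e = 0"
      have "?c (\<theta> \<alpha> i) y e = 0" "?c \<omega> y e = 0" "?c (\<omega>g \<alpha> \<beta>) y e = 0" "?c (\<omega>l j i) y e = 0" "?c (\<psi> i \<alpha>) y e = 0" for \<alpha> \<beta> i j
        using e[of "Inl (\<alpha>, i)"] e[of "Inr (Inl ())"] e[of "Inr (Inr (Inl (\<alpha>, \<beta>)))"] e[of "Inr (Inr (Inr (Inl (j, i))))"]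
          e[of "Inr (Inr (Inr (Inr (i, \<alpha>))))"] by simp_all
      then have "?P y 0 e" by simp
      moreover have "?P y 0 0" by (simp add: linear_0[OF lin[OF _ y]] smooth_forms)
      ultimately show "e = 0" by (rule ex1_unique[of "?P y 0", OF par[OF y]])
    qed
  qed
  show ?thesis by (rule that[of X]) (simp_all add: X lin_X smooth_X)
qed

text \<open>Besides translating the equations into the chart, this shows that torsion and curvature
  components are smooth: on horizontal fields the connection terms drop out and the exterior
  derivative equals twice the \<open>quad\<close> term.\<close>

lemma cartan_forms_chart:
  assumes U: "(U, \<phi>) \<in> B"
  defines "c \<equiv> chart_form B U \<phi>"
  shows "cartan_forms (\<phi> ` U) (\<lambda>\<alpha> i. c (\<theta> \<alpha> i)) (c \<omega>) (\<lambda>\<alpha> \<beta>. c (\<omega>g \<alpha> \<beta>)) (\<lambda>j i. c (\<omega>l j i)) (\<lambda>i \<alpha>. c (\<psi> i \<alpha>))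
    (\<lambda>i \<beta> \<gamma> \<alpha> j k y. a i \<beta> \<gamma> \<alpha> j k (inv_into U \<phi> y)) (\<lambda>\<beta> \<gamma> \<delta> \<alpha> k l y. bg \<beta> \<gamma> \<delta> \<alpha> k l (inv_into U \<phi> y))
    (\<lambda>i \<gamma> \<delta> j k l y. bl i \<gamma> \<delta> j k l (inv_into U \<phi> y))"
proof -
  note cU = is_chartD[OF B.charts[OF U]]
  note sf = B.smooth_chart_form[OF U]
  have quad_a: "(\<Sum>\<beta>\<in>UNIV. \<Sum>\<gamma>\<in>UNIV. \<Sum>j\<in>UNIV. \<Sum>k\<in>UNIV. a i \<beta> \<gamma> \<alpha> j k x * wedge1 (th \<beta> j) (th \<gamma> k) y u v)
    = 2 * quad (\<lambda>\<beta> \<gamma> j k. a i \<beta> \<gamma> \<alpha> j k x) (\<lambda>\<beta> j. th \<beta> j y u) (\<lambda>\<gamma> k. th \<gamma> k y v)" for i \<alpha> x th y u v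
    by (rule quad_wedge) (rule a_skew)
  have quad_bg: "(\<Sum>\<gamma>\<in>UNIV. \<Sum>\<delta>\<in>UNIV. \<Sum>j\<in>UNIV. \<Sum>k\<in>UNIV. bg \<beta> \<gamma> \<delta> \<alpha> j k x * wedge1 (th \<gamma> j) (th \<delta> k) y u v)
    = 2 * quad (\<lambda>\<gamma> \<delta> j k. bg \<beta> \<gamma> \<delta> \<alpha> j k x) (\<lambda>\<beta> j. th \<beta> j y u) (\<lambda>\<gamma> k. th \<gamma> k y v)" for \<beta> \<alpha> x th y u v
    by (rule quad_wedge) (rule bg_skew)
  have quad_bl: "(\<Sum>\<gamma>\<in>UNIV. \<Sum>\<delta>\<in>UNIV. \<Sum>k\<in>UNIV. \<Sum>l\<in>UNIV. bl i \<gamma> \<delta> j k l x * wedge1 (th \<gamma> k) (th \<delta> l) y u v)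
    = 2 * quad (\<lambda>\<gamma> \<delta> k l. bl i \<gamma> \<delta> j k l x) (\<lambda>\<beta> j. th \<beta> j y u) (\<lambda>\<gamma> k. th \<gamma> k y v)" for i j x th y u v
    by (rule quad_wedge) (rule bl_skew)
  note d_theta = B.ext_d_chart_form[OF U smooth_forms(1) structure_theta, unfolded wedge_chart_form quad_a, folded c_def]
  note d_omega = B.ext_d_chart_form[OF U smooth_forms(2) structure_omega, unfolded wedge_chart_form, folded c_def]
  note d_omega_g = B.ext_d_chart_form[OF U smooth_forms(3) structure_omega_g, unfolded wedge_chart_form quad_bg, folded c_def]
  note d_omega_l = B.ext_d_chart_form[OF U smooth_forms(4) structure_omega_l, unfolded wedge_chart_form quad_bl, folded c_def]
  obtain X where X: "\<And>y z \<alpha> i. y \<in> \<phi> ` U \<Longrightarrow> c (\<theta> \<alpha> i) y (X y z) = z $ \<alpha> $ i"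
    "\<And>y z. y \<in> \<phi> ` U \<Longrightarrow> c \<omega> y (X y z) = 0"
    "\<And>y z \<alpha> \<beta>. y \<in> \<phi> ` U \<Longrightarrow> c (\<omega>g \<alpha> \<beta>) y (X y z) = 0"
    "\<And>y z j i. y \<in> \<phi> ` U \<Longrightarrow> c (\<omega>l j i) y (X y z) = 0"
    "\<And>y z i \<alpha>. y \<in> \<phi> ` U \<Longrightarrow> c (\<psi> i \<alpha>) y (X y z) = 0"
    and Xs: "\<And>z. smooth_on (\<phi> ` U) (\<lambda>y. X y z)"
    unfolding c_def using horizontal_fields[OF U] by metis
  \<comment> \<open>Matrix units; on a pair of them \<open>quad\<close> returns a single
    coefficient.\<close>
  define E :: "'p \<Rightarrow> 'q \<Rightarrow> real ^ 'q ^ 'p" where "E \<beta> j = (\<chi> \<alpha> i. single_row \<beta> (\<lambda>i. if i = j then 1 else 0) \<alpha> i)" for \<beta> j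
  have quad_E: "quad f (\<lambda>\<alpha> i. E \<beta> j $ \<alpha> $ i) (\<lambda>\<alpha> i. E \<gamma> k $ \<alpha> $ i) = f \<beta> \<gamma> j k" for f \<beta> \<gamma> j k
  proof -
    have "quad f (\<lambda>\<alpha> i. E \<beta> j $ \<alpha> $ i) (\<lambda>\<alpha> i. E \<gamma> k $ \<alpha> $ i)
      = (\<Sum>j'\<in>UNIV. \<Sum>k'\<in>UNIV. f \<beta> \<gamma> j' k' * ((if j' = j then 1 else 0) * (if k' = k then 1 else 0)))"
      by (simp add: E_def quad_single_rows)
    also have "\<dots> = (\<Sum>k'\<in>UNIV. \<Sum>j'\<in>UNIV. f \<beta> \<gamma> j' k' * ((if j' = j then 1 else 0) * (if k' = k then 1 else 0)))"
      by (rule sum.swap)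
    also have "\<dots> = (\<Sum>k'\<in>UNIV. f \<beta> \<gamma> j k' * ((if k' = k then 1 else 0) * 1))" by simp
    also have "\<dots> = f \<beta> \<gamma> j k" unfolding sum_indicator(1) by simp
    finally show ?thesis .
  qed
  have sa: "smooth_on (\<phi> ` U) (\<lambda>y. a i \<beta> \<gamma> \<alpha> j k (inv_into U \<phi> y))" for i \<beta> \<gamma> \<alpha> j k
  proof (rule smooth_on_transform)
    show "smooth_on (\<phi> ` U) (\<lambda>y. (1 / 2) *\<^sub>R ext_d (c (\<theta> \<alpha> i)) y (X y (E \<beta> j)) (X y (E \<gamma> k)))"
      unfolding c_def
      by (intro smooth_on_scaleR smooth_on_const smooth_on_ext_d_fields sf smooth_forms Xs cU)
    show "(1 / 2) *\<^sub>R ext_d (c (\<theta> \<alpha> i)) y (X y (E \<beta> j)) (X y (E \<gamma> k)) = a i \<beta> \<gamma> \<alpha> j k (inv_into U \<phi> y)"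
      if y: "y \<in> \<phi> ` U" for y
      unfolding d_theta[OF y] wedge1_def X[OF y] quad_E by simp
  qed (rule cU)
  have sl: "smooth_on (\<phi> ` U) (\<lambda>y. bl i \<gamma> \<delta> j k l (inv_into U \<phi> y))" for i \<gamma> \<delta> j k l
  proof (rule smooth_on_transform)
    show "smooth_on (\<phi> ` U) (\<lambda>y. (1 / 2) *\<^sub>R ext_d (c (\<omega>l j i)) y (X y (E \<gamma> k)) (X y (E \<delta> l)))"
      unfolding c_def
      by (intro smooth_on_scaleR smooth_on_const smooth_on_ext_d_fields sf smooth_forms Xs cU)
    show "(1 / 2) *\<^sub>R ext_d (c (\<omega>l j i)) y (X y (E \<gamma> k)) (X y (E \<delta> l)) = bl i \<gamma> \<delta> j k l (inv_into U \<phi> y)"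
      if y: "y \<in> \<phi> ` U" for y
      unfolding d_omega_l[OF y] wedge1_def X[OF y] quad_E by simp
  qed (rule cU)
  show ?thesis
  proof
    show "smooth_1form (\<phi> ` U) (c (\<theta> \<alpha> i))" "smooth_1form (\<phi> ` U) (c \<omega>)" "smooth_1form (\<phi> ` U) (c (\<omega>g \<alpha> \<beta>))"
      "smooth_1form (\<phi> ` U) (c (\<omega>l j i))" "smooth_1form (\<phi> ` U) (c (\<psi> i \<alpha>))" for \<alpha> \<beta> i j
      unfolding c_def by (intro sf smooth_forms)+
  qed (rule cU d_theta d_omega d_omega_g d_omega_l sa sl a_skew a_trace_g a_trace_l bg_skew bl_skew bg_trace bl_trace b_normal; assumption?)+
qed

end

subsection \<open>Normal charts\<close>

context segre_connection
begin

text \<open>The radial flow of the horizontal fields gives a section \<sigma> over a ball of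
  matrices. Its projection has the frame at \<open>x0\<close> as derivative at 0, hence is a local
  diffeomorphism, and its inverse is the chart \<xi>. The last clause is what makes the chart
  useful: it expresses tangent vectors of the base in the frame \<open>fr (\<sigma> z)\<close> by
  the pulled back forms.\<close>

lemma normal_chart:
  fixes x0 :: 'n
  obtains r \<sigma> th om og ol ps W \<xi> \<rho> U where
    "radial_cartan_forms r th om og ol ps (\<lambda>i \<beta> \<gamma> \<alpha> j k z. a i \<beta> \<gamma> \<alpha> j k (\<sigma> z))
      (\<lambda>\<beta> \<gamma> \<delta> \<alpha> k l z. bg \<beta> \<gamma> \<delta> \<alpha> k l (\<sigma> z)) (\<lambda>i \<gamma> \<delta> j k l z. bl i \<gamma> \<delta> j k l (\<sigma> z))"
    "\<sigma> 0 = x0" "\<And>w \<alpha> i. th \<alpha> i 0 w = w $ \<alpha> $ i" "\<And>w. om 0 w = 0" "\<And>w \<alpha> \<beta>. og \<alpha> \<beta> 0 w = 0"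
    "\<And>w j i. ol j i 0 w = 0" "\<And>w i \<alpha>. ps i \<alpha> 0 w = 0"
    "smooth_chart A (W, \<xi>)" "open U" "0 \<in> U" "U \<subseteq> ball 0 r" "linear \<rho>" "bij \<rho>" "\<xi> ` W = \<rho> ` U"
    "\<And>z. z \<in> U \<Longrightarrow> pr (\<sigma> z) \<in> W" "\<And>z. z \<in> U \<Longrightarrow> \<xi> (pr (\<sigma> z)) = \<rho> z"
    "\<And>z w. z \<in> U \<Longrightarrow> coord_field A (W, \<xi>) (\<rho> w) (pr (\<sigma> z)) = fr (\<sigma> z) (\<chi> \<alpha> i. th \<alpha> i z w)"
proof -
  obtain Y \<phi> where Y: "(Y, \<phi>) \<in> B" "x0 \<in> Y" by (rule B.obtain_chart)
  obtain V \<kappa> where V: "(V, \<kappa>) \<in> A" "pr x0 \<in> V" by (rule A.obtain_chart)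
  note cY = is_chartD[OF B.charts[OF Y(1)]] and cV = is_chartD[OF A.charts[OF V(1)]]
  note sY = B.atlas_smooth_chart[OF Y(1)] and sV = A.atlas_smooth_chart[OF V(1)]
  define c where "c = chart_form B Y \<phi>"
  obtain X where X: "\<And>y z \<alpha> i. y \<in> \<phi> ` Y \<Longrightarrow> c (\<theta> \<alpha> i) y (X y z) = z $ \<alpha> $ i"
    "\<And>y z. y \<in> \<phi> ` Y \<Longrightarrow> c \<omega> y (X y z) = 0"
    "\<And>y z \<alpha> \<beta>. y \<in> \<phi> ` Y \<Longrightarrow> c (\<omega>g \<alpha> \<beta>) y (X y z) = 0"
    "\<And>y z j i. y \<in> \<phi> ` Y \<Longrightarrow> c (\<omega>l j i) y (X y z) = 0"
    "\<And>y z i \<alpha>. y \<in> \<phi> ` Y \<Longrightarrow> c (\<psi> i \<alpha>) y (X y z) = 0"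
    and lin_X: "\<And>y. y \<in> \<phi> ` Y \<Longrightarrow> linear (X y)" and smooth_X: "\<And>z. smooth_on (\<phi> ` Y) (\<lambda>y. X y z)"
    unfolding c_def by (rule horizontal_fields[OF Y(1)]) blast
  interpret C: cartan_forms "\<phi> ` Y" "\<lambda>\<alpha> i. c (\<theta> \<alpha> i)" "c \<omega>" "\<lambda>\<alpha> \<beta>. c (\<omega>g \<alpha> \<beta>)" "\<lambda>j i. c (\<omega>l j i)" "\<lambda>i \<alpha>. c (\<psi> i \<alpha>)"
    "\<lambda>i \<beta> \<gamma> \<alpha> j k y. a i \<beta> \<gamma> \<alpha> j k (inv_into Y \<phi> y)" "\<lambda>\<beta> \<gamma> \<delta> \<alpha> k l y. bg \<beta> \<gamma> \<delta> \<alpha> k l (inv_into Y \<phi> y)"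
    "\<lambda>i \<gamma> \<delta> j k l y. bl i \<gamma> \<delta> j k l (inv_into Y \<phi> y)"
    unfolding c_def by (rule cartan_forms_chart[OF Y(1)])
  define h where "h y = \<kappa> (pr (inv_into Y \<phi> y))" for y
  \<comment> \<open>The flow is confined to points whose projection lies in the base chart, so that
    \<kappa> can be applied.\<close>
  define S where "S = \<phi> ` (Y \<inter> pr -` V)"
  note pf = push_forward_coord_field[OF A.smooth_manifold_axioms B.smooth_manifold_axioms pr_smooth Y(1) _ V(1)]
  have S: "open S" "S \<subseteq> \<phi> ` Y" "\<phi> x0 \<in> S" and h: "smooth_on S h"
    unfolding S_def h_def using pf(2,3)[OF Y(2) V(2)] Y V by auto
  have lin_S: "linear (X y)" if "y \<in> S" for y using lin_X that S by blast
  note smooth_S = smooth_on_subset[OF smooth_X S(2)]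
  obtain r \<gamma> where r: "r > 0" and \<gamma>: "smooth_on (ball 0 r) \<gamma>" "\<gamma> ` ball 0 r \<subseteq> S" "\<gamma> 0 = \<phi> x0"
    and radial: "\<And>z. norm z < r \<Longrightarrow> frechet_derivative \<gamma> (at z) z = X (\<gamma> z) z"
    and radial0: "\<And>z. frechet_derivative \<gamma> (at 0) z = X (\<phi> x0) z"
  proof (rule radial_flow[OF S(1,3) lin_S smooth_S])
    fix r \<gamma>
    assume "0 < r" "smooth_on (ball 0 r) \<gamma>" "\<gamma> ` ball 0 r \<subseteq> S" "\<gamma> 0 = \<phi> x0"
      "\<And>z. norm z < r \<Longrightarrow> frechet_derivative \<gamma> (at z) z = X (\<gamma> z) z" "\<And>z. frechet_derivative \<gamma> (at 0) z = X (\<phi> x0) z"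
    then show ?thesis by (rule that)
  qed
  define \<sigma> where "\<sigma> z = inv_into Y \<phi> (\<gamma> z)" for z
  have \<sigma>: "\<sigma> z \<in> Y" "\<phi> (\<sigma> z) = \<gamma> z" "pr (\<sigma> z) \<in> V" "\<gamma> z \<in> \<phi> ` Y" if "z \<in> ball 0 r" for z
  proof -
    have "\<gamma> z \<in> S" using that \<gamma>(2) by blast
    then obtain x where x: "x \<in> Y" "pr x \<in> V" "\<gamma> z = \<phi> x" unfolding S_def by blast
    then have "\<sigma> z = x" by (simp add: \<sigma>_def cY)
    then show "\<sigma> z \<in> Y" "\<phi> (\<sigma> z) = \<gamma> z" "pr (\<sigma> z) \<in> V" "\<gamma> z \<in> \<phi> ` Y" using x by auto
  qed
  have \<sigma>0: "\<sigma> 0 = x0" by (simp add: \<sigma>_def \<gamma>(3) cY(6)[OF Y(2)])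
  have "\<gamma> ` ball 0 r \<subseteq> \<phi> ` Y" using \<gamma>(2) S(2) by blast
  interpret N: cartan_forms "ball 0 r" "\<lambda>\<alpha> i. pullback \<gamma> (c (\<theta> \<alpha> i))" "pullback \<gamma> (c \<omega>)" "\<lambda>\<alpha> \<beta>. pullback \<gamma> (c (\<omega>g \<alpha> \<beta>))"
    "\<lambda>j i. pullback \<gamma> (c (\<omega>l j i))" "\<lambda>i \<alpha>. pullback \<gamma> (c (\<psi> i \<alpha>))" "\<lambda>i \<beta> \<gamma> \<alpha> j k z. a i \<beta> \<gamma> \<alpha> j k (\<sigma> z)"
      "\<lambda>\<beta> \<gamma> \<delta> \<alpha> k l z. bg \<beta> \<gamma> \<delta> \<alpha> k l (\<sigma> z)" "\<lambda>i \<gamma> \<delta> j k l z. bl i \<gamma> \<delta> j k l (\<sigma> z)"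
    unfolding \<sigma>_def by (rule C.cartan_forms_pullback[OF open_ball \<gamma>(1) \<open>\<gamma> ` ball 0 r \<subseteq> \<phi> ` Y\<close>])
  have N: "radial_cartan_forms r (\<lambda>\<alpha> i. pullback \<gamma> (c (\<theta> \<alpha> i))) (pullback \<gamma> (c \<omega>)) (\<lambda>\<alpha> \<beta>. pullback \<gamma> (c (\<omega>g \<alpha> \<beta>)))
    (\<lambda>j i. pullback \<gamma> (c (\<omega>l j i))) (\<lambda>i \<alpha>. pullback \<gamma> (c (\<psi> i \<alpha>))) (\<lambda>i \<beta> \<gamma> \<alpha> j k z. a i \<beta> \<gamma> \<alpha> j k (\<sigma> z))
      (\<lambda>\<beta> \<gamma> \<delta> \<alpha> k l z. bg \<beta> \<gamma> \<delta> \<alpha> k l (\<sigma> z)) (\<lambda>i \<gamma> \<delta> j k l z. bl i \<gamma> \<delta> j k l (\<sigma> z))"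
    by unfold_locales (simp_all add: pullback_def radial X \<sigma>(4))
  have y0: "\<phi> x0 \<in> \<phi> ` Y" using S by blast
  have th0: "pullback \<gamma> (c (\<theta> \<alpha> i)) 0 w = w $ \<alpha> $ i" for w \<alpha> i
    by (simp add: pullback_def radial0 \<gamma>(3) X y0)
  obtain \<rho> where \<rho>: "linear \<rho>" "bij \<rho>" "\<And>z. coord_field A (V, \<kappa>) (\<rho> z) (pr x0) = fr x0 z"
    by (rule A.frame_in_chart[OF frame sV V(2)]) blast
  define \<rho>i where "\<rho>i = inv \<rho>"
  have \<rho>i: "\<rho>i (\<rho> z) = z" "\<rho> (\<rho>i u) = u" for z u
    using \<rho>(2) by (simp_all add: \<rho>i_def bij_is_inj bij_is_surj surj_f_inv_f)
  have lin_\<rho>i: "linear \<rho>i"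
    unfolding \<rho>i_def by (rule linear_bij_inv[OF \<rho>(1,2)])
  define k where "k z = h (\<gamma> z)" for z
  have k: "smooth_on (ball 0 r) k"
    unfolding k_def[abs_def] by (rule smooth_on_compose[OF open_ball S(1) \<gamma>(1) h \<gamma>(2)])
  \<comment> \<open>The soldering condition along \<sigma>; at the centre, where the
    \<theta>-components are the matrix entries, it identifies the derivative of \<open>k\<close>
    with \<rho>.\<close>
  have dk: "coord_field A (V, \<kappa>) (frechet_derivative k (at z) w) (pr (\<sigma> z)) = fr (\<sigma> z) (\<chi> \<alpha> i. pullback \<gamma> (c (\<theta> \<alpha> i)) z w)"
    if z: "z \<in> ball 0 r" for z w
  proof -
    let ?w = "frechet_derivative \<gamma> (at z) w"
    have zS: "\<gamma> z \<in> S" using z \<gamma>(2) by blast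
    have "frechet_derivative k (at z) w = frechet_derivative h (at (\<gamma> z)) ?w"
      unfolding k_def[abs_def]
      by (rule frechet_derivative_compose[OF smooth_on_has_derivative[OF open_ball \<gamma>(1) z] smooth_on_has_derivative[OF S(1) h zS]])
    then have "coord_field A (V, \<kappa>) (frechet_derivative k (at z) w) (pr (\<sigma> z)) = push_forward A pr (\<sigma> z) (coord_field B (Y, \<phi>) ?w (\<sigma> z))"
      unfolding pf(1)[OF \<sigma>(1,3)[OF z]] \<sigma>(2)[OF z] h_def[abs_def] by simp
    also have "\<dots> = fr (\<sigma> z) (\<chi> \<alpha> i. \<theta> \<alpha> i (\<sigma> z) (coord_field B (Y, \<phi>) ?w (\<sigma> z)))"
      by (rule soldering) (simp add: B.tangent_space_chart[OF sY \<sigma>(1)[OF z]])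
    finally show ?thesis by (simp add: pullback_def c_def chart_form_def \<sigma>_def)
  qed
  have dk0: "frechet_derivative k (at 0) w = \<rho> w" for w
  proof -
    have "coord_field A (V, \<kappa>) (frechet_derivative k (at 0) w) (pr x0) = coord_field A (V, \<kappa>) (\<rho> w) (pr x0)"
      using dk[of 0 w] r by (simp add: \<sigma>0 th0 \<rho>(3))
    then show ?thesis by (rule A.coord_field_inject[OF sV V(2)])
  qed
  \<comment> \<open>Precomposition with the inverse of \<rho> makes source and target the same
    space, as the inverse function theorem requires, and the derivative at 0 the identity.\<close>
  define \<Phi> where "\<Phi> u = k (\<rho>i u)" for u
  define T where "T = \<rho>i -` ball 0 r"
  have bl_\<rho>i: "bounded_linear \<rho>i" using lin_\<rho>i by (simp add: linear_conv_bounded_linear)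
  have T: "open T"
    unfolding T_def by (rule open_vimage[OF open_ball]) (rule linear_continuous_on[OF bl_\<rho>i])
  have \<Phi>_smooth: "smooth_on T \<Phi>"
    unfolding \<Phi>_def[abs_def]
    by (rule smooth_on_compose[OF T open_ball smooth_on_linear[OF T bl_\<rho>i] k]) (auto simp: T_def)
  have d\<Phi>: "frechet_derivative \<Phi> (at u) e = frechet_derivative k (at (\<rho>i u)) (\<rho>i e)" if "u \<in> T" for u e
    unfolding \<Phi>_def[abs_def]
    by (rule frechet_derivative_compose[OF bounded_linear_imp_has_derivative[OF bl_\<rho>i] smooth_on_has_derivative[OF open_ball k]])
      (use that in \<open>simp add: T_def\<close>)
  have zero_T: "0 \<in> T" using r by (simp add: T_def linear_0[OF lin_\<rho>i])
  have inj0: "v = 0" if "frechet_derivative \<Phi> (at 0) v = 0" for v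
    using that by (simp add: d\<Phi>[OF zero_T] linear_0[OF lin_\<rho>i] dk0 \<rho>i)
  obtain U1 V1 g where U1: "open U1" "U1 \<subseteq> T" "0 \<in> U1" and V1: "open V1" and hom: "homeomorphism U1 V1 \<Phi> g"
    and g: "smooth_on V1 g"
    by (rule smooth_inverse_function[OF T \<Phi>_smooth zero_T inj0]) blast+
  have ball: "\<rho>i u \<in> ball 0 r" if "u \<in> U1" for u using that U1 by (auto simp: T_def)
  have \<Phi>_pr: "\<Phi> u = \<kappa> (pr (\<sigma> (\<rho>i u)))" for u by (simp add: \<Phi>_def k_def h_def \<sigma>_def)
  have V1_sub: "V1 \<subseteq> \<kappa> ` V"
  proof -
    have "V1 = \<Phi> ` U1" using hom by (simp add: homeomorphism_def)
    then show ?thesis using \<sigma>(3)[OF ball] by (auto simp: \<Phi>_pr)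
  qed
  define W where "W = inv_into V \<kappa> ` V1"
  define \<xi> where "\<xi> m = g (\<kappa> m)" for m
  note ch = A.smooth_chart_compose[OF sV homeomorphism_sym[THEN iffD1, OF hom] V1 V1_sub U1(1) g smooth_on_subset[OF \<Phi>_smooth U1(2)],
      folded \<xi>_def, folded W_def]
  have inv_\<xi>: "inv_into W \<xi> u = pr (\<sigma> (\<rho>i u))" if "u \<in> U1" for u
    using ch(3)[OF that] \<Phi>_pr[of u] \<sigma>(3)[OF ball[OF that]] by (simp add: cV)
  define U where "U = \<rho>i ` U1"
  have U_iff: "z \<in> U \<longleftrightarrow> \<rho> z \<in> U1" for z
    unfolding U_def using \<rho>i by (metis image_iff)
  have img: "\<rho> ` U = U1" unfolding U_def image_image \<rho>i by simp
  show ?thesis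
  proof (rule that[OF N \<sigma>0 th0, of W \<xi> U \<rho>])
    show "smooth_chart A (W, \<xi>)" "\<xi> ` W = \<rho> ` U" using ch(1,2) img by simp_all
    have "U = \<rho> -` U1" using U_iff by auto
    then show "open U"
      using \<rho>(1) U1(1) by (simp add: linear_conv_bounded_linear linear_continuous_on open_vimage)
    show "0 \<in> U" using U1(3) by (simp add: U_iff linear_0[OF \<rho>(1)])
    show "U \<subseteq> ball 0 r" using ball by (auto simp: U_def)
    fix z assume z: "z \<in> U"
    then have u: "\<rho> z \<in> U1" by (simp add: U_iff)
    have m: "pr (\<sigma> z) = inv_into W \<xi> (\<rho> z)" using inv_\<xi>[OF u] by (simp add: \<rho>i)
    show mW: "pr (\<sigma> z) \<in> W" unfolding m by (rule inv_into_into) (use ch(2) u in simp)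
    show \<xi>m: "\<xi> (pr (\<sigma> z)) = \<rho> z" unfolding m by (rule f_inv_into_f) (use ch(2) u in simp)
    have z_ball: "z \<in> ball 0 r" using ball[OF u] by (simp add: \<rho>i)
    fix w
    have "frechet_derivative (\<lambda>y. \<kappa> (inv_into W \<xi> y)) (at (\<rho> z)) = frechet_derivative \<Phi> (at (\<rho> z))"
      by (rule frechet_derivative_cong[OF U1(1) u]) (simp add: inv_\<xi> \<Phi>_pr)
    then have "coord_field A (W, \<xi>) (\<rho> w) (pr (\<sigma> z)) = coord_field A (V, \<kappa>) (frechet_derivative k (at z) w) (pr (\<sigma> z))"
      using A.coord_field_change[OF ch(1) sV mW \<sigma>(3)[OF z_ball], of "\<rho> w"] d\<Phi>[of "\<rho> z" "\<rho> w"] u U1(2)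
      by (auto simp: \<xi>m \<rho>i)
    then show "coord_field A (W, \<xi>) (\<rho> w) (pr (\<sigma> z)) = fr (\<sigma> z) (\<chi> \<alpha> i. pullback \<gamma> (c (\<theta> \<alpha> i)) z w)"
      by (simp add: dk[OF z_ball])
  qed (simp_all add: pullback_def radial0 \<gamma>(3) X y0 \<rho>)
qed

end

subsection \<open>Integrability of the generators\<close>

lemma linear_outer: "linear (\<lambda>t. outer t s)"
  by (rule linearI) (simp_all add: outer_def vec_eq_iff algebra_simps)

lemma outer_nth: "outer t s $ \<alpha> $ i = t $ \<alpha> * s $ i"
  by (simp add: outer_def)

lemma inj_outer: "s \<noteq> 0 \<Longrightarrow> inj (\<lambda>t. outer t s)"
proof (rule injI)
  fix t t' assume "s \<noteq> 0" and eq: "outer t s = outer t' s"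
  then obtain i where i: "s $ i \<noteq> 0" by (auto simp: vec_eq_iff)
  have "t $ \<alpha> * s $ i = t' $ \<alpha> * s $ i" for \<alpha> using arg_cong[OF eq, of "\<lambda>z. z $ \<alpha> $ i"] by (simp add: outer_nth)
  then show "t = t'" using i by (simp add: vec_eq_iff)
qed

lemma dim_range_inj: "linear f \<Longrightarrow> inj f \<Longrightarrow> dim (range f) = DIM('a)"
  for f :: "'a::euclidean_space \<Rightarrow> 'b::euclidean_space"
  using dim_image_eq[of f UNIV] by simp

lemma subspace_range: "linear f \<Longrightarrow> subspace (range f)"
  by (rule linear_subspace_image) auto

context segre_connection
begin

lemma fr_linear: "linear (\<lambda>z. fr x z f)" and inj_fr: "inj (fr x)"
  using frame[of x] by (auto simp: is_frame_def bij_betw_def)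

text \<open>The candidate \<open>V\<close> is a slice of the normal chart, so it is a submanifold
  from the start; what needs proof is that its tangent spaces away from the centre are generators,
  and this is \<open>radial_planes\<close>.\<close>

theorem generators_integrable_if:
  assumes a_sym: "\<And>x i \<beta> \<gamma> \<alpha> j k. sym2 (\<lambda>j k. a i \<beta> \<gamma> \<alpha> j k x) j k = 0"
    and b_sym: "\<And>x i \<gamma> \<delta> j k l. sym3 (\<lambda>j k l. bl i \<gamma> \<delta> j k l x) j k l = 0"
  shows "generators_integrable A CARD('p) generators"
  unfolding generators_integrable_def
proof
  fix p assume "p \<in> generator_bundle generators"
  then obtain x0 s where p: "p = (pr x0, fr x0 ` range (\<lambda>t. outer t s))" and s: "s \<noteq> 0"
    by (auto simp: generator_bundle_def generators_def)
  obtain i0 where i0: "s $ i0 \<noteq> 0" using s by (auto simp: vec_eq_iff)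
  obtain r \<sigma> th om og ol ps W \<xi> \<rho> U where
    N: "radial_cartan_forms r th om og ol ps (\<lambda>i \<beta> \<gamma> \<alpha> j k z. a i \<beta> \<gamma> \<alpha> j k (\<sigma> z))
      (\<lambda>\<beta> \<gamma> \<delta> \<alpha> k l z. bg \<beta> \<gamma> \<delta> \<alpha> k l (\<sigma> z)) (\<lambda>i \<gamma> \<delta> j k l z. bl i \<gamma> \<delta> j k l (\<sigma> z))"
    and \<sigma>0: "\<sigma> 0 = x0" and W: "smooth_chart A (W, \<xi>)" and U: "open U" "0 \<in> U" "U \<subseteq> ball 0 r"
    and \<rho>: "linear \<rho>" "bij \<rho>" "\<xi> ` W = \<rho> ` U"
    and \<sigma>: "\<And>z. z \<in> U \<Longrightarrow> pr (\<sigma> z) \<in> W" "\<And>z. z \<in> U \<Longrightarrow> \<xi> (pr (\<sigma> z)) = \<rho> z"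
    and th: "\<And>z w. z \<in> U \<Longrightarrow> coord_field A (W, \<xi>) (\<rho> w) (pr (\<sigma> z)) = fr (\<sigma> z) (\<chi> \<alpha> i. th \<alpha> i z w)"
  proof (rule normal_chart[of x0], goal_cases)
    case 1
    show ?thesis by (rule 1(1); fact 1)
  qed
  interpret N: radial_cartan_forms r th om og ol ps "\<lambda>i \<beta> \<gamma> \<alpha> j k z. a i \<beta> \<gamma> \<alpha> j k (\<sigma> z)"
    "\<lambda>\<beta> \<gamma> \<delta> \<alpha> k l z. bg \<beta> \<gamma> \<delta> \<alpha> k l (\<sigma> z)" "\<lambda>i \<gamma> \<delta> j k l z. bl i \<gamma> \<delta> j k l (\<sigma> z)" by (rule N)
  note cW = is_chartD[OF smooth_chartD[OF W]]
  let ?R = "range (\<lambda>t. outer t s) :: (real ^ 'q ^ 'p) set"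
  define L where "L = \<rho> ` ?R"
  define V where "V = {m \<in> W. \<xi> m \<in> L}"
  have L: "subspace L" "dim L = CARD('p)"
  proof -
    have lin: "linear (\<lambda>t. \<rho> (outer t s))" using linear_compose[OF linear_outer \<rho>(1)] by (simp add: o_def)
    moreover have inj: "inj (\<lambda>t. \<rho> (outer t s :: real ^ 'q ^ 'p))"
      using inj_outer[OF s] \<rho>(2) by (auto simp: bij_def inj_def)
    ultimately show "subspace L" "dim L = CARD('p)"
      using subspace_range[OF lin] dim_range_inj[OF lin inj] by (simp_all add: L_def image_image)
  qed
  have slice: "\<xi> ` (V \<inter> W) = \<xi> ` W \<inter> L" by (auto simp: V_def)
  have tangent: "tangent_of A V (pr (\<sigma> z)) = fr (\<sigma> z) ` ?R" and in_V: "pr (\<sigma> z) \<in> V" if z: "z \<in> U" "z \<in> ?R" for z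
  proof -
    obtain t where t: "z = outer t s" using z by blast
    have zb: "z \<in> ball 0 r" using z U by blast
    show in_V: "pr (\<sigma> z) \<in> V" using z \<sigma>[OF z(1)] by (auto simp: V_def L_def)
    \<comment> \<open>The tangent space of the slice at \<open>z\<close>, read in the frame
      \<open>fr (\<sigma> z)\<close>, is the range of \<open>f\<close>.\<close>
    define f where "f t' = (\<chi> \<alpha> i. th \<alpha> i z (outer t' s))" for t'
    have lin: "linear f"
      unfolding f_def
      by (rule linearI) (simp_all add: vec_eq_iff linear_add[OF linear_outer] linear_scale[OF linear_outer]
          linear_add[OF smooth_1formD(1)[OF N.smooth_forms(1) zb]] linear_scale[OF smooth_1formD(1)[OF N.smooth_forms(1) zb]])
    have "inj f"
      unfolding linear_injective_0[OF lin]
    proof (intro allI impI)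
      fix t' assume "f t' = 0"
      then have "coord_field A (W, \<xi>) (\<rho> (outer t' s)) (pr (\<sigma> z)) = fr (\<sigma> z) 0"
        unfolding th[OF z(1)] f_def by simp
      also have "\<dots> = coord_field A (W, \<xi>) 0 (pr (\<sigma> z))"
        by (rule ext) (simp add: linear_0[OF fr_linear] linear_0[OF A.linear_coord_field[OF W \<sigma>(1)[OF z(1)]]])
      finally have "\<rho> (outer t' s) = 0" by (rule A.coord_field_inject[OF W \<sigma>(1)[OF z(1)]])
      then have "\<rho> (outer t' s) = \<rho> 0" by (simp add: linear_0[OF \<rho>(1)])
      then have "outer t' s = (outer 0 s :: real ^ 'q ^ 'p)"
        using \<rho>(2) by (simp add: bij_is_inj inj_eq linear_0[OF linear_outer])
      from injD[OF inj_outer[OF s] this] show "t' = 0" .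
    qed
    have "f t' \<in> ?R" for t'
    proof (rule range_eqI)
      show "f t' = outer (\<chi> \<alpha>. th \<alpha> i0 z (outer t' s) / s $ i0) s"
        using N.radial_planes[OF a_sym b_sym zb[unfolded t] i0, of _ _ t'] i0
        by (simp add: f_def t vec_eq_iff outer_nth field_simps)
    qed
    then have "range f \<subseteq> ?R" by blast
    \<comment> \<open>Injectivity of \<open>f\<close> gives both spaces dimension p, so the
      inclusion from \<open>radial_planes\<close> is an equality.\<close>
    moreover have "dim (range f) = dim ?R"
      unfolding dim_range_inj[OF lin \<open>inj f\<close>] dim_range_inj[OF linear_outer inj_outer[OF s]] ..
    ultimately have range_f: "range f = ?R"
      by (intro subspace_dim_equal subspace_range lin linear_outer) simp_all
    have "tangent_of A V (pr (\<sigma> z)) = (\<lambda>w. coord_field A (W, \<xi>) w (pr (\<sigma> z))) ` L"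
      by (rule A.tangent_of_slice[OF W \<sigma>(1)[OF z(1)] in_V L(1) slice])
    also have "\<dots> = fr (\<sigma> z) ` range f"
      by (simp add: L_def image_image th[OF z(1)] f_def)
    finally show "tangent_of A V (pr (\<sigma> z)) = fr (\<sigma> z) ` ?R" unfolding range_f .
  qed
  have point: "\<exists>z\<in>U. z \<in> ?R \<and> m = pr (\<sigma> z)" if m: "m \<in> V" for m
  proof -
    have "\<xi> m \<in> \<rho> ` U" "\<xi> m \<in> L" "m \<in> W" using m \<rho>(3) by (auto simp: V_def)
    then obtain z z' where z: "z \<in> U" "\<xi> m = \<rho> z" "z' \<in> ?R" "\<xi> m = \<rho> z'" unfolding L_def by blast
    then have "z = z'" using \<rho>(2) by (simp add: bij_is_inj inj_eq)
    moreover have "m = pr (\<sigma> z)"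
      using z \<sigma>[OF z(1)] \<open>m \<in> W\<close> cW(5) by (auto simp: inj_on_def)
    ultimately show ?thesis using z by blast
  qed
  have zero: "0 \<in> ?R" using linear_0[OF linear_outer, of s] by (metis rangeI)
  show "\<exists>V. submanifold A CARD('p) V \<and> p \<in> tangent_lift A V \<and> tangent_lift A V \<subseteq> generator_bundle generators"
  proof (intro exI conjI)
    show "submanifold A CARD('p) V"
      unfolding submanifold_def
    proof
      fix m assume "m \<in> V"
      then have "m \<in> W" by (simp add: V_def)
      then show "\<exists>U \<phi> L. smooth_chart A (U, \<phi>) \<and> m \<in> U \<and> subspace L \<and> dim L = CARD('p) \<and> \<phi> ` (V \<inter> U) = \<phi> ` U \<inter> L"
        using W L slice by blast
    qed
    show "p \<in> tangent_lift A V"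
      using tangent[OF U(2) zero] in_V[OF U(2) zero] by (auto simp: tangent_lift_def p \<sigma>0)
    show "tangent_lift A V \<subseteq> generator_bundle generators"
    proof
      fix q assume "q \<in> tangent_lift A V"
      then obtain m where m: "m \<in> V" "q = (m, tangent_of A V m)" by (auto simp: tangent_lift_def)
      obtain z where z: "z \<in> U" "z \<in> ?R" "m = pr (\<sigma> z)" using point[OF m(1)] by blast
      have "fr (\<sigma> z) ` ?R \<in> generators m" using s z(3) unfolding generators_def by blast
      then show "q \<in> generator_bundle generators"
        using tangent[OF z(1,2)] by (simp add: m(2) z(3) generator_bundle_def)
    qed
  qed
qed

end

section \<open>Necessary conditions from integral manifolds\<close>

context segre_connection
begin

text \<open>An integral manifold through the given generator is parametrized by p real variables and
  lifted to the bundle by the section of a normal chart. Pulling the structure equations back along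
  this lift gives forms to which \<open>leaf_identities\<close> applies at the centre.\<close>

lemma integrable_leaf_identities:
  fixes s :: "real ^ 'q"
  assumes card: "CARD('p) \<ge> 2" and int: "generators_integrable A CARD('p) generators" and s: "s $ i0 = 1"
  shows "(\<Sum>j\<in>UNIV. \<Sum>k\<in>UNIV. a i \<beta> \<gamma> \<alpha> j k x0 * (s $ j * s $ k))
      = s $ i * (\<Sum>j\<in>UNIV. \<Sum>k\<in>UNIV. a i0 \<beta> \<gamma> \<alpha> j k x0 * (s $ j * s $ k))"
    and "(\<Sum>j\<in>UNIV. \<Sum>k\<in>UNIV. \<Sum>l\<in>UNIV. bl i \<gamma> \<delta> j k l x0 * (s $ j * s $ k * s $ l))
      = s $ i * (\<Sum>j\<in>UNIV. \<Sum>k\<in>UNIV. \<Sum>l\<in>UNIV. bl i0 \<gamma> \<delta> j k l x0 * (s $ j * s $ k * s $ l))"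
proof -
  let ?R = "\<lambda>s. range (\<lambda>t. outer t s) :: (real ^ 'q ^ 'p) set"
  obtain r \<sigma> th om og ol ps W \<xi> \<rho> U where
    N: "radial_cartan_forms r th om og ol ps (\<lambda>i \<beta> \<gamma> \<alpha> j k z. a i \<beta> \<gamma> \<alpha> j k (\<sigma> z))
      (\<lambda>\<beta> \<gamma> \<delta> \<alpha> k l z. bg \<beta> \<gamma> \<delta> \<alpha> k l (\<sigma> z)) (\<lambda>i \<gamma> \<delta> j k l z. bl i \<gamma> \<delta> j k l (\<sigma> z))"
    and \<sigma>0: "\<sigma> 0 = x0" and W: "smooth_chart A (W, \<xi>)" and U: "open U" "0 \<in> U" "U \<subseteq> ball 0 r"
    and \<rho>: "linear \<rho>" "bij \<rho>" "\<xi> ` W = \<rho> ` U"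
    and \<sigma>: "\<And>z. z \<in> U \<Longrightarrow> pr (\<sigma> z) \<in> W" "\<And>z. z \<in> U \<Longrightarrow> \<xi> (pr (\<sigma> z)) = \<rho> z"
    and th: "\<And>z w. z \<in> U \<Longrightarrow> coord_field A (W, \<xi>) (\<rho> w) (pr (\<sigma> z)) = fr (\<sigma> z) (\<chi> \<alpha> i. th \<alpha> i z w)"
  proof (rule normal_chart[of x0], goal_cases)
    case 1
    show ?thesis by (rule 1(1); fact 1)
  qed
  interpret N: radial_cartan_forms r th om og ol ps "\<lambda>i \<beta> \<gamma> \<alpha> j k z. a i \<beta> \<gamma> \<alpha> j k (\<sigma> z)"
    "\<lambda>\<beta> \<gamma> \<delta> \<alpha> k l z. bg \<beta> \<gamma> \<delta> \<alpha> k l (\<sigma> z)" "\<lambda>i \<gamma> \<delta> j k l z. bl i \<gamma> \<delta> j k l (\<sigma> z)" by (rule N)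
  note cW = is_chartD[OF smooth_chartD[OF W]]
  have "s \<noteq> 0" using s by auto
  then have "(pr x0, fr x0 ` ?R s) \<in> generator_bundle generators"
    unfolding generator_bundle_def generators_def by blast
  then obtain V where V: "submanifold A CARD('p) V" "(pr x0, fr x0 ` ?R s) \<in> tangent_lift A V"
    and lift: "tangent_lift A V \<subseteq> generator_bundle generators"
    using int unfolding generators_integrable_def by blast
  have x0V: "pr x0 \<in> V" and T0: "tangent_of A V (pr x0) = fr x0 ` ?R s"
    using V(2) by (auto simp: tangent_lift_def)
  have gen: "tangent_of A V m \<in> generators m" if "m \<in> V" for m
    using lift that by (auto simp: tangent_lift_def generator_bundle_def)
  from V(1) x0V obtain W' \<xi>' L where W': "smooth_chart A (W', \<xi>')" "pr x0 \<in> W'" and L: "subspace L" "dim L = CARD('p)"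
    and slice: "\<xi>' ` (V \<inter> W') = \<xi>' ` W' \<inter> L"
    unfolding submanifold_def by blast
  note cW' = is_chartD[OF smooth_chartD[OF W'(1)]]
  have "dim (UNIV :: (real ^ 'p) set) = dim L" using L(2) by simp
  \<comment> \<open>Identifies the slice with the coordinate space of dimension p, so that the forms
    on the leaf live on an open set of a Euclidean space.\<close>
  from subspace_isomorphism[OF subspace_UNIV L(1) this] obtain l :: "real ^ 'p \<Rightarrow> 'a" where l: "linear l" "range l = L" by blast
  have bl_l: "bounded_linear l" using l(1) by (simp add: linear_conv_bounded_linear)
  define p0 where "p0 = \<xi>' (pr x0)"
  define \<tau> where "\<tau> u = \<xi> (inv_into W' \<xi>' u)" for u
  define O' where "O' = \<xi>' ` (W' \<inter> W)"
  have O': "open O'" unfolding O'_def by (rule chart_image_open[OF smooth_chartD[OF W'(1)] cW(1)])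
  have \<tau>: "smooth_on O' \<tau>" unfolding O'_def \<tau>_def by (rule A.smooth_transition[OF W'(1) W])
  define \<rho>i where "\<rho>i = inv \<rho>"
  have \<rho>i: "\<rho>i (\<rho> z) = z" "\<rho> (\<rho>i u) = u" for z u
    using \<rho>(2) by (simp_all add: \<rho>i_def bij_is_inj bij_is_surj surj_f_inv_f)
  have lin_\<rho>i: "linear \<rho>i"
    unfolding \<rho>i_def using linear_bij_inv[OF \<rho>(1,2)] .
  have bl_\<rho>i: "bounded_linear \<rho>i" using lin_\<rho>i by (simp add: linear_conv_bounded_linear)
  define N where "N = (\<lambda>v. p0 + l v) -` O'"
  have N_open: "open N"
    unfolding N_def by (rule open_vimage[OF O']) (intro continuous_intros linear_continuous_on bl_l)
  \<comment> \<open>The leaf in normal coordinates; composing with \<sigma> lifts it to the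
    bundle.\<close>
  define k where "k v = \<rho>i (\<tau> (p0 + l v))" for v
  have aff: "smooth_on N (\<lambda>v. p0 + l v)"
    by (intro smooth_on_add[OF N_open] smooth_on_const smooth_on_linear[OF N_open bl_l])
  have k: "smooth_on N k"
    unfolding k_def[abs_def]
    by (rule smooth_on_linear_comp[OF N_open bl_\<rho>i smooth_on_compose[OF N_open O' aff \<tau>]]) (auto simp: N_def)
  have dk: "\<rho> (frechet_derivative k (at v) t) = frechet_derivative \<tau> (at (p0 + l v)) (l t)" if v: "v \<in> N" for v t
  proof -
    have D: "((\<lambda>v. \<tau> (p0 + l v)) has_derivative (\<lambda>t. frechet_derivative \<tau> (at (p0 + l v)) (l t))) (at v)"
    proof (rule has_derivative_compose[of "\<lambda>v. p0 + l v" l])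
      show "((\<lambda>v. p0 + l v) has_derivative l) (at v)"
        using has_derivative_add[OF has_derivative_const bounded_linear_imp_has_derivative[OF bl_l]] by simp
      show "(\<tau> has_derivative frechet_derivative \<tau> (at (p0 + l v))) (at (p0 + l v))"
        by (rule smooth_on_has_derivative[OF O' \<tau>]) (use v in \<open>simp add: N_def\<close>)
    qed
    have "frechet_derivative k (at v) t = \<rho>i (frechet_derivative \<tau> (at (p0 + l v)) (l t))"
      unfolding k_def[abs_def] by (rule frechet_derivative_compose[OF D bounded_linear_imp_has_derivative[OF bl_\<rho>i]])
    then show ?thesis by (simp add: \<rho>i)
  qed
  define m where "m v = inv_into W' \<xi>' (p0 + l v)" for v
  have m: "m v \<in> W'" "m v \<in> W" "\<xi>' (m v) = p0 + l v" "k v \<in> U" "pr (\<sigma> (k v)) = m v" "m v \<in> V" if v: "v \<in> N" for v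
  proof -
    obtain m' where m': "m' \<in> W'" "m' \<in> W" "p0 + l v = \<xi>' m'" using v by (auto simp: N_def O'_def)
    then have mm: "m v = m'" by (simp add: m_def cW'(6))
    show W1: "m v \<in> W'" "m v \<in> W" "\<xi>' (m v) = p0 + l v" using m' by (simp_all add: mm)
    obtain z where z: "z \<in> U" "\<xi> (m v) = \<rho> z" using W1(2) \<rho>(3) by blast
    have kz: "k v = z" using z(2) by (simp add: k_def \<tau>_def m_def \<rho>i)
    then show "k v \<in> U" using z by simp
    show "pr (\<sigma> (k v)) = m v"
      unfolding kz by (rule inj_onD[OF cW(5)]) (use z \<sigma> W1 in auto)
    have "p0 \<in> L" using slice x0V W'(2) by (auto simp: p0_def)
    then have "p0 + l v \<in> L" using l(2) by (intro subspace_add[OF L(1)]) auto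
    then have "\<xi>' (m v) \<in> \<xi>' ` (V \<inter> W')" unfolding slice using imageI[OF W1(1), of \<xi>'] W1(3) by simp
    then show "m v \<in> V" using W1(1) cW'(5) by (auto simp: inj_on_def)
  qed
  have "k ` N \<subseteq> ball 0 r" using m(4) U(3) by blast
  interpret P: cartan_forms N "\<lambda>\<alpha> i. pullback k (th \<alpha> i)" "pullback k om" "\<lambda>\<alpha> \<beta>. pullback k (og \<alpha> \<beta>)"
    "\<lambda>j i. pullback k (ol j i)" "\<lambda>i \<alpha>. pullback k (ps i \<alpha>)" "\<lambda>i \<beta> \<gamma> \<alpha> j l y. a i \<beta> \<gamma> \<alpha> j l (\<sigma> (k y))"
    "\<lambda>\<beta> \<gamma> \<delta> \<alpha> j l y. bg \<beta> \<gamma> \<delta> \<alpha> j l (\<sigma> (k y))" "\<lambda>i \<gamma> \<delta> j l l' y. bl i \<gamma> \<delta> j l l' (\<sigma> (k y))"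
    by (rule N.cartan_forms_pullback[OF N_open k \<open>k ` N \<subseteq> ball 0 r\<close>])
  let ?f = "\<lambda>v t. \<chi> \<alpha> i. pullback k (th \<alpha> i) v t"
  \<comment> \<open>The slice chart gives the tangent space as the image of \<open>l\<close>;
    changing to the normal chart expresses the same space by the pulled back forms in the frame
    \<open>fr (\<sigma> (k v))\<close>.\<close>
  have tangent: "fr (\<sigma> (k v)) ` range (?f v) = tangent_of A V (m v)" if v: "v \<in> N" for v
  proof -
    have "fr (\<sigma> (k v)) (?f v t) = coord_field A (W', \<xi>') (l t) (m v)" for t
    proof -
      have "fr (\<sigma> (k v)) (?f v t) = coord_field A (W, \<xi>) (\<rho> (frechet_derivative k (at v) t)) (m v)"
        unfolding pullback_def th[OF m(4)[OF v], symmetric] m(5)[OF v] ..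
      also have "\<dots> = coord_field A (W', \<xi>') (l t) (m v)"
        unfolding dk[OF v] A.coord_field_change[OF W'(1) W m(1,2)[OF v]] m(3)[OF v] \<tau>_def[abs_def] ..
      finally show ?thesis .
    qed
    then have "fr (\<sigma> (k v)) ` range (?f v) = (\<lambda>w. coord_field A (W', \<xi>') w (m v)) ` range l"
      by (simp add: image_image)
    then show ?thesis
      unfolding l(2) A.tangent_of_slice[OF W'(1) m(1)[OF v] m(6)[OF v] L(1) slice] .
  qed
  \<comment> \<open>The generator may be given in a different frame over the same point;
    \<open>fibre\<close> rewrites it in the frame of the section.\<close>
  have planes: "\<exists>s'. s' \<noteq> 0 \<and> range (?f v) = ?R s'" if v: "v \<in> N" for v
  proof -
    obtain x' s' where x': "tangent_of A V (m v) = fr x' ` ?R s'" "pr x' = m v" "s' \<noteq> 0"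
      using gen[OF m(6)[OF v]] unfolding generators_def by blast
    have "pr x' = pr (\<sigma> (k v))" using x'(2) m(5)[OF v] by simp
    from fibre[OF this x'(3)] obtain s'' where s'': "s'' \<noteq> 0" "fr x' ` ?R s' = fr (\<sigma> (k v)) ` ?R s''" by blast
    then have "fr (\<sigma> (k v)) ` range (?f v) = fr (\<sigma> (k v)) ` ?R s''" using tangent[OF v] x'(1) by simp
    then have "range (?f v) = ?R s''" by (rule iffD1[OF inj_image_eq_iff[OF inj_fr]])
    then show ?thesis using s''(1) by (intro exI[of _ s''] conjI)
  qed
  have m0: "m 0 = pr x0" by (simp add: m_def linear_0[OF l(1)] p0_def cW'(6)[OF W'(2)])
  have x0W: "pr x0 \<in> W" "\<xi> (pr x0) = 0" using \<sigma>[OF U(2)] by (simp_all add: \<sigma>0 linear_0[OF \<rho>(1)])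
  have N0: "0 \<in> N" using x0W W'(2) by (simp add: N_def O'_def linear_0[OF l(1)] p0_def)
  have k0: "k 0 = 0" using x0W m0 by (simp add: k_def \<tau>_def m_def linear_0[OF lin_\<rho>i])
  \<comment> \<open>At the centre the frame of the section is \<open>fr x0\<close> itself, in which
    the generator was chosen with direction \<open>s\<close>.\<close>
  have plane0: "range (?f 0) = ?R s"
    by (rule iffD1[OF inj_image_eq_iff[OF inj_fr[of x0]]]) (use tangent[OF N0, unfolded m0 T0] in \<open>simp only: k0 \<sigma>0\<close>)
  show "(\<Sum>j\<in>UNIV. \<Sum>k\<in>UNIV. a i \<beta> \<gamma> \<alpha> j k x0 * (s $ j * s $ k))
      = s $ i * (\<Sum>j\<in>UNIV. \<Sum>k\<in>UNIV. a i0 \<beta> \<gamma> \<alpha> j k x0 * (s $ j * s $ k))"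
    by (rule P.leaf_identities(1)[OF card N0 planes plane0 s, unfolded k0 \<sigma>0])
  show "(\<Sum>j\<in>UNIV. \<Sum>k\<in>UNIV. \<Sum>l\<in>UNIV. bl i \<gamma> \<delta> j k l x0 * (s $ j * s $ k * s $ l))
      = s $ i * (\<Sum>j\<in>UNIV. \<Sum>k\<in>UNIV. \<Sum>l\<in>UNIV. bl i0 \<gamma> \<delta> j k l x0 * (s $ j * s $ k * s $ l))"
    by (rule P.leaf_identities(2)[OF card N0 planes plane0 s, unfolded k0 \<sigma>0])
qed

text \<open>A nonzero \<open>s\<close> is rescaled to have a coordinate equal to 1; homogeneity of
  degree 2 and 3 carries the leaf identities back. Cross-multiplication gives a form without
  reference to that coordinate, valid also for s = 0.\<close>

lemma integrable_proportional:
  assumes card: "CARD('p) \<ge> 2" and int: "generators_integrable A CARD('p) generators"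
  shows "(\<Sum>j\<in>UNIV. \<Sum>k\<in>UNIV. a i \<beta> \<gamma> \<alpha> j k x * (s j * s k)) * s l
      = (\<Sum>j\<in>UNIV. \<Sum>k\<in>UNIV. a l \<beta> \<gamma> \<alpha> j k x * (s j * s k)) * s i"
    and "(\<Sum>j\<in>UNIV. \<Sum>k\<in>UNIV. \<Sum>m\<in>UNIV. bl i \<gamma> \<delta> j k m x * (s j * s k * s m)) * s l
      = (\<Sum>j\<in>UNIV. \<Sum>k\<in>UNIV. \<Sum>m\<in>UNIV. bl l \<gamma> \<delta> j k m x * (s j * s k * s m)) * s i"
proof -
  define P where "P i s = (\<Sum>j\<in>UNIV. \<Sum>k\<in>UNIV. a i \<beta> \<gamma> \<alpha> j k x * (s j * s k))" for i s
  define Q where "Q i s = (\<Sum>j\<in>UNIV. \<Sum>k\<in>UNIV. \<Sum>m\<in>UNIV. bl i \<gamma> \<delta> j k m x * (s j * s k * s m))" for i s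
  have "P i s * s l = P l s * s i \<and> Q i s * s l = Q l s * s i"
  proof (cases "\<exists>i0. s i0 \<noteq> 0")
    case True
    then obtain i0 where i0: "s i0 \<noteq> 0" by blast
    define s' where "s' = (\<chi> j. s j / s i0)"
    have s'_nth: "s' $ j = s j / s i0" for j by (simp add: s'_def)
    have s': "s' $ i0 = 1" using i0 by (simp add: s'_nth)
    have P: "P i s = (s i0)\<^sup>2 * P i (($) s')" for i
      unfolding P_def sum_distrib_left s'_nth by (intro sum.cong refl) (use i0 in \<open>simp add: field_simps power2_eq_square\<close>)
    have Q: "Q i s = (s i0)^3 * Q i (($) s')" for i
      unfolding Q_def sum_distrib_left s'_nth by (intro sum.cong refl) (use i0 in \<open>simp add: field_simps power3_eq_cube\<close>)
    have leaf: "P i (($) s') = s' $ i * P i0 (($) s')" "Q i (($) s') = s' $ i * Q i0 (($) s')" for i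
      unfolding P_def Q_def by (rule integrable_leaf_identities[OF card int s'])+
    have "P i s = s i / s i0 * P i0 s" "Q i s = s i / s i0 * Q i0 s" for i
      unfolding P[of i] P[of i0] Q[of i] Q[of i0] leaf[of i] by (simp_all add: s'_nth)
    from this(1)[of i] this(1)[of l] this(2)[of i] this(2)[of l] show ?thesis
      using i0 by (simp add: mult_ac)
  next
    case False
    then show ?thesis by simp
  qed
  then show "P i s * s l = P l s * s i" "Q i s * s l = Q l s * s i" by blast+
qed

theorem integrable_imp:
  assumes card: "CARD('p) \<ge> 2" and int: "generators_integrable A CARD('p) generators"
  shows "sym2 (\<lambda>j k. a i \<beta> \<gamma> \<alpha> j k x) j k = 0" "sym3 (\<lambda>j k l. bl i \<gamma> \<delta> j k l x) j k l = 0"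
    "alt3 (\<lambda>\<beta> \<gamma> \<delta>. bg \<beta> \<gamma> \<delta> \<alpha> k l x) \<beta> \<gamma> \<delta> = 0"
proof -
  note prop_a = integrable_proportional(1)[OF card int] and prop_b = integrable_proportional(2)[OF card int]
  \<comment> \<open>Proved at every point of the bundle before the curvature is treated, since there
    the alternation of the torsion is needed on a whole neighbourhood.\<close>
  have a_sym: "sym2 (\<lambda>j k. a i \<beta> \<gamma> \<alpha> j k x) j k = 0" for i \<beta> \<gamma> \<alpha> j k x
  proof (rule traceless_proportional_sym2[of "\<lambda>i j k. a i \<beta> \<gamma> \<alpha> j k x"])
    fix k
    have "(\<Sum>i\<in>UNIV. a i \<beta> \<gamma> \<alpha> k i x) = - (\<Sum>i\<in>UNIV. a i \<gamma> \<beta> \<alpha> i k x)"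
      unfolding sum_negf[symmetric] by (intro sum.cong refl a_skew)
    then show "(\<Sum>i\<in>UNIV. a i \<beta> \<gamma> \<alpha> k i x) = 0" by (simp add: a_trace_l)
  qed (rule prop_a a_trace_l)+
  then show "sym2 (\<lambda>j k. a i \<beta> \<gamma> \<alpha> j k x) j k = 0" .
  obtain r \<sigma> th om og ol ps where
    N: "radial_cartan_forms r th om og ol ps (\<lambda>i \<beta> \<gamma> \<alpha> j k z. a i \<beta> \<gamma> \<alpha> j k (\<sigma> z))
      (\<lambda>\<beta> \<gamma> \<delta> \<alpha> k l z. bg \<beta> \<gamma> \<delta> \<alpha> k l (\<sigma> z)) (\<lambda>i \<gamma> \<delta> j k l z. bl i \<gamma> \<delta> j k l (\<sigma> z))"
    and \<sigma>0: "\<sigma> 0 = x" and r: "0 \<in> ball (0 :: real ^ 'q ^ 'p) r"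
    and forms: "\<And>w \<alpha> i. th \<alpha> i 0 w = w $ \<alpha> $ i" "\<And>w. om 0 w = 0" "\<And>w \<alpha> \<beta>. og \<alpha> \<beta> 0 w = 0"
    "\<And>w j i. ol j i 0 w = 0" "\<And>w i \<alpha>. ps i \<alpha> 0 w = 0"
  proof (rule normal_chart[of x], goal_cases)
    case (1 r \<sigma> th om og ol ps W \<xi> \<rho> U)
    show ?thesis by (rule 1(1)[OF 1(2,3) _ 1(4-8)]) (use 1(11,12) in blast)
  qed
  interpret N: radial_cartan_forms r th om og ol ps "\<lambda>i \<beta> \<gamma> \<alpha> j k z. a i \<beta> \<gamma> \<alpha> j k (\<sigma> z)"
    "\<lambda>\<beta> \<gamma> \<delta> \<alpha> k l z. bg \<beta> \<gamma> \<delta> \<alpha> k l (\<sigma> z)" "\<lambda>i \<gamma> \<delta> j k l z. bl i \<gamma> \<delta> j k l (\<sigma> z)" by (rule N)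
  \<comment> \<open>At the centre of a normal chart all forms but \<theta> vanish on every vector,
    so a matrix is its own horizontal lift.\<close>
  have lift: "\<exists>w. (\<forall>\<alpha> i. th \<alpha> i 0 w = Z \<alpha> i) \<and> om 0 w = 0 \<and> (\<forall>\<alpha> \<beta>. og \<alpha> \<beta> 0 w = 0)
      \<and> (\<forall>i j. ol i j 0 w = 0) \<and> (\<forall>i \<alpha>. ps i \<alpha> 0 w = 0)" for Z
    by (rule exI[of _ "\<chi> \<alpha> i. Z \<alpha> i"]) (simp add: forms)
  show "sym3 (\<lambda>j k l. bl i \<gamma> \<delta> j k l x) j k l = 0" "alt3 (\<lambda>\<beta> \<gamma> \<delta>. bg \<beta> \<gamma> \<delta> \<alpha> k l x) \<beta> \<gamma> \<delta> = 0"
    using N.curvature_symmetries[OF r lift a_sym prop_b] by (simp_all add: \<sigma>0)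
qed

theorem generators_integrable_iff:
  assumes "CARD('p) \<ge> 2"
  shows "generators_integrable A CARD('p) generators \<longleftrightarrow>
    (\<forall>x. (\<forall>i \<beta> \<gamma> \<alpha> j k. sym2 (\<lambda>j k. a i \<beta> \<gamma> \<alpha> j k x) j k = 0) \<and>
         (\<forall>i \<gamma> \<delta> j k l. sym3 (\<lambda>j k l. bl i \<gamma> \<delta> j k l x) j k l = 0) \<and>
         (\<forall>\<beta> \<gamma> \<delta> \<alpha> k l. alt3 (\<lambda>\<beta> \<gamma> \<delta>. bg \<beta> \<gamma> \<delta> \<alpha> k l x) \<beta> \<gamma> \<delta> = 0))"
proof (intro iffI allI conjI)
  assume int: "generators_integrable A CARD('p) generators"
  show "sym2 (\<lambda>j k. a i \<beta> \<gamma> \<alpha> j k x) j k = 0" for x i \<beta> \<gamma> \<alpha> j k by (rule integrable_imp(1)[OF assms int])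
  show "sym3 (\<lambda>j k l. bl i \<gamma> \<delta> j k l x) j k l = 0" for x i \<gamma> \<delta> j k l by (rule integrable_imp(2)[OF assms int])
  show "alt3 (\<lambda>\<beta> \<gamma> \<delta>. bg \<beta> \<gamma> \<delta> \<alpha> k l x) \<beta> \<gamma> \<delta> = 0" for x \<beta> \<gamma> \<delta> \<alpha> k l by (rule integrable_imp(3)[OF assms int])
qed (rule generators_integrable_if; simp)

end

subsection \<open>The two families of generators\<close>

context smooth_manifold
begin

text \<open>Needed, like the rule for exterior derivatives below, because transposition replaces the
  connection forms by their negatives.\<close>

lemma smooth_form_uminus:
  assumes "smooth_form A \<eta>"
  shows "smooth_form A (\<lambda>x v. - \<eta> x v)"
  unfolding smooth_form_def
proof clarify
  fix U \<phi> assume U: "(U, \<phi>) \<in> A"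
  note cU = charts[OF U]
  have "linear (\<lambda>z. \<eta> x (coord_field A (U, \<phi>) z x))" if "x \<in> U" for x
    using assms U that by (auto simp: smooth_form_def)
  moreover have "smooth_map A eucl U (\<lambda>x. \<eta> x (coord_field A (U, \<phi>) z x))" for z
    using assms U by (auto simp: smooth_form_def)
  then have "smooth_map A eucl U (\<lambda>x. - \<eta> x (coord_field A (U, \<phi>) z x))" for z
    unfolding smooth_map_eucl_target
    using smooth_on_linear_comp[OF chart_image_open[OF charts is_chartD(1)[OF cU]] bounded_linear_minus[OF bounded_linear_ident]]
    by (force intro: continuous_on_minus)
  ultimately show "(\<forall>x\<in>U. linear (\<lambda>z. - \<eta> x (coord_field A (U, \<phi>) z x))) \<and>
     (\<forall>z. smooth_map A eucl U (\<lambda>x. - \<eta> x (coord_field A (U, \<phi>) z x)))"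
    by (simp add: linear_compose_neg)
qed

lemma has_ext_deriv_uminus:
  assumes \<eta>: "smooth_form A \<eta>" and d: "has_ext_deriv A \<eta> \<Theta>"
  shows "has_ext_deriv A (\<lambda>x v. - \<eta> x v) (\<lambda>x v w. - \<Theta> x v w)"
  unfolding has_ext_deriv_def Let_def
proof clarify
  fix U \<phi> x z w assume U: "(U, \<phi>) \<in> A" "x \<in> U"
  have sm: "smooth_at A x (\<lambda>y. \<eta> y (coord_field A (U, \<phi>) z y))" if "smooth_form A \<eta>" for \<eta> z
    unfolding smooth_at_def by (rule exI[of _ U]) (use that U in \<open>auto simp: smooth_form_def\<close>)
  note sU = atlas_smooth_chart[OF U(1)]
  have neg: "coord_field A (U, \<phi>) w x (\<lambda>y. - \<eta> y (coord_field A (U, \<phi>) z y))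
    = - coord_field A (U, \<phi>) w x (\<lambda>y. \<eta> y (coord_field A (U, \<phi>) z y))" for w z
    by (rule fun_cong[OF has_derivative_unique[OF has_derivative_chart[OF sU U(2) sm[OF smooth_form_uminus[OF \<eta>]]]
        has_derivative_minus[OF has_derivative_chart[OF sU U(2) sm[OF \<eta>]]]]])
  have "coord_field A (U, \<phi>) z x (\<lambda>y. \<eta> y (coord_field A (U, \<phi>) w y)) - coord_field A (U, \<phi>) w x (\<lambda>y. \<eta> y (coord_field A (U, \<phi>) z y))
    = \<Theta> x (coord_field A (U, \<phi>) z x) (coord_field A (U, \<phi>) w x)"
    using d U unfolding has_ext_deriv_def Let_def by blast
  then show "coord_field A (U, \<phi>) z x (\<lambda>y. - \<eta> y (coord_field A (U, \<phi>) w y)) - coord_field A (U, \<phi>) w x (\<lambda>y. - \<eta> y (coord_field A (U, \<phi>) z y))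
    = - \<Theta> x (coord_field A (U, \<phi>) z x) (coord_field A (U, \<phi>) w x)"
    unfolding neg by simp
qed

end

lemma has_ext_deriv_cong: "has_ext_deriv A \<eta> \<Theta> \<Longrightarrow> (\<And>x v w. \<Theta> x v w = \<Theta>' x v w) \<Longrightarrow> has_ext_deriv A \<eta> \<Theta>'"
  by (simp add: has_ext_deriv_def)

lemma wedge_flip: "wedge (\<lambda>x v. - \<eta> x v) \<kappa> x v w = wedge \<kappa> \<eta> x v w" "wedge \<eta> (\<lambda>x v. - \<kappa> x v) x v w = wedge \<kappa> \<eta> x v w"
  and wedge_anticommute: "wedge \<eta> \<kappa> x v w = - wedge \<kappa> \<eta> x v w"
  by (simp_all add: wedge_def)

lemma sym3_uminus: "sym3 (\<lambda>x y z. - f x y z) x y z = - sym3 f x y z"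
  and alt3_uminus: "alt3 (\<lambda>x y z. - f x y z) x y z = - alt3 f x y z"
  by (simp_all add: sym3_def alt3_def field_simps)

lemma transpose_outer: "transpose (outer t s) = outer s t"
  by (simp add: transpose_def outer_def vec_eq_iff mult.commute)

lemma matrix_outer: "S ** outer t s ** T = outer (S *v t) (s v* T)"
proof -
  have "(S ** outer t s) = outer (S *v t) s"
    by (simp add: vec_eq_iff matrix_matrix_mult_def outer_def matrix_vector_mult_def sum_distrib_right mult.assoc)
  moreover have "outer t' s ** T = outer t' (s v* T)" for t'
    by (simp add: vec_eq_iff matrix_matrix_mult_def outer_def vector_matrix_mult_def sum_distrib_left mult_ac)
  ultimately show ?thesis by simp
qed

context normal_Cartan_connection
begin

lemma fr_frame: "is_frame A (pr x) (fr x)"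
  using fr_adapted by (intro frames) blast

text \<open>The group acts by z \<mapsto> c S z T, so it sends \<open>outer t s\<close> to the outer
  product of c S t with the transpose of T applied to s. Each factor is transformed by itself, which
  is why both families of planes are preserved.\<close>

lemma same_fibre:
  assumes "pr x' = pr x"
  obtains f h where "linear f" "bij f" "linear h" "bij h" "\<And>t s. fr x' (outer t s) = fr x (outer (f t) (h s))"
proof -
  have "fr x' \<in> F (pr x)" "fr x \<in> F (pr x)" using fr_adapted[of "pr x"] assms by auto
  then obtain g where g: "fr x' = fr x \<circ> g" "g \<in> grassmann_group" using orbit by blast
  then obtain c S T where c: "c \<noteq> 0" "det S = 1" "det T = 1" "\<And>z. g z = c *\<^sub>R (S ** z ** T)"
    by (auto simp: grassmann_group_def)
  define f where "f = (*v) (c *\<^sub>R S)"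
  define h where "h = (*v) (transpose T)"
  have "invertible (c *\<^sub>R S)" by (rule scalar_invertible[OF c(1)]) (simp add: invertible_det_nz c)
  moreover have "invertible (transpose T)" by (simp add: invertible_det_nz c)
  ultimately have "bij f" "bij h" by (simp_all add: f_def h_def invertible_eq_bij)
  moreover have "linear f" "linear h" by (simp_all add: f_def h_def)
  moreover have "g (outer t s) = outer (f t) (h s)" for t s
    unfolding c(4) matrix_outer f_def h_def
    by (simp add: scaleR_matrix_vector_assoc[symmetric] outer_def vec_eq_iff mult.assoc)
  ultimately show ?thesis using that[of f h] by (simp add: g)
qed

lemma alpha_segre_connection: "segre_connection A B pr fr \<theta> \<omega> \<omega>g \<omega>l \<psi> a bg bl"
proof unfold_locales
  fix x' x and s :: "real ^ 'q" assume "pr x' = pr x" "s \<noteq> 0"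
  from this(1) obtain f h where fh: "linear f" "bij f" "linear h" "bij h" "\<And>t s. fr x' (outer t s) = fr x (outer (f t) (h s))"
    by (rule same_fibre) blast
  have "fr x' ` range (\<lambda>t. outer t s) = (\<lambda>t. fr x (outer t (h s))) ` range f"
    by (simp add: image_image fh(5))
  then have "fr x' ` range (\<lambda>t. outer t s) = fr x ` range (\<lambda>t. outer t (h s))"
    using fh(2) by (simp add: image_image bij_is_surj)
  moreover have "h s \<noteq> 0" using \<open>s \<noteq> 0\<close> fh(3,4) by (metis bij_is_inj injD linear_0)
  ultimately show "\<exists>s'. s' \<noteq> 0 \<and> fr x' ` range (\<lambda>t. outer t s) = fr x ` range (\<lambda>t. outer t s')"
    by blast
qed (rule pr_smooth fr_frame soldering smooth_forms structure_theta structure_omega_g structure_omega_l structure_omega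
    a_skew a_trace_g a_trace_l bg_skew bl_skew bg_trace bl_trace b_normal parallelism; assumption?)+

text \<open>Transposing the model matrices exchanges the two families of generators; since the group
  acts on the other side, the two connection forms change roles and signs.\<close>

lemma beta_segre_connection:
  "segre_connection A B pr (\<lambda>x z. fr x (transpose z)) (\<lambda>i \<alpha>. \<theta> \<alpha> i) \<omega> (\<lambda>i j x v. - \<omega>l j i x v) (\<lambda>\<beta> \<alpha> x v. - \<omega>g \<alpha> \<beta> x v)
    (\<lambda>\<alpha> i. \<psi> i \<alpha>) (\<lambda>\<alpha> j k i \<beta> \<gamma>. a i \<beta> \<gamma> \<alpha> j k) (\<lambda>j k l i \<gamma> \<delta> x. - bl i \<gamma> \<delta> j k l x) (\<lambda>\<alpha> k l \<beta> \<gamma> \<delta> x. - bg \<beta> \<gamma> \<delta> \<alpha> k l x)"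
proof unfold_locales
  show "is_frame A (pr x) (\<lambda>z. fr x (transpose z))" for x
    unfolding is_frame_def
  proof (intro conjI allI)
    have "linear (transpose :: real ^ 'p ^ 'q \<Rightarrow> real ^ 'q ^ 'p)"
      by (rule linearI) (simp_all add: transpose_def vec_eq_iff)
    from linear_compose[OF this, of "\<lambda>z. fr x z f" for f] fr_frame[of x] show "linear (\<lambda>z. fr x (transpose z) f)" for f
      by (simp add: is_frame_def o_def)
    have "bij (transpose :: real ^ 'p ^ 'q \<Rightarrow> real ^ 'q ^ 'p)"
      by (rule bij_betw_byWitness[where f' = transpose]) (simp_all add: transpose_transpose)
    from bij_betw_trans[OF this, of "fr x" "tangent_space A (pr x)"] fr_frame[of x]
    show "bij_betw (\<lambda>z. fr x (transpose z)) UNIV (tangent_space A (pr x))"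
      by (simp add: is_frame_def o_def)
  qed
  show "push_forward A pr x v = fr x (transpose (\<chi> i \<alpha>. \<theta> \<alpha> i x v))" if "v \<in> tangent_space B x" for x v
    unfolding soldering[OF that] by (simp add: transpose_def)
  fix x' x and s :: "real ^ 'p" assume "pr x' = pr x" "s \<noteq> 0"
  from this(1) obtain f h where fh: "linear f" "bij f" "linear h" "bij h" "\<And>t s. fr x' (outer t s) = fr x (outer (f t) (h s))"
    by (rule same_fibre) blast
  have "fr x' ` range (outer s) = (\<lambda>t. fr x (outer (f s) t)) ` range h"
    by (simp add: image_image fh(5))
  then have "fr x' ` range (outer s) = fr x ` range (outer (f s))"
    using fh(4) by (simp add: image_image bij_is_surj)
  moreover have "f s \<noteq> 0" using \<open>s \<noteq> 0\<close> fh(1,2) by (metis bij_is_inj injD linear_0)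
  ultimately show "\<exists>s'. s' \<noteq> 0 \<and> (\<lambda>z. fr x' (transpose z)) ` range (\<lambda>t. outer t s) = (\<lambda>z. fr x (transpose z)) ` range (\<lambda>t. outer t s')"
    unfolding image_image transpose_outer by (intro exI[of _ "f s"]) simp
next
  fix X :: "'q \<Rightarrow> 'q \<Rightarrow> real" and Y :: "'p \<Rightarrow> 'p \<Rightarrow> real" and x Z r W
  assume "(\<Sum>\<gamma>\<in>UNIV. X \<gamma> \<gamma>) = 0" "(\<Sum>k\<in>UNIV. Y k k) = 0"
  then have "(\<Sum>\<gamma>\<in>UNIV. - Y \<gamma> \<gamma>) = 0" "(\<Sum>k\<in>UNIV. - X k k) = 0" by (simp_all add: sum_negf)
  note par = parallelism[where X = "\<lambda>\<alpha> \<beta>. - Y \<beta> \<alpha>" and Y = "\<lambda>j i. - X i j" and x = x and Z = "\<lambda>\<alpha> i. Z i \<alpha>"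
      and r = r and W = "\<lambda>i \<alpha>. W \<alpha> i", OF this]
  have neg: "- r = r' \<longleftrightarrow> r = - r'" for r r' :: real by auto
  show "\<exists>!v. v \<in> tangent_space B x \<and> (\<forall>i \<alpha>. \<theta> \<alpha> i x v = Z i \<alpha>) \<and> \<omega> x v = r \<and>
            (\<forall>i j. - \<omega>l j i x v = X i j) \<and> (\<forall>\<beta> \<alpha>. - \<omega>g \<alpha> \<beta> x v = Y \<beta> \<alpha>) \<and> (\<forall>\<alpha> i. \<psi> i \<alpha> x v = W \<alpha> i)"
    by (rule iffD1[OF arg_cong[where f = Ex1] par], rule ext) (auto simp: neg)
next
  have swap3: "(\<Sum>k\<in>UNIV. \<Sum>\<beta>\<in>UNIV. \<Sum>\<gamma>\<in>UNIV. g k \<beta> \<gamma>) = (\<Sum>\<beta>\<in>UNIV. \<Sum>\<gamma>\<in>UNIV. \<Sum>k\<in>UNIV. g k \<beta> \<gamma>)"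
    for g :: "'q \<Rightarrow> 'p \<Rightarrow> 'p \<Rightarrow> real"
    by (rule trans[OF sum.swap], rule sum.cong[OF refl], rule sum.swap)
  have swap4: "(\<Sum>j\<in>UNIV. \<Sum>k\<in>UNIV. \<Sum>\<beta>\<in>UNIV. \<Sum>\<gamma>\<in>UNIV. f j k \<beta> \<gamma>) = (\<Sum>\<beta>\<in>UNIV. \<Sum>\<gamma>\<in>UNIV. \<Sum>j\<in>UNIV. \<Sum>k\<in>UNIV. f j k \<beta> \<gamma>)"
    for f :: "'q \<Rightarrow> 'q \<Rightarrow> 'p \<Rightarrow> 'p \<Rightarrow> real"
    by (rule trans[OF sum.cong[OF refl swap3] swap3])
  have swap2: "(\<Sum>j\<in>UNIV. \<Sum>\<beta>\<in>UNIV. f j \<beta>) = (\<Sum>\<beta>\<in>UNIV. \<Sum>j\<in>UNIV. f j \<beta>)" for f :: "'q \<Rightarrow> 'p \<Rightarrow> real"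
    by (rule sum.swap)
  \<comment> \<open>Reversing the order of matrix multiplication and changing both signs turns the
    quadratic term into its negative, in accordance with the sign of the left-hand side.\<close>
  have product: "(\<Sum>k\<in>UNIV. wedge (\<lambda>x v. - \<kappa> k x v) (\<lambda>x v. - \<eta> k x v) x v w) = - (\<Sum>k\<in>UNIV. wedge (\<eta> k) (\<kappa> k) x v w)"
    for \<eta> \<kappa> :: "'i::finite \<Rightarrow> 'n form1" and x v w
    unfolding wedge_flip sum_negf[symmetric] by (intro sum.cong refl wedge_anticommute)
  show "has_ext_deriv B (\<theta> \<alpha> i) (\<lambda>x v w.
          (\<Sum>\<beta>\<in>UNIV. wedge (\<theta> \<beta> i) (\<lambda>x v. - \<omega>g \<alpha> \<beta> x v) x v w)
          + (\<Sum>j\<in>UNIV. wedge (\<lambda>x v. - \<omega>l j i x v) (\<theta> \<alpha> j) x v w)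
          + wedge \<omega> (\<theta> \<alpha> i) x v w
          + (\<Sum>j\<in>UNIV. \<Sum>k\<in>UNIV. \<Sum>\<beta>\<in>UNIV. \<Sum>\<gamma>\<in>UNIV.
               a i \<beta> \<gamma> \<alpha> j k x * wedge (\<theta> \<beta> j) (\<theta> \<gamma> k) x v w))" for \<alpha> i
    unfolding swap4 wedge_flip by (rule has_ext_deriv_cong[OF structure_theta]) simp
  show "has_ext_deriv B (\<lambda>x v. - \<omega>l j i x v) (\<lambda>x v w.
          (\<Sum>k\<in>UNIV. wedge (\<lambda>x v. - \<omega>l k i x v) (\<lambda>x v. - \<omega>l j k x v) x v w)
          + real CARD('p) / real (CARD('q) + CARD('p)) *
              ((if i = j then \<Sum>k\<in>UNIV. \<Sum>\<gamma>\<in>UNIV. wedge (\<theta> \<gamma> k) (\<psi> k \<gamma>) x v w else 0)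
               - real CARD('q) * (\<Sum>\<gamma>\<in>UNIV. wedge (\<theta> \<gamma> i) (\<psi> j \<gamma>) x v w))
          + (\<Sum>k\<in>UNIV. \<Sum>l\<in>UNIV. \<Sum>\<gamma>\<in>UNIV. \<Sum>\<delta>\<in>UNIV.
               - bl i \<gamma> \<delta> j k l x * wedge (\<theta> \<gamma> k) (\<theta> \<delta> l) x v w))" for j i
    unfolding swap4 swap2 product
    by (rule has_ext_deriv_cong[OF P.has_ext_deriv_uminus[OF smooth_forms(4) structure_omega_l]])
      (auto simp: wedge_flip wedge_anticommute[of "\<psi> _ _"] sum_negf add.commute[of "real CARD('q)"] algebra_simps)
  show "has_ext_deriv B (\<lambda>x v. - \<omega>g \<alpha> \<beta> x v) (\<lambda>x v w.
          (\<Sum>\<gamma>\<in>UNIV. wedge (\<lambda>x v. - \<omega>g \<gamma> \<beta> x v) (\<lambda>x v. - \<omega>g \<alpha> \<gamma> x v) x v w)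
          + real CARD('q) / real (CARD('q) + CARD('p)) *
              ((if \<beta> = \<alpha> then \<Sum>k\<in>UNIV. \<Sum>\<gamma>\<in>UNIV. wedge (\<psi> k \<gamma>) (\<theta> \<gamma> k) x v w else 0)
               - real CARD('p) * (\<Sum>k\<in>UNIV. wedge (\<psi> k \<beta>) (\<theta> \<alpha> k) x v w))
          + (\<Sum>k\<in>UNIV. \<Sum>l\<in>UNIV. \<Sum>\<gamma>\<in>UNIV. \<Sum>\<delta>\<in>UNIV.
               - bg \<beta> \<gamma> \<delta> \<alpha> k l x * wedge (\<theta> \<gamma> k) (\<theta> \<delta> l) x v w))" for \<alpha> \<beta>
    unfolding swap4 swap2 product
    by (rule has_ext_deriv_cong[OF P.has_ext_deriv_uminus[OF smooth_forms(3) structure_omega_g]])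
      (auto simp: wedge_flip wedge_anticommute[of "\<psi> _ _"] sum_negf add.commute[of "real CARD('q)"] algebra_simps)
  show "has_ext_deriv B \<omega> (\<lambda>x v w. \<Sum>i\<in>UNIV. \<Sum>\<alpha>\<in>UNIV. wedge (\<psi> i \<alpha>) (\<theta> \<alpha> i) x v w)"
    unfolding swap2 by (rule structure_omega)
next
  fix i :: 'q and j k l :: 'q and \<alpha> \<beta> \<gamma> \<delta> :: 'p and x
  show "a i \<beta> \<gamma> \<alpha> j k x = - a i \<gamma> \<beta> \<alpha> k j x" by (rule a_skew)
  show "(\<Sum>i\<in>UNIV. a i \<beta> \<gamma> \<alpha> i k x) = 0" by (rule a_trace_l)
  show "(\<Sum>\<alpha>\<in>UNIV. a i \<alpha> \<gamma> \<alpha> j k x) = 0" by (rule a_trace_g)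
  show "- bl i \<gamma> \<delta> j k l x = - (- bl i \<delta> \<gamma> j l k x)" by (subst bl_skew) simp
  show "- bg \<beta> \<gamma> \<delta> \<alpha> k l x = - (- bg \<beta> \<delta> \<gamma> \<alpha> l k x)" by (subst bg_skew) simp
  show "(\<Sum>i\<in>UNIV. - bl i \<gamma> \<delta> i k l x) = 0" by (simp add: sum_negf bl_trace)
  show "(\<Sum>\<alpha>\<in>UNIV. - bg \<alpha> \<gamma> \<delta> \<alpha> k l x) = 0" by (simp add: sum_negf bg_trace)
  show "(\<Sum>i\<in>UNIV. - bl i \<gamma> \<delta> k i l x) - (\<Sum>\<alpha>\<in>UNIV. - bg \<gamma> \<alpha> \<delta> \<alpha> k l x)
    + (\<Sum>i\<in>UNIV. - bl i \<delta> \<gamma> l i k x) - (\<Sum>\<alpha>\<in>UNIV. - bg \<delta> \<alpha> \<gamma> \<alpha> l k x) = 0"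
    using b_normal[of \<gamma> \<delta> k l x] by (simp add: sum_negf)
qed (intro pr_smooth smooth_forms P.smooth_form_uminus)+

lemma alpha_semiintegrable_iff:
  assumes "CARD('p) \<ge> 2"
  shows "alpha_semiintegrable A F \<longleftrightarrow>
    (\<forall>x. (\<forall>i \<beta> \<gamma> \<alpha> j k. sym2 (\<lambda>j k. a i \<beta> \<gamma> \<alpha> j k x) j k = 0) \<and>
         (\<forall>i \<gamma> \<delta> j k l. sym3 (\<lambda>j k l. bl i \<gamma> \<delta> j k l x) j k l = 0) \<and>
         (\<forall>\<beta> \<gamma> \<delta> \<alpha> k l. alt3 (\<lambda>\<beta> \<gamma> \<delta>. bg \<beta> \<gamma> \<delta> \<alpha> k l x) \<beta> \<gamma> \<delta> = 0))"
proof -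
  interpret S: segre_connection A B pr fr \<theta> \<omega> \<omega>g \<omega>l \<psi> a bg bl by (rule alpha_segre_connection)
  have "alpha_generators F = S.generators"
    by (rule ext) (auto simp: alpha_generators_def S.generators_def fr_adapted[symmetric] full_SetCompr_eq)
  then show ?thesis
    unfolding alpha_semiintegrable_def using S.generators_integrable_iff[OF assms] by simp
qed

text \<open>The criterion for the other family applied to transposed frames. Greek and Latin indices
  trade places, so symmetrization and alternation do as well, and the signs of the curvature
  components do not affect their vanishing.\<close>

lemma beta_semiintegrable_iff:
  assumes "CARD('q) \<ge> 2"
  shows "beta_semiintegrable A F \<longleftrightarrow>
    (\<forall>x. (\<forall>i \<beta> \<gamma> \<alpha> j k. sym2 (\<lambda>\<beta> \<gamma>. a i \<beta> \<gamma> \<alpha> j k x) \<beta> \<gamma> = 0) \<and>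
         (\<forall>i \<gamma> \<delta> j k l. alt3 (\<lambda>j k l. bl i \<gamma> \<delta> j k l x) j k l = 0) \<and>
         (\<forall>\<beta> \<gamma> \<delta> \<alpha> k l. sym3 (\<lambda>\<beta> \<gamma> \<delta>. bg \<beta> \<gamma> \<delta> \<alpha> k l x) \<beta> \<gamma> \<delta> = 0))"
proof -
  interpret S: segre_connection A B pr "\<lambda>x z. fr x (transpose z)" "\<lambda>i \<alpha>. \<theta> \<alpha> i" \<omega> "\<lambda>i j x v. - \<omega>l j i x v"
    "\<lambda>\<beta> \<alpha> x v. - \<omega>g \<alpha> \<beta> x v" "\<lambda>\<alpha> i. \<psi> i \<alpha>" "\<lambda>\<alpha> j k i \<beta> \<gamma>. a i \<beta> \<gamma> \<alpha> j k"
    "\<lambda>j k l i \<gamma> \<delta> x. - bl i \<gamma> \<delta> j k l x" "\<lambda>\<alpha> k l \<beta> \<gamma> \<delta> x. - bg \<beta> \<gamma> \<delta> \<alpha> k l x"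
    by (rule beta_segre_connection)
  have "beta_generators F = S.generators"
  proof
    fix m
    have "(\<lambda>z. fr x (transpose z)) ` range (\<lambda>t. outer t s) = fr x ` {outer s t | t. True}" for x s
      by (simp add: image_image transpose_outer full_SetCompr_eq)
    then show "beta_generators F m = S.generators m"
      by (auto simp: beta_generators_def S.generators_def fr_adapted[symmetric])
  qed
  then show ?thesis
    unfolding beta_semiintegrable_def
    using S.generators_integrable_iff[OF assms, unfolded sym3_uminus alt3_uminus neg_equal_0_iff_equal] by auto
qed

end

theorem theorem2p5:
  fixes A :: "('m::{t2_space, second_countable_topology}, real ^ 'q ^ 'p) atlas"
    and B :: "('n::{t2_space, second_countable_topology}, 'e::euclidean_space) atlas"
  assumes "normal_Cartan_connection A SC F B pr fr \<theta> \<omega> \<omega>g \<omega>l \<psi> a bg bl c"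
  shows "(CARD('p) > 2 \<and> CARD('q) \<ge> 2 \<longrightarrow>
          (alpha_semiintegrable A F \<longleftrightarrow>
            (\<forall>x. (\<forall>i \<beta> \<gamma> \<alpha> j k. sym2 (\<lambda>j k. a i \<beta> \<gamma> \<alpha> j k x) j k = 0) \<and>
                 (\<forall>i \<gamma> \<delta> j k l. sym3 (\<lambda>j k l. bl i \<gamma> \<delta> j k l x) j k l = 0) \<and>
                 (\<forall>\<beta> \<gamma> \<delta> \<alpha> k l. alt3 (\<lambda>\<beta> \<gamma> \<delta>. bg \<beta> \<gamma> \<delta> \<alpha> k l x) \<beta> \<gamma> \<delta> = 0)))) \<and>
         (CARD('p) \<ge> 2 \<and> CARD('q) > 2 \<longrightarrow>
          (beta_semiintegrable A F \<longleftrightarrow>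
            (\<forall>x. (\<forall>i \<beta> \<gamma> \<alpha> j k. sym2 (\<lambda>\<beta> \<gamma>. a i \<beta> \<gamma> \<alpha> j k x) \<beta> \<gamma> = 0) \<and>
                 (\<forall>i \<gamma> \<delta> j k l. alt3 (\<lambda>j k l. bl i \<gamma> \<delta> j k l x) j k l = 0) \<and>
                 (\<forall>\<beta> \<gamma> \<delta> \<alpha> k l. sym3 (\<lambda>\<beta> \<gamma> \<delta>. bg \<beta> \<gamma> \<delta> \<alpha> k l x) \<beta> \<gamma> \<delta> = 0))))"
proof -
  interpret normal_Cartan_connection A SC F B pr fr \<theta> \<omega> \<omega>g \<omega>l \<psi> a bg bl c by (rule assms)
  show ?thesis using alpha_semiintegrable_iff beta_semiintegrable_iff by simp
qed

end
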